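(* Let $0<\varepsilon<1$. There is an algorithm which, for every sufficiently large positive integer $m$, on input $m$ and with $n=2\phi(m)$, constructs a symplectic lattice $\Lambda\subset\mathbb{R}^n$ satisfying $$\Delta(\Lambda)>\frac{(1-\varepsilon)m}{2^{2\phi(m)}}$$ using at most $\exp\big(1.5\,n\log n\,(1+o(1))\big)$ binary operations, where $o(1)$ denotes a quantity tending to $0$ as $m\to\infty$.
   Context: $\phi$ is Euler's totient function. A lattice in a Euclidean space $E$ of dimension $n$ is a discrete free $\mathbb{Z}$-submodule of rank $n$. Its dual is $\Lambda^\#=\{x\in E: \langle x,y\rangle\in\mathbb{Z}\ \forall y\in\Lambda\}$, and $\Lambda$ is symplectic if there is an isometry $\sigma$ of $E$ with $\sigma(\Lambda)=\Lambda^\#$ and $\sigma^2=-\mathrm{Id}$. $\mathrm{Vol}(\Lambda)$ is the volume of a fundamental region of $\Lambda$, $\mu_\Lambda=\min\{\|x\| : x\in\Lambda\setminus\{0\}\}$, $B(r)$ the closed ball of radius $r$ centered at $0$, and the density of $\Lambda$ is $\Delta(\Lambda)=\frac{\mathrm{Vol}(B(\mu_\Lambda))}{2^n\,\mathrm{Vol}(\Lambda)}$. Constructing a lattice means outputting an exact finite description of it up to isometry, e.g. the Gram matrix of a $\mathbb{Z}$-basis, with entries encoded exactly as real algebraic numbers. *)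

theory Defs
  imports
    "HOL-Analysis.Analysis"
    "HOL-Library.Log_Nat"
    "HOL-Library.Nat_Bijection"
    "HOL-Number_Theory.Totient"
    "Jordan_Normal_Form.Matrix"
begin

hide_const (open) Finite_Cartesian_Product.vec

section \<open>Euclidean space of variable dimension\<close>

text \<open>The dimension depends on the input of the algorithm, so it cannot be a type: Euclidean
  \<open>n\<close>-space is \<^term>\<open>carrier_vec n :: real vec set\<close> with \<^const>\<open>scalar_prod\<close> as inner product.\<close>

definition vnorm :: "real vec \<Rightarrow> real" where
  "vnorm x = sqrt (scalar_prod x x)"

definition vball :: "nat \<Rightarrow> real \<Rightarrow> real vec set" where
  "vball n r = {x \<in> carrier_vec n. vnorm x \<le> r}"

definition lborel_vec :: "nat \<Rightarrow> real vec measure" where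
  "lborel_vec n = embed_measure (\<Pi>\<^sub>M i\<in>{..<n}. lborel) (Matrix.vec n)"

definition linear_isometry :: "nat \<Rightarrow> (real vec \<Rightarrow> real vec) \<Rightarrow> bool" where
  "linear_isometry n \<sigma> \<longleftrightarrow>
     bij_betw \<sigma> (carrier_vec n) (carrier_vec n) \<and>
     (\<forall>x\<in>carrier_vec n. \<forall>y\<in>carrier_vec n. \<sigma> (x + y) = \<sigma> x + \<sigma> y) \<and>
     (\<forall>a. \<forall>x\<in>carrier_vec n. \<sigma> (a \<cdot>\<^sub>v x) = a \<cdot>\<^sub>v \<sigma> x) \<and>
     (\<forall>x\<in>carrier_vec n. \<forall>y\<in>carrier_vec n. scalar_prod (\<sigma> x) (\<sigma> y) = scalar_prod x y)"

section \<open>Lattices\<close>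

text \<open>The columns of \<open>B\<close> form a \<open>\<int>\<close>-basis of \<open>\<Lambda>\<close>: every element of \<open>\<Lambda>\<close> is an integral combination
  of them in exactly one way.\<close>

definition Z_basis :: "nat \<Rightarrow> real vec set \<Rightarrow> real mat \<Rightarrow> bool" where
  "Z_basis n \<Lambda> B \<longleftrightarrow> B \<in> carrier_mat n n \<and>
     bij_betw (\<lambda>c :: int vec. B *\<^sub>v map_vec of_int c) (carrier_vec n) \<Lambda>"

definition discrete_set :: "real vec set \<Rightarrow> bool" where
  "discrete_set \<Lambda> \<longleftrightarrow> (\<forall>x\<in>\<Lambda>. \<exists>e>0. \<forall>y\<in>\<Lambda>. vnorm (y - x) < e \<longrightarrow> y = x)"

definition is_lattice :: "nat \<Rightarrow> real vec set \<Rightarrow> bool" where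
  "is_lattice n \<Lambda> \<longleftrightarrow> discrete_set \<Lambda> \<and> (\<exists>B. Z_basis n \<Lambda> B)"

definition dual_lattice :: "nat \<Rightarrow> real vec set \<Rightarrow> real vec set" where
  "dual_lattice n \<Lambda> = {x \<in> carrier_vec n. \<forall>y\<in>\<Lambda>. scalar_prod x y \<in> \<int>}"

definition symplectic_lattice :: "nat \<Rightarrow> real vec set \<Rightarrow> bool" where
  "symplectic_lattice n \<Lambda> \<longleftrightarrow> is_lattice n \<Lambda> \<and>
     (\<exists>\<sigma>. linear_isometry n \<sigma> \<and> \<sigma> ` \<Lambda> = dual_lattice n \<Lambda> \<and>
          (\<forall>x\<in>carrier_vec n. \<sigma> (\<sigma> x) = - x))"

definition fundamental_region :: "nat \<Rightarrow> real vec set \<Rightarrow> real vec set \<Rightarrow> bool" where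
  "fundamental_region n \<Lambda> F \<longleftrightarrow> F \<in> sets (lborel_vec n) \<and>
     (\<forall>x\<in>carrier_vec n. \<exists>!y. y \<in> \<Lambda> \<and> x - y \<in> F)"

text \<open>All (measurable) fundamental regions of a lattice have the same volume, so the choice made
  here is immaterial.\<close>

definition covolume :: "nat \<Rightarrow> real vec set \<Rightarrow> real" where
  "covolume n \<Lambda> = measure (lborel_vec n) (SOME F. fundamental_region n \<Lambda> F)"

definition min_norm :: "nat \<Rightarrow> real vec set \<Rightarrow> real" where
  "min_norm n \<Lambda> = (LEAST r. r \<in> vnorm ` (\<Lambda> - {0\<^sub>v n}))"

definition lattice_density :: "nat \<Rightarrow> real vec set \<Rightarrow> real" where
  "lattice_density n \<Lambda> = measure (lborel_vec n) (vball n (min_norm n \<Lambda>)) / (2 ^ n * covolume n \<Lambda>)"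

section \<open>Exact encodings by lists of natural numbers\<close>

text \<open>A real algebraic number is encoded by a nonzero integer polynomial (number of coefficients,
  then the coefficients, constant term first) and a rational interval isolating it from the other
  real roots. Codes are self-delimiting, hence may be concatenated.\<close>

definition rat_code :: "rat \<Rightarrow> nat list" where
  "rat_code q = (case quotient_of q of (a, b) \<Rightarrow> [int_encode a, nat b])"

definition codes_real_alg :: "nat list \<Rightarrow> real \<Rightarrow> bool" where
  "codes_real_alg w \<alpha> \<longleftrightarrow> (\<exists>(p :: int poly) (a :: rat) (b :: rat). p \<noteq> 0 \<and>
     {x. of_rat a \<le> x \<and> x \<le> of_rat b \<and> poly (map_poly of_int p) x = 0} = {\<alpha>} \<and>
     w = length (coeffs p) # map int_encode (coeffs p) @ rat_code a @ rat_code b)"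

definition codes_matrix :: "nat \<Rightarrow> nat list \<Rightarrow> real mat \<Rightarrow> bool" where
  "codes_matrix n w G \<longleftrightarrow> (\<exists>ws. length ws = n * n \<and>
     (\<forall>i<n. \<forall>j<n. codes_real_alg (ws ! (i * n + j)) (G $$ (i, j))) \<and>
     w = n # concat ws)"

definition codes_lattice :: "nat \<Rightarrow> nat list \<Rightarrow> real vec set \<Rightarrow> bool" where
  "codes_lattice n w \<Lambda> \<longleftrightarrow>
     (\<exists>B. Z_basis n \<Lambda> B \<and> codes_matrix n w (transpose_mat B * B))"

section \<open>Algorithms and binary operations\<close>

text \<open>Random access machine with logarithmic cost, in structured form. Memory cells hold natural
  numbers; every step is charged, up to a constant factor, the number of bit operations performed
  by the schoolbook methods on the operands involved, and a memory access is charged the length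
  of the address plus the length of the content.\<close>

type_synonym mem = "nat \<Rightarrow> nat"

datatype aexp =
    Const nat
  | Load aexp
  | Add aexp aexp
  | Sub aexp aexp
  | Mul aexp aexp
  | Quot aexp aexp

datatype program =
    Store aexp aexp
  | Seq program program
  | Cond aexp program program
  | While aexp program

definition bits :: "nat \<Rightarrow> nat" where
  "bits k = max 1 (floorlog 2 k)"

fun aval :: "aexp \<Rightarrow> mem \<Rightarrow> nat" where
  "aval (Const k) s = k"
| "aval (Load e) s = s (aval e s)"
| "aval (Add e f) s = aval e s + aval f s"
| "aval (Sub e f) s = aval e s - aval f s"
| "aval (Mul e f) s = aval e s * aval f s"
| "aval (Quot e f) s = aval e s div aval f s"

fun acost :: "aexp \<Rightarrow> mem \<Rightarrow> nat" where
  "acost (Const k) s = bits k"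
| "acost (Load e) s = acost e s + bits (aval e s) + bits (s (aval e s))"
| "acost (Add e f) s = acost e s + acost f s + bits (aval e s) + bits (aval f s)"
| "acost (Sub e f) s = acost e s + acost f s + bits (aval e s) + bits (aval f s)"
| "acost (Mul e f) s = acost e s + acost f s + bits (aval e s) * bits (aval f s)"
| "acost (Quot e f) s = acost e s + acost f s + bits (aval e s) * bits (aval f s)"

text \<open>\<open>runs c s t s'\<close>: started in \<open>s\<close>, the program \<open>c\<close> halts in \<open>s'\<close> after \<open>t\<close> binary operations.
  Conditions are true iff their value is nonzero.\<close>

inductive runs :: "program \<Rightarrow> mem \<Rightarrow> nat \<Rightarrow> mem \<Rightarrow> bool" where
  Store: "runs (Store e f) s
            (acost e s + acost f s + bits (aval e s) + bits (aval f s)) (s(aval e s := aval f s))"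
| Seq: "runs c s t s' \<Longrightarrow> runs d s' u s'' \<Longrightarrow> runs (Seq c d) s (t + u) s''"
| CondTrue: "aval e s \<noteq> 0 \<Longrightarrow> runs c s t s' \<Longrightarrow>
            runs (Cond e c d) s (acost e s + bits (aval e s) + t) s'"
| CondFalse: "aval e s = 0 \<Longrightarrow> runs d s t s' \<Longrightarrow>
            runs (Cond e c d) s (acost e s + bits (aval e s) + t) s'"
| WhileFalse: "aval e s = 0 \<Longrightarrow> runs (While e c) s (acost e s + bits (aval e s)) s"
| WhileTrue: "aval e s \<noteq> 0 \<Longrightarrow> runs c s t s' \<Longrightarrow> runs (While e c) s' u s'' \<Longrightarrow>
            runs (While e c) s (acost e s + bits (aval e s) + t + u) s''"

definition input_mem :: "nat \<Rightarrow> mem" where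
  "input_mem m = (\<lambda>_. 0)(0 := m)"

text \<open>Cell \<open>0\<close> holds the length of the output, which occupies the cells following it.\<close>

definition output_list :: "mem \<Rightarrow> nat list" where
  "output_list s = map s [1..<Suc (s 0)]"

definition computes_within :: "program \<Rightarrow> nat \<Rightarrow> real \<Rightarrow> nat list \<Rightarrow> bool" where
  "computes_within A m T w \<longleftrightarrow>
     (\<exists>t s. runs A (input_mem m) t s \<and> real t \<le> T \<and> output_list s = w)"

end

(*
  Let N = phi(m). The m-periodic functions orthogonal to all functions of a smaller period form a
  lattice L of rank N on which the shift by 1 acts with all its m powers; b is a basis of L and A the
  inverse of its Gram matrix B. For a real "Hankel" vector s, the symmetric matrices
  H_s(i, j) = s(e_i + e_j) give symplectic lattices whose quadratic form at (x, y) is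
  alpha * B(x + H_s y) + A(y) / alpha, and the m shifts act on the pairs (s, y) preserving this value.

  Averaging over s in the torus (a Siegel mean value argument) the expected number of short vectors
  with y <> 0 is the volume of the ball, and they come in orbits of length m under the shifts; so if
  the volume of the ball of radius sqrt R0 is less than m, some lattice has no short vectors.
  A perturbation estimate shows that s may be taken in the grid (1/p) Z^N with p = N^(2.5 + o(1)).

  The algorithm tries all p^N = exp (2.5 N log N (1 + o(1))) grid points. For each of them it finds the
  minimum of the form over exp (0.5 N log N (1 + o(1))) vectors y, which suffices because A(y) is bounded
  for a short vector and y has small coordinates in a suitable basis: entropy coding of these by
  a width and a digit for every coordinate keeps their number near the volume bound. The total is
  exp (3 N log N (1 + o(1))) with 2 N = n. Programs are generated from arithmetic expressions by combinators
  whose correctness and cost are derived by syntax-directed rules (evq below).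
*)
theory Submission
  imports Defs "Jordan_Normal_Form.Determinant" "HOL-Number_Theory.Number_Theory" "HOL-Real_Asymp.Real_Asymp"
begin

text \<open>The shifts act on each single lattice, with \<open>s\<close> fixed: \<open>H_s y\<close>
  is a correlation of \<open>y\<close> with a periodic function, so it commutes with translation,
  and every short vector brings \<open>m\<close> of them. The Hankel family is small enough to have
  this symmetry and still large enough to average over, because for one nonzero integral
  \<open>y\<close> the map from \<open>s\<close> to \<open>H_s y\<close> is already nonsingular.
  That is the arithmetic core; it rests on the irreducibility of the cyclotomic polynomial. The
  average number of short vectors over a fixed \<open>y\<close> is then the volume of a slice. Two
  discretisations remain: the sum over \<open>y\<close> is compared with an integral by moving
  \<open>y\<close> in a unit cube, and grid points stand for cells of the torus. Both displacements
  are controlled in mean square, at the price of a small fraction of every cell. The scaling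
  \<open>\<alpha> = K * N\<close> makes the first cost \<open>N / (4 * \<alpha>)\<close> a small
  constant, and it makes vectors with \<open>y = 0\<close> long. With \<open>\<theta>\<close> of
  order \<open>1 / sqrt N\<close> the relative loss from the second is of order
  \<open>N^5 / p^2\<close>, up to the subpolynomial factor \<open>T^2\<close>; this is the origin of
  the exponent 2.5.\<close>

lemmas sum_cong = sum.cong[OF refl]

abbreviation "rv \<equiv> map_vec (of_int :: int => real)"

section \<open>Volumes and lattices\<close>

definition leb :: "nat => (nat => real) measure" where
 "leb n = (\<Pi>\<^sub>M i\<in>{..<n}. lborel)"

abbreviation "bleb n \<equiv> borel_measurable (leb n)"
abbreviation "nnleb n \<equiv> integral\<^sup>N (leb n)"

interpretation leb: product_sigma_finite "%_::nat. lborel :: real measure"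
 by (simp add: product_sigma_finite_def sigma_finite_lborel)

lemma sigma_finite_leb: "sigma_finite_measure (leb n)"
 unfolding leb_def by (rule leb.sigma_finite) simp

lemma space_leb: "space (leb n) = PiE {..<n} (%_. UNIV)"
 by (simp add: leb_def space_PiM)

text \<open>Completing the square in coordinate 0. The Schur complement \<open>Q'\<close> is again
  positive definite because a vector \<open>c\<close> is extended by the coordinate
  \<open>- l / q\<close> that minimises the form, and the value of \<open>Q\<close> there is the
  value of \<open>Q'\<close> at \<open>c\<close>. The factor is triangular so that substitutions in
  integrals reduce to single coordinates.\<close>

lemma cholesky:
 fixes Q :: "nat => nat => real"
 assumes "!!i j. i < n ==> j < n ==> Q i j = Q j i"
  and "!!c. \<exists>i<n. c i ~= 0 ==> 0 < (\<Sum>i<n. \<Sum>j<n. Q i j*c i*c j)"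
 shows "\<exists>W. (\<forall>i j. j < i --> W i j = 0) & (\<forall>i<n. 0 < W i i) &
  (\<forall>i<n. \<forall>j<n. Q i j = (\<Sum>k<n. W k i*W k j))"
 using assms
proof (induction n arbitrary: Q)
 case 0
 show ?case by (rule exI[of _ "%_ _. 0"]) simp
next
 case (Suc n Q)
 define q where "q = Q 0 0"
 have "0 < (\<Sum>i<Suc n. \<Sum>j<Suc n. Q i j*(if i = 0 then 1 else 0)*(if j = 0 then 1 else 0))"
  using Suc.prems(2)[of "%i. if i = 0 then 1 else 0"] by force
 also have "\<dots> = q" unfolding sum.lessThan_Suc_shift q_def by simp
 finally have q: "0 < q" .
 define Q' where "Q' i j = Q (Suc i) (Suc j) - Q 0 (Suc i)*Q 0 (Suc j) / q" for i j
 have sym: "Q' i j = Q' j i" if "i < n" "j < n" for i j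
  using Suc.prems(1)[of "Suc i" "Suc j"] that by (simp add: Q'_def mult.commute)
 have pd: "0 < (\<Sum>i<n. \<Sum>j<n. Q' i j*c i*c j)" if nz: "\<exists>i<n. c i ~= 0" for c
 proof -
  define l where "l = (\<Sum>j<n. Q 0 (Suc j)*c j)"
  define d where "d i = (case i of 0 => - l / q | Suc k => c k)" for i
  have [simp]: "d 0 = - l / q" "d (Suc k) = c k" for k by (simp_all add: d_def)
  obtain i where "i < n" "c i ~= 0" using nz by auto
  hence "\<exists>i<Suc n. d i ~= 0" by (intro exI[of _ "Suc i"]) simp
  hence "0 < (\<Sum>i<Suc n. \<Sum>j<Suc n. Q i j*d i*d j)" by (rule Suc.prems(2))
  also have "\<dots> = q*(l/q)*(l/q) + (\<Sum>j<n. Q 0 (Suc j)*(- l / q)*c j) +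
    ((\<Sum>i<n. Q (Suc i) 0*c i*(- l / q)) + (\<Sum>i<n. \<Sum>j<n. Q (Suc i) (Suc j)*c i*c j))"
   unfolding sum.lessThan_Suc_shift by (simp add: q_def sum.distrib sum_subtractf sum_negf)
  also have "(\<Sum>j<n. Q 0 (Suc j)*(- l / q)*c j) = (- l / q)*l"
   unfolding l_def by (subst sum_distrib_left) (intro sum.cong refl, simp)
  also have "(\<Sum>i<n. Q (Suc i) 0*c i*(- l / q)) = (- l / q)*l"
   unfolding l_def by (subst sum_distrib_left) (intro sum.cong refl, use Suc.prems(1) in simp)
  also have "q*(l/q)*(l/q) + (- l / q)*l + ((- l / q)*l + (\<Sum>i<n. \<Sum>j<n. Q (Suc i) (Suc j)*c i*c j))
    = (\<Sum>i<n. \<Sum>j<n. Q (Suc i) (Suc j)*c i*c j) - l*l / q"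
   using q by (simp add: field_simps)
  also have "l*l / q = (\<Sum>i<n. \<Sum>j<n. Q 0 (Suc i)*Q 0 (Suc j) / q*c i*c j)"
   unfolding l_def sum_product sum_divide_distrib by (intro sum.cong refl) simp
  also have "(\<Sum>i<n. \<Sum>j<n. Q (Suc i) (Suc j)*c i*c j) - (\<Sum>i<n. \<Sum>j<n. Q 0 (Suc i)*Q 0 (Suc j) / q*c i*c j)
    = (\<Sum>i<n. \<Sum>j<n. Q' i j*c i*c j)"
   by (simp add: Q'_def sum_subtractf[symmetric] left_diff_distrib)
  finally show ?thesis .
 qed
 from Suc.IH[OF sym pd] obtain W where W: "!!i j. j < i ==> W i j = 0" "!!i. i < n ==> 0 < W i i"
  "!!i j. i < n ==> j < n ==> Q' i j = (\<Sum>k<n. W k i*W k j)" by blast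
 define V where "V i j = (case i of 0 => Q 0 j / sqrt q | Suc i' => (case j of 0 => 0 | Suc j' => W i' j'))" for i j
 have V: "V 0 j = Q 0 j / sqrt q" "V (Suc a) 0 = 0" "V (Suc a) (Suc b) = W a b" for a b j by (simp_all add: V_def)
 have sq: "sqrt q * sqrt q = q" using q by simp
 show ?case
 proof (intro exI[of _ V] conjI allI impI)
  fix i j :: nat assume "j < i"
  thus "V i j = 0" by (cases i; cases j) (auto simp: V W)
 next
  fix i assume "i < Suc n"
  thus "0 < V i i" using q by (cases i) (auto simp: V W q_def[symmetric])
 next
  fix i j assume ij: "i < Suc n" "j < Suc n"
  have "(\<Sum>k<Suc n. V k i*V k j) = Q 0 i*Q 0 j / q + (\<Sum>k<n. V (Suc k) i*V (Suc k) j)"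
   unfolding sum.lessThan_Suc_shift using sq by (simp add: V)
  also have "\<dots> = Q i j"
  proof (cases i)
   case 0 thus ?thesis using q by (simp add: V q_def)
  next
   case i: (Suc a)
   show ?thesis
   proof (cases j)
    case 0 thus ?thesis using q Suc.prems(1)[of 0 i] ij by (simp add: V q_def)
   next
    case (Suc b)
    thus ?thesis using W(3)[of a b] i ij by (simp add: V Q'_def)
   qed
  qed
  finally show "Q i j = (\<Sum>k<Suc n. V k i*V k j)" by simp
 qed
qed

lemma measurable_upd_leb:
 assumes "k < n" and [measurable]: "g \<in> bleb n"
 shows "(%v. v(k := g v)) \<in> measurable (leb n) (leb n)"
proof -
 have e: "{..<n} = insert k ({..<n} - {k})" using assms by auto
 have "(%v. v(k := g v)) \<in> measurable (leb n) (PiM (insert k ({..<n} - {k})) (%_. lborel))"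
 proof (rule measurable_PiM_single')
  fix i assume i: "i \<in> insert k ({..<n} - {k})"
  show "(%v. (v(k := g v)) i) \<in> measurable (leb n) lborel"
  proof (cases "i = k")
   case True thus ?thesis by simp
  next
   case False
   hence "i \<in> {..<n}" using i by auto
   hence "(%v. v i) \<in> measurable (leb n) lborel"
    unfolding leb_def by (rule measurable_component_singleton)
   thus ?thesis using False by simp
  qed
 next
  show "(%v i. (v(k := g v)) i) \<in> space (leb n) \<rightarrow> (\<Pi>\<^sub>E i\<in>insert k ({..<n} - {k}). space lborel)"
   using assms by (auto simp: space_leb PiE_def extensional_def)
 qed
 thus ?thesis unfolding leb_def[of n] using e by simp
qed

lemma measurable_coord [measurable]: "i < n ==> (%v. v i) \<in> bleb n"
 unfolding leb_def using measurable_component_singleton[of i "{..<n}" "%_. lborel"] by simp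

text \<open>The elementary step of a triangular substitution: coordinate \<open>k\<close> is scaled
  and moved by a function \<open>h\<close> of the other coordinates. For fixed other coordinates
  this is an affine substitution on the line.\<close>

lemma nn_integral_upd:
 assumes k: "k < n" and a: "0 < a" and [measurable]: "f \<in> bleb n"
  and h [measurable]: "h \<in> bleb n" and hk: "!!v x. h (v(k := x)) = h v"
 shows "ennreal a*(nnleb n (%v. f (v(k := a * v k + h v)))) = (nnleb n (%v. f v))"
proof -
 let ?I = "{..<n} - {k}"
 have e: "insert k ?I = {..<n}" using k by auto
 have pe: "PiM (insert k ?I) (%_. lborel :: real measure) = leb n" by (simp only: leb_def e)
 have me: "(%y. x(k := y)) \<in> measurable lborel (leb n)" if "x \<in> space (PiM ?I (%_. lborel :: real measure))" for x
 proof -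
  have "(%y. x(k := y)) \<in> measurable lborel (PiM (insert k ?I) (%_. lborel))"
   using that by (intro measurable_fun_upd[where J="?I"]) auto
  thus ?thesis by (simp only: pe)
 qed
 have m2: "(%v. f (v(k := a * v k + h v))) \<in> bleb n"
  using k by (intro measurable_compose[OF measurable_upd_leb]) auto
 have "(nnleb n (%v. f v)) = (\<integral>\<^sup>+x. (\<integral>\<^sup>+y. f (x(k := y)) \<partial>lborel) \<partial>PiM ?I (%_. lborel))"
  by (rule leb.product_nn_integral_insert[of ?I k f, unfolded pe]) auto
 also have "\<dots> = (\<integral>\<^sup>+x. ennreal a*(\<integral>\<^sup>+y. f (x(k := h x + a*y)) \<partial>lborel) \<partial>PiM ?I (%_. lborel))"
 proof (rule nn_integral_cong)
  fix x assume x: "x \<in> space (PiM ?I (%_. lborel :: real measure))"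
  have "(%y. f (x(k := y))) \<in> borel_measurable borel"
   using measurable_compose[OF me[OF x], of f borel] by simp
  from nn_integral_real_affine[OF this, of a "h x"] a
  show "(\<integral>\<^sup>+y. f (x(k := y)) \<partial>lborel) = ennreal a*(\<integral>\<^sup>+y. f (x(k := h x + a*y)) \<partial>lborel)" by simp
 qed
 also have "\<dots> = (\<integral>\<^sup>+x. ennreal a*(\<integral>\<^sup>+y. f ((x(k := y))(k := a*(x(k := y)) k + h (x(k := y)))) \<partial>lborel) \<partial>PiM ?I (%_. lborel))"
  by (simp add: hk add.commute)
 also have "\<dots> = ennreal a*(\<integral>\<^sup>+x. (\<integral>\<^sup>+y. f ((x(k := y))(k := a*(x(k := y)) k + h (x(k := y)))) \<partial>lborel) \<partial>PiM ?I (%_. lborel))"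
 proof (rule nn_integral_cmult)
  have "(%(x, y). f ((x(k := y))(k := a*(x(k := y)) k + h (x(k := y))))) \<in> borel_measurable (PiM ?I (%_. lborel) \<Otimes>\<^sub>M lborel)"
  proof -
   have "(%(x, y). x(k := y)) \<in> measurable (PiM ?I (%_. lborel :: real measure) \<Otimes>\<^sub>M lborel) (PiM (insert k ?I) (%_. lborel))"
    by (rule measurable_add_dim)
   hence "(%p. (fst p)(k := snd p)) \<in> measurable (PiM ?I (%_. lborel :: real measure) \<Otimes>\<^sub>M lborel) (leb n)"
    by (simp only: pe split_beta')
   from measurable_compose[OF this m2] show ?thesis by (simp add: case_prod_beta)
  qed
  thus "(%x. \<integral>\<^sup>+ y. f ((x(k := y))(k := a*(x(k := y)) k + h (x(k := y)))) \<partial>lborel) \<in> borel_measurable (PiM ?I (%_. lborel))"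
   by (intro lborel.borel_measurable_nn_integral) auto
 qed
 also have "(\<integral>\<^sup>+x. (\<integral>\<^sup>+y. f ((x(k := y))(k := a*(x(k := y)) k + h (x(k := y)))) \<partial>lborel) \<partial>PiM ?I (%_. lborel))
   = (nnleb n (%v. f (v(k := a * v k + h v))))"
  by (rule leb.product_nn_integral_insert[of ?I k "%v. f (v(k := a * v k + h v))", unfolded pe, symmetric]) (use m2 in auto)
 finally show ?thesis by simp
qed

definition aff :: "nat => (nat => nat => real) => (nat => real) => (nat => real) => (nat => real)" where
 "aff n W b v = (\<lambda>i\<in>{..<n}. (\<Sum>j<n. W i j * v j) + b i)"

text \<open>Rows are introduced in increasing order. Row \<open>k\<close> involves only coordinates
  from \<open>k\<close> on, and these still have their original values when the rows before
  \<open>k\<close> have been put in; so each row is one application of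
  \<open>nn_integral_upd\<close>, and the Jacobian is the product of the diagonal.\<close>

lemma nn_integral_triangular:
 assumes tri: "!!i j. j < i ==> W i j = 0" and pos: "!!i. i < n ==> 0 < W i i" and f: "f \<in> bleb n"
 shows "ennreal (\<Prod>i<n. W i i)*(nnleb n (%v. f (aff n W b v))) = (nnleb n (%v. f v))"
proof -
 define A where "A k v = (\<lambda>i\<in>{..<n}. if i < k then (\<Sum>j<n. W i j * v j) + b i else v i)" for k and v :: "nat => real"
 have A: "A k \<in> measurable (leb n) (leb n)" for k
  unfolding A_def leb_def[of n] by (rule measurable_restrict) (auto simp: leb_def[symmetric])
 have "k <= n ==> f \<in> bleb n ==> ennreal (\<Prod>i<k. W i i)*(nnleb n (%v. f (A k v))) = (nnleb n (%v. f v))" for k f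
 proof (induction k arbitrary: f)
  case 0
  have "(nnleb n (%v. f (A 0 v))) = (nnleb n (%v. f v))"
   by (rule nn_integral_cong) (auto simp: A_def space_leb PiE_restrict)
  thus ?case by simp
 next
  case (Suc k f)
  define h where "h v = (\<Sum>j\<in>{k<..<n}. W k j * v j) + b k" for v
  have h: "h \<in> bleb n" unfolding h_def by measurable auto
  have hk: "h (v(k := x)) = h v" for v x unfolding h_def by (intro arg_cong2[of _ _ _ _ "(+)"] sum.cong) auto
  let ?f = "%v. f (v(k := W k k * v k + h v))"
  have fm: "?f \<in> bleb n"
   using Suc.prems h by (intro measurable_compose[OF measurable_upd_leb]) auto
  have *: "?f (A k v) = f (A (Suc k) v)" for v
  proof -
   have "(\<Sum>j<n. W k j * v j) = (\<Sum>j\<in>{k..<n}. W k j * v j)"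
    using tri by (intro sum.mono_neutral_right) auto
   also have "\<dots> = W k k * v k + (\<Sum>j\<in>{k<..<n}. W k j * v j)"
    using Suc.prems by (subst sum.atLeast_Suc_lessThan) (auto simp: atLeastSucLessThan_greaterThanLessThan)
   finally have "W k k*A k v k + h (A k v) = (\<Sum>j<n. W k j * v j) + b k"
    using Suc.prems by (auto simp: h_def A_def intro!: sum.cong)
   hence "(A k v)(k := W k k*A k v k + h (A k v)) = A (Suc k) v"
    using Suc.prems by (auto simp: A_def fun_eq_iff less_Suc_eq)
   thus ?thesis by simp
  qed
  have pk: "0 < W k k" using pos Suc.prems by simp
  have pp: "0 <= (\<Prod>i<k. W i i)" using pos Suc.prems by (intro prod_nonneg) (auto intro: less_imp_le)
  have "ennreal (\<Prod>i<Suc k. W i i)*(nnleb n (%v. f (A (Suc k) v))) = ennreal (W k k)*(ennreal (\<Prod>i<k. W i i)*(nnleb n (%v. ?f (A k v))))"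
   using pk pp by (simp only:*prod.lessThan_Suc) (simp add: ennreal_mult mult_ac)
  also have "\<dots> = ennreal (W k k)*(nnleb n (%v. ?f v))"
   by (subst Suc.IH[OF Suc_leD[OF Suc.prems(1)] fm]) (rule refl)
  also have "\<dots> = (nnleb n (%v. f v))"
   by (rule nn_integral_upd[OF _ pk Suc.prems(2) h hk]) (use Suc.prems in simp)
  finally show ?case .
 qed
 from this[OF le_refl f] have "ennreal (\<Prod>i<n. W i i)*(nnleb n (%v. f (A n v))) = (nnleb n (%v. f v))" .
 moreover have "A n v = aff n W b v" for v by (auto simp: A_def aff_def)
 ultimately show ?thesis by simp
qed

section \<open>Tilings by the unit cube\<close>

definition cube :: "real => nat => (nat => real) set" where
 "cube t n = PiE {..<n} (%_. {t..<t+1})"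

definition ZZ :: "nat => (nat => int) set" where
 "ZZ n = PiE {..<n} (%_. UNIV)"

abbreviation "nnZ n \<equiv> integral\<^sup>N (count_space (ZZ n))"

definition vadd :: "nat => (nat => int) => (nat => real) => (nat => real)" where
 "vadd n x v = (\<lambda>i\<in>{..<n}. of_int (x i) + v i)"

lemma countable_ZZ: "countable (ZZ n)"
 unfolding ZZ_def by (rule countable_PiE) auto

lemma sets_cube [measurable]: "cube t n \<in> sets (leb n)"
 unfolding cube_def leb_def by (rule sets_PiM_I_finite) auto

lemma vadd_measurable [measurable]: "vadd n x \<in> measurable (leb n) (leb n)"
 unfolding vadd_def leb_def[of n] by (rule measurable_restrict) (auto simp: leb_def[symmetric])

lemma nn_integral_translate:
 assumes f: "f \<in> bleb n"
 shows "(nnleb n (%v. f (\<lambda>i\<in>{..<n}. v i + b i))) = (nnleb n (%v. f v))"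
proof -
 have "aff n (%i j. if i = j then 1 else 0) b v = (\<lambda>i\<in>{..<n}. v i + b i)" for v
  by (auto simp: aff_def fun_eq_iff if_distrib[of "%x. x*_"] cong: if_cong)
 with nn_integral_triangular[of "%i j. if i = j then 1 else 0" n f b] f show ?thesis by simp
qed

lemma nn_integral_count_space_unique:
 assumes "x0 \<in> A" "!!x. x \<in> A ==> g x = (if x = x0 then c else 0)"
 shows "(\<integral>\<^sup>+x. g x \<partial>count_space A) = (c::ennreal)"
proof -
 have "(\<integral>\<^sup>+x. g x \<partial>count_space A) = (\<integral>\<^sup>+x. c*indicator {x0} x \<partial>count_space A)"
  using assms(2) by (intro nn_integral_cong) auto
 also have "\<dots> = c" using assms(1) by (subst nn_integral_cmult_indicator) auto
 finally show ?thesis .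
qed

lemma nn_integral_swap_ZZ:
 assumes "!!x. x \<in> ZZ k ==> F x \<in> bleb n"
 shows "(nnleb n (%v. (nnZ k (%x. F x v)))) = (nnZ k (%x. (nnleb n (%v. F x v))))"
proof -
 interpret C: sigma_finite_measure "count_space (ZZ k)"
  by (rule sigma_finite_measure_count_space_countable[OF countable_ZZ])
 interpret L: sigma_finite_measure "leb n" by (rule sigma_finite_leb)
 interpret P: pair_sigma_finite "count_space (ZZ k)" "leb n" ..
 have "(%(x, v). F x v) \<in> borel_measurable (count_space (ZZ k) \<Otimes>\<^sub>M leb n)"
  by (rule measurable_pair_measure_countable1[OF countable_ZZ]) (use assms in simp)
 from P.Fubini'[OF this] show ?thesis by simp
qed

lemma borel_measurable_ZZ_sum:
 assumes "!!x. x \<in> ZZ k ==> F x \<in> borel_measurable M"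
 shows "(%v. nnZ k (%x. F x v)) \<in> borel_measurable M"
proof -
 interpret C: sigma_finite_measure "count_space (ZZ k)"
  by (rule sigma_finite_measure_count_space_countable[OF countable_ZZ])
 have "(%(x, v). F x v) \<in> borel_measurable (count_space (ZZ k) \<Otimes>\<^sub>M M)"
  by (rule measurable_pair_measure_countable1[OF countable_ZZ]) (use assms in simp)
 hence "(%(v, x). F x v) \<in> borel_measurable (M \<Otimes>\<^sub>M count_space (ZZ k))"
  using measurable_compose[OF measurable_pair_swap'[of M "count_space (ZZ k)"], of "%(x, v). F x v" borel] by (simp add: split_beta')
 thus ?thesis by (rule C.borel_measurable_nn_integral)
qed

lemma cube_unique:
 assumes v: "v \<in> space (leb n)"
 shows "\<exists>x0\<in>ZZ n. \<forall>x\<in>ZZ n. vadd n (%i. - x i) v \<in> cube t n \<longleftrightarrow> x = x0"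
proof (intro bexI ballI)
 let ?x0 = "\<lambda>i\<in>{..<n}. \<lfloor>v i - t\<rfloor>"
 show "?x0 \<in> ZZ n" by (simp add: ZZ_def)
 fix x assume x: "x \<in> ZZ n"
 have "vadd n (%i. - x i) v \<in> cube t n \<longleftrightarrow> (\<forall>i<n. t <= v i - x i & v i - x i < t + 1)"
  by (auto simp: vadd_def cube_def PiE_def Pi_def)
 also have "\<dots> \<longleftrightarrow> (\<forall>i<n. x i = \<lfloor>v i - t\<rfloor>)"
  by (intro all_cong) (auto simp: floor_eq_iff eq_commute[of "x _"] algebra_simps)
 also have "\<dots> \<longleftrightarrow> x = ?x0" using x by (auto simp: ZZ_def PiE_def extensional_def fun_eq_iff)
 finally show "vadd n (%i. - x i) v \<in> cube t n \<longleftrightarrow> x = ?x0" .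
qed

text \<open>Each summand is translated back, which moves the translation into the indicator. The
  translates of a half-open cube tile space, so for every \<open>v\<close> exactly one
  \<open>x\<close> survives.\<close>

lemma unfold_cube:
 assumes f [measurable]: "f \<in> bleb n"
 shows "(nnleb n (%v. indicator (cube t n) v * (nnZ n (%x. f (vadd n x v))))) = (nnleb n (%v. f v))"
proof -
 have "(nnleb n (%v. indicator (cube t n) v * (nnZ n (%x. f (vadd n x v)))))
   = (nnleb n (%v. (nnZ n (%x. indicator (cube t n) v * f (vadd n x v)))))"
  by (simp add: nn_integral_cmult)
 also have "\<dots> = (nnZ n (%x. (nnleb n (%v. indicator (cube t n) v * f (vadd n x v)))))"
  by (rule nn_integral_swap_ZZ) measurable
 also have "\<dots> = (nnZ n (%x. (nnleb n (%v. indicator (cube t n) (vadd n (%i. - x i) v)*f v))))"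
 proof (rule nn_integral_cong)
  fix x
  have "(%v. indicator (cube t n) (vadd n (%i. - x i) v)*f v) \<in> bleb n" by measurable
  from nn_integral_translate[OF this, of "%i. of_int (x i)"]
  have "(nnleb n (%v. indicator (cube t n) (vadd n (%i. - x i) v)*f v)) =
   (nnleb n (%v. indicator (cube t n) (vadd n (%i. - x i) (\<lambda>i\<in>{..<n}. v i + of_int (x i)))*f (\<lambda>i\<in>{..<n}. v i + of_int (x i))))" by simp
  also have "\<dots> = (nnleb n (%v. indicator (cube t n) v * f (vadd n x v)))"
  proof (rule nn_integral_cong)
   fix v assume "v \<in> space (leb n)"
   hence "vadd n (%i. - x i) (\<lambda>i\<in>{..<n}. v i + of_int (x i)) = v"
    by (auto simp: vadd_def space_leb PiE_def extensional_def fun_eq_iff)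
   moreover have "(\<lambda>i\<in>{..<n}. v i + of_int (x i)) = vadd n x v" by (auto simp: vadd_def add.commute)
   ultimately show "indicator (cube t n) (vadd n (%i. - x i) (\<lambda>i\<in>{..<n}. v i + of_int (x i)))*f (\<lambda>i\<in>{..<n}. v i + of_int (x i)) =
     indicator (cube t n) v * f (vadd n x v)" by simp
  qed
  finally show "(nnleb n (%v. indicator (cube t n) v * f (vadd n x v))) = (nnleb n (%v. indicator (cube t n) (vadd n (%i. - x i) v)*f v))" by simp
 qed
 also have "\<dots> = (nnleb n (%v. (nnZ n (%x. indicator (cube t n) (vadd n (%i. - x i) v)*f v))))"
  by (rule nn_integral_swap_ZZ[symmetric]) measurable
 also have "\<dots> = (nnleb n (%v. f v))"
 proof (rule nn_integral_cong)
  fix v assume v: "v \<in> space (leb n)"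
  from cube_unique[OF v, of t] obtain x0 where "x0 \<in> ZZ n" "!!x. x \<in> ZZ n ==> vadd n (%i. - x i) v \<in> cube t n \<longleftrightarrow> x = x0" by blast
  thus "(nnZ n (%x. indicator (cube t n) (vadd n (%i. - x i) v)*f v)) = f v"
   by (intro nn_integral_count_space_unique[of x0]) auto
 qed
 finally show ?thesis .
qed

section \<open>Lebesgue measure on vectors\<close>

lemma inj_on_vec: "inj_on (Matrix.vec n) (space (leb n))"
proof (rule inj_onI)
 fix f g assume fg: "f \<in> space (leb n)" "g \<in> space (leb n)" "Matrix.vec n f = Matrix.vec n g"
 hence "f i = g i" if "i < n" for i using that by (metis index_vec)
 with fg(1,2) show "f = g" by (auto simp: space_leb PiE_def extensional_def fun_eq_iff) metis
qed

lemma emeasure_lborel_vec: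
 assumes "F \<in> sets (lborel_vec n)"
 shows "emeasure (lborel_vec n) F = (nnleb n (%v. indicator F (Matrix.vec n v)))"
  and "(%v. indicator F (Matrix.vec n v) :: ennreal) \<in> bleb n"
proof -
 have m: "Matrix.vec n \<in> measurable (leb n) (lborel_vec n)"
  unfolding lborel_vec_def leb_def[symmetric] by (rule measurable_embed_measure2'[OF inj_on_vec])
 from measurable_compose[OF m borel_measurable_indicator[OF assms]]
 show meas: "(%v. indicator F (Matrix.vec n v) :: ennreal) \<in> bleb n" .
 have "emeasure (lborel_vec n) F = emeasure (leb n) (Matrix.vec n -` F \<inter> space (leb n))"
  using emeasure_embed_measure'[OF inj_on_vec, of F] assms unfolding lborel_vec_def leb_def[symmetric] by simp
 also have "\<dots> = (nnleb n (%v. indicator (Matrix.vec n -` F \<inter> space (leb n)) v))"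
  by (rule nn_integral_indicator[symmetric]) (rule measurable_sets[OF m assms])
 also have "\<dots> = (nnleb n (%v. indicator F (Matrix.vec n v)))"
  by (rule nn_integral_cong) (auto simp: indicator_def)
 finally show "emeasure (lborel_vec n) F = (nnleb n (%v. indicator F (Matrix.vec n v)))" .
qed

lemma sets_lborel_vecI:
 assumes "S \<in> sets (leb n)"
 shows "Matrix.vec n ` S \<in> sets (lborel_vec n)"
 unfolding lborel_vec_def leb_def[symmetric] using assms by (rule in_sets_embed_measure)

lemma vnorm_sq: "0 <= scalar_prod x (x :: real vec)"
 unfolding scalar_prod_def by (rule sum_nonneg) simp

lemma vball_measure:
 assumes "0 < r"
 shows "measure (lborel_vec n) (vball n r) = unit_ball_vol (real n)*r^n"
proof -
 let ?S = "{f. sqrt (\<Sum>i\<in>{..<n}. (f i)\<^sup>2) <= r} \<inter> space (leb n)"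
 have "?S = {f \<in> space (leb n). sqrt (\<Sum>i\<in>{..<n}. (f i)\<^sup>2) <= r}" by auto
 also have "\<dots> \<in> sets (leb n)" by simp
 finally have S: "?S \<in> sets (leb n)" .
 have v: "vball n r = Matrix.vec n ` ?S"
 proof (intro equalityI subsetI)
  fix x assume x: "x \<in> vball n r"
  have "x = Matrix.vec n (\<lambda>i\<in>{..<n}. x $ i)" using x by (auto simp: vball_def)
  moreover have "(\<lambda>i\<in>{..<n}. x $ i) \<in> ?S"
   using x by (auto simp: vball_def vnorm_def scalar_prod_def space_leb power2_eq_square atLeast0LessThan)
  ultimately show "x \<in> Matrix.vec n ` ?S" by blast
 qed (auto simp: vball_def vnorm_def scalar_prod_def power2_eq_square atLeast0LessThan)
 have "emeasure (lborel_vec n) (vball n r) = (nnleb n (%v. indicator (vball n r) (Matrix.vec n v)))"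
  unfolding v by (rule emeasure_lborel_vec sets_lborel_vecI[OF S])+
 also have "\<dots> = (nnleb n (%v. indicator ?S v))"
  by (rule nn_integral_cong) (auto simp: indicator_def vball_def vnorm_def scalar_prod_def power2_eq_square atLeast0LessThan)
 also have "\<dots> = emeasure (leb n) ?S" by simp
 also have "\<dots> = ennreal (unit_ball_vol (real n)*r^n)"
  using emeasure_cball_aux[of "{..<n}" r] assms by (simp add: leb_def)
 finally show ?thesis using assms by (simp add: measure_def)
qed

section \<open>Lattices with an upper triangular basis\<close>

definition upmat :: "nat => (nat => nat => real) => real mat" where
 "upmat n W = mat n n (%(i, j). W i j)"

definition lat :: "nat => real mat => real vec set" where
 "lat n B = (%c :: int vec. B *\<^sub>v rv c) ` carrier_vec n"

lemma map_vec_of_int_carrier [simp]: "c \<in> carrier_vec n ==> rv c \<in> carrier_vec n"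
 by simp

locale based_lattice =
 fixes n :: nat and W :: "nat => nat => real"
 assumes tri: "!!i j. j < i ==> W i j = 0" and pos: "!!i. i < n ==> 0 < W i i"
begin

definition "B = upmat n W"

lemma B_carrier [simp]: "B \<in> carrier_mat n n" by (simp add: B_def upmat_def)

lemma det_B: "det B = (\<Prod>i<n. W i i)"
proof -
 have "upper_triangular B" unfolding B_def upmat_def using tri by auto
 from det_upper_triangular[OF this B_carrier] have "det B = prod_list (diag_mat B)" .
 also have "\<dots> = (\<Prod>i<n. W i i)"
  by (simp add: prod_list_diag_prod B_def upmat_def atLeast0LessThan)
 finally show ?thesis .
qed

lemma det_pos: "0 < (\<Prod>i<n. W i i)" by (rule prod_pos) (use pos in auto)

lemma B_inverse_ex: "\<exists>Bi. Bi \<in> carrier_mat n n & B*Bi = 1\<^sub>m n & Bi*B = 1\<^sub>m n"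
proof -
 have "det B ~= 0" using det_B det_pos by (metis less_irrefl)
 hence "B \<in> Units (ring_mat TYPE(real) n undefined)"
  by (rule det_non_zero_imp_unit[OF B_carrier])
 thus ?thesis by (auto simp: Units_def ring_mat_def)
qed

definition "Bi = (SOME Bi. Bi \<in> carrier_mat n n & B*Bi = 1\<^sub>m n & Bi*B = 1\<^sub>m n)"

lemma Bi [simp]: "Bi \<in> carrier_mat n n" "B*Bi = 1\<^sub>m n" "Bi*B = 1\<^sub>m n"
 using someI_ex[OF B_inverse_ex] by (auto simp: Bi_def)

lemma dims: "dim_row B = n" "dim_col B = n" "dim_row Bi = n" "dim_col Bi = n"
 using carrier_matD[OF B_carrier] carrier_matD[OF Bi(1)] by auto

lemma B_zero [simp]: "B *\<^sub>v 0\<^sub>v n = 0\<^sub>v n" "Bi *\<^sub>v 0\<^sub>v n = 0\<^sub>v n"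
 by (auto simp: dims)

lemma mat_vec_carrier [simp]: "x \<in> carrier_vec n ==> B *\<^sub>v x \<in> carrier_vec n" "x \<in> carrier_vec n ==> Bi *\<^sub>v x \<in> carrier_vec n"
 by (rule mult_mat_vec_carrier[OF B_carrier], assumption, rule mult_mat_vec_carrier[OF Bi(1)], assumption)

lemma Bi_index: "i < n ==> x \<in> carrier_vec n ==> (Bi *\<^sub>v x) $ i = (\<Sum>j<n. Bi $$ (i, j)*x $ j)"
 using carrier_matD[OF Bi(1)] by (simp add: scalar_prod_def atLeast0LessThan)

lemma BBi_vec: "x \<in> carrier_vec n ==> B *\<^sub>v (Bi *\<^sub>v x) = x" "x \<in> carrier_vec n ==> Bi *\<^sub>v (B *\<^sub>v x) = x"
 by (simp_all flip: assoc_mult_mat_vec[of _ n n _ n])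

lemma Z_basis: "Z_basis n (lat n B) B"
proof -
 have "inj_on (%c :: int vec. B *\<^sub>v rv c) (carrier_vec n)"
 proof (rule inj_onI)
  fix c d :: "int vec" assume cd: "c \<in> carrier_vec n" "d \<in> carrier_vec n" "B *\<^sub>v rv c = B *\<^sub>v rv d"
  hence "rv c = (rv d :: real vec)" by (metis BBi_vec(2) map_vec_of_int_carrier)
  hence "c $ i = d $ i" if "i < n" for i using that cd(1,2)
   by (metis carrier_vecD index_map_vec(1) of_int_eq_iff)
  thus "c = d" using cd by auto
 qed
 thus ?thesis unfolding Z_basis_def lat_def by (auto intro: inj_on_imp_bij_betw)
qed

text \<open>The defining property of a region, read in coordinates with respect to the basis, in the
  form in which it can be summed over translates of the cube. Regions are defined by
  \<open>x - y\<close> and translates by addition, whence the sign in \<open>V\<close>.\<close>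

lemma fundamental_region_iff:
 assumes "u \<in> space (leb n)" "fundamental_region n (lat n B) F"
 shows "\<exists>x0\<in>ZZ n. \<forall>x\<in>ZZ n. Matrix.vec n (aff n W (%_. 0) (vadd n x u)) \<in> F \<longleftrightarrow> x = x0"
proof -
 let ?p = "Matrix.vec n (aff n W (%_. 0) u)"
 define V where "V x = Matrix.vec n (%i. - x i)" for x :: "nat => int"
 have key: "Matrix.vec n (aff n W (%_. 0) (vadd n x u)) = ?p - B *\<^sub>v rv (V x)" for x
  by (auto simp: aff_def vadd_def B_def upmat_def scalar_prod_def V_def atLeast0LessThan
    distrib_left sum.distrib sum_negf)
 have "?p \<in> carrier_vec n" by simp
 with assms(2) obtain y where y: "y \<in> lat n B" "?p - y \<in> F" "!!y'. y' \<in> lat n B ==> ?p - y' \<in> F ==> y' = y"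
  unfolding fundamental_region_def by metis
 from y(1) obtain c where c: "c \<in> carrier_vec n" "y = B *\<^sub>v rv c" unfolding lat_def by blast
 define x0 where "x0 = (\<lambda>i\<in>{..<n}. - c $ i)"
 have Vx0: "V x0 = c" using c(1) by (auto simp: V_def x0_def)
 show ?thesis
 proof (intro bexI ballI)
  show "x0 \<in> ZZ n" by (simp add: ZZ_def x0_def)
  fix x assume x: "x \<in> ZZ n"
  show "Matrix.vec n (aff n W (%_. 0) (vadd n x u)) \<in> F \<longleftrightarrow> x = x0"
  proof
   assume "x = x0"
   thus "Matrix.vec n (aff n W (%_. 0) (vadd n x u)) \<in> F" unfolding key using y(2) c(2) Vx0 by simp
  next
   assume "Matrix.vec n (aff n W (%_. 0) (vadd n x u)) \<in> F"
   hence f: "?p - B *\<^sub>v rv (V x) \<in> F" unfolding key .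
   have Vc: "V x \<in> carrier_vec n" by (simp add: V_def)
   hence "B *\<^sub>v rv (V x) \<in> lat n B" by (auto simp: lat_def)
   from y(3)[OF this f] have "B *\<^sub>v rv (V x) = B *\<^sub>v rv c" using c by simp
   hence "V x = c" using Z_basis c(1) Vc unfolding Z_basis_def bij_betw_def inj_on_def by blast
   hence "x i = x0 i" if "i < n" for i
    using that by (auto simp: V_def x0_def)
   thus "x = x0" using x by (auto simp: ZZ_def x0_def fun_eq_iff)
  qed
 qed
qed

text \<open>\<open>covolume\<close> picks a region by \<open>SOME\<close>, so the volume of an
  arbitrary measurable one has to be found. After the substitution by \<open>W\<close> its indicator
  is unfolded over the unit cube, where the inner sum is identically 1.\<close>

lemma fundamental_region_volume:
 assumes F: "fundamental_region n (lat n B) F"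
 shows "measure (lborel_vec n) F = (\<Prod>i<n. W i i)"
proof -
 have S: "F \<in> sets (lborel_vec n)" using F by (simp add: fundamental_region_def)
 let ?f = "%v. indicator F (Matrix.vec n v) :: ennreal"
 have m: "?f \<in> bleb n" by (rule emeasure_lborel_vec(2)[OF S])
 have am: "aff n W (%_. 0) \<in> measurable (leb n) (leb n)"
  unfolding aff_def leb_def[of n] by simp
 have m2: "(%v. ?f (aff n W (%_. 0) v)) \<in> bleb n"
  by (rule measurable_compose[OF am m])
 have "emeasure (lborel_vec n) F = (nnleb n (%v. ?f v))" by (rule emeasure_lborel_vec(1)[OF S])
 also have "\<dots> = ennreal (\<Prod>i<n. W i i)*(nnleb n (%v. ?f (aff n W (%_. 0) v)))"
  by (rule nn_integral_triangular[OF tri pos m, symmetric])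
 also have "(nnleb n (%v. ?f (aff n W (%_. 0) v))) =
   (nnleb n (%v. indicator (cube 0 n) v * (nnZ n (%x. ?f (aff n W (%_. 0) (vadd n x v))))))"
  by (rule unfold_cube[OF m2, symmetric])
 also have "\<dots> = (nnleb n (%v. indicator (cube 0 n) v))"
 proof (rule nn_integral_cong)
  fix v assume v: "v \<in> space (leb n)"
  from fundamental_region_iff[OF this F] obtain x0 where "x0 \<in> ZZ n"
   "!!x. x \<in> ZZ n ==> Matrix.vec n (aff n W (%_. 0) (vadd n x v)) \<in> F \<longleftrightarrow> x = x0" by blast
  hence "(nnZ n (%x. ?f (aff n W (%_. 0) (vadd n x v)))) = 1"
   by (intro nn_integral_count_space_unique[of x0]) auto
  thus "indicator (cube 0 n) v * (nnZ n (%x. ?f (aff n W (%_. 0) (vadd n x v)))) = indicator (cube 0 n) v"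
   by simp
 qed
 also have "\<dots> = emeasure (leb n) (cube 0 n)" by simp
 also have "\<dots> = (\<Prod>i\<in>{..<n}. emeasure lborel {0..<(0::real)+1})"
  unfolding cube_def leb_def by (rule leb.emeasure_PiM) auto
 also have "\<dots> = 1" by simp
 finally show ?thesis using det_pos by (simp add: measure_def)
qed

lemma fundamental_region_exists: "\<exists>F. fundamental_region n (lat n B) F"
proof -
 let ?S = "{v \<in> space (leb n). \<forall>i<n. 0 <= (\<Sum>j<n. Bi $$ (i, j) * v j) & (\<Sum>j<n. Bi $$ (i, j) * v j) < 1}"
 have "?S = space (leb n) \<inter> (\<Inter>i\<in>{..<n}. {v \<in> space (leb n). 0 <= (\<Sum>j<n. Bi $$ (i, j) * v j) & (\<Sum>j<n. Bi $$ (i, j) * v j) < 1})"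
  by auto
 also have "\<dots> \<in> sets (leb n)"
 by simp
 finally have S: "?S \<in> sets (leb n)" .
 define F where "F = {x \<in> carrier_vec n. \<forall>i<n. 0 <= (Bi *\<^sub>v x) $ i & (Bi *\<^sub>v x) $ i < 1}"
 have FS: "F = Matrix.vec n ` ?S"
 proof (intro equalityI subsetI)
  fix x assume x: "x \<in> F"
  have "x = Matrix.vec n (\<lambda>i\<in>{..<n}. x $ i)" using x by (auto simp: F_def)
  moreover have "(\<lambda>i\<in>{..<n}. x $ i) \<in> ?S"
   using x by (auto simp: F_def space_leb Bi_index)
  ultimately show "x \<in> Matrix.vec n ` ?S" by blast
 next
  fix x assume "x \<in> Matrix.vec n ` ?S"
  then obtain v where "v \<in> ?S" "x = Matrix.vec n v" by blast
  thus "x \<in> F" by (auto simp: F_def Bi_index)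
 qed
 have "F \<in> sets (lborel_vec n)" unfolding FS by (rule sets_lborel_vecI[OF S])
 moreover have "\<exists>!y. y \<in> lat n B & x - y \<in> F" if x: "x \<in> carrier_vec n" for x
 proof -
  define z where "z = Bi *\<^sub>v x"
  have z: "z \<in> carrier_vec n" "x = B *\<^sub>v z" using x BBi_vec(1)[OF x] by (simp_all add: z_def)
  have iff: "x - B *\<^sub>v rv c \<in> F \<longleftrightarrow> c = Matrix.vec n (%i. \<lfloor>z $ i\<rfloor>)" if c: "c \<in> carrier_vec n" for c
  proof -
   have "Bi *\<^sub>v (x - B *\<^sub>v rv c) = z - rv c"
    using c x by (subst mult_minus_distrib_mat_vec[of _ n n]) (auto simp: BBi_vec z_def)
   hence "x - B *\<^sub>v rv c \<in> F \<longleftrightarrow> (\<forall>i<n. 0 <= z $ i - of_int (c $ i) & z $ i - of_int (c $ i) < 1)"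
    using x c by (auto simp: F_def)
   also have "\<dots> \<longleftrightarrow> (\<forall>i<n. c $ i = \<lfloor>z $ i\<rfloor>)"
    by (intro all_cong) (auto simp: floor_eq_iff eq_commute[of "c $ _"])
   also have "\<dots> \<longleftrightarrow> c = Matrix.vec n (%i. \<lfloor>z $ i\<rfloor>)" using c by auto
   finally show ?thesis .
  qed
  show ?thesis
  using iff by (auto simp: lat_def)
 qed
 ultimately show ?thesis unfolding fundamental_region_def by (intro exI[of _ F]) simp
qed

lemma covolume: "covolume n (lat n B) = (\<Prod>i<n. W i i)"
 unfolding covolume_def
 by (rule fundamental_region_volume) (rule someI_ex[OF fundamental_region_exists])

text \<open>With a common denominator \<open>D\<close> of the Gram matrix all values
  \<open>D * q c\<close> are natural numbers. This gives the gap \<open>1 / D\<close> behind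
  discreteness, and it makes the minimum attained, without which the \<open>LEAST\<close> over real
  norms in \<open>min_norm\<close> would say nothing.\<close>

lemma min_gram:
 assumes n: "0 < n" and D: "0 < D" "!!i j. i < n ==> j < n ==> of_nat D*(transpose_mat B*B) $$ (i, j) \<in> \<int>"
 shows "discrete_set (lat n B)"
  and "(!!c. c \<in> carrier_vec n ==> c ~= 0\<^sub>v n ==> r < vnorm (B *\<^sub>v rv (c :: int vec))) ==> r < min_norm n (lat n B)"
proof -
 let ?Q = "transpose_mat B*B"
 note [simp] = dims
 define q where "q c = scalar_prod (B *\<^sub>v rv c) (B *\<^sub>v rv (c :: int vec))" for c
 have BT: "transpose_mat B \<in> carrier_mat n n" by simp
 have q: "q c = (\<Sum>i<n. \<Sum>j<n. ?Q $$ (i, j) * of_int (c $ i) * of_int (c $ j))" if c: "c \<in> carrier_vec n" for c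
 proof -
  let ?c = "rv c :: real vec"
  have "q c = scalar_prod (transpose_mat B *\<^sub>v (B *\<^sub>v ?c)) ?c"
   unfolding q_def by (rule transpose_vec_mult_scalar[symmetric, OF B_carrier]) (use c in auto)
  also have "transpose_mat B *\<^sub>v (B *\<^sub>v ?c) = ?Q *\<^sub>v ?c"
   by (rule assoc_mult_mat_vec[symmetric, OF BT B_carrier]) (use c in simp)
  also have "scalar_prod (?Q *\<^sub>v ?c) ?c = (\<Sum>i<n. \<Sum>j<n. ?Q $$ (i, j) * of_int (c $ i) * of_int (c $ j))"
  proof -
   have d: "dim_row ?Q = n" "dim_col ?Q = n" "dim_vec c = n" using c by auto
   have r: "(?Q *\<^sub>v ?c) $ i = (\<Sum>j<n. ?Q $$ (i, j) * of_int (c $ j))" if "i < n" for i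
    using that d by (subst index_mult_mat_vec) (auto simp: scalar_prod_def atLeast0LessThan simp del: index_mult_mat)
   have "scalar_prod (?Q *\<^sub>v ?c) ?c = (\<Sum>i<n. (?Q *\<^sub>v ?c) $ i * of_int (c $ i))"
    using d by (simp add: scalar_prod_def atLeast0LessThan)
   also have "\<dots> = (\<Sum>i<n. (\<Sum>j<n. ?Q $$ (i, j) * of_int (c $ j)) * of_int (c $ i))"
    by (rule sum_cong) (simp only: r lessThan_iff)
   also have "\<dots> = (\<Sum>i<n. \<Sum>j<n. ?Q $$ (i, j) * of_int (c $ i) * of_int (c $ j))"
    unfolding sum_distrib_right by (intro sum.cong refl) (simp only: mult_ac)
   finally show ?thesis .
  qed
  finally show ?thesis .
 qed
 have qZ: "\<exists>k::nat. of_nat D*q c = of_nat k" if c: "c \<in> carrier_vec n" for c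
 proof -
  have "of_nat D*q c = (\<Sum>i<n. \<Sum>j<n. (of_nat D*?Q $$ (i, j))*(of_int (c $ i) * of_int (c $ j)))"
   unfolding q[OF c] sum_distrib_left by (simp only: mult_ac)
  also have "\<dots> \<in> \<int>" by (intro Ints_sum Ints_mult[OF D(2)] Ints_mult Ints_of_int) auto
  finally have "of_nat D*q c \<in> \<int>" .
  moreover have "0 <= of_nat D*q c" unfolding q_def using vnorm_sq by simp
  ultimately obtain z :: int where "of_nat D*q c = of_int z" "0 <= z" by (auto elim!: Ints_cases)
  thus ?thesis by (intro exI[of _ "nat z"]) simp
 qed
 have qpos: "0 < q c" if c: "c \<in> carrier_vec n" "c ~= 0\<^sub>v n" for c
 proof -
  let ?x = "B *\<^sub>v rv c"
  have x: "?x \<in> carrier_vec n" using c by simp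
  have "?x ~= 0\<^sub>v n"
  proof
   assume a: "?x = 0\<^sub>v n"
   have "rv c = Bi *\<^sub>v ?x" using BBi_vec(2)[of "rv c"] c by simp
   hence z: "rv c = (0\<^sub>v n :: real vec)" unfolding a by simp
   have "c $ i = 0" if "i < n" for i
   proof -
    have "real_of_int (c $ i) = map_vec real_of_int c $ i" using that c by simp
    also have "\<dots> = 0" unfolding z using that by simp
    finally show ?thesis by simp
   qed
   thus False using c by auto
  qed
  then obtain i where i: "i < n" "?x $ i ~= 0" by (auto simp: vec_eq_iff)
  have "0 < ?x $ i*?x $ i" using i(2) not_real_square_gt_zero by blast
  also have "\<dots> <= q c" unfolding q_def scalar_prod_def using i(1) by (intro member_le_sum) auto
  finally show ?thesis .
 qed
 have qD: "1 / of_nat D <= q c" if c: "c \<in> carrier_vec n" "c ~= 0\<^sub>v n" for c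
 proof -
  obtain k :: nat where k: "of_nat D*q c = of_nat k" using qZ[OF c(1)] by blast
  hence "of_nat k > (0::real)" using qpos[OF c] D by (metis mult_pos_pos of_nat_0_less_iff)
  hence "1 <= of_nat D*q c" unfolding k by simp
  thus ?thesis using D by (simp add: field_simps)
 qed
 have vq: "vnorm (B *\<^sub>v rv c) = sqrt (q c)" for c by (simp add: vnorm_def q_def)
 show "discrete_set (lat n B)"
  unfolding discrete_set_def
 proof (intro ballI exI[of _ "sqrt (1 / of_nat D)"] conjI impI)
  show "0 < sqrt (1 / real D)" using D by simp
  fix x y assume "x \<in> lat n B" "y \<in> lat n B" and l: "vnorm (y - x) < sqrt (1 / real D)"
  then obtain c d where cd: "c \<in> carrier_vec n" "d \<in> carrier_vec n" "x = B *\<^sub>v rv c" "y = B *\<^sub>v rv d"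
   unfolding lat_def by blast
  have "y - x = B *\<^sub>v (rv d - rv c)"
   using cd by (simp add: mult_minus_distrib_mat_vec[OF B_carrier])
  also have "rv d - rv c = (rv (d - c) :: real vec)"
   using cd by auto
  finally have "sqrt (q (d - c)) < sqrt (1 / real D)" using l vq by simp
  hence "d - c = 0\<^sub>v n" using qD[of "d - c"] cd by auto
  hence "d $ i = c $ i" if "i < n" for i
  proof -
   have "(d - c) $ i = 0" using \<open>d - c = 0\<^sub>v n\<close> that by simp
   thus ?thesis using that cd by simp
  qed
  hence "d = c" using cd by auto
  thus "y = x" using cd by simp
 qed
 have nz: "B *\<^sub>v rv c ~= 0\<^sub>v n" if "c \<in> carrier_vec n" "c ~= 0\<^sub>v n" for c :: "int vec"
 proof
  assume a: "B *\<^sub>v rv c = 0\<^sub>v n"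
  have "q c = 0" unfolding q_def a by simp
  thus False using qpos[OF that] by simp
 qed
 have lz: "lat n B - {0\<^sub>v n} = (%c :: int vec. B *\<^sub>v rv c) ` (carrier_vec n - {0\<^sub>v n})"
 proof (intro equalityI subsetI)
  fix x assume "x \<in> lat n B - {0\<^sub>v n}"
  then obtain c where c: "c \<in> carrier_vec n" "x = B *\<^sub>v rv c" "x ~= 0\<^sub>v n" unfolding lat_def by blast
  have "c ~= 0\<^sub>v n"
  using c by (auto simp: of_int_hom.vec_hom_zero)
  with c show "x \<in> (%c :: int vec. B *\<^sub>v rv c) ` (carrier_vec n - {0\<^sub>v n})" by blast
 qed (use nz in \<open>auto simp: lat_def\<close>)
 show "r < min_norm n (lat n B)" if r: "!!c. c \<in> carrier_vec n ==> c ~= 0\<^sub>v n ==> r < vnorm (B *\<^sub>v rv (c :: int vec))"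
 proof -
  define P where "P k \<longleftrightarrow> (\<exists>c. c \<in> carrier_vec n & c ~= 0\<^sub>v n & of_nat D*q c = of_nat k)" for k :: nat
  have "unit_vec n 0 ~= (0\<^sub>v n :: int vec)" using n by simp
  hence "\<exists>k. P k" unfolding P_def using qZ[of "unit_vec n 0"] by (metis unit_vec_carrier)
  hence "P (LEAST k. P k)" by (rule LeastI_ex)
  then obtain c where c: "c \<in> carrier_vec n" "c ~= 0\<^sub>v n" "of_nat D*q c = of_nat (LEAST k. P k)" unfolding P_def by blast
  have "min_norm n (lat n B) = vnorm (B *\<^sub>v rv c)"
   unfolding min_norm_def
  proof (rule Least_equality)
   show "vnorm (B *\<^sub>v rv c) \<in> vnorm ` (lat n B - {0\<^sub>v n})" unfolding lz using c by blast
   fix y assume "y \<in> vnorm ` (lat n B - {0\<^sub>v n})"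
   then obtain d where d: "d \<in> carrier_vec n" "d ~= 0\<^sub>v n" "y = vnorm (B *\<^sub>v rv d)" unfolding lz by blast
   obtain k :: nat where k: "of_nat D*q d = of_nat k" using qZ[OF d(1)] by blast
   hence "P k" unfolding P_def using d by blast
   hence "(LEAST k. P k) <= k" by (rule Least_le)
   hence "of_nat D*q c <= of_nat D*q d" unfolding k c(3) by simp
   hence "q c <= q d" using D by simp
   thus "vnorm (B *\<^sub>v rv c) <= y" unfolding d(3) vq by simp
  qed
  thus ?thesis using r[OF c(1,2)] by simp
 qed
qed

end

section \<open>Symplectic lattices from their Gram matrices\<close>

definition Jmat :: "nat => real mat" where
 "Jmat N = four_block_mat (0\<^sub>m N N) (- 1\<^sub>m N) (1\<^sub>m N) (0\<^sub>m N N)"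

lemma Jmat_carrier [simp]: "Jmat N \<in> carrier_mat (2*N) (2*N)"
 unfolding Jmat_def mult_2 by simp

lemma Jmat_sq: "Jmat N*Jmat N = - 1\<^sub>m (2*N)"
proof -
 have "Jmat N*Jmat N = four_block_mat (- 1\<^sub>m N) (0\<^sub>m N N) (0\<^sub>m N N) (- 1\<^sub>m N)"
  unfolding Jmat_def by (subst mult_four_block_mat[of _ N N _ N _ N]) auto
 also have "\<dots> = - 1\<^sub>m (2*N)" by (rule eq_matI) auto
 finally show ?thesis .
qed

lemma Jmat_transpose: "transpose_mat (Jmat N) = - Jmat N"
 unfolding Jmat_def by auto

lemma Jmat_Ints: "i < 2*N ==> j < 2*N ==> Jmat N $$ (i, j) \<in> \<int>"
 unfolding Jmat_def by auto

context based_lattice begin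

text \<open>The isometry is \<open>S = B J B^T\<close>. The relation \<open>Q J Q = J\<close> gives
  \<open>S S = -1\<close>, and \<open>S\<close> is skew since \<open>J\<close> is; together they
  make \<open>S\<close> orthogonal. Moreover \<open>B^T S B = J\<close>, so \<open>S (B c)\<close>
  has the integral inner products \<open>J c\<close> with the basis.\<close>

lemma symplectic:
 assumes n: "n = 2*N" and QJQ: "(transpose_mat B*B)*Jmat N*(transpose_mat B*B) = Jmat N"
  and d: "discrete_set (lat n B)"
 shows "symplectic_lattice n (lat n B)"
proof -
 note [simp] = dims
 define J where "J = Jmat N"
 define T where "T = transpose_mat B"
 define Ti where "Ti = transpose_mat Bi"
 have J: "J \<in> carrier_mat n n" "J*J = - 1\<^sub>m n" "transpose_mat J = - J" using Jmat_sq[of N] Jmat_transpose[of N] n by (auto simp: J_def)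
 have T: "T \<in> carrier_mat n n" "Ti \<in> carrier_mat n n" by (auto simp: T_def Ti_def)
 have TTi: "T*Ti = 1\<^sub>m n" "Ti*T = 1\<^sub>m n"
  using transpose_mult[OF Bi(1) B_carrier] transpose_mult[OF B_carrier Bi(1)] transpose_one[of n] unfolding T_def Ti_def Bi(2,3) by metis+
 note a = assoc_mult_mat[of _ n n _ n _ n]
 have TT: "T*(Ti*X) = X" "Ti*(T*X) = X" "B*(Bi*X) = X" "Bi*(B*X) = X" "J*(J*X) = - X" if "X \<in> carrier_mat n n" for X
  using that T TTi J by (simp_all flip: a)
 have mc [simp]: "X*Y \<in> carrier_mat n n" if "X \<in> carrier_mat n n" "Y \<in> carrier_mat n n" for X Y :: "real mat" using that by simp
 note [simp] = J(1) T Bi(1) B_carrier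
 have q1: "T*(B*(J*(T*B))) = J" using QJQ[folded T_def J_def] by (simp add: a)
 have q2: "J*(T*B) = Bi*(Ti*J)"
 proof -
  have "Bi*(Ti*(T*(B*(J*(T*B))))) = J*(T*B)" by (simp add: TT)
  thus ?thesis unfolding q1 by simp
 qed
 have dm: "dim_row J = n" "dim_col J = n" "dim_row T = n" "dim_col T = n" "dim_row Ti = n" "dim_col Ti = n" using J(1) T carrier_matD by blast+
 define S where "S = B*(J*T)"
 have S [simp]: "S \<in> carrier_mat n n" by (simp add: S_def)
 have SS: "S*S = - 1\<^sub>m n"
 proof -
  have "S*S = B*((J*(T*B))*(J*T))" by (simp add: S_def a)
  also have "\<dots> = B*(Bi*(Ti*(J*(J*T))))" unfolding q2 by (simp add: a)
  also have "\<dots> = - 1\<^sub>m n" by (simp add: TT TTi dm)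
  finally show ?thesis .
 qed
 have ST: "transpose_mat S = - S"
 by (simp add: S_def J(3) transpose_mult[of _ n n _ n] T_def a dm)
 define \<sigma> where "\<sigma> x = S *\<^sub>v x" for x
 have \<sigma>c: "\<sigma> x \<in> carrier_vec n" if "x \<in> carrier_vec n" for x
  unfolding \<sigma>_def using that by (rule mult_mat_vec_carrier[OF S])
 have \<sigma>\<sigma>: "\<sigma> (\<sigma> x) = - x" if x: "x \<in> carrier_vec n" for x
 proof -
  have "\<sigma> (\<sigma> x) = (S*S) *\<^sub>v x" unfolding \<sigma>_def using assoc_mult_mat_vec[OF S S x] by simp
  thus ?thesis unfolding SS using x by simp
 qed
 have uminus_uminus: "- (- x) = x" for x :: "real vec" by simp
 have \<sigma>m: "\<sigma> (- x) = - \<sigma> x" if x: "x \<in> carrier_vec n" for x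
  unfolding \<sigma>_def using x carrier_matD[OF S] by auto
 have "linear_isometry n \<sigma>"
  unfolding linear_isometry_def
 proof (intro conjI ballI allI)
  show "bij_betw \<sigma> (carrier_vec n) (carrier_vec n)"
   by (rule bij_betw_byWitness[where f' = "%x. - \<sigma> x"]) (auto simp: \<sigma>\<sigma> \<sigma>c \<sigma>m uminus_uminus)
  show "\<sigma> (x + y) = \<sigma> x + \<sigma> y" if "x \<in> carrier_vec n" "y \<in> carrier_vec n" for x y
   unfolding \<sigma>_def using that by (rule mult_add_distrib_mat_vec[OF S])
  show "\<sigma> (k \<cdot>\<^sub>v x) = k \<cdot>\<^sub>v \<sigma> x" if "x \<in> carrier_vec n" for k x
   unfolding \<sigma>_def using that by (rule mult_mat_vec[OF S])
  show "scalar_prod (\<sigma> x) (\<sigma> y) = scalar_prod x y" if x: "x \<in> carrier_vec n" and y: "y \<in> carrier_vec n" for x y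
  proof -
   have "scalar_prod (\<sigma> x) (\<sigma> y) = scalar_prod (transpose_mat S *\<^sub>v \<sigma> x) y"
    unfolding \<sigma>_def by (rule transpose_vec_mult_scalar[symmetric, OF S y]) (use \<sigma>c[OF x] in \<open>simp add: \<sigma>_def\<close>)
   also have "transpose_mat S *\<^sub>v \<sigma> x = - \<sigma> (\<sigma> x)"
    unfolding ST \<sigma>_def[of "\<sigma> x"] using \<sigma>c[OF x] carrier_matD[OF S] by simp
   also have "\<dots> = x" by (simp add: \<sigma>\<sigma>[OF x])
   finally show ?thesis .
  qed
 qed
 moreover have "\<sigma> ` lat n B = dual_lattice n (lat n B)"
 proof (intro equalityI subsetI)
  fix z assume "z \<in> \<sigma> ` lat n B"
  then obtain c :: "int vec" where c: "c \<in> carrier_vec n" "z = \<sigma> (B *\<^sub>v rv c)" unfolding lat_def by blast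
  have zc: "z \<in> carrier_vec n" unfolding c(2) using c(1) by (intro \<sigma>c) simp
  have "scalar_prod z y \<in> \<int>" if y: "y \<in> lat n B" for y
  proof -
   obtain d :: "int vec" where d: "d \<in> carrier_vec n" "y = B *\<^sub>v rv d" using y unfolding lat_def by blast
   have "scalar_prod z y = scalar_prod (T *\<^sub>v z) (rv d)"
    unfolding d(2) T_def by (rule transpose_vec_mult_scalar[symmetric, OF B_carrier]) (use d zc in auto)
   also have "T *\<^sub>v z = (T*(S*B)) *\<^sub>v rv c"
    unfolding c(2) \<sigma>_def using c(1) by (simp add: assoc_mult_mat_vec[of _ n n _ n])
   also have "T*(S*B) = J" using q1 by (simp add: S_def a)
   finally have e: "scalar_prod z y = scalar_prod (J *\<^sub>v rv c) (rv d)" .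
   note Jc = carrier_matD[OF J(1)]
   show ?thesis unfolding e using c(1) d(1) Jmat_Ints[of _ N] n Jc
    by (auto simp: scalar_prod_def J_def intro!: Ints_sum Ints_mult)
  qed
  thus "z \<in> dual_lattice n (lat n B)" using zc by (simp add: dual_lattice_def)
 next
  fix x assume "x \<in> dual_lattice n (lat n B)"
  hence x: "x \<in> carrier_vec n" "!!y. y \<in> lat n B ==> scalar_prod x y \<in> \<int>" by (auto simp: dual_lattice_def)
  define z where "z = T *\<^sub>v x"
  have z: "z \<in> carrier_vec n" unfolding z_def by (rule mult_mat_vec_carrier[OF T(1) x(1)])
  have zi: "z $ i \<in> \<int>" if i: "i < n" for i
  proof -
   have "scalar_prod x (B *\<^sub>v rv (unit_vec n i :: int vec)) \<in> \<int>"
    by (rule x(2)) (auto simp: lat_def)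
   also have "scalar_prod x (B *\<^sub>v rv (unit_vec n i :: int vec)) = scalar_prod z (rv (unit_vec n i :: int vec))"
    unfolding z_def T_def by (rule transpose_vec_mult_scalar[symmetric, OF B_carrier]) (use x in auto)
   also have "rv (unit_vec n i :: int vec) = (unit_vec n i :: real vec)"
    by (auto simp: unit_vec_def)
   also have "scalar_prod z (unit_vec n i) = z $ i" using i by simp
   finally show ?thesis .
  qed
  \<comment> \<open>\<open>B w\<close> is \<open>\<sigma> x\<close>; hence \<open>x\<close>, being
    \<open>- \<sigma> (\<sigma> x)\<close>, is the image of the lattice vector with coordinates
    \<open>- w\<close>.\<close>
  define w where "w = J *\<^sub>v z"
  have wc: "w \<in> carrier_vec n" unfolding w_def by (rule mult_mat_vec_carrier[OF J(1) z])
  have wZ: "w $ i \<in> \<int>" if "i < n" for i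
   unfolding w_def using that z zi Jmat_Ints[of _ N] n carrier_matD[OF J(1)]
   by (auto simp: scalar_prod_def J_def intro!: Ints_sum Ints_mult)
  define c :: "int vec" where "c = Matrix.vec n (%i. \<lfloor>- w $ i\<rfloor>)"
  have c: "c \<in> carrier_vec n" by (simp add: c_def)
  have mc: "rv c = - w"
  proof (rule eq_vecI)
   fix i assume "i < dim_vec (- w)"
   hence i: "i < n" using wc by simp
   hence "map_vec real_of_int c $ i = of_int \<lfloor>- w $ i\<rfloor>" by (simp add: c_def)
   also have "\<dots> = - w $ i" using wZ[OF i] by simp
   also have "\<dots> = (- w) $ i" using i wc by simp
   finally show "map_vec real_of_int c $ i = (- w) $ i" .
  qed (use wc in \<open>simp add: c_def\<close>)
  have "\<sigma> (B *\<^sub>v rv c) = (S*B) *\<^sub>v (- w)"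
   unfolding \<sigma>_def mc using wc by (simp add: assoc_mult_mat_vec[of _ n n _ n])
  also have "\<dots> = - ((S*B) *\<^sub>v w)"
   using wc by auto
  also have "(S*B) *\<^sub>v w = (S*(B*(J*T))) *\<^sub>v x"
   unfolding w_def z_def using x by (simp add: assoc_mult_mat_vec[of _ n n _ n] mult_mat_vec_carrier[of _ n n])
  also have "S*(B*(J*T)) = - 1\<^sub>m n" using SS unfolding S_def .
  also have "- ((- 1\<^sub>m n) *\<^sub>v x) = x" using x(1) by simp
  finally show "x \<in> \<sigma> ` lat n B" using c unfolding lat_def by auto
 qed
 ultimately show ?thesis
  unfolding symplectic_lattice_def is_lattice_def using d Z_basis \<sigma>\<sigma> by blast
qed

text \<open>Determinants in \<open>Q J Q = J\<close> leave \<open>det B ^ 4 = 1\<close>, and a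
  triangular basis with positive diagonal has positive determinant.\<close>

lemma covolume_one:
 assumes n: "n = 2*N" and QJQ: "(transpose_mat B*B)*Jmat N*(transpose_mat B*B) = Jmat N"
 shows "covolume n (lat n B) = 1"
proof -
 have Jc: "Jmat N \<in> carrier_mat n n" using n by simp
 let ?b = "Determinant.det B" and ?j = "Determinant.det (Jmat N)"
 have Tc: "transpose_mat B*B \<in> carrier_mat n n" by (rule mult_carrier_mat[of _ n n]) auto
 have dQ: "Determinant.det (transpose_mat B*B) = ?b*?b"
  using det_mult[of "transpose_mat B" n B] det_transpose[OF B_carrier] by simp
 have "?j*?j = Determinant.det (- 1\<^sub>m n :: real mat)" using det_mult[OF Jc Jc] Jmat_sq[of N] n by simp
 also have "\<dots> ~= 0"
 using det_mult[of "- 1\<^sub>m n" n "- 1\<^sub>m n :: real mat"] by auto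
 finally have j: "?j ~= 0" by auto
 have "(?b*?b)*?j*(?b*?b) = ?j"
  using arg_cong[OF QJQ, of Determinant.det] det_mult[OF mult_carrier_mat[OF Tc Jc] Tc] det_mult[OF Tc Jc] dQ by simp
 hence "?b^4 = 1^4" using j by (simp add: power4_eq_xxxx)
 moreover have "0 <= ?b" using det_B det_pos by simp
 ultimately have "?b = 1" by (metis power_eq_imp_eq_base zero_le_one zero_less_numeral)
 thus ?thesis using covolume det_B by simp
qed

end

text \<open>From here on only Gram matrices occur. The basis given by Cholesky has irrational
  entries in general, but the output describes just the Gram matrix, which is rational. The strict
  bound on all values passes to the minimum because that is attained.\<close>

theorem lattice_of_gram:
 fixes Q :: "nat => nat => real"
 assumes n: "n = 2*N" "0 < N"
  and sym: "!!i j. i < n ==> j < n ==> Q i j = Q j i"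
  and pd: "!!c. \<exists>i<n. c i ~= 0 ==> 0 < (\<Sum>i<n. \<Sum>j<n. Q i j*c i*c j)"
  and D: "0 < D" "!!i j. i < n ==> j < n ==> of_nat D*Q i j \<in> \<int>"
  and QJQ: "mat n n (%(i, j). Q i j)*Jmat N*mat n n (%(i, j). Q i j) = Jmat N"
  and r: "0 < r" "!!c :: nat => int. \<exists>i<n. c i ~= 0 ==> r\<^sup>2 < (\<Sum>i<n. \<Sum>j<n. Q i j * of_int (c i) * of_int (c j))"
 shows "\<exists>\<Lambda> B. Z_basis n \<Lambda> B & transpose_mat B*B = mat n n (%(i, j). Q i j) & symplectic_lattice n \<Lambda> &
  unit_ball_vol (real n)*r^n / 2^n < lattice_density n \<Lambda>"
proof -
 obtain W where W: "!!i j. j < i ==> W i j = 0" "!!i. i < n ==> 0 < W i i"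
  "!!i j. i < n ==> j < n ==> Q i j = (\<Sum>k<n. W k i*W k j)"
  using cholesky[of n Q, OF sym pd] by blast
 interpret based_lattice n W by unfold_locales (use W in auto)
 have G: "transpose_mat B*B = mat n n (%(i, j). Q i j)"
  by (rule eq_matI) (auto simp: B_def upmat_def scalar_prod_def W(3) atLeast0LessThan)
 have D': "of_nat D*(transpose_mat B*B) $$ (i, j) \<in> \<int>" if "i < n" "j < n" for i j
  using D(2)[OF that] that by (simp add: G)
 have n0: "0 < n" using n by simp
 have J: "(transpose_mat B*B)*Jmat N*(transpose_mat B*B) = Jmat N" using QJQ by (simp only: G)
 have disc: "discrete_set (lat n B)" by (rule min_gram(1)[OF n0 D(1) D'])
 have "r < vnorm (B *\<^sub>v rv c)" if c: "c \<in> carrier_vec n" "c ~= 0\<^sub>v n" for c :: "int vec"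
 proof -
  let ?c = "rv c :: real vec"
  have ex: "\<exists>i<n. c $ i ~= 0" using c by auto
  have x: "(B *\<^sub>v ?c) $ k = (\<Sum>i<n. W k i * of_int (c $ i))" if "k < n" for k
   using that c by (simp add: B_def upmat_def scalar_prod_def atLeast0LessThan)
  have "r\<^sup>2 < (\<Sum>i<n. \<Sum>j<n. Q i j * of_int (c $ i) * of_int (c $ j))" by (rule r(2)[OF ex])
  also have "\<dots> = (\<Sum>i<n. \<Sum>j<n. \<Sum>k<n. (W k i * of_int (c $ i))*(W k j * of_int (c $ j)))"
   by (intro sum.cong refl) (simp add: W(3) sum_distrib_left mult_ac)
  also have "\<dots> = (\<Sum>i<n. \<Sum>k<n. \<Sum>j<n. (W k i * of_int (c $ i))*(W k j * of_int (c $ j)))"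
   by (intro sum.cong refl sum.swap)
  also have "\<dots> = (\<Sum>k<n. \<Sum>i<n. \<Sum>j<n. (W k i * of_int (c $ i))*(W k j * of_int (c $ j)))"
   by (rule sum.swap)
  also have "\<dots> = (\<Sum>k<n. (\<Sum>i<n. W k i * of_int (c $ i))*(\<Sum>j<n. W k j * of_int (c $ j)))"
   by (simp only: sum_product)
  also have "\<dots> = scalar_prod (B *\<^sub>v ?c) (B *\<^sub>v ?c)"
   using carrier_matD[OF B_carrier] by (simp add: scalar_prod_def[of "B *\<^sub>v ?c"] x atLeast0LessThan del: index_mult_mat_vec)
  finally have "r\<^sup>2 < scalar_prod (B *\<^sub>v ?c) (B *\<^sub>v ?c)" .
  thus ?thesis unfolding vnorm_def by (intro real_less_rsqrt)
 qed
 from min_gram(2)[OF n0 D(1) D' this] have rmin: "r < min_norm n (lat n B)" .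
 have "lattice_density n (lat n B) = unit_ball_vol (real n)*min_norm n (lat n B)^n / 2^n"
  unfolding lattice_density_def covolume_one[OF n(1) J] using vball_measure[of "min_norm n (lat n B)" n] rmin r(1) by simp
 moreover have "unit_ball_vol (real n)*r^n < unit_ball_vol (real n)*min_norm n (lat n B)^n"
  using rmin r(1) n0 by (intro mult_strict_left_mono power_strict_mono) auto
 ultimately have "unit_ball_vol (real n)*r^n / 2^n < lattice_density n (lat n B)"
  by (simp add: divide_strict_right_mono)
 thus ?thesis using Z_basis G symplectic[OF n(1) J disc] by blast
qed

section \<open>Averaging over shift-invariant families of lattices\<close>

lemma nn_integral_ZZ_shift:
 fixes g :: "(nat => int) => ennreal"
 assumes "z \<in> ZZ n"
 shows "(nnZ n (%x. g (\<lambda>i\<in>{..<n}. x i + z i))) = (nnZ n (%x. g x))"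
proof (rule nn_integral_bij_count_space)
 show "bij_betw (%x. \<lambda>i\<in>{..<n}. x i + z i) (ZZ n) (ZZ n)"
  by (rule bij_betw_byWitness[where f' = "%x. \<lambda>i\<in>{..<n}. x i - z i"])
    (auto simp: ZZ_def PiE_def extensional_def)
qed

definition periodic :: "nat => ((nat => real) => ennreal) => bool" where
 "periodic n \<Phi> \<longleftrightarrow> (\<forall>z\<in>ZZ n. \<forall>v\<in>space (leb n). \<Phi> (vadd n z v) = \<Phi> v)"

text \<open>A translated cube again contains exactly one representative of each class modulo
  integral vectors, and unfolding the translated integrand picks out that one term.\<close>

lemma periodic_cube_shift:
 assumes m [measurable]: "\<Phi> \<in> bleb n" and p: "periodic n \<Phi>"
 shows "(nnleb n (%v. indicator (cube t n) v * \<Phi> (\<lambda>i\<in>{..<n}. v i + b i))) = (nnleb n (%v. indicator (cube t n) v * \<Phi> v))"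
proof -
 let ?f = "%v. indicator (cube t n) v * \<Phi> v"
 let ?s = "%v. \<lambda>i\<in>{..<n}. v i + b i"
 have fm: "?f \<in> bleb n" by simp
 have sm: "?s \<in> measurable (leb n) (leb n)"
  unfolding leb_def[of n] by simp
 have "(nnleb n (%v. ?f v)) = (nnleb n (%v. ?f (?s v)))"
  by (rule nn_integral_translate[OF fm, symmetric])
 also have "\<dots> = (nnleb n (%v. indicator (cube t n) v * (nnZ n (%x. ?f (?s (vadd n x v))))))"
  by (rule unfold_cube[symmetric]) (rule measurable_compose[OF sm fm])
 also have "\<dots> = (nnleb n (%v. indicator (cube t n) v * \<Phi> (?s v)))"
 proof (rule nn_integral_cong, rule arg_cong2[of _ _ _ _ "(*)"], rule refl)
  fix v assume v: "v \<in> space (leb n)"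
  have sv: "?s v \<in> space (leb n)" by (auto simp: space_leb)
  obtain x0 where x0: "x0 \<in> ZZ n" "!!x. x \<in> ZZ n ==> vadd n (%i. - x i) (?s v) \<in> cube t n \<longleftrightarrow> x = x0"
   using cube_unique[OF sv, of t] by blast
  define y0 where "y0 = (\<lambda>i\<in>{..<n}. - x0 i)"
  have y0: "y0 \<in> ZZ n" by (auto simp: y0_def ZZ_def)
  show "(nnZ n (%x. ?f (?s (vadd n x v)))) = \<Phi> (?s v)"
  proof (rule nn_integral_count_space_unique[OF y0])
   fix x assume x: "x \<in> ZZ n"
   define x' where "x' = (\<lambda>i\<in>{..<n}. - x i)"
   have x': "x' \<in> ZZ n" by (auto simp: x'_def ZZ_def)
   have e: "?s (vadd n x v) = vadd n x (?s v)" by (auto simp: vadd_def)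
   have e2: "vadd n x (?s v) = vadd n (%i. - x' i) (?s v)" by (auto simp: vadd_def x'_def)
   have "x' = x0 \<longleftrightarrow> x = y0" using x x0(1) by (auto simp: x'_def y0_def ZZ_def PiE_def extensional_def fun_eq_iff)
   hence "vadd n x (?s v) \<in> cube t n \<longleftrightarrow> x = y0" unfolding e2 using x0(2)[OF x'] by simp
   moreover have "\<Phi> (vadd n x (?s v)) = \<Phi> (?s v)" using p x sv unfolding periodic_def by blast
   ultimately show "?f (?s (vadd n x v)) = (if x = y0 then \<Phi> (?s v) else 0)" unfolding e by auto
  qed
 qed
 finally show ?thesis by simp
qed

lemma emeasure_cube: "emeasure (leb n) (cube t n) = 1"
using leb.emeasure_PiM by (simp add: cube_def leb_def)

definition lin :: "nat => (nat => nat => int) => (nat => real) => (nat => real)" where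
 "lin n M s = (\<lambda>i\<in>{..<n}. \<Sum>l<n. of_int (M i l) * s l)"

lemma lin_measurable: "lin n M \<in> measurable (leb n) (leb n)"
 unfolding lin_def leb_def[of n] by simp

text \<open>Averaging over all translates by \<open>M t\<close> replaces the Haar measure of the torus by itself,
 so the image under a surjective endomorphism of the uniform measure is uniform.\<close>

lemma torus_average:
 assumes f [measurable]: "f \<in> bleb n"
  and surj: "!!t. \<exists>s. \<forall>i<n. (\<Sum>l<n. of_int (M i l) * s l) = (t i :: real)"
 shows "(nnleb n (%s. indicator (cube t0 n) s*(nnZ n (%x. f (vadd n x (lin n M s)))))) = (nnleb n (%v. f v))"
proof -
 define G where "G v = (nnZ n (%x. f (vadd n x v)))" for v
 have Gm [measurable]: "G \<in> bleb n"
  unfolding G_def by (rule borel_measurable_ZZ_sum) measurable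
 have Gp: "periodic n G"
  unfolding periodic_def
 proof (intro ballI)
  fix z v assume z: "z \<in> ZZ n"
  have "vadd n x (vadd n z v) = vadd n (\<lambda>i\<in>{..<n}. x i + z i) v" for x by (auto simp: vadd_def)
  thus "G (vadd n z v) = G v" unfolding G_def
   using nn_integral_ZZ_shift[OF z, of "%x. f (vadd n x v)"] by simp
 qed
 define \<Phi> where "\<Phi> s = G (lin n M s)" for s
 have \<Phi>m [measurable]: "\<Phi> \<in> bleb n"
  unfolding \<Phi>_def by (rule measurable_compose[OF lin_measurable Gm])
 have \<Phi>p: "periodic n \<Phi>"
  unfolding periodic_def
 proof (intro ballI)
  fix z v assume z: "z \<in> ZZ n" and v: "v \<in> space (leb n)"
  let ?z = "\<lambda>i\<in>{..<n}. \<Sum>l<n. M i l*z l"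
  have "lin n M (vadd n z v) = vadd n ?z (lin n M v)"
   by (auto simp: lin_def vadd_def distrib_left sum.distrib)
  moreover have "?z \<in> ZZ n" by (auto simp: ZZ_def)
  moreover have "lin n M v \<in> space (leb n)" by (auto simp: lin_def space_leb)
  ultimately show "\<Phi> (vadd n z v) = \<Phi> v" using Gp unfolding periodic_def \<Phi>_def by metis
 qed
 have Gt: "G (\<lambda>i\<in>{..<n}. lin n M s i + b i) = \<Phi> (\<lambda>i\<in>{..<n}. s i + sb i)" if "!!i. i < n ==> (\<Sum>l<n. of_int (M i l) * sb l) = b i" for s b sb
 proof -
  have "(\<lambda>i\<in>{..<n}. lin n M s i + b i) = lin n M (\<lambda>i\<in>{..<n}. s i + sb i)"
   using that by (auto simp: lin_def distrib_left sum.distrib restrict_def)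
  thus ?thesis by (simp add: \<Phi>_def)
 qed
 have inner: "(nnleb n (%s. indicator (cube t0 n) s*G (\<lambda>i\<in>{..<n}. lin n M s i + b i))) = (nnleb n (%s. indicator (cube t0 n) s*\<Phi> s))" for b
 proof -
  obtain sb where sb: "!!i. i < n ==> (\<Sum>l<n. of_int (M i l) * sb l) = b i" using surj[of b] by blast
  have "G (\<lambda>i\<in>{..<n}. lin n M s i + b i) = \<Phi> (\<lambda>i\<in>{..<n}. s i + sb i)" for s by (rule Gt) (rule sb)
  thus ?thesis using periodic_cube_shift[OF \<Phi>m \<Phi>p, of t0 sb] by simp
 qed
 have shm: "(%(s, b). \<lambda>i\<in>{..<n}. lin n M s i + b i) \<in> measurable (leb n \<Otimes>\<^sub>M leb n) (leb n)"
 proof -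
  have "(%p. \<lambda>i\<in>{..<n}. lin n M (fst p) i + snd p i) \<in> measurable (leb n \<Otimes>\<^sub>M leb n) (\<Pi>\<^sub>M i\<in>{..<n}. lborel)"
  proof (rule measurable_restrict)
   fix i assume i: "i \<in> {..<n}"
   have 1: "(%p. lin n M (fst p) i) \<in> borel_measurable (leb n \<Otimes>\<^sub>M leb n)"
    using i by (intro measurable_compose[OF measurable_fst] measurable_compose[OF lin_measurable] measurable_coord) auto
   have 2: "(%p. snd p i) \<in> borel_measurable (leb n \<Otimes>\<^sub>M leb n)"
    using i by simp
   show "(%p. lin n M (fst p) i + snd p i) \<in> measurable (leb n \<Otimes>\<^sub>M leb n) lborel"
    using borel_measurable_add[OF 1 2] by simp
  qed
  thus ?thesis by (simp add: leb_def split_beta')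
 qed
 interpret L: sigma_finite_measure "leb n" by (rule sigma_finite_leb)
 interpret P: pair_sigma_finite "leb n" "leb n" ..
 have "(nnleb n (%s. indicator (cube t0 n) s*\<Phi> s)) = (nnleb n (%b. indicator (cube 0 n) b*(nnleb n (%s. indicator (cube t0 n) s*\<Phi> s))))"
  by (simp add: nn_integral_multc emeasure_cube)
 also have "\<dots> = (nnleb n (%b. (nnleb n (%s. indicator (cube 0 n) b*(indicator (cube t0 n) s*G (\<lambda>i\<in>{..<n}. lin n M s i + b i))))))"
 proof (rule nn_integral_cong)
  fix b
  have "(%s. \<lambda>i\<in>{..<n}. lin n M s i + b i) \<in> measurable (leb n) (leb n)"
  proof -
   have m: "(%v. \<lambda>i\<in>{..<n}. v i + b i) \<in> measurable (leb n) (leb n)"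
    unfolding leb_def[of n] by simp
   show ?thesis by (rule measurable_compose[OF lin_measurable m])
  qed
  from measurable_compose[OF this Gm]
  have "(%s. indicator (cube t0 n) s*G (\<lambda>i\<in>{..<n}. lin n M s i + b i)) \<in> bleb n" by simp
  thus "indicator (cube 0 n) b*(nnleb n (%s. indicator (cube t0 n) s*\<Phi> s)) =
   (nnleb n (%s. indicator (cube 0 n) b*(indicator (cube t0 n) s*G (\<lambda>i\<in>{..<n}. lin n M s i + b i))))"
   by (subst nn_integral_cmult) (simp_all only: inner)
 qed
 also have "\<dots> = (nnleb n (%s. (nnleb n (%b. indicator (cube 0 n) b*(indicator (cube t0 n) s*G (\<lambda>i\<in>{..<n}. lin n M s i + b i))))))"
 proof (rule P.Fubini')
  show "(%(s, b). indicator (cube 0 n) b*(indicator (cube t0 n) s*G (\<lambda>i\<in>{..<n}. lin n M s i + b i))) \<in> borel_measurable (leb n \<Otimes>\<^sub>M leb n)"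
   using measurable_compose[OF shm Gm] by (simp add: split_beta')
 qed
 also have "\<dots> = (nnleb n (%s. indicator (cube t0 n) s*(nnleb n (%v. f v))))"
 proof (rule nn_integral_cong)
  fix s assume "s \<in> space (leb n)"
  have e: "(\<lambda>i\<in>{..<n}. lin n M s i + b i) = (\<lambda>i\<in>{..<n}. b i + lin n M s i)" for b by auto
  have m: "(%v. \<lambda>i\<in>{..<n}. v i + lin n M s i) \<in> measurable (leb n) (leb n)"
   unfolding leb_def[of n] by simp
  have "(nnleb n (%b. indicator (cube 0 n) b*(indicator (cube t0 n) s*G (\<lambda>i\<in>{..<n}. lin n M s i + b i))))
    = (nnleb n (%b. indicator (cube t0 n) s*(indicator (cube 0 n) b*G (\<lambda>i\<in>{..<n}. b i + lin n M s i))))"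
   unfolding e by (simp only: mult_ac)
  also have "\<dots> = indicator (cube t0 n) s*(nnleb n (%b. indicator (cube 0 n) b*G (\<lambda>i\<in>{..<n}. b i + lin n M s i)))"
   using measurable_compose[OF m Gm] by (intro nn_integral_cmult borel_measurable_times_ennreal borel_measurable_indicator sets_cube)
  also have "(nnleb n (%b. indicator (cube 0 n) b*G (\<lambda>i\<in>{..<n}. b i + lin n M s i))) = (nnleb n (%b. indicator (cube 0 n) b*G b))"
   by (rule periodic_cube_shift[OF Gm Gp])
  also have "\<dots> = (nnleb n (%v. f v))" unfolding G_def by (rule unfold_cube[OF f])
  finally show "(nnleb n (%b. indicator (cube 0 n) b*(indicator (cube t0 n) s*G (\<lambda>i\<in>{..<n}. lin n M s i + b i)))) =
   indicator (cube t0 n) s*(nnleb n (%v. f v))" .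
 qed
 also have "\<dots> = (nnleb n (%v. f v))" by (simp add: nn_integral_multc emeasure_cube)
 finally show ?thesis by (simp add: \<Phi>_def G_def)
qed

section \<open>Radial integrals and second moments\<close>

fun radial :: "nat => (real => ennreal) => ennreal" where
 "radial 0 h = h 0"
| "radial (Suc k) h = (\<integral>\<^sup>+y. radial k (%q. h (q + y\<^sup>2)) \<partial>lborel)"

lemma comp_borel: "i \<in> J ==> (%v. v i) \<in> borel_measurable (PiM J (%_::nat. lborel :: real measure))"
 using measurable_component_singleton[of i J "%_. lborel :: real measure"] by simp

lemma nn_integral_radial:
 assumes "finite J" "h \<in> borel_measurable borel"
 shows "(\<integral>\<^sup>+v. h (\<Sum>i\<in>J. (v i)\<^sup>2) \<partial>PiM J (%_::nat. lborel)) = radial (card J) h"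
 using assms
proof (induction J arbitrary: h rule: finite_induct)
 case empty
 thus ?case by (simp add: PiM_empty)
next
 case (insert i J h)
 have [measurable]: "h \<in> borel_measurable borel" by fact
 have sm: "(%v. \<Sum>i\<in>insert i J. (v i)\<^sup>2) \<in> borel_measurable (PiM (insert i J) (%_::nat. lborel :: real measure))"
  by (intro borel_measurable_sum borel_measurable_power comp_borel)
 have "(\<integral>\<^sup>+v. h (\<Sum>i\<in>insert i J. (v i)\<^sup>2) \<partial>PiM (insert i J) (%_. lborel)) =
   (\<integral>\<^sup>+y. (\<integral>\<^sup>+x. h (\<Sum>j\<in>insert i J. ((x(i := y)) j)\<^sup>2) \<partial>PiM J (%_. lborel)) \<partial>lborel)"
  by (rule leb.product_nn_integral_insert_rev[OF insert.hyps]) (rule measurable_compose[OF sm insert.prems])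
 also have "\<dots> = (\<integral>\<^sup>+y. (\<integral>\<^sup>+x. h ((\<Sum>j\<in>J. (x j)\<^sup>2) + y\<^sup>2) \<partial>PiM J (%_. lborel)) \<partial>lborel)"
 proof -
  have "(\<Sum>j\<in>insert i J. ((x(i := y)) j)\<^sup>2) = (\<Sum>j\<in>J. (x j)\<^sup>2) + y\<^sup>2" for x and y :: real
  proof -
   have "(\<Sum>j\<in>J. ((x(i := y)) j)\<^sup>2) = (\<Sum>j\<in>J. (x j)\<^sup>2)"
    by (rule sum_cong) (use insert.hyps in auto)
   thus ?thesis using insert.hyps by simp
  qed
  thus ?thesis by simp
 qed
 also have "\<dots> = (\<integral>\<^sup>+y. radial (card J) (%q. h (q + y\<^sup>2)) \<partial>lborel)"
  by (intro nn_integral_cong) (subst insert.IH[symmetric], auto)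
 finally show ?case using insert.hyps by simp
qed

text \<open>Iterating over single coordinates separates a ball in dimension \<open>k1 + k2\<close>
  into slices; only the numbers of coordinates in the two groups enter, and no product of two
  product measures has to be identified with a third.\<close>

lemma radial_add: "radial k2 (%t. radial k1 (%q. h (q + t))) = radial (k1 + k2) h"
proof (induction k2 arbitrary: h)
 case (Suc k2)
 show ?case using Suc.IH[of "%q. h (q + _\<^sup>2)"] by (simp add: add.assoc)
qed simp

lemma radial_measurable:
 assumes "h \<in> borel_measurable borel"
 shows "(%t. radial k (%q. h (q + t))) \<in> borel_measurable borel"
proof -
 have [measurable]: "h \<in> borel_measurable borel" by fact
 interpret L: sigma_finite_measure "leb k" by (rule sigma_finite_leb)
 have "radial k (%q. h (q + t)) = (nnleb k (%v. h ((\<Sum>i\<in>{..<k}. (v i)\<^sup>2) + t)))" for t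
  unfolding leb_def by (subst nn_integral_radial[of "{..<k}" "%q. h (q + t)"]) auto
 moreover have "(%t. nnleb k (%v. h ((\<Sum>i\<in>{..<k}. (v i)\<^sup>2) + t))) \<in> borel_measurable borel"
  by simp
 ultimately show ?thesis by simp
qed

lemma ball_iterated:
 assumes "0 < R"
 shows "(nnleb n (%y. (nnleb n (%z. indicator {..R} ((\<Sum>i<n. (z i)\<^sup>2) + (\<Sum>i<n. (y i)\<^sup>2)))))) = ennreal (unit_ball_vol (real (2*n)) * R^n)"
proof -
 define h where "h = (indicator {..R} :: real => ennreal)"
 have h: "h \<in> borel_measurable borel" by (simp add: h_def)
 have 1: "(nnleb n (%z. h ((\<Sum>i<n. (z i)\<^sup>2) + t))) = radial n (%q. h (q + t))" for t
  using nn_integral_radial[of "{..<n}" "%q. h (q + t)"] h by (simp add: leb_def)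
 have "(nnleb n (%y. (nnleb n (%z. h ((\<Sum>i<n. (z i)\<^sup>2) + (\<Sum>i<n. (y i)\<^sup>2)))))) = radial n (%t. radial n (%q. h (q + t)))"
  unfolding 1 using nn_integral_radial[OF _ radial_measurable[OF h, of n], of "{..<n}"] by (simp add: leb_def)
 also have "\<dots> = radial (2*n) h" unfolding radial_add by (simp add: mult_2)
 also have "\<dots> = (\<integral>\<^sup>+v. h (\<Sum>i<2*n. (v i)\<^sup>2) \<partial>leb (2*n))"
  using nn_integral_radial[of "{..<2*n}" h] h by (simp add: leb_def)
 also have "\<dots> = (\<integral>\<^sup>+v. indicator ({f. sqrt (\<Sum>i\<in>{..<2*n}. (f i)\<^sup>2) <= sqrt R} \<inter> space (leb (2*n))) v \<partial>leb (2*n))"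
  by (rule nn_integral_cong) (auto simp: h_def indicator_def)
 also have "\<dots> = emeasure (leb (2*n)) ({f. sqrt (\<Sum>i\<in>{..<2*n}. (f i)\<^sup>2) <= sqrt R} \<inter> space (leb (2*n)))"
 by simp
 also have "\<dots> = ennreal (unit_ball_vol (real (2*n)) * sqrt R^(2*n))"
  using emeasure_cball_aux[of "{..<2*n}" "sqrt R"] assms by (simp add: leb_def)
 also have "sqrt R^(2*n) = R^n" using assms by (simp add: power_mult)
 finally show ?thesis by (simp add: h_def)
qed

lemma second_moment_1:
 fixes a h c d :: real
 assumes "0 < h"
 shows "(\<integral>\<^sup>+y. indicator {a - h..<a + h} y*ennreal ((d + c*(y - a))\<^sup>2) \<partial>lborel) <= ennreal (2*h*(d\<^sup>2 + h\<^sup>2 / 3*c\<^sup>2))"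
proof -
 define F where "F y = d\<^sup>2*y + d*c*(y - a)\<^sup>2 + c\<^sup>2*(y - a)^3 / 3" for y
 have D: "(F has_real_derivative (d + c*(y - a))\<^sup>2) (at y)" for y
  unfolding F_def by (auto intro!: derivative_eq_intros simp: power2_eq_square field_simps)
 have "(\<integral>\<^sup>+y. indicator {a - h..<a + h} y*ennreal ((d + c*(y - a))\<^sup>2) \<partial>lborel) <= (\<integral>\<^sup>+y. ennreal ((d + c*(y - a))\<^sup>2)*indicator {a - h..a + h} y \<partial>lborel)"
  by (intro nn_integral_mono) (auto simp: indicator_def)
 also have "\<dots> = ennreal (F (a + h) - F (a - h))"
  using assms by (intro nn_integral_FTC_Icc D) auto
 also have "F (a + h) - F (a - h) = 2*h*(d\<^sup>2 + h\<^sup>2 / 3*c\<^sup>2)"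
  by (simp add: F_def power2_eq_square power3_eq_cube field_simps)
 finally show ?thesis .
qed

text \<open>The cube is centred at \<open>a\<close>, so mixed terms vanish by symmetry and every
  coordinate contributes its variance \<open>h^2 / 3\<close>. The constant \<open>d\<close> is there
  for the induction, where it absorbs the coordinates already fixed.\<close>

lemma second_moment:
 fixes a :: "nat => real"
 assumes "finite J" "0 < h"
 shows "(\<integral>\<^sup>+v. indicator (PiE J (%i. {a i - h..<a i + h})) v * ennreal ((d + (\<Sum>i\<in>J. c i*(v i - a i)))\<^sup>2) \<partial>PiM J (%_. lborel))
  <= ennreal ((2*h)^card J*(d\<^sup>2 + h\<^sup>2 / 3*(\<Sum>i\<in>J. (c i)\<^sup>2)))"
 using assms(1)
proof (induction J rule: finite_induct)
 case empty
 thus ?case by (simp add: PiM_empty nn_integral_count_space_finite)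
next
 case (insert i J)
 let ?X = "%J v. d + (\<Sum>i\<in>J. c i*(v i - a i))"
 let ?b = "%J v. indicator (PiE J (%i. {a i - h..<a i + h})) v :: ennreal"
 have Jm: "PiE J (%i. {a i - h..<a i + h}) \<in> sets (PiM J (%_. lborel))" if "finite J" for J
  by (rule sets_PiM_I_finite) (use that in auto)
 have Xm: "(%v. ?X J v) \<in> borel_measurable (PiM J (%_. lborel))" for J
  by (intro borel_measurable_add borel_measurable_const borel_measurable_sum borel_measurable_times borel_measurable_diff comp_borel)
 have m: "(%v. ?b J v * ennreal ((?X J v)\<^sup>2)) \<in> borel_measurable (PiM J (%_. lborel))" if "finite J" for J
  using Jm[OF that] Xm[of J] by simp
 have "(\<integral>\<^sup>+v. ?b (insert i J) v * ennreal ((?X (insert i J) v)\<^sup>2) \<partial>PiM (insert i J) (%_. lborel)) =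
   (\<integral>\<^sup>+x. (\<integral>\<^sup>+y. ?b (insert i J) (x(i := y))*ennreal ((?X (insert i J) (x(i := y)))\<^sup>2) \<partial>lborel) \<partial>PiM J (%_. lborel))"
  using insert.hyps m[of "insert i J"] by (intro leb.product_nn_integral_insert) auto
 also have "\<dots> = (\<integral>\<^sup>+x. (\<integral>\<^sup>+y. ?b J x*(indicator {a i - h..<a i + h} y*ennreal ((?X J x + c i*(y - a i))\<^sup>2)) \<partial>lborel) \<partial>PiM J (%_. lborel))"
 proof (intro nn_integral_cong)
  fix x and y :: real assume x: "x \<in> space (PiM J (%_. lborel :: real measure))"
  have 1: "?X (insert i J) (x(i := y)) = ?X J x + c i*(y - a i)"
  proof -
   have "(\<Sum>j\<in>J. c j*((x(i := y)) j - a j)) = (\<Sum>j\<in>J. c j*(x j - a j))"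
    by (rule sum_cong) (use insert.hyps in auto)
   thus ?thesis using insert.hyps by simp
  qed
  have "x(i := y) \<in> PiE (insert i J) (%i. {a i - h..<a i + h}) \<longleftrightarrow> x \<in> PiE J (%i. {a i - h..<a i + h}) & y \<in> {a i - h..<a i + h}"
   using x insert.hyps by (auto simp: PiE_def space_PiM extensional_def)
  hence 2: "?b (insert i J) (x(i := y)) = ?b J x*indicator {a i - h..<a i + h} y"
   by (auto simp: indicator_def)
  show "?b (insert i J) (x(i := y))*ennreal ((?X (insert i J) (x(i := y)))\<^sup>2) = ?b J x*(indicator {a i - h..<a i + h} y*ennreal ((?X J x + c i*(y - a i))\<^sup>2))"
   unfolding 1 2 by (simp add: mult.assoc)
 qed
 also have "\<dots> <= (\<integral>\<^sup>+x. ?b J x*ennreal (2*h*((?X J x)\<^sup>2 + h\<^sup>2 / 3*(c i)\<^sup>2)) \<partial>PiM J (%_. lborel))"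
  by (intro nn_integral_mono) (subst nn_integral_cmult, simp, intro mult_left_mono second_moment_1[OF assms(2)], simp)
 also have "\<dots> = (\<integral>\<^sup>+x. ennreal (2*h)*(?b J x*ennreal ((?X J x)\<^sup>2)) + ennreal (2*h*(h\<^sup>2 / 3*(c i)\<^sup>2))*?b J x \<partial>PiM J (%_. lborel))"
 proof (rule nn_integral_cong)
  fix x
  have "ennreal (2*h*((?X J x)\<^sup>2 + h\<^sup>2 / 3*(c i)\<^sup>2)) = ennreal (2*h)*ennreal ((?X J x)\<^sup>2) + ennreal (2*h*(h\<^sup>2 / 3*(c i)\<^sup>2))"
   using assms(2) by (simp only: distrib_left) (subst ennreal_mult[symmetric]; simp)
  thus "?b J x*ennreal (2*h*((?X J x)\<^sup>2 + h\<^sup>2 / 3*(c i)\<^sup>2)) = ennreal (2*h)*(?b J x*ennreal ((?X J x)\<^sup>2)) + ennreal (2*h*(h\<^sup>2 / 3*(c i)\<^sup>2))*?b J x"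
   by (simp add: distrib_left mult_ac)
 qed
 also have "\<dots> = ennreal (2*h)*(\<integral>\<^sup>+x. ?b J x*ennreal ((?X J x)\<^sup>2) \<partial>PiM J (%_. lborel)) + ennreal (2*h*(h\<^sup>2 / 3*(c i)\<^sup>2))*emeasure (PiM J (%_. lborel)) (PiE J (%i. {a i - h..<a i + h}))"
  using m[OF insert.hyps(1)] Jm[OF insert.hyps(1)] by (subst nn_integral_add) (auto simp: nn_integral_cmult)
 also have "emeasure (PiM J (%_. lborel)) (PiE J (%i. {a i - h..<a i + h})) = (\<Prod>j\<in>J. emeasure lborel {a j - h..<a j + h})"
  by (rule leb.emeasure_PiM) (use insert.hyps in auto)
 also have "\<dots> = ennreal ((2*h)^card J)" using assms(2) by (simp add: ennreal_power)
 also have "ennreal (2*h)*(\<integral>\<^sup>+x. ?b J x*ennreal ((?X J x)\<^sup>2) \<partial>PiM J (%_. lborel)) + ennreal (2*h*(h\<^sup>2 / 3*(c i)\<^sup>2))*ennreal ((2*h)^card J)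
   <= ennreal (2*h)*ennreal ((2*h)^card J*(d\<^sup>2 + h\<^sup>2 / 3*(\<Sum>i\<in>J. (c i)\<^sup>2))) + ennreal (2*h*(h\<^sup>2 / 3*(c i)\<^sup>2))*ennreal ((2*h)^card J)"
  by (intro add_mono mult_left_mono insert.IH) auto
 also have "\<dots> = ennreal ((2*h)^card (insert i J)*(d\<^sup>2 + h\<^sup>2 / 3*(\<Sum>i\<in>insert i J. (c i)\<^sup>2)))"
  using assms(2) insert.hyps
  by (simp add: ennreal_mult[symmetric] ennreal_plus[symmetric] sum_nonneg del: ennreal_plus) (simp add: field_simps)
 finally show ?case .
qed

section \<open>The shift on the lattice and on its dual\<close>

lemma sum_periodic_shift:
 fixes f :: "nat => 'a :: comm_monoid_add"
 assumes "!!k. f (k + m) = f k"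
 shows "(\<Sum>k<m. f (k + c)) = (\<Sum>k<m. f k)"
proof (induction c)
 case (Suc c)
 have "(\<Sum>k<m. f (k + Suc c)) = (\<Sum>k<m. f (Suc k + c))" by simp
 also have "\<dots> = (\<Sum>k<m. f (k + c))"
 proof (cases m)
  case (Suc m')
  have "(\<Sum>k<Suc m'. f (Suc k + c)) = (\<Sum>k<m'. f (Suc k + c)) + f (m + c)" by (simp add: Suc)
  also have "f (m + c) = f (0 + c)" using assms[of c] by (simp add: add.commute)
  also have "(\<Sum>k<m'. f (Suc k + c)) + f (0 + c) = (\<Sum>k<Suc m'. f (k + c))"
   unfolding sum.lessThan_Suc_shift by (simp add: add.commute)
  finally show ?thesis by (simp add: Suc)
 qed simp
 finally show ?case using Suc by simp
qed simp

text \<open>\<open>\<beta>\<close> is a basis of the lattice \<open>L\<close> of integral \<open>m\<close>-periodic functions on which the shift has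
 characteristic polynomial the cyclotomic polynomial, dual to the evaluations at the points \<open>e i\<close>;
 \<open>A\<close> is the inverse of the Gram matrix of \<open>\<beta>\<close>, i.e. the Gram matrix of the dual lattice.\<close>

locale shift_lattice =
 fixes N m :: nat and T :: real and e :: "nat => nat" and \<beta> :: "nat => nat => int" and A :: "nat => nat => real"
 assumes N_pos: "0 < N" and m_pos: "0 < m"
  and e_lt: "!!i. i < N ==> e i < m" and e_inj: "inj_on e {..<N}"
  and per: "!!i k. i < N ==> \<beta> i (k + m) = \<beta> i k"
  and delta: "!!i j. i < N ==> j < N ==> \<beta> i (e j) = of_bool (i = j)"
  and shift: "!!i k. i < N ==> \<beta> i (k + 1) = (\<Sum>j<N. \<beta> i (e j + 1)*\<beta> j k)"
  and A_sym: "!!i j. i < N ==> j < N ==> A i j = A j i"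
  and AB: "!!i k. i < N ==> k < N ==> (\<Sum>j<N. A i j * of_int (\<Sum>l<m. \<beta> j l*\<beta> k l)) = of_bool (i = k)"
  and A_contr: "!!u. (\<Sum>i<N. \<Sum>j<N. A i j*u i*u j) <= (\<Sum>i<N. (u i)\<^sup>2)"
  and T_bound: "!!i. i < N ==> of_int (\<Sum>k<m. \<bar>\<beta> i k\<bar>) <= T"
  and free: "!!c z i. 0 < c ==> c < m ==> (!!k. (\<Sum>i<N. z i*real_of_int (\<beta> i (k + c))) = (\<Sum>i<N. z i * of_int (\<beta> i k))) ==> i < N ==> z i = 0"
  and nonsing: "!!y t. \<exists>i<N. y i ~= 0 ==> \<exists>s. \<forall>i<N. (\<Sum>l<N. of_int (\<Sum>j<N. y j*\<beta> l (e i + e j)) * s l) = (t i :: real)"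
begin

definition val :: "(nat => real) => nat => real" where
 "val z k = (\<Sum>i<N. z i * of_int (\<beta> i k))"

definition nB :: "(nat => real) => real" where
 "nB z = (\<Sum>k<m. (val z k)\<^sup>2)"

definition nA :: "(nat => real) => real" where
 "nA y = (\<Sum>i<N. \<Sum>j<N. A i j*y i*y j)"

text \<open>The Riesz representer of the functional with coordinates \<open>y\<close>: by
  \<open>rho_inner\<close> its inner product with \<open>val v\<close> over a period is the pairing
  of \<open>y\<close> with \<open>v\<close>, and its squared norm is \<open>nA y\<close>. Facts
  about the dual form become facts about periodic functions.\<close>

definition rho :: "(nat => real) => nat => real" where
 "rho y k = val (%i. \<Sum>j<N. A i j*y j) k"

definition hank :: "(nat => real) => (nat => real) => nat => real" where
 "hank s y i = (\<Sum>j<N. val s (e i + e j)*y j)"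

text \<open>\<open>hank s y\<close> lives at the points \<open>e i\<close> only. This is the same
  correlation at every \<open>k\<close>; by \<open>hfun_val\<close> it is the function in the span
  of \<open>\<beta>\<close> that takes these values.\<close>

definition hfun :: "(nat => real) => (nat => real) => nat => real" where
 "hfun s y k = (\<Sum>j<N. y j * val s (k + e j))"

lemma val_e: "i < N ==> val z (e i) = z i"
 unfolding val_def by (subst sum.remove[of _ i]) (auto simp: delta)

lemma val_per: "val z (k + m) = val z k"
 unfolding val_def by (intro sum.cong refl) (simp add: per)

lemma beta_shift: "i < N ==> \<beta> i (k + c) = (\<Sum>j<N. \<beta> i (e j + c)*\<beta> j k)"
proof (induction c arbitrary: k)
 case 0
 hence "(\<Sum>j<N. \<beta> i (e j + 0)*\<beta> j k) = (\<Sum>j<N. of_bool (i = j)*\<beta> j k)"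
  by (intro sum.cong) (auto simp: delta)
 also have "\<dots> = \<beta> i k" using 0 by simp
 finally show ?case by simp
next
 case (Suc c)
 have "\<beta> i (k + Suc c) = \<beta> i ((k + 1) + c)" by simp
 also have "\<dots> = (\<Sum>j<N. \<beta> i (e j + c)*\<beta> j (k + 1))" by (rule Suc.IH) fact
 also have "\<dots> = (\<Sum>j<N. \<Sum>l<N. \<beta> i (e j + c)*\<beta> j (e l + 1)*\<beta> l k)"
  by (intro sum.cong refl) (subst shift[of _ k], simp, simp only: sum_distrib_left mult.assoc)
 also have "\<dots> = (\<Sum>l<N. \<Sum>j<N. \<beta> i (e j + c)*\<beta> j (e l + 1)*\<beta> l k)" by (rule sum.swap)
 also have "\<dots> = (\<Sum>l<N. \<beta> i ((e l + 1) + c)*\<beta> l k)"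
 proof (intro sum.cong refl)
  fix l
  have "\<beta> i (e l + 1 + c) = (\<Sum>j<N. \<beta> i (e j + c)*\<beta> j (e l + 1))" by (rule Suc.IH[OF Suc.prems])
  thus "(\<Sum>j<N. \<beta> i (e j + c)*\<beta> j (e l + 1)*\<beta> l k) = \<beta> i (e l + 1 + c)*\<beta> l k"
   by (simp only: sum_distrib_right)
 qed
 finally show ?case by simp
qed

lemma val_shift: "val z (k + c) = (\<Sum>i<N. val z (e i + c) * of_int (\<beta> i k))"
using sum.swap by (simp add: val_def sum_distrib_right beta_shift[of _ k c] sum_distrib_left mult.assoc)

lemma val_shift': "val z (k + c) = val (%i. val z (e i + c)) k"
 by (subst val_shift) (simp add: val_def)

lemma val_diff: "val (%i. z i - w i) k = val z k - val w k"
 by (simp add: val_def left_diff_distrib sum_subtractf)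

lemma val_add: "val (%i. z i + w i) k = val z k + val w k"
 by (simp add: val_def distrib_right sum.distrib)

lemma nB_nonneg: "0 <= nB z" unfolding nB_def by (rule sum_nonneg) simp

lemma nB_quad: "nB z = (\<Sum>i<N. \<Sum>j<N. of_int (\<Sum>l<m. \<beta> i l*\<beta> j l)*z i*z j)"
proof -
 have "nB z = (\<Sum>k<m. \<Sum>i<N. \<Sum>j<N. (z i * of_int (\<beta> i k))*(z j * of_int (\<beta> j k)))"
  unfolding nB_def val_def power2_eq_square sum_product ..
 also have "\<dots> = (\<Sum>i<N. \<Sum>k<m. \<Sum>j<N. (z i * of_int (\<beta> i k))*(z j * of_int (\<beta> j k)))" by (rule sum.swap)
 also have "\<dots> = (\<Sum>i<N. \<Sum>j<N. \<Sum>k<m. (z i * of_int (\<beta> i k))*(z j * of_int (\<beta> j k)))" by (intro sum.cong refl sum.swap)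
 also have "\<dots> = (\<Sum>i<N. \<Sum>j<N. of_int (\<Sum>l<m. \<beta> i l*\<beta> j l)*z i*z j)"
  by (intro sum.cong refl) (simp add: sum_distrib_left mult_ac)
 finally show ?thesis .
qed

lemma val_sq_le_nB: "i < N ==> (z i)\<^sup>2 <= nB z"
 unfolding nB_def using member_le_sum[of "e i" "{..<m}" "%k. (val z k)\<^sup>2"] e_lt[of i] by (simp add: val_e)

lemma nB_pos: "\<exists>i<N. z i ~= 0 ==> 0 < nB z"
 using val_sq_le_nB[of _ z] by (metis order_less_le_trans zero_less_power2)

lemma BA: "i < N ==> k < N ==> (\<Sum>j<N. A j i * of_int (\<Sum>l<m. \<beta> j l*\<beta> k l)) = of_bool (i = k)"
proof -
 assume ik: "i < N" "k < N"
 have "(\<Sum>j<N. A j i * of_int (\<Sum>l<m. \<beta> j l*\<beta> k l)) = (\<Sum>j<N. A i j * of_int (\<Sum>l<m. \<beta> j l*\<beta> k l))"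
 proof (rule sum_cong)
  fix j assume "j \<in> {..<N}"
  hence "A j i = A i j" using A_sym[of i j] ik by simp
  thus "A j i * of_int (\<Sum>l<m. \<beta> j l*\<beta> k l) = A i j * of_int (\<Sum>l<m. \<beta> j l*\<beta> k l)" by simp
 qed
 thus ?thesis using AB[OF ik] by simp
qed

lemma rho_inner: "(\<Sum>k<m. rho y k * val v k) = (\<Sum>i<N. y i * v i)"
proof -
 have "(\<Sum>k<m. rho y k * val v k) = (\<Sum>k<m. \<Sum>i<N. \<Sum>j<N. ((\<Sum>l<N. A i l*y l) * of_int (\<beta> i k))*(v j * of_int (\<beta> j k)))"
  unfolding rho_def val_def sum_product ..
 also have "\<dots> = (\<Sum>i<N. \<Sum>k<m. \<Sum>j<N. ((\<Sum>l<N. A i l*y l) * of_int (\<beta> i k))*(v j * of_int (\<beta> j k)))" by (rule sum.swap)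
 also have "\<dots> = (\<Sum>i<N. \<Sum>j<N. \<Sum>k<m. ((\<Sum>l<N. A i l*y l) * of_int (\<beta> i k))*(v j * of_int (\<beta> j k)))" by (intro sum.cong refl sum.swap)
 also have "\<dots> = (\<Sum>i<N. \<Sum>j<N. \<Sum>l<N. v j*y l*(A i l * of_int (\<Sum>k<m. \<beta> i k*\<beta> j k)))"
 proof (rule sum_cong, rule sum_cong)
  fix i j
  have "(\<Sum>k<m. ((\<Sum>l<N. A i l*y l) * of_int (\<beta> i k))*(v j * of_int (\<beta> j k))) =
   (\<Sum>l<N. A i l*y l)*(v j * of_int (\<Sum>k<m. \<beta> i k*\<beta> j k))"
   by (simp add: sum_distrib_left mult_ac)
  also have "\<dots> = (\<Sum>l<N. v j*y l*(A i l * of_int (\<Sum>k<m. \<beta> i k*\<beta> j k)))"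
   unfolding sum_distrib_right by (intro sum.cong refl) (simp only: mult_ac)
  finally show "(\<Sum>k<m. ((\<Sum>l<N. A i l*y l) * of_int (\<beta> i k))*(v j * of_int (\<beta> j k))) =
   (\<Sum>l<N. v j*y l*(A i l * of_int (\<Sum>k<m. \<beta> i k*\<beta> j k)))" .
 qed
 also have "\<dots> = (\<Sum>j<N. \<Sum>i<N. \<Sum>l<N. v j*y l*(A i l * of_int (\<Sum>k<m. \<beta> i k*\<beta> j k)))" by (rule sum.swap)
 also have "\<dots> = (\<Sum>j<N. \<Sum>l<N. \<Sum>i<N. v j*y l*(A i l * of_int (\<Sum>k<m. \<beta> i k*\<beta> j k)))" by (intro sum.cong refl sum.swap)
 also have "\<dots> = (\<Sum>j<N. \<Sum>l<N. v j*y l * of_bool (l = j))"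
  unfolding sum_distrib_left[symmetric] by (intro sum.cong refl) (simp only: BA lessThan_iff)
 also have "\<dots> = (\<Sum>j<N. v j*y j)" by simp
 finally show ?thesis by (simp add: mult.commute)
qed

lemma nA_rho: "nA y = (\<Sum>k<m. (rho y k)\<^sup>2)"
 using rho_inner[of y "%i. \<Sum>j<N. A i j*y j"] unfolding rho_def[symmetric] nA_def
 by (simp add: power2_eq_square sum_distrib_left mult_ac)

lemma nA_nonneg: "0 <= nA y" unfolding nA_rho by (rule sum_nonneg) simp

lemma nA_pos: assumes "\<exists>i<N. y i ~= 0" shows "0 < nA y"
proof (rule ccontr)
 assume "\<not> 0 < nA y"
 hence "nA y = 0" using nA_nonneg[of y] by simp
 hence z: "rho y k = 0" if "k < m" for k unfolding nA_rho using that by (simp add: sum_nonneg_eq_0_iff)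
 obtain i where i: "i < N" "y i ~= 0" using assms by blast
 have "(\<Sum>j<N. y j*(if j = i then 1 else 0)) = 0" unfolding rho_inner[symmetric] using z by simp
 thus False using i by (simp add: if_distrib cong: if_cong)
qed

lemma nA_contr: "nA u <= (\<Sum>i<N. (u i)\<^sup>2)" unfolding nA_def by (rule A_contr)

lemma rho_e: "i < N ==> rho y (e i) = (\<Sum>j<N. A i j*y j)" by (simp add: rho_def val_e)

lemma rho_per: "rho y (k + m) = rho y k" unfolding rho_def by (rule val_per)

lemma sum_rho_e_le: "(\<Sum>i<N. (rho y (e i))\<^sup>2) <= nA y"
proof -
 have "(\<Sum>i<N. (rho y (e i))\<^sup>2) = (\<Sum>k\<in>e ` {..<N}. (rho y k)\<^sup>2)"
  using sum.reindex[OF e_inj, of "%k. (rho y k)\<^sup>2"] by simp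
 also have "\<dots> <= nA y" unfolding nA_rho by (rule sum_mono2) (use e_lt in auto)
 finally show ?thesis .
qed

lemma nA_add: "nA (%i. y i + u i) = nA y + 2*(\<Sum>i<N. rho y (e i)*u i) + nA u"
proof -
 have "nA (%i. y i + u i) = nA y + (\<Sum>i<N. \<Sum>j<N. A i j*y j*u i) + (\<Sum>i<N. \<Sum>j<N. A i j*u j*y i) + nA u"
  unfolding nA_def by (simp add: algebra_simps sum.distrib)
 also have "(\<Sum>i<N. \<Sum>j<N. A i j*u j*y i) = (\<Sum>j<N. \<Sum>i<N. A i j*u j*y i)" by (rule sum.swap)
 also have "\<dots> = (\<Sum>i<N. \<Sum>j<N. A i j*y j*u i)"
  by (intro sum.cong refl) (use A_sym in \<open>auto simp: mult_ac\<close>)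
 also have "(\<Sum>i<N. \<Sum>j<N. A i j*y j*u i) = (\<Sum>i<N. rho y (e i)*u i)"
  by (intro sum.cong refl) (simp add: rho_e sum_distrib_right)
 finally show ?thesis by simp
qed

text \<open>The adjoint of the shift by \<open>c\<close>, see \<open>rot_inner\<close>. It is an
  extensional function so that different rotations can be compared as elements of
  \<open>ZZ N\<close>.\<close>

definition rot :: "nat => (nat => int) => nat => int" where
 "rot c y = (\<lambda>k\<in>{..<N}. \<Sum>i<N. y i*\<beta> k (e i + c))"

lemma rot_inner: "(\<Sum>k<N. of_int (rot c y k) * v k) = (\<Sum>i<N. of_int (y i) * val v (e i + c))"
using sum.swap by (simp add: rot_def sum_distrib_left sum_distrib_right mult_ac val_def)

lemma hfun_val: "hfun s y k = val (hank s y) k"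
using sum.swap by (simp add: hfun_def val_shift[of s k] sum_distrib_left val_def[of "hank s y"] hank_def sum_distrib_right mult_ac)

text \<open>The entry \<open>val s (k + e j)\<close> depends only on the sum of its indices, so a
  shift may be moved from one side of the Hankel matrix to the other. This is the symmetry shared by
  all lattices of the family.\<close>

lemma hfun_rot: "hfun s (%i. of_int (rot c y i)) k = hfun s (%i. of_int (y i)) (k + c)"
proof -
 have v: "val (%j. val s (k + e j)) (e i + c) = val s (k + c + e i)" for i
  using val_shift'[of s "e i + c" k] by (simp add: add_ac)
 have "hfun s (%i. of_int (rot c y i)) k = (\<Sum>i<N. of_int (y i) * val (%j. val s (k + e j)) (e i + c))"
  unfolding hfun_def by (rule rot_inner)
 thus ?thesis by (simp only: v hfun_def)
qed

text \<open>Pairing the rotated vector \<open>r\<close> with its own representer moves the shift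
  onto the latter. Cauchy-Schwarz over a period, where a shift is invisible, then gives
  \<open>nA r ^ 2 <= nA y * nA r\<close>.\<close>

lemma nA_rot: "nA (%i. of_int (rot c y i)) <= nA (%i. of_int (y i))"
proof -
 let ?y = "%i. of_int (y i) :: real" and ?r = "%i. of_int (rot c y i) :: real"
 let ?v = "%i. \<Sum>j<N. A i j*?r j"
 have "nA ?r = (\<Sum>i<N. ?r i*?v i)" unfolding nA_def by (simp add: sum_distrib_left mult_ac)
 also have "\<dots> = (\<Sum>i<N. ?y i * val ?v (e i + c))" by (rule rot_inner)
 also have "\<dots> = (\<Sum>k<m. rho ?y k * val (%i. val ?v (e i + c)) k)" by (rule rho_inner[symmetric])
 also have "\<dots> = (\<Sum>k<m. rho ?y k*rho ?r (k + c))" unfolding rho_def[of ?r] by (simp only: val_shift'[symmetric])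
 finally have "(nA ?r)\<^sup>2 = (\<Sum>k<m. rho ?y k*rho ?r (k + c))\<^sup>2" by simp
 also have "\<dots> <= (\<Sum>k<m. (rho ?y k)\<^sup>2)*(\<Sum>k<m. (rho ?r (k + c))\<^sup>2)" by (rule Cauchy_Schwarz_ineq_sum)
 also have "(\<Sum>k<m. (rho ?r (k + c))\<^sup>2) = (\<Sum>k<m. (rho ?r k)\<^sup>2)"
  by (rule sum_periodic_shift) (simp add: rho_per)
 finally have "nA ?r*nA ?r <= nA ?y*nA ?r" by (simp add: nA_rho power2_eq_square)
 thus ?thesis using nA_nonneg[of ?r] nA_nonneg[of ?y] by (cases "nA ?r = 0") auto
qed

text \<open>If two rotations coincide, the representer of \<open>y\<close> pairs equally with every
  function \<open>val w\<close> and with its translate by \<open>d - c\<close>. Applied to the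
  difference of the representer and a translate of itself, this shows that the representer has a
  period smaller than \<open>m\<close>; by \<open>free\<close> it is zero.\<close>

lemma rot_inj:
 assumes cd: "c < d" "d < m" and eq: "rot c y = rot d y" and i: "i < N"
 shows "y i = 0"
proof -
 let ?y = "%i. of_int (y i) :: real"
 have 1: "(\<Sum>i<N. ?y i * val v (e i + c)) = (\<Sum>i<N. ?y i * val v (e i + d))" for v
  using rot_inner[of c y v] rot_inner[of d y v] eq by simp
 have 2: "(\<Sum>k<m. rho ?y k * val v (k + c)) = (\<Sum>k<m. rho ?y k * val v (k + d))" for v
  using 1[of v] rho_inner[of ?y "%i. val v (e i + c)"] rho_inner[of ?y "%i. val v (e i + d)"]
  by (simp add: val_shift'[of v, symmetric])
 let ?f = "d - c"
 have 3: "(\<Sum>k<m. rho ?y k * val w k) = (\<Sum>k<m. rho ?y k * val w (k + ?f))" for w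
 proof -
  let ?v = "%i. val w (e i + (m - c))"
  have "val ?v (k + c) = val w k" for k
  proof -
   have "val ?v (k + c) = val w (k + c + (m - c))" by (simp add: val_shift'[symmetric])
   also have "k + c + (m - c) = k + m" using cd by simp
   finally show ?thesis by (simp only: val_per)
  qed
  moreover have "val ?v (k + d) = val w (k + ?f)" for k
  proof -
   have "val ?v (k + d) = val w (k + d + (m - c))" by (simp add: val_shift'[symmetric])
   also have "k + d + (m - c) = (k + ?f) + m" using cd by simp
   finally show ?thesis by (simp only: val_per)
  qed
  ultimately show ?thesis using 2[of ?v] by simp
 qed
 have 4: "(\<Sum>k<m. rho ?y k * val w k) = (\<Sum>k<m. rho ?y (k + (m - ?f)) * val w k)" for w
 proof -
  have "(\<Sum>k<m. rho ?y k * val w (k + ?f)) = (\<Sum>k<m. rho ?y (k + (m - ?f)) * val w (k + (m - ?f) + ?f))"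
  proof (rule sum_periodic_shift[symmetric])
   fix k
   have "k + m + ?f = (k + ?f) + m" by simp
   thus "rho ?y (k + m) * val w (k + m + ?f) = rho ?y k * val w (k + ?f)" by (simp only: rho_per val_per)
  qed
  also have "\<dots> = (\<Sum>k<m. rho ?y (k + (m - ?f)) * val w k)"
  using cd by (simp add: val_per)
  finally show ?thesis using 3[of w] by simp
 qed
 let ?a = "%i. \<Sum>j<N. A i j*?y j"
 let ?g = "m - ?f"
 let ?w = "%i. ?a i - val ?a (e i + ?g)"
 have w: "val ?w k = rho ?y k - rho ?y (k + ?g)" for k
  unfolding val_diff rho_def by (simp add: val_shift'[symmetric])
 have "(\<Sum>k<m. (val ?w k)\<^sup>2) = (\<Sum>k<m. rho ?y k * val ?w k) - (\<Sum>k<m. rho ?y (k + ?g) * val ?w k)"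
  unfolding sum_subtractf[symmetric] by (intro sum.cong refl) (simp add: w power2_eq_square algebra_simps)
 hence "(\<Sum>k<m. (val ?w k)\<^sup>2) = 0" using 4[of ?w] by simp
 hence z: "val ?w k = 0" if "k < m" for k using that by (simp add: sum_nonneg_eq_0_iff)
 have z': "val ?w k = 0" for k
 proof -
  have "val ?w (k mod m + m*q) = val ?w (k mod m)" for q
  proof (induction q)
   case (Suc q)
   have "val ?w (k mod m + m*Suc q) = val ?w ((k mod m + m*q) + m)" by (simp add: algebra_simps)
   thus ?case using Suc by (simp only: val_per)
  qed simp
  from this[of "k div m"] show ?thesis using z[of "k mod m"] m_pos by simp
 qed
 have vg: "val ?a (k + ?g) = val ?a k" for k
  using z'[of k] w[of k] unfolding rho_def by linarith
 have a0: "?a i = 0" if "i < N" for i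
  by (rule free[OF _ _ vg[unfolded val_def] that]) (use cd in auto)
 have "rho ?y k = 0" for k unfolding rho_def val_def by (rule sum.neutral) (use a0 in auto)
 hence "nA ?y = 0" by (simp add: nA_rho)
 thus ?thesis using nA_pos[of ?y] i by force
qed

lemma sum_shift_abs: "i < N ==> (\<Sum>c<m. \<bar>real_of_int (\<beta> i (k + c))\<bar>) <= T"
proof -
 assume i: "i < N"
 have "(\<Sum>c<m. \<bar>real_of_int (\<beta> i (k + c))\<bar>) = (\<Sum>c<m. \<bar>real_of_int (\<beta> i (c + k))\<bar>)" by (simp add: add.commute)
 also have "\<dots> = (\<Sum>c<m. \<bar>real_of_int (\<beta> i c)\<bar>)"
  by (rule sum_periodic_shift) (simp add: per i)
 also have "\<dots> <= T" using T_bound[OF i] by simp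
 finally show ?thesis .
qed

lemma T_nonneg: "0 <= T"
 using sum_shift_abs[OF N_pos, of 0] by (meson sum_nonneg abs_ge_zero order_trans)

text \<open>Schur's test. Written with the representer of \<open>y\<close>, the inner sum runs over
  a full period of the kernel \<open>\<beta> l (k + c)\<close>, whose absolute row and column sums
  are at most \<open>T\<close>; its operator norm is therefore at most \<open>T\<close>.\<close>

lemma hfun_unit_bound:
 assumes l: "l < N"
 shows "(\<Sum>k<m. (\<Sum>j<N. y j * of_int (\<beta> l (k + e j)))\<^sup>2) <= T\<^sup>2*nA y"
proof -
 let ?b = "%k c. real_of_int (\<beta> l (k + c))"
 have e: "(\<Sum>j<N. y j*?b k (e j)) = (\<Sum>c<m. rho y c*?b k c)" for k
 proof -
  have v: "val (%i. ?b k (e i)) c = ?b k c" for c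
  using beta_shift[OF l, of c k] by (simp add: val_def add.commute)
  show ?thesis using rho_inner[of y "%i. ?b k (e i)"] by (simp add: v)
 qed
 have 1: "(\<Sum>c<m. rho y c*?b k c)\<^sup>2 <= T*(\<Sum>c<m. (rho y c)\<^sup>2*\<bar>?b k c\<bar>)" for k
 proof -
  have "(\<Sum>c<m. rho y c*?b k c)\<^sup>2 = (\<Sum>c<m. (rho y c*(sgn (?b k c) * sqrt \<bar>?b k c\<bar>)) * sqrt \<bar>?b k c\<bar>)\<^sup>2"
  by (simp add: sgn_mult_abs mult.assoc)
  also have "\<dots> <= (\<Sum>c<m. (rho y c*(sgn (?b k c) * sqrt \<bar>?b k c\<bar>))\<^sup>2)*(\<Sum>c<m. (sqrt \<bar>?b k c\<bar>)\<^sup>2)"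
   by (rule Cauchy_Schwarz_ineq_sum)
  also have "(\<Sum>c<m. (rho y c*(sgn (?b k c) * sqrt \<bar>?b k c\<bar>))\<^sup>2) = (\<Sum>c<m. (rho y c)\<^sup>2*\<bar>?b k c\<bar>)"
  proof (intro sum.cong refl)
   fix c
   have "(sgn b * sqrt \<bar>b\<bar>)\<^sup>2 = \<bar>b\<bar>" for b :: real by (cases "b = 0") (auto simp: sgn_if)
   thus "(rho y c*(sgn (?b k c) * sqrt \<bar>?b k c\<bar>))\<^sup>2 = (rho y c)\<^sup>2*\<bar>?b k c\<bar>" by (simp only: power_mult_distrib[of "rho y c"])
  qed
  also have "(\<Sum>c<m. (rho y c)\<^sup>2*\<bar>?b k c\<bar>)*(\<Sum>c<m. (sqrt \<bar>?b k c\<bar>)\<^sup>2) <= (\<Sum>c<m. (rho y c)\<^sup>2*\<bar>?b k c\<bar>)*T"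
   using sum_shift_abs[OF l, of k] by (intro mult_left_mono sum_nonneg) auto
  finally show ?thesis by (simp only: mult.commute)
 qed
 have "(\<Sum>k<m. (\<Sum>j<N. y j*?b k (e j))\<^sup>2) <= (\<Sum>k<m. T*(\<Sum>c<m. (rho y c)\<^sup>2*\<bar>?b k c\<bar>))"
  unfolding e by (intro sum_mono 1)
 also have "\<dots> = T*(\<Sum>c<m. (rho y c)\<^sup>2*(\<Sum>k<m. \<bar>?b k c\<bar>))"
 using sum.swap by (simp add: sum_distrib_left)
 also have "\<dots> <= T*(\<Sum>c<m. (rho y c)\<^sup>2*T)"
 proof (intro mult_left_mono sum_mono T_nonneg)
  fix c
  show "(\<Sum>k<m. \<bar>?b k c\<bar>) <= T" using sum_shift_abs[OF l, of c] by (simp add: add.commute)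
 qed auto
 also have "\<dots> = T\<^sup>2*nA y" by (simp add: nA_rho power2_eq_square sum_distrib_left mult_ac)
 finally show ?thesis .
qed

end

section \<open>Volume of the ellipsoids\<close>

lemma gram_square_sum:
 fixes W :: "nat => nat => real"
 shows "(\<Sum>i<n. \<Sum>j<n. (\<Sum>k<n. W k i*W k j)*z i*z j) = (\<Sum>k<n. (\<Sum>i<n. W k i*z i)\<^sup>2)"
proof -
 have "(\<Sum>i<n. \<Sum>j<n. (\<Sum>k<n. W k i*W k j)*z i*z j) = (\<Sum>i<n. \<Sum>j<n. \<Sum>k<n. (W k i*z i)*(W k j*z j))"
  by (simp add: sum_distrib_left mult_ac)
 also have "\<dots> = (\<Sum>i<n. \<Sum>k<n. \<Sum>j<n. (W k i*z i)*(W k j*z j))" by (intro sum_cong sum.swap)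
 also have "\<dots> = (\<Sum>k<n. \<Sum>i<n. \<Sum>j<n. (W k i*z i)*(W k j*z j))" by (rule sum.swap)
 finally show ?thesis by (simp only: sum_product power2_eq_square)
qed

context shift_lattice begin

lemma nB_measurable [measurable]: "nB \<in> bleb N"
by (simp add: nB_quad[abs_def])

lemma nA_measurable [measurable]: "nA \<in> bleb N"
 unfolding nA_def[abs_def] by simp

text \<open>\<open>A\<close> inverts the Gram matrix of \<open>\<beta>\<close>, so the determinants
  of the two Cholesky factors are reciprocal, and the powers of \<open>\<alpha>\<close> from the two
  halves cancel. The ellipsoid has the volume of a ball, whatever \<open>\<alpha>\<close>
  is.\<close>

lemma ellipsoid_volume:
 assumes \<alpha>: "0 < \<alpha>" and R: "0 < R"
 shows "(nnleb N (%y. (nnleb N (%z. indicator {..R} (\<alpha>*nB z + nA y / \<alpha>))))) = ennreal (unit_ball_vol (real (2*N)) * R^N)"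
proof -
 define Bm where "Bm i j = real_of_int (\<Sum>l<m. \<beta> i l*\<beta> j l)" for i j
 have Bpd: "0 < (\<Sum>i<N. \<Sum>j<N. Bm i j*c i*c j)" if "\<exists>i<N. c i ~= 0" for c
  using nB_pos[OF that] unfolding nB_quad Bm_def .
 have Apd: "0 < (\<Sum>i<N. \<Sum>j<N. A i j*c i*c j)" if "\<exists>i<N. c i ~= 0" for c
  using nA_pos[OF that] unfolding nA_def .
 have Bsym: "Bm i j = Bm j i" for i j unfolding Bm_def by (simp add: mult.commute)
 obtain W where W: "!!i j. j < i ==> W i j = 0" "!!i. i < N ==> 0 < W i i"
  "!!i j. i < N ==> j < N ==> Bm i j = (\<Sum>k<N. W k i*W k j)"
  using cholesky[of N Bm, OF Bsym Bpd] by blast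
 obtain U where U: "!!i j. j < i ==> U i j = 0" "!!i. i < N ==> 0 < U i i"
  "!!i j. i < N ==> j < N ==> A i j = (\<Sum>k<N. U k i*U k j)"
  using cholesky[of N A, OF A_sym Apd] by blast
 interpret W: based_lattice N W by unfold_locales (use W in auto)
 interpret U: based_lattice N U by unfold_locales (use U in auto)
 have TW: "transpose_mat W.B*W.B \<in> carrier_mat N N" by (rule mult_carrier_mat[of _ N N]) auto
 have TU: "transpose_mat U.B*U.B \<in> carrier_mat N N" by (rule mult_carrier_mat[of _ N N]) auto
 have prod1: "(transpose_mat U.B*U.B)*(transpose_mat W.B*W.B) = 1\<^sub>m N"
 proof (rule eq_matI)
  fix i j assume "i < dim_row (1\<^sub>m N :: real mat)" "j < dim_col (1\<^sub>m N :: real mat)"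
  hence ij: "i < N" "j < N" by auto
  have w: "(transpose_mat W.B*W.B) $$ (a, b) = Bm a b" if "a < N" "b < N" for a b
   using that by (simp add: W.B_def upmat_def scalar_prod_def W(3) atLeast0LessThan)
  have u: "(transpose_mat U.B*U.B) $$ (a, b) = A a b" if "a < N" "b < N" for a b
   using that by (simp add: U.B_def upmat_def scalar_prod_def U(3) atLeast0LessThan)
  have "((transpose_mat U.B*U.B)*(transpose_mat W.B*W.B)) $$ (i, j) = (\<Sum>k<N. (transpose_mat U.B*U.B) $$ (i, k)*(transpose_mat W.B*W.B) $$ (k, j))"
   using ij carrier_matD[OF TW] carrier_matD[OF TU] by (subst index_mult_mat(1)) (auto simp: scalar_prod_def atLeast0LessThan simp del: index_mult_mat(1))
  also have "\<dots> = (\<Sum>k<N. A i k*Bm k j)" by (rule sum_cong) (use ij w u in simp)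
  also have "\<dots> = of_bool (i = j)" using AB[OF ij] by (simp add: Bm_def mult.commute)
  finally show "((transpose_mat U.B*U.B)*(transpose_mat W.B*W.B)) $$ (i, j) = 1\<^sub>m N $$ (i, j)" using ij by simp
 qed (use carrier_matD[OF TW] carrier_matD[OF TU] in auto)
 define dW where "dW = (\<Prod>i<N. W i i)"
 define dU where "dU = (\<Prod>i<N. U i i)"
 have d0: "0 < dW" "0 < dU" unfolding dW_def dU_def by (rule W.det_pos U.det_pos)+
 have "Determinant.det (transpose_mat U.B*U.B)*Determinant.det (transpose_mat W.B*W.B) = 1"
  using det_mult[OF TU TW] prod1 by simp
 hence "(dU*dU)*(dW*dW) = 1"
  using det_mult[of "transpose_mat U.B" N U.B] det_mult[of "transpose_mat W.B" N W.B]
   det_transpose[OF U.B_carrier] det_transpose[OF W.B_carrier] U.det_B W.det_B by (simp add: dW_def dU_def)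
 hence "(dU*dW)^2 = 1^2" by (simp add: power2_eq_square mult_ac)
 hence dd: "dU*dW = 1" using d0 by (metis power_eq_imp_eq_base zero_le_one zero_less_numeral mult_nonneg_nonneg less_imp_le)
 define a where "a = sqrt \<alpha>"
 have a: "0 < a" "a*a = \<alpha>" using \<alpha> by (auto simp: a_def)
 define X where "X c = (nnleb N (%z. indicator {..R} ((\<Sum>i<N. (z i)\<^sup>2) + c)))" for c :: real
 have Xr: "X c = radial N (%q. indicator {..R} (q + c))" for c
  unfolding X_def using nn_integral_radial[of "{..<N}" "%q. indicator {..R} (q + c)"] by (simp add: leb_def)
 have Xm [measurable]: "X \<in> borel_measurable borel"
  using radial_measurable[of "indicator {..R}" N] by (simp add: Xr[abs_def])
 have inner: "ennreal (dW*a^N)*(nnleb N (%z. indicator {..R} (\<alpha>*nB z + c))) = X c" for c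
 proof -
  let ?W = "%i j. a*W i j"
  have "(\<Sum>i<N. (aff N ?W (%_. 0) z i)\<^sup>2) = \<alpha>*nB z" for z
  proof -
   have "(\<Sum>i<N. (aff N ?W (%_. 0) z i)\<^sup>2) = (\<Sum>i<N. \<alpha>*(\<Sum>j<N. W i j*z j)\<^sup>2)"
    by (intro sum.cong refl) (simp add: aff_def a(2)[symmetric] power2_eq_square sum_distrib_left[symmetric] mult.assoc)
   also have "\<dots> = \<alpha>*(\<Sum>i<N. \<Sum>j<N. (\<Sum>k<N. W k i*W k j)*z i*z j)"
    by (simp only: gram_square_sum sum_distrib_left)
   also have "\<dots> = \<alpha>*nB z" unfolding nB_quad Bm_def[symmetric]
    by (intro arg_cong[of _ _ "(*) \<alpha>"] sum.cong refl) (simp add: W(3))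
   finally show ?thesis .
  qed
  moreover have "(%v. indicator {..R} ((\<Sum>i<N. (v i)\<^sup>2) + c) :: ennreal) \<in> bleb N" by simp
  from nn_integral_triangular[of ?W N, OF _ _ this, of "%_. 0"]
  have "ennreal (\<Prod>i<N. a*W i i)*(nnleb N (%v. indicator {..R} ((\<Sum>i<N. (aff N ?W (%_. 0) v i)\<^sup>2) + c))) = X c"
   using W a unfolding X_def by simp
  ultimately show ?thesis by (simp add: prod.distrib dW_def mult.commute)
 qed
 have outer: "ennreal (dU / a^N)*(nnleb N (%y. X (nA y / \<alpha>))) = (nnleb N (%y. X (\<Sum>i<N. (y i)\<^sup>2)))"
 proof -
  let ?W = "%i j. U i j / a"
  have "(\<Sum>i<N. (aff N ?W (%_. 0) z i)\<^sup>2) = nA z / \<alpha>" for z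
  proof -
   have "(\<Sum>i<N. (aff N ?W (%_. 0) z i)\<^sup>2) = (\<Sum>i<N. (\<Sum>j<N. U i j*z j)\<^sup>2 / \<alpha>)"
    by (intro sum.cong refl) (simp add: aff_def a(2)[symmetric] power2_eq_square sum_divide_distrib[symmetric])
   also have "\<dots> = (\<Sum>i<N. \<Sum>j<N. (\<Sum>k<N. U k i*U k j)*z i*z j) / \<alpha>"
    by (simp only: gram_square_sum sum_divide_distrib)
   also have "(\<Sum>i<N. \<Sum>j<N. (\<Sum>k<N. U k i*U k j)*z i*z j) = nA z" unfolding nA_def
    by (intro sum.cong refl) (simp add: U(3))
   finally show ?thesis .
  qed
  moreover have "(%v. X (\<Sum>i<N. (v i)\<^sup>2)) \<in> bleb N" by simp
  from nn_integral_triangular[of ?W N, OF _ _ this, of "%_. 0"]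
  have "ennreal (\<Prod>i<N. U i i / a)*(nnleb N (%v. X (\<Sum>i<N. (aff N ?W (%_. 0) v i)\<^sup>2))) = (nnleb N (%y. X (\<Sum>i<N. (y i)\<^sup>2)))"
   using U a by simp
  ultimately show ?thesis by (simp add: prod_dividef dU_def)
 qed
 let ?E = "%y. (nnleb N (%z. indicator {..R} (\<alpha>*nB z + nA y / \<alpha>)))"
 interpret L: sigma_finite_measure "leb N" by (rule sigma_finite_leb)
 have Em: "?E \<in> bleb N" by simp
 have one: "ennreal (dU / a^N)*ennreal (dW*a^N) = 1"
  using d0 a dd by (simp add: ennreal_mult[symmetric])
 have "(nnleb N (%y. ?E y)) = ennreal (dU / a^N)*(ennreal (dW*a^N)*(nnleb N (%y. ?E y)))"
  by (simp only: mult.assoc[symmetric] one mult_1)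
 also have "\<dots> = ennreal (dU / a^N)*(nnleb N (%y. X (nA y / \<alpha>)))"
  by (simp only: nn_integral_cmult[OF Em, symmetric] inner)
 also have "\<dots> = ennreal (unit_ball_vol (real (2*N)) * R^N)"
  unfolding outer using ball_iterated[OF R, of N] by (simp only: X_def)
 finally show ?thesis .
qed

section \<open>Counting short vectors on average over the torus\<close>

definition hmat :: "(nat => int) => nat => nat => int" where
 "hmat y i l = (\<Sum>j<N. y j*\<beta> l (e i + e j))"

text \<open>Seen as a map of \<open>s\<close>, the product \<open>H_s y\<close> has the integral
  matrix \<open>hmat y\<close>. Integrality makes it an endomorphism of the torus, to which
  \<open>torus_average\<close> applies once it is surjective.\<close>

lemma hmat_hank: "(\<Sum>l<N. of_int (hmat y i l) * s l) = hank s (%j. of_int (y j)) i"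
using sum.swap by (simp add: hmat_def sum_distrib_left mult_ac hank_def val_def)

lemma hfun_coeff: "hfun s y k = (\<Sum>l<N. (\<Sum>j<N. y j * of_int (\<beta> l (k + e j))) * s l)"
using sum.swap by (simp add: hfun_def val_def sum_distrib_left mult_ac)

lemma hank_diff: "hank (%i. s i - g i) y i = hank s y i - hank g y i"
 by (simp add: hank_def val_diff left_diff_distrib sum_subtractf)

lemma val_cong: "(!!i. i < N ==> z i = w i) ==> val z k = val w k"
 unfolding val_def by simp

lemma nB_cong: "(!!i. i < N ==> z i = w i) ==> nB z = nB w"
 unfolding nB_def using val_cong by metis

lemma nA_cong: "(!!i. i < N ==> z i = w i) ==> nA z = nA w"
 unfolding nA_def by simp

definition rotx :: "nat => (nat => int) => nat => int" where
 "rotx c x = (\<lambda>i\<in>{..<N}. \<Sum>l<N. x l*\<beta> l (e i + c))"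

text \<open>Both sides are squared norms over one period, of a function and of its translate by
  \<open>c\<close>. Together with \<open>nA_rot\<close> this gives every vector of a lattice its
  \<open>m\<close> rotations, none of them longer.\<close>

lemma nB_rot:
 "nB (vadd N (rotx c x) (lin N (hmat (rot c y)) s)) = nB (%i. of_int (x i) + hank s (%j. of_int (y j)) i)"
proof -
 let ?w = "%i. of_int (x i) + hank s (%j. of_int (y j)) i"
 let ?z = "vadd N (rotx c x) (lin N (hmat (rot c y)) s)"
 have "val ?z k = val ?w (k + c)" for k
 proof -
  have "val ?z k = val (%i. val (%j. of_int (x j)) (e i + c) + hank s (%j. of_int (rot c y j)) i) k"
   by (rule val_cong) (simp add: vadd_def lin_def rotx_def hmat_hank val_def)
  also have "\<dots> = val (%j. of_int (x j)) (k + c) + hfun s (%j. of_int (rot c y j)) k"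
   by (simp add: val_add val_shift'[symmetric] hfun_val)
  also have "\<dots> = val ?w (k + c)" by (simp add: hfun_rot val_add hfun_val)
  finally show ?thesis .
 qed
 hence "nB ?z = (\<Sum>k<m. (val ?w (k + c))\<^sup>2)" by (simp add: nB_def)
 also have "\<dots> = nB ?w" unfolding nB_def by (rule sum_periodic_shift) (simp add: val_per)
 finally show ?thesis .
qed

lemma nB_plus_le:
 assumes "0 < \<alpha>" "\<alpha>*nB z <= P" "\<alpha>*nB d <= \<theta>\<^sup>2" "0 < \<theta>"
 shows "\<alpha>*nB (%i. z i + d i) <= \<alpha>*nB z + 2 * sqrt P*\<theta> + \<theta>\<^sup>2"
proof -
 let ?i = "\<Sum>k<m. val z k * val d k"
 have "nB (%i. z i + d i) = nB z + 2*?i + nB d"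
  by (simp add: nB_def val_add power2_sum sum.distrib sum_distrib_left mult.assoc)
 moreover have "\<alpha>*?i <= sqrt P*\<theta>"
 proof -
  have "(\<alpha>*?i)\<^sup>2 <= \<alpha>\<^sup>2*(nB z*nB d)"
   unfolding power_mult_distrib nB_def by (intro mult_left_mono Cauchy_Schwarz_ineq_sum) simp
  also have "\<dots> = (\<alpha>*nB z)*(\<alpha>*nB d)" by (simp add: power2_eq_square)
  also have "\<dots> <= P*\<theta>\<^sup>2" using assms nB_nonneg[of z] nB_nonneg[of d] by (intro mult_mono) (auto intro: order_trans[of 0 "\<alpha>*nB z"])
  finally have "\<alpha>*?i <= sqrt (P*\<theta>\<^sup>2)" by (rule real_le_rsqrt)
  thus ?thesis using assms by (simp add: real_sqrt_mult)
 qed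
 ultimately have "\<alpha>*nB (%i. z i + d i) = \<alpha>*nB z + 2*(\<alpha>*?i) + \<alpha>*nB d" by (simp add: algebra_simps)
 with \<open>\<alpha>*?i <= sqrt P*\<theta>\<close> assms(3) show ?thesis by linarith
qed

text \<open>Rotation by \<open>k\<close> is undone by pairing with a function that is shifted on by
  \<open>m - k\<close>.\<close>

lemma rot_nonzero:
 assumes "k <= m" "i < N" "y i ~= 0"
 shows "\<exists>j<N. rot k y j ~= 0"
proof (rule ccontr)
 assume "\<not> ?thesis"
 hence z: "(\<Sum>j<N. of_int (rot k y j) * v j) = (0::real)" for v by simp
 let ?u = "%l. if l = i then 1 else 0 :: real"
 let ?v = "%j. val ?u (e j + (m - k))"
 have "val ?v (e l + k) = ?u l" if "l < N" for l
 proof -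
  have "val ?v (e l + k) = val ?u (e l + k + (m - k))" by (simp add: val_shift'[symmetric])
  also have "e l + k + (m - k) = e l + m" using assms(1) by simp
  also have "val ?u (e l + m) = ?u l" using that by (simp only: val_per val_e)
  finally show ?thesis .
 qed
 hence "(\<Sum>l<N. of_int (y l) * val ?v (e l + k)) = (\<Sum>l<N. of_int (y l)*?u l)" by simp
 also have "\<dots> = of_int (y i)" using assms(2) by (simp add: if_distrib cong: if_cong)
 finally show False using rot_inner[of k y ?v] z[of ?v] assms(3) by simp
qed

lemma nn_integral_count_space_point:
 "x0 \<in> Z ==> g x0 <= (\<integral>\<^sup>+x. g x \<partial>count_space Z)" for g :: "'b => ennreal"
proof -
 assume "x0 \<in> Z"
 hence "g x0 = (\<integral>\<^sup>+x. (if x = x0 then g x0 else 0) \<partial>count_space Z)"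
  by (intro nn_integral_count_space_unique[symmetric]) auto
 also have "\<dots> <= (\<integral>\<^sup>+x. g x \<partial>count_space Z)" by (intro nn_integral_mono) auto
 finally show ?thesis .
qed

text \<open>Chebyshev's inequality in integrated form: after division by \<open>\<theta>^2\<close>
  the integral bounds the part of the cell around \<open>g\<close> in which moving \<open>s\<close>
  displaces the point by more than \<open>\<theta>\<close>. For each \<open>k\<close> the
  displacement is a linear form in \<open>s - g\<close>, to which \<open>second_moment\<close>
  applies.\<close>

lemma perturbation_moment:
 assumes h: "0 < h" and \<alpha>: "0 < \<alpha>" and \<theta>: "0 < \<theta>" and nA: "nA y <= B"
 shows "(nnleb N (%s. indicator (PiE {..<N} (%l. {g l - h..<g l + h})) s*ennreal (\<alpha>*nB (hank (%l. s l - g l) y) / \<theta>\<^sup>2)))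
   <= ennreal ((2*h)^N*(\<alpha>*(h\<^sup>2 / 3)*(real N*T\<^sup>2*B) / \<theta>\<^sup>2))"
proof -
 let ?I = "%s. indicator (PiE {..<N} (%l. {g l - h..<g l + h})) s :: ennreal"
 define c where "c k l = (\<Sum>j<N. y j * of_int (\<beta> l (k + e j)))" for k l
 let ?X = "%k s. \<Sum>l<N. c k l*(s l - g l)"
 have cell: "PiE {..<N} (%l. {g l - h..<g l + h}) \<in> sets (leb N)" unfolding leb_def by simp
 have e: "ennreal (\<alpha>*nB (hank (%l. s l - g l) y) / \<theta>\<^sup>2) = (\<Sum>k<m. ennreal (\<alpha> / \<theta>\<^sup>2)*ennreal ((?X k s)\<^sup>2))" for s
 using \<alpha> by (simp add: nB_def hfun_val[symmetric] hfun_coeff c_def sum_distrib_left sum_divide_distrib ennreal_mult[symmetric] sum_ennreal)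
 have Xm: "(%s. ?I s*ennreal ((?X k s)\<^sup>2)) \<in> bleb N" for k
  using cell by simp
 have m2: "(nnleb N (%s. ?I s*ennreal ((?X k s)\<^sup>2))) <= ennreal ((2*h)^N*(h\<^sup>2 / 3*(\<Sum>l<N. (c k l)\<^sup>2)))" for k
  using second_moment[of "{..<N}" h g 0 "c k"] h by (simp add: leb_def)
 have "(nnleb N (%s. ?I s*ennreal (\<alpha>*nB (hank (%l. s l - g l) y) / \<theta>\<^sup>2))) = (nnleb N (%s. (\<Sum>k<m. ennreal (\<alpha> / \<theta>\<^sup>2)*(?I s*ennreal ((?X k s)\<^sup>2)))))"
  unfolding e by (simp add: sum_distrib_left mult_ac)
 also have "\<dots> = (\<Sum>k<m. ennreal (\<alpha> / \<theta>\<^sup>2)*(nnleb N (%s. ?I s*ennreal ((?X k s)\<^sup>2))))"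
  using Xm by (simp add: nn_integral_sum nn_integral_cmult)
 also have "\<dots> <= (\<Sum>k<m. ennreal (\<alpha> / \<theta>\<^sup>2)*ennreal ((2*h)^N*(h\<^sup>2 / 3*(\<Sum>l<N. (c k l)\<^sup>2))))"
  by (intro sum_mono mult_left_mono m2) auto
 also have "\<dots> = ennreal (\<Sum>k<m. \<alpha> / \<theta>\<^sup>2*((2*h)^N*(h\<^sup>2 / 3*(\<Sum>l<N. (c k l)\<^sup>2))))"
  using h \<alpha> by (simp add: ennreal_mult[symmetric] sum_nonneg)
 also have "\<dots> <= ennreal ((2*h)^N*(\<alpha>*(h\<^sup>2 / 3)*(real N*T\<^sup>2*B) / \<theta>\<^sup>2))"
 proof (rule ennreal_leI)
  have "(\<Sum>k<m. \<Sum>l<N. (c k l)\<^sup>2) = (\<Sum>l<N. \<Sum>k<m. (c k l)\<^sup>2)" by (rule sum.swap)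
  also have "\<dots> <= (\<Sum>l<N. T\<^sup>2*nA y)" unfolding c_def by (intro sum_mono hfun_unit_bound) auto
  also have "\<dots> <= real N*T\<^sup>2*B" using nA by (simp add: mult_left_mono mult.assoc)
  finally have "(2*h)^N*(\<alpha>*(h\<^sup>2 / 3) / \<theta>\<^sup>2)*(\<Sum>k<m. \<Sum>l<N. (c k l)\<^sup>2) <= (2*h)^N*(\<alpha>*(h\<^sup>2 / 3) / \<theta>\<^sup>2)*(real N*T\<^sup>2*B)"
   using h \<alpha> by (intro mult_left_mono) auto
  thus "(\<Sum>k<m. \<alpha> / \<theta>\<^sup>2*((2*h)^N*(h\<^sup>2 / 3*(\<Sum>l<N. (c k l)\<^sup>2)))) <= (2*h)^N*(\<alpha>*(h\<^sup>2 / 3)*(real N*T\<^sup>2*B) / \<theta>\<^sup>2)"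
   by (simp add: sum_distrib_left mult_ac sum_divide_distrib)
 qed
 finally show ?thesis .
qed

text \<open>The analogous bound for moving \<open>y\<close> by \<open>u\<close>: the linear term of
  \<open>nA (y + u)\<close> has mean zero over the centred cube, and its second moment is controlled
  by the representer of \<open>y\<close>.\<close>

lemma dual_moment:
 assumes \<alpha>: "0 < \<alpha>" and \<tau>: "0 < \<tau>" and nA: "nA y <= \<alpha> * R"
 shows "(nnleb N (%u. indicator (cube (-1/2) N) u*ennreal ((2 / \<alpha>*(\<Sum>i<N. rho y (e i)*u i))\<^sup>2 / \<tau>\<^sup>2))) <= ennreal (R / (3*\<alpha>*\<tau>\<^sup>2))"
proof -
 let ?c = "%i. 2 / \<alpha>*rho y (e i)"
 have c: "cube (-1/2) N = PiE {..<N} (%i. {0 - 1/2..<0 + 1/2})" by (simp add: cube_def)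
 have "(nnleb N (%u. indicator (cube (-1/2) N) u*ennreal ((2 / \<alpha>*(\<Sum>i<N. rho y (e i)*u i))\<^sup>2 / \<tau>\<^sup>2)))
  = (nnleb N (%u. ennreal (1 / \<tau>\<^sup>2)*(indicator (cube (-1/2) N) u*ennreal ((0 + (\<Sum>i<N. ?c i*(u i - 0)))\<^sup>2))))"
  by (intro nn_integral_cong) (simp add: ennreal_mult[symmetric] mult.left_commute[of "ennreal _" "indicator _ _"] sum_distrib_left mult.assoc)
 also have "\<dots> = ennreal (1 / \<tau>\<^sup>2)*(nnleb N (%u. indicator (cube (-1/2) N) u*ennreal ((0 + (\<Sum>i<N. ?c i*(u i - 0)))\<^sup>2)))"
  by (rule nn_integral_cmult) measurable
 also have "\<dots> <= ennreal (1 / \<tau>\<^sup>2)*ennreal ((2*(1/2))^card {..<N}*(0\<^sup>2 + (1/2)\<^sup>2 / 3*(\<Sum>i<N. (?c i)\<^sup>2)))"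
  unfolding c leb_def by (intro mult_left_mono second_moment) auto
 also have "\<dots> = ennreal (1 / \<tau>\<^sup>2*((\<Sum>i<N. (?c i)\<^sup>2) / 12))"
  by (subst ennreal_mult[symmetric]) (auto simp: power2_eq_square intro!: sum_nonneg)
 also have "\<dots> <= ennreal (R / (3*\<alpha>*\<tau>\<^sup>2))"
 proof (rule ennreal_leI)
  have "(\<Sum>i<N. (?c i)\<^sup>2) = 4 / \<alpha>\<^sup>2*(\<Sum>i<N. (rho y (e i))\<^sup>2)"
   unfolding sum_distrib_left by (intro sum.cong refl) (simp add: power_divide)
  also have "\<dots> <= 4 / \<alpha>\<^sup>2*(\<alpha> * R)" using sum_rho_e_le[of y] nA by (intro mult_left_mono) auto
  also have "\<dots> = 4 * R / \<alpha>" by (simp add: power2_eq_square)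
  finally have "1 / \<tau>\<^sup>2*((\<Sum>i<N. (?c i)\<^sup>2) / 12) <= 1 / \<tau>\<^sup>2*((4 * R / \<alpha>) / 12)"
   by (intro mult_left_mono divide_right_mono) auto
  thus "1 / \<tau>\<^sup>2*((\<Sum>i<N. (?c i)\<^sup>2) / 12) <= R / (3*\<alpha>*\<tau>\<^sup>2)" by (simp add: field_simps)
 qed
 finally show ?thesis .
qed

text \<open>Suppose that every grid lattice has a vector of value at most \<open>R\<close> with
  nonzero \<open>y\<close>, and fix one for each cell. Its \<open>m\<close> rotations stay below
  \<open>R + t\<close> while \<open>s\<close> moves over most of the cell and \<open>y\<close> over
  most of a unit cube. They are distinct and the cells are disjoint, so the number of short vectors
  integrated over the torus is almost \<open>m\<close>; but this integral is at most the volume of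
  the ellipsoid.\<close>

theorem average_bound:
 fixes \<alpha> R t \<theta> \<tau> :: real and p :: nat
 assumes \<alpha>: "0 < \<alpha>" and p: "0 < p" and R: "0 <= R" and \<theta>: "0 < \<theta>" and \<tau>: "0 < \<tau>"
  and slack: "2 * sqrt R*\<theta> + \<theta>\<^sup>2 + \<tau> + real N / (4*\<alpha>) <= t"
  and bad: "!!c :: nat => nat. c \<in> PiE {..<N} (%_. {..<p}) ==>
   \<exists>x y. (\<exists>i<N. y i ~= 0) & \<alpha>*nB (%i. of_int (x i) + hank (%l. real (c l) / real p) (%j. of_int (y j)) i) + nA (%j. of_int (y j)) / \<alpha> <= R"
 shows "real m*(1 - \<alpha>\<^sup>2*real N*T\<^sup>2 * R / (12*(real p)\<^sup>2*\<theta>\<^sup>2) - R / (3*\<alpha>*\<tau>\<^sup>2))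
  <= unit_ball_vol (real (2*N))*(R + t)^N"
proof -
 define D where "D = PiE {..<N} (%_. {..<p})"
 have D: "finite D" "card D = p^N" unfolding D_def by (auto intro!: finite_PiE simp: card_PiE)
 define Pr where "Pr c x y \<longleftrightarrow> (\<exists>i<N. y i ~= 0) & \<alpha>*nB (%i. of_int (x i) + hank (%l. real (c l) / real p) (%j. of_int (y j)) i) + nA (%j. of_int (y j)) / \<alpha> <= R"
  for c :: "nat => nat" and x y :: "nat => int"
 have "\<forall>c\<in>D. \<exists>x y. Pr c x y" using bad unfolding D_def Pr_def by blast
 then obtain xc yc where Pr: "\<forall>c\<in>D. Pr c (xc c) (yc c)" by metis
 have xy: "\<exists>i<N. yc c i ~= 0"
  "\<alpha>*nB (%i. of_int (xc c i) + hank (%l. real (c l) / real p) (%j. of_int (yc c j)) i) + nA (%j. of_int (yc c j)) / \<alpha> <= R"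
  if "c \<in> D" for c
  using Pr that unfolding Pr_def by blast+
 define h where "h = 1 / (2*real p)"
 have h: "0 < h" "2*h = 1 / real p" using p by (auto simp: h_def)
 define g where "g c l = real (c l) / real p" for c :: "nat => nat" and l
 define cell where "cell c = PiE {..<N} (%l. {g c l - h..<g c l + h})" for c
 \<comment> \<open>The unit cube starts at \<open>- h\<close> so that it contains the whole cells
   centred at the grid points, also those at coordinate 0.\<close>
 define Q where "Q = cube (-h) N"
 define C where "C = cube (-1/2) N"
 have cell_sets [measurable]: "cell c \<in> sets (leb N)" for c unfolding cell_def leb_def by simp
 have Q_sets [measurable]: "Q \<in> sets (leb N)" "C \<in> sets (leb N)" by (simp_all add: Q_def C_def)
 define w where "w = (2*h)^N"
 have w: "0 < w" "w*real (p^N) = 1" using p h by (auto simp: w_def power_divide)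
 have em_cell: "emeasure (leb N) (cell c) = ennreal w" for c
 using leb.emeasure_PiM h by (simp add: cell_def leb_def w_def ennreal_power)
 have cell_Q: "cell c \<subseteq> Q" if c: "c \<in> D" for c
 proof -
  have "g c l + h <= - h + 1" "- h <= g c l - h" if "l < N" for l
  proof -
   have "c l + 1 <= p" using c that by (auto simp: D_def PiE_def Pi_def)
   hence "real (c l) + 1 <= real p" by linarith
   hence "(real (c l) + 1) / real p <= 1" by simp
   thus "g c l + h <= - h + 1" using h(2) by (simp add: g_def add_divide_distrib)
  qed (auto simp: g_def)
  thus ?thesis unfolding cell_def Q_def cube_def by (intro PiE_mono) force
 qed
 have cell_disj: "c = c'" if c: "c \<in> D" "c' \<in> D" "v \<in> cell c" "v \<in> cell c'" for c c' v
 proof -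
  have "c l = c' l" if l: "l < N" for l
  proof -
   have "g c l - h <= v l" "v l < g c l + h" "g c' l - h <= v l" "v l < g c' l + h"
    using c(3,4) l by (auto simp: cell_def PiE_def)
   hence "\<bar>g c l - g c' l\<bar> < 1 / real p" using h(2) by linarith
   moreover have "g c l - g c' l = (real (c l) - real (c' l)) / real p" by (simp only: g_def diff_divide_distrib)
   ultimately have "\<bar>real (c l) - real (c' l)\<bar> / real p < 1 / real p" by simp
   hence "\<bar>real (c l) - real (c' l)\<bar> < 1" using p by (simp only: divide_less_cancel)
   thus ?thesis by linarith
  qed
  thus ?thesis using c(1,2) unfolding D_def by (intro PiE_ext) auto
 qed
 have cells: "(\<Sum>c\<in>D. indicator (cell c) v) <= (indicator Q v :: ennreal)" for v
 proof (cases "\<exists>c\<in>D. v \<in> cell c")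
  case True
  then obtain c0 where c0: "c0 \<in> D" "v \<in> cell c0" by blast
  have "(\<Sum>c\<in>D. indicator (cell c) v) = (indicator (cell c0) v :: ennreal) + (\<Sum>c\<in>D - {c0}. indicator (cell c) v)"
   using D c0 by (intro sum.remove) auto
  also have "(\<Sum>c\<in>D - {c0}. indicator (cell c) v) = (0 :: ennreal)"
   using cell_disj[OF c0(1) _ c0(2)] by (intro sum.neutral) (auto simp: indicator_def)
  finally show ?thesis using cell_Q[OF c0(1)] by auto
 qed (simp add: indicator_def)
 define F where "F y x s u = (indicator {..R + t} (\<alpha>*nB (vadd N x (lin N (hmat y) s)) + nA (vadd N y u) / \<alpha>) :: ennreal)" for y x s u
 have Fm: "(%(s, u). F y x s u) \<in> borel_measurable (leb N \<Otimes>\<^sub>M leb N)" for y x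
 proof -
  note [measurable] = lin_measurable
  show ?thesis unfolding F_def by simp
 qed
 interpret L: sigma_finite_measure "leb N" by (rule sigma_finite_leb)
 interpret P: pair_sigma_finite "leb N" "leb N" ..
 define G where "G y s u = (nnZ N (%x. F y x s u))" for y s u
 have Gm [measurable]: "(%(s, u). G y s u) \<in> borel_measurable (leb N \<Otimes>\<^sub>M leb N)" for y
 proof -
  have "(%q. nnZ N (%x. (%(s, u). F y x s u) q)) \<in> borel_measurable (leb N \<Otimes>\<^sub>M leb N)"
   by (rule borel_measurable_ZZ_sum) (rule Fm)
  thus ?thesis by (simp add: G_def split_beta')
 qed
 have swap: "(%(u, s). H s u) \<in> borel_measurable (leb N \<Otimes>\<^sub>M leb N)" if "(%(s, u). H s u) \<in> borel_measurable (leb N \<Otimes>\<^sub>M leb N)" for H :: "_ => _ => ennreal"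
  using measurable_pair_swap[OF that] by simp
 have sec: "(%s. H s u) \<in> bleb N" if "(%(s, u). H s u) \<in> borel_measurable (leb N \<Otimes>\<^sub>M leb N)" "u \<in> space (leb N)" for H :: "_ => _ => ennreal" and u
  using measurable_Pair1[OF that] by simp
 \<comment> \<open>The part of the count that is due to the rotation by \<open>k\<close> of the
   vector chosen for the cell \<open>c\<close>.\<close>
 define a where "a c k = (nnleb N (%u. indicator C u*(nnleb N (%s. indicator (cell c) s*F (rot k (yc c)) (rotx k (xc c)) s u))))" for c k
 define J where "J y = (if \<exists>i<N. y i ~= 0 then (nnleb N (%u. indicator C u*(nnleb N (%s. indicator Q s*G y s u)))) else 0)" for y
 define V where "V v = (nnleb N (%z. indicator {..R + t} (\<alpha>*nB z + nA v / \<alpha>)))" for v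
 define \<beta>1 where "\<beta>1 = \<alpha>\<^sup>2*real N*T\<^sup>2 * R / (12*(real p)\<^sup>2*\<theta>\<^sup>2)"
 define \<beta>2 where "\<beta>2 = R / (3*\<alpha>*\<tau>\<^sup>2)"
 have \<beta>: "0 <= \<beta>1" "0 <= \<beta>2" using \<alpha> R by (auto simp: \<beta>1_def \<beta>2_def)
 have t0: "0 < t"
 proof -
  have "0 <= 2 * sqrt R*\<theta>" "0 < \<theta>\<^sup>2" "0 <= real N / (4*\<alpha>)" using R \<theta> \<alpha> by auto
  thus ?thesis using slack \<tau> by linarith
 qed
 have lower: "ennreal w <= a c k + (ennreal (w*\<beta>1) + ennreal (w*\<beta>2))" if c: "c \<in> D" for c k
 proof -
  let ?y = "rot k (yc c)" and ?x = "rotx k (xc c)"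
  let ?ry = "%i. of_int (?y i) :: real" and ?yc = "%i. of_int (yc c i) :: real"
  let ?e1 = "%s. ennreal (\<alpha>*nB (hank (%l. s l - g c l) ?yc) / \<theta>\<^sup>2)"
  let ?lin = "%u. 2 / \<alpha>*(\<Sum>i<N. rho ?ry (e i)*u i)"
  let ?e2 = "%u. ennreal ((?lin u)\<^sup>2 / \<tau>\<^sup>2)"
  have z: "\<alpha>*nB (%i. of_int (xc c i) + hank (g c) ?yc i) + nA ?yc / \<alpha> <= R"
   using xy(2)[OF c] by (simp add: g_def[abs_def])
  have nAy: "nA ?yc <= \<alpha> * R"
  proof -
   have "0 <= \<alpha>*nB (%i. of_int (xc c i) + hank (g c) ?yc i)" using \<alpha> nB_nonneg by simp
   hence "nA ?yc / \<alpha> <= R" using z by linarith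
   thus ?thesis using \<alpha> by (simp add: field_simps)
  qed
  have nAr: "nA ?ry <= \<alpha> * R" using nA_rot[of k "yc c"] nAy by linarith
  \<comment> \<open>Markov's inequality pointwise: either both displacements are within
    \<open>\<theta>\<close> and \<open>\<tau>\<close>, and then the slack keeps the rotated vector
    in the count, or one of the two error terms exceeds 1.\<close>
  have pw: "1 <= F ?y ?x s u + ?e1 s + ?e2 u" if u: "u \<in> C" for s u
  proof (cases "\<alpha>*nB (hank (%l. s l - g c l) ?yc) <= \<theta>\<^sup>2 & (?lin u)\<^sup>2 <= \<tau>\<^sup>2")
   case False
   then consider "1 < \<alpha>*nB (hank (%l. s l - g c l) ?yc) / \<theta>\<^sup>2" | "1 < (?lin u)\<^sup>2 / \<tau>\<^sup>2"
    using \<theta> \<tau> by auto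
   thus ?thesis
   by (smt (verit) ennreal_1 ennreal_leI add_increasing add_increasing2 order_trans zero_le le_add_same_cancel2)
  next
   case True
   let ?z = "%i. of_int (xc c i) + hank (g c) ?yc i"
   let ?d = "hank (%l. s l - g c l) ?yc"
   have d: "(%i. of_int (xc c i) + hank s ?yc i) = (%i. ?z i + ?d i)" by (simp add: hank_diff)
   have P: "\<alpha>*nB ?z <= R" using z nA_nonneg[of ?yc] \<alpha> by (smt (verit) divide_nonneg_pos)
   have 1: "\<alpha>*nB (vadd N ?x (lin N (hmat ?y) s)) <= \<alpha>*nB ?z + 2 * sqrt R*\<theta> + \<theta>\<^sup>2"
    unfolding nB_rot d by (rule nB_plus_le[OF \<alpha> P]) (use True \<theta> in auto)
   have "nA (vadd N ?y u) = nA (%i. ?ry i + u i)" by (rule nA_cong) (simp add: vadd_def)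
   also have "\<dots> = nA ?ry + \<alpha>*?lin u + nA u" unfolding nA_add using \<alpha> by simp
   also have "\<dots> <= nA ?yc + \<alpha>*\<tau> + real N / 4"
   proof -
    have "?lin u <= \<tau>" using True \<tau> by (metis abs_le_square_iff abs_of_pos abs_le_D1)
    from mult_left_mono[OF this, of \<alpha>] have l: "\<alpha>*?lin u <= \<alpha>*\<tau>" using \<alpha> by simp
    have "nA u <= (\<Sum>i<N. (u i)\<^sup>2)" by (rule nA_contr)
    also have "\<dots> <= (\<Sum>i<N. 1/4)"
    proof (rule sum_mono)
     fix i assume "i \<in> {..<N}"
     hence "- (1/2) <= u i" "u i <= 1/2" using u by (force simp: C_def cube_def PiE_def)+
     hence "\<bar>u i\<bar> <= 1/2" by linarith
     hence "(u i)\<^sup>2 <= (1/2)\<^sup>2" by (metis abs_ge_zero power2_abs power_mono)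
     thus "(u i)\<^sup>2 <= 1/4" by (simp add: power2_eq_square)
    qed
    also have "\<dots> = real N / 4" by simp
    finally show ?thesis using nA_rot[of k "yc c"] l by linarith
   qed
   finally have "nA (vadd N ?y u) / \<alpha> <= (nA ?yc + \<alpha>*\<tau> + real N / 4) / \<alpha>" using \<alpha> by (simp add: divide_right_mono)
   also have "\<dots> = nA ?yc / \<alpha> + \<tau> + real N / (4*\<alpha>)" using \<alpha> by (simp add: add_divide_distrib)
   finally have "\<alpha>*nB (vadd N ?x (lin N (hmat ?y) s)) + nA (vadd N ?y u) / \<alpha> <= R + t"
    using 1 z slack by linarith
   hence "F ?y ?x s u = 1" by (simp add: F_def)
   hence "1 + 0 + 0 <= F ?y ?x s u + ?e1 s + ?e2 u" by simp
   thus ?thesis by simp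
  qed
  have e1m: "(%s. ?e1 s) \<in> bleb N"
  by (simp add: nB_def hfun_val[symmetric] hfun_coeff)
  have e2m: "(%u. ?e2 u) \<in> bleb N" by simp
  have I1: "(nnleb N (%s. indicator (cell c) s*?e1 s)) <= ennreal (w*\<beta>1)"
  proof -
   have "(nnleb N (%s. indicator (cell c) s*?e1 s)) <= ennreal ((2*h)^N*(\<alpha>*(h\<^sup>2 / 3)*(real N*T\<^sup>2*(\<alpha> * R)) / \<theta>\<^sup>2))"
    unfolding cell_def by (rule perturbation_moment[OF h(1) \<alpha> \<theta> nAy])
   also have "(2*h)^N*(\<alpha>*(h\<^sup>2 / 3)*(real N*T\<^sup>2*(\<alpha> * R)) / \<theta>\<^sup>2) = w*\<beta>1"
    unfolding w_def \<beta>1_def h_def by (simp add: power2_eq_square field_simps)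
   finally show ?thesis .
  qed
  have I2: "(nnleb N (%u. indicator C u*?e2 u)) <= ennreal \<beta>2"
   unfolding C_def \<beta>2_def by (rule dual_moment[OF \<alpha> \<tau> nAr])
  let ?f = "%u. nnleb N (%s. indicator (cell c) s*F ?y ?x s u)"
  have fm: "?f \<in> bleb N"
  proof -
   have "(%(u, s). indicator (cell c) s*F ?y ?x s u) \<in> borel_measurable (leb N \<Otimes>\<^sub>M leb N)"
    using swap[OF Fm, of ?y ?x] by simp
   from L.borel_measurable_nn_integral[OF this] show ?thesis .
  qed
  have inner: "ennreal w <= ?f u + ennreal (w*\<beta>1) + ennreal w*?e2 u" if u: "u \<in> C" for u
  proof -
   have us: "u \<in> space (leb N)" using u by (auto simp: C_def cube_def space_leb)
   have "ennreal w = (nnleb N (%s. indicator (cell c) s))" by (simp add: em_cell)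
   also have "\<dots> <= (nnleb N (%s. indicator (cell c) s*F ?y ?x s u + indicator (cell c) s*?e1 s + indicator (cell c) s*?e2 u))"
    using pw[OF u] by (intro nn_integral_mono) (auto simp: indicator_def)
   also have "\<dots> = ?f u + (nnleb N (%s. indicator (cell c) s*?e1 s)) + ennreal w*?e2 u"
   proof -
    have "(%s. indicator (cell c) s*F ?y ?x s u) \<in> bleb N"
     using sec[OF Fm us, of ?y ?x] by simp
    thus ?thesis using e1m by (simp add: nn_integral_add nn_integral_multc em_cell)
   qed
   also have "\<dots> <= ?f u + ennreal (w*\<beta>1) + ennreal w*?e2 u" by (intro add_mono I1 order_refl)
   finally show ?thesis .
  qed
  have "ennreal w = (nnleb N (%u. indicator C u*ennreal w))"
   unfolding C_def by (simp add: nn_integral_multc emeasure_cube)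
  also have "\<dots> <= (nnleb N (%u. indicator C u*?f u + indicator C u*ennreal (w*\<beta>1) + ennreal w*(indicator C u*?e2 u)))"
   using inner by (intro nn_integral_mono) (auto simp: indicator_def)
  also have "\<dots> = a c k + ennreal (w*\<beta>1) + ennreal w*(nnleb N (%u. indicator C u*?e2 u))"
   using fm by (simp add: nn_integral_add nn_integral_multc nn_integral_cmult a_def) (simp add: C_def emeasure_cube)
  also have "\<dots> <= a c k + ennreal (w*\<beta>1) + ennreal w*ennreal \<beta>2" by (intro add_mono mult_left_mono I2) auto
  finally show ?thesis using w \<beta> by (simp add: ennreal_mult add.assoc)
 qed
 \<comment> \<open>For a fixed \<open>y\<close> at most one rotation index can occur in a cell, by
   \<open>rot_inj\<close>, and different cells integrate over disjoint regions; so all contributions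
   fit under one integral over \<open>Q\<close>.\<close>
 have upper: "(\<Sum>c\<in>D. \<Sum>k<m. if y = rot k (yc c) then a c k else 0) <= J y" if y: "y \<in> ZZ N" for y
 proof (cases "\<exists>i<N. y i ~= 0")
  case False
  have "y ~= rot k (yc c)" if "c \<in> D" "k < m" for c k
   using xy(1)[OF that(1)] rot_nonzero[of k _ "yc c"] that(2) False by auto
  thus ?thesis by simp
 next
  case True
  have 1: "(\<Sum>k<m. if y = rot k (yc c) then a c k else 0) <= (nnleb N (%u. indicator C u*(nnleb N (%s. indicator (cell c) s*G y s u))))" if c: "c \<in> D" for c
  proof (cases "\<exists>k<m. y = rot k (yc c)")
   case True
   then obtain k0 where k0: "k0 < m" "y = rot k0 (yc c)" by blast
   obtain i where i: "i < N" "yc c i ~= 0" using xy(1)[OF c] by blast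
   have ne: "y ~= rot k (yc c)" if "k < m" "k ~= k0" for k
    using rot_inj[of k k0 "yc c" i] rot_inj[of k0 k "yc c" i] that k0 i by (metis linorder_neqE_nat)
   have "(\<Sum>k<m. if y = rot k (yc c) then a c k else 0) = a c k0 + (\<Sum>k\<in>{..<m} - {k0}. if y = rot k (yc c) then a c k else 0)"
    using k0 by (subst sum.remove[of _ k0]) auto
   also have "(\<Sum>k\<in>{..<m} - {k0}. if y = rot k (yc c) then a c k else 0) = 0"
    by (rule sum.neutral) (use ne in auto)
   also have "a c k0 + 0 <= (nnleb N (%u. indicator C u*(nnleb N (%s. indicator (cell c) s*G y s u))))"
    unfolding a_def k0(2)[symmetric] G_def add_0_right
    by (intro nn_integral_mono mult_left_mono nn_integral_count_space_point) (auto simp: ZZ_def rotx_def split: if_splits)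
   finally show ?thesis .
  next
   case False
   hence "(\<Sum>k<m. if y = rot k (yc c) then a c k else 0) = 0" by simp
   thus ?thesis by simp
  qed
  have Gs: "(%s. G y s u) \<in> bleb N" if "u \<in> space (leb N)" for u
   by (rule sec[OF Gm that])
  have Gi: "(%u. nnleb N (%s. indicator (cell c) s*G y s u)) \<in> bleb N" for c
  by simp
  have "(\<Sum>c\<in>D. \<Sum>k<m. if y = rot k (yc c) then a c k else 0) <= (\<Sum>c\<in>D. nnleb N (%u. indicator C u*(nnleb N (%s. indicator (cell c) s*G y s u))))"
   by (intro sum_mono 1)
  also have "\<dots> = (nnleb N (%u. (\<Sum>c\<in>D. indicator C u*(nnleb N (%s. indicator (cell c) s*G y s u)))))"
   by (intro nn_integral_sum[symmetric]) measurable
  also have "\<dots> <= (nnleb N (%u. indicator C u*(nnleb N (%s. indicator Q s*G y s u))))"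
  proof (rule nn_integral_mono)
   fix u assume u: "u \<in> space (leb N)"
   have "(\<Sum>c\<in>D. indicator C u*(nnleb N (%s. indicator (cell c) s*G y s u))) = indicator C u*(\<Sum>c\<in>D. nnleb N (%s. indicator (cell c) s*G y s u))"
    by (rule sum_distrib_left[symmetric])
   also have "(\<Sum>c\<in>D. nnleb N (%s. indicator (cell c) s*G y s u)) = (nnleb N (%s. (\<Sum>c\<in>D. indicator (cell c) s*G y s u)))"
    by (intro nn_integral_sum[symmetric] borel_measurable_times_ennreal borel_measurable_indicator cell_sets Gs[OF u])
   also have "\<dots> = (nnleb N (%s. (\<Sum>c\<in>D. indicator (cell c) s)*G y s u))" by (simp add: sum_distrib_right)
   also have "\<dots> <= (nnleb N (%s. indicator Q s*G y s u))" by (intro nn_integral_mono mult_right_mono cells) auto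
   finally show "(\<Sum>c\<in>D. indicator C u*(nnleb N (%s. indicator (cell c) s*G y s u))) <= indicator C u*(nnleb N (%s. indicator Q s*G y s u))"
    by (simp only: mult_left_mono zero_le)
  qed
  finally show ?thesis using True by (simp add: J_def)
 qed
 have Vm [measurable]: "V \<in> bleb N" unfolding V_def[abs_def] by simp
 \<comment> \<open>Here the torus average enters: for nonzero \<open>y\<close> the endomorphism
   \<open>hmat y\<close> is surjective, and together with the sum over \<open>x\<close> it is
   replaced by a free point of space.\<close>
 have JV: "J y <= (nnleb N (%u. indicator C u*V (vadd N y u)))" for y
 proof (cases "\<exists>i<N. y i ~= 0")
  case True
  have "(nnleb N (%s. indicator Q s*G y s u)) = V (vadd N y u)" for u
   unfolding Q_def G_def F_def V_def
  proof (rule torus_average)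
   show "(%z. indicator {..R + t} (\<alpha>*nB z + nA (vadd N y u) / \<alpha>) :: ennreal) \<in> bleb N" by simp
   show "\<exists>s. \<forall>i<N. (\<Sum>l<N. of_int (hmat y i l) * s l) = t i" for t :: "nat => real"
    unfolding hmat_def by (rule nonsing[OF True])
  qed
  thus ?thesis by (simp add: J_def)
 qed (auto simp: J_def)
 have "ennreal (real m) = (\<Sum>c\<in>D. \<Sum>k<m. ennreal w)"
  using D w by (simp add: ennreal_of_nat_eq_real_of_nat ennreal_mult[symmetric]) (simp add: mult.commute mult.left_commute)
 also have "\<dots> <= (\<Sum>c\<in>D. \<Sum>k<m. a c k + (ennreal (w*\<beta>1) + ennreal (w*\<beta>2)))" by (intro sum_mono lower)
 also have "\<dots> = (\<Sum>c\<in>D. \<Sum>k<m. a c k) + (\<Sum>c\<in>D. \<Sum>k<m. ennreal (w*\<beta>1) + ennreal (w*\<beta>2))" by (simp add: sum.distrib)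
 also have "(\<Sum>c\<in>D. \<Sum>k<m. ennreal (w*\<beta>1) + ennreal (w*\<beta>2)) = ennreal (real m*(\<beta>1 + \<beta>2))"
 proof -
  have "(\<Sum>c\<in>D. \<Sum>k<m. ennreal (w*\<beta>1) + ennreal (w*\<beta>2)) = (\<Sum>c\<in>D. \<Sum>k<m. ennreal (w*(\<beta>1 + \<beta>2)))"
   using w \<beta> by (simp add: distrib_left)
  also have "\<dots> = ennreal (real (p^N)*(real m*(w*(\<beta>1 + \<beta>2))))"
   using D w \<beta> by (simp add: ennreal_of_nat_eq_real_of_nat ennreal_mult)
  also have "real (p^N)*(real m*(w*(\<beta>1 + \<beta>2))) = (w*real (p^N))*(real m*(\<beta>1 + \<beta>2))" by simp
  finally show ?thesis by (simp only: w(2) mult_1)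
 qed
 also have "(\<Sum>c\<in>D. \<Sum>k<m. a c k) = (\<Sum>c\<in>D. \<Sum>k<m. nnZ N (%y. (if y = rot k (yc c) then a c k else 0)))"
  by (intro sum.cong refl nn_integral_count_space_unique[symmetric]) (auto simp: ZZ_def rot_def)
 also have "\<dots> = (nnZ N (%y. (\<Sum>c\<in>D. \<Sum>k<m. if y = rot k (yc c) then a c k else 0)))"
  by (simp add: nn_integral_sum)
 also have "\<dots> <= (nnZ N (%y. J y))" by (intro nn_integral_mono upper) simp
 also have "\<dots> <= (nnZ N (%y. (nnleb N (%u. indicator C u*V (vadd N y u)))))" by (intro nn_integral_mono JV)
 also have "\<dots> = (nnleb N (%u. (nnZ N (%y. indicator C u*V (vadd N y u)))))"
  by (rule nn_integral_swap_ZZ[symmetric]) measurable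
 also have "\<dots> = (nnleb N (%u. indicator C u*(nnZ N (%y. V (vadd N y u)))))" by (simp add: nn_integral_cmult)
 also have "\<dots> = (nnleb N (%v. V v))" unfolding C_def by (rule unfold_cube[OF Vm])
 also have "\<dots> = ennreal (unit_ball_vol (real (2*N))*(R + t)^N)"
  unfolding V_def using ellipsoid_volume[OF \<alpha>, of "R + t"] R t0 by simp
 finally have "ennreal (real m) <= ennreal (unit_ball_vol (real (2*N))*(R + t)^N) + ennreal (real m*(\<beta>1 + \<beta>2))"
  by simp
 also have "\<dots> = ennreal (unit_ball_vol (real (2*N))*(R + t)^N + real m*(\<beta>1 + \<beta>2))"
  using R t0 \<beta> by simp
 finally have "real m <= unit_ball_vol (real (2*N))*(R + t)^N + real m*(\<beta>1 + \<beta>2)"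
  using R t0 \<beta> by (subst (asm) ennreal_le_iff) auto
 hence "real m*(1 - \<beta>1 - \<beta>2) <= unit_ball_vol (real (2*N))*(R + t)^N" by (simp add: algebra_simps)
 thus ?thesis by (simp add: \<beta>1_def \<beta>2_def)
qed

end

section \<open>The cyclotomic lattice of periodic functions\<close>

definition crad :: "nat => nat" where
 "crad m = \<Prod>(prime_factors m)"

text \<open>An index \<open>k\<close> modulo \<open>m\<close> is described by
  \<open>k mod cof m\<close> and, by the Chinese remainder theorem, by the residues of
  \<open>k div cof m\<close> modulo the primes dividing \<open>m\<close>. All kernels below are a
  condition on the first part times a product over these primes.\<close>

definition cof :: "nat => nat" where
 "cof m = m div crad m"

text \<open>All prime residues are nonzero, which leaves \<open>q - 1\<close> choices at each prime
  and hence \<open>totient m\<close> points altogether. They are the evaluation points to which the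
  basis is dual.\<close>

definition csup :: "nat => nat set" where
 "csup m = {l. l < m & (\<forall>q\<in>prime_factors m. \<not> q dvd l div cof m)}"

definition celem :: "nat => nat => nat" where
 "celem m i = sorted_list_of_set (csup m) ! i"

text \<open>At a prime \<open>q\<close> the factor is the difference of the unit vectors at a
  nonzero residue and at 0, a basis vector of the root lattice of type A. The lattice consists of
  \<open>cof m\<close> copies of the tensor product of these root lattices.\<close>

definition cyb :: "nat => nat => nat => int" where
 "cyb m l k = of_bool (k mod cof m = l mod cof m) *
   (\<Prod>q\<in>prime_factors m. of_bool ((k div cof m) mod q = (l div cof m) mod q) - of_bool (q dvd k div cof m))"

lemma sum_mod_mult:
 fixes g h :: "nat => 'a :: comm_semiring_0"
 assumes "coprime a b" "0 < a" "0 < b"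
 shows "(\<Sum>v<a*b. g (v mod a)*h (v mod b)) = (\<Sum>r<a. g r)*(\<Sum>r<b. h r)"
proof -
 let ?f = "%v. (v mod a, v mod b)"
 have inj: "inj_on ?f {..<a*b}"
 proof (rule inj_onI)
  fix x y assume xy: "x \<in> {..<a*b}" "y \<in> {..<a*b}" "?f x = ?f y"
  hence "[x = y] (mod a)" "[x = y] (mod b)" by (auto simp: cong_def)
  hence "[x = y] (mod a*b)" using assms(1) by (metis coprime_cong_mult_nat)
  thus "x = y" using xy by (auto simp: cong_def)
 qed
 have "?f ` {..<a*b} = {..<a} \<times> {..<b}"
  by (rule card_subset_eq) (use assms in \<open>auto simp: card_image[OF inj]\<close>)
 with inj have bij: "bij_betw ?f {..<a*b} ({..<a} \<times> {..<b})" by (simp add: bij_betw_def)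
 have "(\<Sum>v<a*b. g (v mod a)*h (v mod b)) = (\<Sum>(x, y)\<in>{..<a} \<times> {..<b}. g x*h y)"
  using sum.reindex_bij_betw[OF bij, of "%(x, y). g x*h y"] by simp
 also have "\<dots> = (\<Sum>r<a. g r)*(\<Sum>r<b. h r)"
  by (simp add: sum_product sum.cartesian_product)
 finally show ?thesis .
qed

lemma coprime_prod_primes:
 fixes q :: nat
 assumes "finite P" "\<forall>p\<in>P. prime p" "prime q" "q \<notin> P"
 shows "coprime q (\<Prod>P)"
 using assms by (induction P) (auto intro: primes_coprime)

lemma sum_prod_residues:
 fixes f :: "nat => nat => 'a :: comm_semiring_1"
 assumes "finite P" "\<forall>q\<in>P. prime q"
 shows "(\<Sum>v<\<Prod>P. \<Prod>q\<in>P. f q (v mod q)) = (\<Prod>q\<in>P. \<Sum>r<q. f q r)"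
 using assms
proof (induction P rule: finite_induct)
 case (insert q P)
 have pos: "0 < \<Prod>P" "0 < q" using insert by (auto simp: prime_gt_0_nat)
 have "(\<Sum>v<\<Prod>(insert q P). \<Prod>p\<in>insert q P. f p (v mod p))
   = (\<Sum>v<q*\<Prod>P. f q (v mod q)*(\<Prod>p\<in>P. f p ((v mod \<Prod>P) mod p)))"
 proof -
  have "(v mod \<Prod>P) mod p = v mod p" if "p \<in> P" for v p
   using that insert(1) by (intro mod_mod_cancel dvd_prodI)
  hence "(\<Prod>p\<in>P. f p ((v mod \<Prod>P) mod p)) = (\<Prod>p\<in>P. f p (v mod p))" for v
   by simp
  thus ?thesis using insert(1,2) by simp
 qed
 also have "\<dots> = (\<Sum>r<q. f q r)*(\<Sum>r<\<Prod>P. \<Prod>p\<in>P. f p (r mod p))"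
  by (rule sum_mod_mult) (use insert pos coprime_prod_primes in auto)
 finally show ?case using insert by simp
qed simp

locale cyclo =
 fixes m :: nat
 assumes m: "1 < m"
begin

abbreviation "P \<equiv> prime_factors m"
abbreviation "M \<equiv> cof m"
abbreviation "R \<equiv> crad m"
abbreviation "b \<equiv> cyb m"
abbreviation "vv k \<equiv> k div M"

lemma finP: "finite P" and primeP: "q \<in> P ==> prime q" and gtP: "q \<in> P ==> 1 < q" and posP: "q \<in> P ==> 0 < q" and
 dvdP: "q \<in> P ==> q dvd R"
proof -
 show "finite P" by simp
 show "prime q" if "q \<in> P" using that by auto
 thus "1 < q" "0 < q" if "q \<in> P" using that prime_gt_1_nat[of q] by auto
 show "q dvd R" if "q \<in> P" unfolding crad_def using that by auto
qed

lemma R_pos: "0 < R" unfolding crad_def by (intro prod_pos) (use posP in auto)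

lemma cof_prod: "m = R*(\<Prod>p\<in>P. p^(multiplicity p m - 1))"
proof -
 have "m = (\<Prod>p\<in>P. p^multiplicity p m)" using prime_factorization_nat m by simp
 also have "\<dots> = (\<Prod>p\<in>P. p*p^(multiplicity p m - 1))"
 proof (rule prod.cong[OF refl])
  fix p assume "p \<in> P"
  hence "multiplicity p m > 0" by (auto simp: prime_factors_multiplicity)
  thus "p^multiplicity p m = p*p^(multiplicity p m - 1)" by (metis Suc_diff_1 power_Suc)
 qed
 also have "\<dots> = R*(\<Prod>p\<in>P. p^(multiplicity p m - 1))" by (simp add: prod.distrib crad_def)
 finally show ?thesis .
qed

lemma m_eq: "m = R*M"
 unfolding cof_def using cof_prod by (metis dvd_mult_div_cancel dvd_triv_left)

lemma M_eq: "M = (\<Prod>p\<in>P. p^(multiplicity p m - 1))"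
 using cof_prod R_pos unfolding cof_def by (metis nonzero_mult_div_cancel_left less_numeral_extra(3))

lemma M_pos: "0 < M" using m_eq m by (cases M) auto

lemma sum_fibre:
 fixes g :: "nat => 'a :: semiring_1"
 shows "(\<Sum>k<m. of_bool (k mod M = l mod M)*g (vv k)) = (\<Sum>v<R. g v)"
proof -
 have "(\<Sum>k<m. of_bool (k mod M = l mod M)*g (vv k)) = (\<Sum>k\<in>{k\<in>{..<m}. k mod M = l mod M}. g (vv k))"
  unfolding sum.inter_filter[OF finite_lessThan] by (rule sum.cong) auto
 also have "\<dots> = (\<Sum>v<R. g v)"
 proof (rule sum.reindex_bij_witness[where i = "%v. v * M + l mod M" and j = "%k. vv k"])
  fix v assume v: "v \<in> {..<R}"
  have "v * M + l mod M < Suc v * M" using M_pos by simp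
  also have "\<dots> <= R*M" using v by (intro mult_right_mono) auto
  finally have "v * M + l mod M < m" by (simp only: m_eq[symmetric])
  thus "v * M + l mod M \<in> {k\<in>{..<m}. k mod M = l mod M}" by simp
  show "vv (v * M + l mod M) = v" using M_pos by simp
 next
  fix k assume k: "k \<in> {k\<in>{..<m}. k mod M = l mod M}"
  thus "vv k*M + l mod M = k" by (metis (mono_tags, lifting) div_mult_mod_eq mem_Collect_eq)
  show "vv k \<in> {..<R}" using k by (auto intro: less_mult_imp_div_less simp flip: m_eq)
 qed simp
 finally show ?thesis .
qed

text \<open>On a fibre of \<open>k mod M\<close>, a sum of products over primes becomes a product of
  sums over residues. Every identity between the kernels thereby reduces to a computation modulo one
  prime.\<close>

lemma crt_sum:
 fixes f :: "nat => nat => 'a :: comm_semiring_1"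
 shows "(\<Sum>k<m. of_bool (k mod M = l mod M)*(\<Prod>q\<in>P. f q (vv k mod q))) = (\<Prod>q\<in>P. \<Sum>r<q. f q r)"
 using sum_fibre[of l "%v. \<Prod>q\<in>P. f q (v mod q)"] sum_prod_residues[OF finP, of f] primeP by (simp add: crad_def)

lemma vv_add_m: "vv (k + m) = vv k + R" "(k + m) mod M = k mod M"
proof -
 have 1: "k + m = R*M + k" using m_eq by linarith
 show "vv (k + m) = vv k + R" by (simp only: 1) (use M_pos in simp)
 show "(k + m) mod M = k mod M" by (simp only: 1) simp
qed

lemma vv_lt: "k < m ==> vv k < R"
 using m_eq by (metis less_mult_imp_div_less)

lemma vv_inj:
 assumes "k < m" "l < m" "k mod M = l mod M" "!!q. q \<in> P ==> vv k mod q = vv l mod q"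
 shows "k = l"
proof -
 have "[vv k = vv l] (mod R)" unfolding crad_def
  by (rule coprime_cong_prod_nat) (use assms(4) in \<open>auto simp: cong_def intro: primes_coprime in_prime_factors_imp_prime\<close>)
 moreover have "vv k < R" "vv l < R" using assms vv_lt by auto
 ultimately have "vv k = vv l" by (simp add: cong_def)
 thus ?thesis using assms(3) by (metis div_mult_mod_eq)
qed

lemma b_per: "b l (k + m) = b l k"
proof -
 have "(vv k + R) mod q = vv k mod q & (q dvd vv k + R \<longleftrightarrow> q dvd vv k)" if "q \<in> P" for q
  using dvdP[OF that] by (metis dvd_add_left_iff mod_add_right_eq add.right_neutral dvd_imp_mod_0)
 thus ?thesis unfolding cyb_def vv_add_m by simp
qed

lemma b_delta: assumes "l \<in> csup m" "k \<in> csup m" shows "b l k = of_bool (l = k)"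
using assms vv_inj[of k l] assms(2) finP prod_zero by (auto simp: cyb_def csup_def)

lemma finS: "finite (csup m)" by (auto simp: csup_def)

lemma card_csup: "card (csup m) = totient m"
proof -
 have "card (csup m) = (\<Sum>k<m. \<Prod>q\<in>P. of_bool (vv k mod q ~= 0))"
 proof -
  have "(\<Sum>k<m. \<Prod>q\<in>P. of_bool (vv k mod q ~= 0)) = (\<Sum>k<m. of_bool (k \<in> csup m) :: nat)"
  proof (rule sum_cong)
   fix k assume "k \<in> {..<m}"
   thus "(\<Prod>q\<in>P. of_bool (vv k mod q ~= 0)) = (of_bool (k \<in> csup m) :: nat)"
    by (auto simp: csup_def dvd_eq_mod_eq_0 intro!: prod.neutral)
  qed
  also have "\<dots> = card {k\<in>{..<m}. k \<in> csup m}" by (simp add: Int_def)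
  also have "{k\<in>{..<m}. k \<in> csup m} = csup m" by (auto simp: csup_def)
  finally show ?thesis by simp
 qed
 also have "\<dots> = (\<Sum>k<m. \<Sum>r<M. of_bool (k mod M = r mod M)*(\<Prod>q\<in>P. of_bool (vv k mod q ~= 0)))"
 using M_pos by simp
 also have "\<dots> = (\<Sum>r<M. \<Sum>k<m. of_bool (k mod M = r mod M)*(\<Prod>q\<in>P. of_bool (vv k mod q ~= 0)))"
  by (rule sum.swap)
 also have "\<dots> = (\<Sum>r<M. \<Prod>q\<in>P. \<Sum>r<q. of_bool (r ~= 0))"
  by (rule sum_cong) (rule crt_sum[of _ "%q r. of_bool (r ~= 0)"])
 also have "\<dots> = M*(\<Prod>q\<in>P. q - 1)"
 proof -
  have "(\<Sum>r<q. of_bool (r ~= 0) :: nat) = q - 1" if "0 < q" for q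
  proof -
   have "(\<Sum>r<q. of_bool (r ~= 0) :: nat) = card ({..<q} \<inter> {r. r ~= 0})" by simp
   also have "{..<q} \<inter> {r. r ~= 0} = {..<q} - {0}" by auto
   finally show ?thesis using that by simp
  qed
  hence "(\<Prod>q\<in>P. \<Sum>r<q. of_bool (r ~= 0) :: nat) = (\<Prod>q\<in>P. q - 1)" using posP by simp
  thus ?thesis by simp
 qed
 also have "\<dots> = totient m"
 using m totient_formula1 by (simp add: M_eq prod.distrib)
 finally show ?thesis .
qed

section \<open>Functions without components of smaller period\<close>

abbreviation "N \<equiv> totient m"
abbreviation "e \<equiv> celem m"

lemma e_bij: "bij_betw e {..<N} (csup m)"
 using bij_betw_nth[of "sorted_list_of_set (csup m)" "{..<N}" "csup m"] finS card_csup
 by (simp add: celem_def[abs_def])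

lemma e_S: "i < N ==> e i \<in> csup m" using e_bij by (auto simp: bij_betw_def)
lemma e_lt: "i < N ==> e i < m" using e_S by (auto simp: csup_def)
lemma e_inj: "i < N ==> j < N ==> e i = e j ==> i = j" using e_bij by (auto simp: bij_betw_def inj_on_def)

lemma sum_e: "(\<Sum>i<N. f (e i)) = (\<Sum>k\<in>csup m. f k)" by (rule sum.reindex_bij_betw[OF e_bij])

text \<open>The sum along steps \<open>m div q\<close> is \<open>q\<close> times the projection to
  functions of period \<open>m div q\<close>, and every proper divisor of \<open>m\<close> divides
  one of these periods; so the condition expresses orthogonality to all functions of smaller period.
  The ring is a type variable because integral and real functions both occur.\<close>

definition V :: "(nat => 'a :: comm_ring_1) set" where
 "V = {f. (\<forall>k. f (k + m) = f k) & (\<forall>q\<in>P. \<forall>k. (\<Sum>t<q. f (k + t*(m div q))) = 0)}"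

lemma VD: "f \<in> V ==> f (k + m) = f k" "f \<in> V ==> q \<in> P ==> (\<Sum>t<q. f (k + t*(m div q))) = 0"
 by (auto simp: V_def)

lemma V_mod: assumes "f \<in> V" shows "f (k mod m) = f k"
proof -
 have "f (k + j*m) = f k" for k j
 proof (induction j)
  case (Suc j)
  thus ?case using VD(1)[OF assms, of "k + j*m"] by (simp add: ac_simps)
 qed simp
 from this[of "k mod m" "k div m"] show ?thesis by simp
qed

lemma V_sum: assumes "!!i. i \<in> I ==> f i \<in> V" shows "(%k. \<Sum>i\<in>I. c i*f i k) \<in> V"
proof -
 have "(\<Sum>t<q. \<Sum>i\<in>I. c i*f i (k + t*(m div q))) = 0" if q: "q \<in> P" for q k
 proof -
  have "(\<Sum>t<q. \<Sum>i\<in>I. c i*f i (k + t*(m div q))) = (\<Sum>i\<in>I. c i*(\<Sum>t<q. f i (k + t*(m div q))))"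
   by (subst sum.swap) (simp add: sum_distrib_left)
  also have "\<dots> = 0" using VD(2)[OF assms q] by simp
  finally show ?thesis .
 qed
 moreover have "(\<Sum>i\<in>I. c i*f i (k + m)) = (\<Sum>i\<in>I. c i*f i k)" for k
  by (rule sum_cong) (simp add: VD(1)[OF assms])
 ultimately show ?thesis by (simp add: V_def)
qed

lemma V_diff: assumes "f \<in> V" "g \<in> V" shows "(%k. f k - g k) \<in> V"
proof -
 have "(\<Sum>t<q. f (k + t*(m div q)) - g (k + t*(m div q))) = 0" if "q \<in> P" for q k
  using VD(2)[OF assms(1) that] VD(2)[OF assms(2) that] by (simp add: sum_subtractf)
 thus ?thesis using VD(1)[OF assms(1)] VD(1)[OF assms(2)] by (simp add: V_def)
qed

lemma V_shift: assumes "f \<in> V" shows "(%k. f (k + c)) \<in> V"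
proof -
 have "f (k + m + c) = f (k + c)" for k using VD(1)[OF assms, of "k + c"] by (simp add: ac_simps)
 moreover have "(\<Sum>t<q. f (k + t*(m div q) + c)) = 0" if "q \<in> P" for q k
  using VD(2)[OF assms that, of "k + c"] by (simp add: ac_simps)
 ultimately show ?thesis by (simp add: V_def)
qed

lemma m_div_q: "q \<in> P ==> m div q = (R div q)*M"
 using dvdP[of q] by (subst m_eq) (simp add: div_mult_swap mult.commute)

lemma vv_shift: "q \<in> P ==> vv (k + t*(m div q)) = vv k + t*(R div q)" "q \<in> P ==> (k + t*(m div q)) mod M = k mod M"
 using M_pos by (auto simp: m_div_q simp flip: mult.assoc)

lemma R_div_dvd: assumes "q \<in> P" "p \<in> P" "p ~= q" shows "p dvd R div q"
proof -
 have "R = q*\<Prod>(P - {q})" unfolding crad_def using assms by (subst prod.remove[of _ q]) auto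
 hence "R div q = \<Prod>(P - {q})" using posP[OF assms(1)] by simp
 thus ?thesis using assms by auto
qed

lemma R_div_coprime: assumes "q \<in> P" shows "coprime q (R div q)"
proof -
 have "R = q*\<Prod>(P - {q})" unfolding crad_def using assms by (subst prod.remove[of _ q]) auto
 hence "R div q = \<Prod>(P - {q})" using posP[OF assms(1)] by simp
 thus ?thesis using coprime_prod_primes[of "P - {q}" q] assms by auto
qed

lemma sum_residue_shift:
 fixes g :: "nat => 'a :: comm_monoid_add"
 assumes "q \<in> P"
 shows "(\<Sum>t<q. g ((v + t*(R div q)) mod q)) = (\<Sum>r<q. g r)"
proof -
 have inj: "inj_on (%t. (v + t*(R div q)) mod q) {..<q}"
 proof (rule inj_onI)
  fix x y assume xy: "x \<in> {..<q}" "y \<in> {..<q}" "(v + x*(R div q)) mod q = (v + y*(R div q)) mod q"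
  hence "[v + x*(R div q) = v + y*(R div q)] (mod q)" by (simp add: cong_def)
  hence "[x*(R div q) = y*(R div q)] (mod q)" by (simp add: cong_add_lcancel_nat)
  hence "[x = y] (mod q)" using R_div_coprime[OF assms] by (metis cong_mult_rcancel_nat coprime_commute)
  thus "x = y" using xy by (simp add: cong_def)
 qed
 have "(%t. (v + t*(R div q)) mod q) ` {..<q} = {..<q}"
  by (rule card_subset_eq) (use posP[OF assms] in \<open>auto simp: card_image[OF inj]\<close>)
 hence "bij_betw (%t. (v + t*(R div q)) mod q) {..<q} {..<q}" using inj by (simp add: bij_betw_def)
 thus ?thesis by (rule sum.reindex_bij_betw)
qed

text \<open>A step \<open>m div q\<close> leaves the part modulo \<open>M\<close> and the residues
  at the other primes alone, and it adds a unit modulo \<open>q\<close> to the residue at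
  \<open>q\<close>. So \<open>q\<close> steps run through all residues there, and the sum along them
  is a constant times the sum of the factor at \<open>q\<close>.\<close>

lemma V_tensor:
 fixes f :: "nat => nat => 'a :: comm_ring_1"
 assumes "!!q. q \<in> P ==> (\<Sum>r<q. f q r) = 0"
 shows "(%k. of_bool (k mod M = l mod M)*(\<Prod>q\<in>P. f q (vv k mod q))) \<in> V"
proof -
 have "(vv k + R) mod q = vv k mod q" if "q \<in> P" for q k
  using dvdP[OF that] by auto
 hence 1: "(\<Prod>q\<in>P. f q ((vv k + R) mod q)) = (\<Prod>q\<in>P. f q (vv k mod q))" for k
  by simp
 have "(\<Sum>t<q. \<Prod>p\<in>P. f p ((vv k + t*(R div q)) mod p)) = 0" if q: "q \<in> P" for q k
 proof -
  have "(\<Sum>t<q. \<Prod>p\<in>P. f p ((vv k + t*(R div q)) mod p))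
    = (\<Sum>t<q. f q ((vv k + t*(R div q)) mod q)*(\<Prod>p\<in>P - {q}. f p (vv k mod p)))"
  proof (rule sum_cong)
   fix t
   have "(vv k + t*(R div q)) mod p = vv k mod p" if "p \<in> P - {q}" for p
    using R_div_dvd[OF q, of p] that by (metis Diff_iff dvd_imp_mod_0 dvd_mult insertI1 mod_add_right_eq add.right_neutral)
   hence "(\<Prod>p\<in>P - {q}. f p ((vv k + t*(R div q)) mod p)) = (\<Prod>p\<in>P - {q}. f p (vv k mod p))"
    by simp
   thus "(\<Prod>p\<in>P. f p ((vv k + t*(R div q)) mod p)) = f q ((vv k + t*(R div q)) mod q)*(\<Prod>p\<in>P - {q}. f p (vv k mod p))"
    using q by (subst prod.remove[of _ q]) auto
  qed
  also have "\<dots> = (\<Sum>t<q. f q ((vv k + t*(R div q)) mod q))*(\<Prod>p\<in>P - {q}. f p (vv k mod p))"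
   by (simp add: sum_distrib_right)
  also have "\<dots> = 0" using sum_residue_shift[OF q, of "f q" "vv k"] assms[OF q] by simp
  finally show ?thesis .
 qed
 thus ?thesis by (simp add: V_def vv_add_m vv_shift 1)
qed

lemma b_tensor: "of_int (b l k) = (of_bool (k mod M = l mod M) *
   (\<Prod>q\<in>P. of_bool (vv k mod q = vv l mod q) - of_bool (vv k mod q = 0)) :: 'a :: comm_ring_1)"
 by (simp add: cyb_def dvd_eq_mod_eq_0)

lemma b_V: "l \<in> csup m ==> (%k. of_int (b l k) :: 'a :: comm_ring_1) \<in> V"
 unfolding b_tensor
proof (rule V_tensor)
 fix q assume q: "q \<in> P"
 thus "(\<Sum>r<q. of_bool (r = vv l mod q) - of_bool (r = 0) :: 'a) = 0"
  by (simp add: sum_subtractf of_bool_def)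
qed

text \<open>Induction on the number of primes dividing \<open>k div M\<close>. If \<open>q\<close>
  is one of them, the relation at \<open>q\<close> expresses \<open>f k\<close> by values at points
  where \<open>q\<close> has dropped out of this set and no other prime has entered it; if there is
  none, \<open>k mod m\<close> lies in \<open>csup m\<close>.\<close>

lemma V_zero:
 assumes f: "f \<in> V" and S: "!!k. k \<in> csup m ==> f k = 0"
 shows "f k = 0"
proof (induction "card {q\<in>P. q dvd vv k}" arbitrary: k rule: less_induct)
 case less
 show ?case
 proof (cases "\<exists>q\<in>P. q dvd vv k")
  case False
  have "vv (k mod m) = vv k mod R"
  proof -
   have "M * R = m" by (subst m_eq) (rule mult.commute)
   hence "k mod m = M*(vv k mod R) + k mod M" using mod_mult2_eq[of k M R] by metis
   thus ?thesis using M_pos by simp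
  qed
  hence "k mod m \<in> csup m" using False m dvdP by (auto simp: csup_def dvd_mod_iff)
  thus ?thesis using S V_mod[OF f] by metis
 next
  case True
  then obtain q where q: "q \<in> P" "q dvd vv k" by blast
  have "f (k + t*(m div q)) = 0" if t: "t \<in> {..<q} - {0}" for t
  proof (rule less)
   have nq: "\<not> q dvd vv k + t*(R div q)"
   proof
    assume "q dvd vv k + t*(R div q)"
    hence "q dvd t*(R div q)" using q(2) by (metis dvd_add_right_iff)
    hence "q dvd t" using R_div_coprime[OF q(1)] by (metis coprime_dvd_mult_left_iff)
    thus False using t by auto
   qed
   have "p dvd vv k + t*(R div q) \<longleftrightarrow> p dvd vv k" if "p \<in> P" "p ~= q" for p
    using R_div_dvd[OF q(1) that] by (metis dvd_add_left_iff dvd_mult)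
   hence "{p\<in>P. p dvd vv (k + t*(m div q))} \<subset> {q\<in>P. q dvd vv k}"
    using q nq by (auto simp: vv_shift)
   thus "card {p\<in>P. p dvd vv (k + t*(m div q))} < card {q\<in>P. q dvd vv k}"
    by (intro psubset_card_mono) auto
  qed
  hence "(\<Sum>t\<in>{..<q} - {0}. f (k + t*(m div q))) = 0" by simp
  hence "(\<Sum>t<q. f (k + t*(m div q))) = f k" using posP[OF q(1)] by (subst sum.remove[of _ 0]) auto
  thus ?thesis using VD(2)[OF f q(1), of k] by simp
 qed
qed

lemma V_expand:
 assumes "f \<in> V"
 shows "f k = (\<Sum>i<N. f (e i) * of_int (b (e i) k))"
proof -
 have g: "(%k. \<Sum>i<N. f (e i) * of_int (b (e i) k)) \<in> V" by (rule V_sum) (use b_V e_S in auto)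
 have "f k - (\<Sum>i<N. f (e i) * of_int (b (e i) k)) = 0"
 proof (rule V_zero[OF V_diff[OF assms g]])
  fix k assume k: "k \<in> csup m"
  then obtain j where j: "j < N" "k = e j" using e_bij by (auto simp: bij_betw_def)
  have "(\<Sum>i<N. f (e i) * of_int (b (e i) k)) = (\<Sum>i\<in>{j}. f (e i) * of_int (b (e i) k))"
   by (rule sum.mono_neutral_right) (use j e_S e_inj in \<open>auto simp: b_delta\<close>)
  thus "f k - (\<Sum>i<N. f (e i) * of_int (b (e i) k)) = 0" using j e_S by (simp add: b_delta)
 qed
 thus ?thesis by simp
qed

end

section \<open>The dual form and short digit expansions\<close>

definition cyA :: "nat => nat => nat => real" where
 "cyA m l k = of_bool (k mod cof m = l mod cof m) / real (crad m) *
   (\<Prod>q\<in>prime_factors m. real q * of_bool ((k div cof m) mod q = (l div cof m) mod q) - 1)"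

text \<open>At each prime, on nonzero residues, this is the matrix of partial sums, inverse to a
  difference operator. It expresses dual coordinates by digits that remain small for short
  vectors.\<close>

definition cykap :: "nat => nat => nat => int" where
 "cykap m l k = of_bool (k mod cof m = l mod cof m) *
   (\<Prod>q\<in>prime_factors m. of_bool ((k div cof m) mod q <= (l div cof m) mod q))"

context cyclo
begin

lemma A_sym: "cyA m l k = cyA m k l"
 unfolding cyA_def by (intro arg_cong2[of _ _ _ _ "(*)"] prod.cong arg_cong2[of _ _ _ _ "(/)"]) auto

lemma A_V: "(%k. cyA m l k) \<in> V"
proof -
 have "(%k. \<Sum>i\<in>{0::nat}. 1 / real R*(of_bool (k mod M = l mod M)*(\<Prod>q\<in>P. real q * of_bool (vv k mod q = vv l mod q) - 1))) \<in> V"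
 proof (rule V_sum, rule V_tensor)
  fix q assume "q \<in> P"
  from posP[OF this] show "(\<Sum>r<q. real q * of_bool (r = vv l mod q) - 1) = 0"
   by (simp add: sum_subtractf of_bool_def flip: sum_distrib_left)
 qed
 thus ?thesis by (simp add: cyA_def)
qed

lemma sum_of_bool_eq: "a < (q :: nat) ==> (\<Sum>r<q. of_bool (r = a)*f r) = (f a :: 'a :: semiring_1)"
 by simp

text \<open>\<open>cyA\<close> is the kernel of the orthogonal projection to \<open>V\<close>: at
  each prime it is the identity minus the mean, \<open>of_bool (r = s) - 1 / q\<close>, with the
  denominators collected in \<open>1 / R\<close>. So it reproduces \<open>b\<close>, it is
  idempotent, and its restriction to the evaluation points inverts the Gram matrix.\<close>

lemma A_reproduce: "(\<Sum>l<m. of_int (b i l)*cyA m l k) = of_int (b i k)"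
proof -
 have "(\<Sum>l<m. of_int (b i l)*cyA m l k) = (\<Sum>l<m. of_bool (i mod M = k mod M) / real R*(of_bool (l mod M = i mod M) *
   (\<Prod>q\<in>P. (of_bool (vv l mod q = vv i mod q) - of_bool (vv l mod q = 0))*(real q * of_bool (vv l mod q = vv k mod q) - 1))))"
  by (rule sum_cong, subst A_sym[of _ k]) (auto simp: cyA_def b_tensor prod.distrib)
 also have "\<dots> = of_bool (i mod M = k mod M) / real R*(\<Prod>q\<in>P. \<Sum>r<q. (of_bool (r = vv i mod q) - of_bool (r = 0))*(real q * of_bool (r = vv k mod q) - 1))"
  unfolding sum_distrib_left[symmetric] by (subst crt_sum) (rule refl)
 also have "(\<Prod>q\<in>P. \<Sum>r<q. (of_bool (r = vv i mod q) - of_bool (r = 0))*(real q * of_bool (r = vv k mod q) - 1))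
   = (\<Prod>q\<in>P. real q*(of_bool (vv k mod q = vv i mod q) - of_bool (vv k mod q = 0)))"
 proof (rule prod.cong[OF refl])
  fix q assume "q \<in> P"
  from posP[OF this] show "(\<Sum>r<q. (of_bool (r = vv i mod q) - of_bool (r = 0))*(real q * of_bool (r = vv k mod q) - 1))
   = real q*(of_bool (vv k mod q = vv i mod q) - of_bool (vv k mod q = 0))"
   by (simp only: left_diff_distrib sum_subtractf sum_of_bool_eq mod_less_divisor) auto
 qed
 also have "\<dots> = real R*(\<Prod>q\<in>P. of_bool (vv k mod q = vv i mod q) - of_bool (vv k mod q = 0))"
  by (simp add: prod.distrib crad_def)
 finally show ?thesis using R_pos by (auto simp: b_tensor)
qed

lemma A_idem: "(\<Sum>l<m. cyA m i l*cyA m l k) = cyA m i k"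
proof -
 have "(\<Sum>l<m. cyA m i l*cyA m l k) = (\<Sum>l<m. of_bool (i mod M = k mod M) / (real R)\<^sup>2*(of_bool (l mod M = i mod M) *
   (\<Prod>q\<in>P. (real q * of_bool (vv l mod q = vv i mod q) - 1)*(real q * of_bool (vv l mod q = vv k mod q) - 1))))"
  by (rule sum_cong, subst A_sym[of _ k]) (auto simp: cyA_def prod.distrib power2_eq_square)
 also have "\<dots> = of_bool (i mod M = k mod M) / (real R)\<^sup>2*(\<Prod>q\<in>P. \<Sum>r<q. (real q * of_bool (r = vv i mod q) - 1)*(real q * of_bool (r = vv k mod q) - 1))"
  unfolding sum_distrib_left[symmetric] by (subst crt_sum) (rule refl)
 also have "(\<Prod>q\<in>P. \<Sum>r<q. (real q * of_bool (r = vv i mod q) - 1)*(real q * of_bool (r = vv k mod q) - 1))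
   = (\<Prod>q\<in>P. real q*(real q * of_bool (vv k mod q = vv i mod q) - 1))"
 proof (rule prod.cong[OF refl])
  fix q assume q: "q \<in> P"
  have "(\<Sum>r<q. (real q * of_bool (r = vv i mod q) - 1)*(real q * of_bool (r = vv k mod q) - 1))
   = (\<Sum>r<q. of_bool (r = vv i mod q)*(real q*(real q * of_bool (r = vv k mod q) - 1)) - (of_bool (r = vv k mod q)*real q - 1))"
   by (rule sum_cong) (auto simp: algebra_simps)
  also have "\<dots> = real q*(real q * of_bool (vv k mod q = vv i mod q) - 1)"
   using posP[OF q] by (simp only: sum_subtractf sum_of_bool_eq mod_less_divisor) auto
  finally show "(\<Sum>r<q. (real q * of_bool (r = vv i mod q) - 1)*(real q * of_bool (r = vv k mod q) - 1))
   = real q*(real q * of_bool (vv k mod q = vv i mod q) - 1)" .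
 qed
 also have "\<dots> = real R*(\<Prod>q\<in>P. real q * of_bool (vv k mod q = vv i mod q) - 1)"
  by (simp add: prod.distrib crad_def)
 finally show ?thesis by (auto simp: cyA_def power2_eq_square)
qed

text \<open>The row of \<open>cyA\<close> at \<open>e i\<close> lies in \<open>V\<close>, so the sum
  over \<open>j\<close> is its expansion in the basis, and pairing it with \<open>b (e k)\<close>
  reproduces the value \<open>b (e k) (e i)\<close>.\<close>

lemma A_inverse:
 assumes "i < N" "k < N"
 shows "(\<Sum>j<N. cyA m (e i) (e j) * of_int (\<Sum>l<m. b (e j) l*b (e k) l)) = of_bool (i = k)"
proof -
 have "(\<Sum>j<N. cyA m (e i) (e j) * of_int (\<Sum>l<m. b (e j) l*b (e k) l))
   = (\<Sum>l<m. of_int (b (e k) l)*(\<Sum>j<N. cyA m (e i) (e j) * of_int (b (e j) l)))"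
  by (simp only: of_int_sum of_int_mult sum_distrib_left) (subst sum.swap, simp only: mult_ac)
 also have "\<dots> = (\<Sum>l<m. of_int (b (e k) l)*cyA m l (e i))"
 proof -
  have "(\<Sum>j<N. cyA m (e i) (e j) * of_int (b (e j) l)) = cyA m l (e i)" for l
   using V_expand[OF A_V, of "e i" l] A_sym[of l "e i"] by linarith
  thus ?thesis by simp
 qed
 also have "\<dots> = of_bool (i = k)" using assms e_S e_inj b_delta by (auto simp: A_reproduce)
 finally show ?thesis .
qed

lemma A_square:
 "(\<Sum>i<N. \<Sum>j<N. cyA m (e i) (e j)*u i*u j) = (\<Sum>l<m. (\<Sum>i<N. u i*cyA m (e i) l)\<^sup>2)"
proof -
 have "(\<Sum>l<m. (\<Sum>i<N. u i*cyA m (e i) l)\<^sup>2) = (\<Sum>l<m. \<Sum>i<N. \<Sum>j<N. u i*u j*(cyA m (e i) l*cyA m l (e j)))"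
  by (simp only: power2_eq_square sum_product A_sym[of _ "e _"] mult_ac)
 also have "\<dots> = (\<Sum>i<N. \<Sum>j<N. u i*u j*(\<Sum>l<m. cyA m (e i) l*cyA m l (e j)))"
  by (subst sum.swap, subst sum.swap[of _ "{..<N}"]) (simp only: sum_distrib_left)
 finally show ?thesis unfolding A_idem by (simp only: mult_ac)
qed

text \<open>Projections do not increase length: \<open>w\<close> is the projection of
  \<open>u\<close> placed on the evaluation points, \<open>?s\<close> is both the squared norm of
  \<open>w\<close> and its inner product with \<open>u\<close>, and restricting \<open>w\<close> to
  those points only shortens it.\<close>

lemma A_contraction: "(\<Sum>i<N. \<Sum>j<N. cyA m (e i) (e j)*u i*u j) <= (\<Sum>i<N. (u i)\<^sup>2)"
proof -
 define w where "w l = (\<Sum>i<N. u i*cyA m (e i) l)" for l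
 let ?s = "\<Sum>i<N. \<Sum>j<N. cyA m (e i) (e j)*u i*u j"
 have s: "?s = (\<Sum>l<m. (w l)\<^sup>2)" unfolding A_square w_def ..
 have "?s = (\<Sum>j<N. \<Sum>i<N. cyA m (e i) (e j)*u i*u j)" by (rule sum.swap)
 also have "\<dots> = (\<Sum>j<N. u j*w (e j))" by (simp only: w_def sum_distrib_left mult_ac)
 finally have s': "?s = (\<Sum>j<N. u j*w (e j))" .
 have "(\<Sum>j<N. (w (e j))\<^sup>2) = (\<Sum>k\<in>csup m. (w k)\<^sup>2)" by (rule sum_e)
 also have "\<dots> <= ?s" unfolding s by (rule sum_mono2) (auto simp: csup_def)
 finally have 1: "(\<Sum>j<N. (w (e j))\<^sup>2) <= ?s" .
 have "0 <= (\<Sum>j<N. (u j - w (e j))\<^sup>2)" by (intro sum_nonneg) simp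
 also have "\<dots> = (\<Sum>j<N. (u j)\<^sup>2) - 2*(\<Sum>j<N. u j*w (e j)) + (\<Sum>j<N. (w (e j))\<^sup>2)"
  by (simp add: power2_diff sum.distrib sum_subtractf sum_distrib_left mult.assoc)
 finally show ?thesis using 1 unfolding s'[symmetric] by linarith
qed

text \<open>Each prime contributes two entries of absolute value 1. This is the constant
  \<open>T\<close> of \<open>shift_lattice\<close>, a subpolynomial factor in \<open>m\<close> by
  \<open>two_power_omega_le\<close>.\<close>

lemma b_abs: "l \<in> csup m ==> (\<Sum>k<m. \<bar>b l k\<bar>) = 2^card P"
proof -
 assume l: "l \<in> csup m"
 have "(\<Sum>k<m. \<bar>b l k\<bar>) = (\<Sum>k<m. of_bool (k mod M = l mod M)*(\<Prod>q\<in>P. \<bar>of_bool (vv k mod q = vv l mod q) - of_bool (vv k mod q = 0)\<bar> :: int))"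
  by (simp only: cyb_def dvd_eq_mod_eq_0 abs_mult abs_prod abs_bool_eq)
 also have "\<dots> = (\<Prod>q\<in>P. \<Sum>r<q. \<bar>of_bool (r = vv l mod q) - of_bool (r = 0)\<bar> :: int)" by (rule crt_sum)
 also have "\<dots> = (\<Prod>q\<in>P. 2)"
 proof (rule prod.cong[OF refl])
  fix q assume q: "q \<in> P"
  hence nz: "vv l mod q ~= 0" using l by (auto simp: csup_def dvd_eq_mod_eq_0)
  have "(\<Sum>r<q. \<bar>of_bool (r = vv l mod q) - of_bool (r = 0)\<bar> :: int) = (\<Sum>r<q. of_bool (r = vv l mod q)*1 + of_bool (r = 0)*1)"
   by (rule sum_cong) (use nz in auto)
  also have "\<dots> = 2" using posP[OF q] by (simp only: sum.distrib sum_of_bool_eq mod_less_divisor)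
  finally show "(\<Sum>r<q. \<bar>of_bool (r = vv l mod q) - of_bool (r = 0)\<bar> :: int) = 2" .
 qed
 finally show ?thesis by simp
qed

text \<open>Periods \<open>c\<close> and \<open>m\<close> give the period \<open>gcd c m\<close>,
  which divides \<open>m div q\<close> for some prime \<open>q\<close>. The relation at
  \<open>q\<close> then has \<open>q\<close> equal terms, and these must vanish.\<close>

lemma V_period_zero:
 fixes f :: "nat => 'a :: {idom, ring_char_0}"
 assumes f: "f \<in> V" and c: "0 < c" "c < m" and per: "!!k. f (k + c) = f k"
 shows "f k = 0"
proof -
 define g where "g = gcd c m"
 have g: "g dvd m" "g <= c" "0 < g" using c by (auto simp: g_def)
 have pj: "f (k + j*c) = f k" for k j
 proof (induction j)
  case (Suc j)
  thus ?case using per[of "k + j*c"] by (simp add: ac_simps)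
 qed simp
 have pm: "f (k + j*m) = f k" for k j
  using V_mod[OF f, of "k + j*m"] V_mod[OF f, of k] by simp
 obtain x y where xy: "c*x = m*y + g" using bezout_nat[of c m] c unfolding g_def by auto
 have pg: "f (k + j*g) = f k" for k j
 proof -
  have "f (k + j*g) = f (k + j*g + (j*y)*m)" by (rule pm[symmetric])
  also have "k + j*g + (j*y)*m = k + j*(c*x)" unfolding xy by (simp add: algebra_simps)
  also have "\<dots> = k + (j*x)*c" by simp
  also have "f \<dots> = f k" by (rule pj)
  finally show ?thesis .
 qed
 obtain d where d: "m = g*d" using g by blast
 hence "d ~= 1" using g c by auto
 then obtain q where q: "prime q" "q dvd d" using prime_factor_nat by blast
 have "m ~= 0" using m by simp
 moreover have "q dvd m" by (metis d dvd_mult q(2))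
 ultimately have qP: "q \<in> P" using q(1) by (simp add: in_prime_factors_iff)
 from q obtain d' where d': "d = q*d'" by blast
 have "m div q = d'*g" using d d' posP[OF qP] by simp
 hence "f (k + t*(m div q)) = f k" for t using pg[of k "t*d'"] by (simp only: mult.assoc)
 hence "(\<Sum>t<q. f (k + t*(m div q))) = of_nat q*f k" by simp
 thus ?thesis using VD(2)[OF f qP, of k] posP[OF qP] by simp
qed

text \<open>The inverse of the matrix \<open>cykap\<close> on the support is the tensor product of difference operators;
 its rows are restrictions of functions in \<^term>\<open>V\<close>, so it may be applied to the projection onto
 \<^term>\<open>V\<close>, whose squared norm is the dual form, and there Schur's test applies.\<close>

definition dif :: "nat => nat => int" where
 "dif l k = of_bool (k mod M = l mod M) *
   (\<Prod>q\<in>P. of_bool (vv k mod q = vv l mod q) - of_bool (vv k mod q = vv l mod q - 1))"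

lemma dif_V: "l \<in> csup m ==> (%k. of_int (dif l k) :: real) \<in> V"
proof -
 assume l: "l \<in> csup m"
 have "(%k. of_bool (k mod M = l mod M) *
   (\<Prod>q\<in>P. of_bool (vv k mod q = vv l mod q) - of_bool (vv k mod q = vv l mod q - 1)) :: real) \<in> V"
 proof (rule V_tensor)
  fix q assume q: "q \<in> P"
  from posP[OF q] have "vv l mod q < q" "vv l mod q - 1 < q" by (auto intro: less_imp_diff_less)
  thus "(\<Sum>r<q. of_bool (r = vv l mod q) - of_bool (r = vv l mod q - 1)) = (0 :: real)"
   using sum_of_bool_eq[of "vv l mod q" q "%_. 1 :: real"] sum_of_bool_eq[of "vv l mod q - 1" q "%_. 1 :: real"]
   by (simp only: sum_subtractf) (simp only: mult_1_right)
 qed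
 thus ?thesis by (simp add: dif_def)
qed

text \<open>Modulo one prime the sum over nonzero residues \<open>r\<close> up to \<open>a\<close>
  telescopes: \<open>c = r\<close> cancels against \<open>c = r - 1\<close> for the next
  \<open>r\<close>, and since \<open>c\<close> is nonzero only \<open>c = a\<close> remains. The
  restriction to nonzero \<open>r\<close> comes from summing over \<open>csup m\<close>.\<close>

lemma kap_dif:
 assumes "u \<in> csup m" "w \<in> csup m"
 shows "(\<Sum>v\<in>csup m. cykap m u v * dif v w) = of_bool (u = w)"
proof -
 have "(\<Sum>v\<in>csup m. cykap m u v * dif v w) = (\<Sum>v<m. of_bool (u mod M = w mod M)*(of_bool (v mod M = u mod M) *
   (\<Prod>q\<in>P. of_bool (vv v mod q ~= 0) * of_bool (vv v mod q <= vv u mod q)*(of_bool (vv w mod q = vv v mod q) - of_bool (vv w mod q = vv v mod q - 1)))))"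
 proof (rule sum.mono_neutral_cong_left)
  show "finite {..<m}" "csup m \<subseteq> {..<m}" by (auto simp: csup_def)
  show "\<forall>i\<in>{..<m} - csup m. of_bool (u mod M = w mod M)*(of_bool (i mod M = u mod M) *
   (\<Prod>q\<in>P. of_bool (vv i mod q ~= 0) * of_bool (vv i mod q <= vv u mod q)*(of_bool (vv w mod q = vv i mod q) - of_bool (vv w mod q = vv i mod q - 1)))) = (0::int)"
  proof
   fix i assume "i \<in> {..<m} - csup m"
   then obtain q where "q \<in> P" "vv i mod q = 0" by (auto simp: csup_def)
   hence "(\<Prod>q\<in>P. of_bool (vv i mod q ~= 0) * of_bool (vv i mod q <= vv u mod q)*(of_bool (vv w mod q = vv i mod q) - of_bool (vv w mod q = vv i mod q - 1))) = (0::int)"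
    by (intro prod_zero bexI[of _ q]) simp_all
   thus "of_bool (u mod M = w mod M)*(of_bool (i mod M = u mod M) *
   (\<Prod>q\<in>P. of_bool (vv i mod q ~= 0) * of_bool (vv i mod q <= vv u mod q)*(of_bool (vv w mod q = vv i mod q) - of_bool (vv w mod q = vv i mod q - 1)))) = (0::int)"
    by simp
  qed
  fix v assume v: "v \<in> csup m"
  hence nz: "vv v mod q ~= 0" if "q \<in> P" for q using that by (auto simp: csup_def dvd_eq_mod_eq_0)
  have "cykap m u v * dif v w = of_bool (u mod M = w mod M)*(of_bool (v mod M = u mod M) *
   (\<Prod>q\<in>P. of_bool (vv v mod q <= vv u mod q)*(of_bool (vv w mod q = vv v mod q) - of_bool (vv w mod q = vv v mod q - 1))))"
   unfolding cykap_def dif_def prod.distrib by auto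
  also have "(\<Prod>q\<in>P. of_bool (vv v mod q <= vv u mod q)*(of_bool (vv w mod q = vv v mod q) - of_bool (vv w mod q = vv v mod q - 1)))
   = (\<Prod>q\<in>P. of_bool (vv v mod q ~= 0) * of_bool (vv v mod q <= vv u mod q)*(of_bool (vv w mod q = vv v mod q) - of_bool (vv w mod q = vv v mod q - 1)) :: int)"
   by (rule prod.cong[OF refl]) (use nz in simp)
  finally show "cykap m u v * dif v w = of_bool (u mod M = w mod M)*(of_bool (v mod M = u mod M) *
   (\<Prod>q\<in>P. of_bool (vv v mod q ~= 0) * of_bool (vv v mod q <= vv u mod q)*(of_bool (vv w mod q = vv v mod q) - of_bool (vv w mod q = vv v mod q - 1))))" .
 qed
 also have "\<dots> = of_bool (u mod M = w mod M)*(\<Prod>q\<in>P. \<Sum>r<q. of_bool (r ~= 0) * of_bool (r <= vv u mod q)*(of_bool (vv w mod q = r) - of_bool (vv w mod q = r - 1)))"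
  unfolding sum_distrib_left[symmetric] by (subst crt_sum) (rule refl)
 also have "\<dots> = of_bool (u mod M = w mod M)*(\<Prod>q\<in>P. of_bool (vv w mod q = vv u mod q))"
 proof (intro arg_cong2[of _ _ _ _ "(*)"] prod.cong refl)
  fix q assume q: "q \<in> P"
  define a where "a = vv u mod q"
  define c where "c = vv w mod q"
  have ac: "a < q" "c < q" "c ~= 0" using posP[OF q] assms(2) q by (auto simp: a_def c_def csup_def dvd_eq_mod_eq_0)
  have "(\<Sum>r<q. of_bool (r ~= 0) * of_bool (r <= a)*(of_bool (c = r) - of_bool (c = r - 1)))
   = (\<Sum>r<q. of_bool (r = c) * of_bool (c <= a)) - (\<Sum>r<q. of_bool (r = c + 1)*(of_bool (c + 1 <= a) :: int))"
   unfolding sum_subtractf[symmetric] by (rule sum_cong) (use ac in auto)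
  also have "(\<Sum>r<q. of_bool (r = c) * of_bool (c <= a)) = (of_bool (c <= a) :: int)"
   by (rule sum_of_bool_eq) (use ac in simp)
  also have "(\<Sum>r<q. of_bool (r = c + 1)*(of_bool (c + 1 <= a) :: int)) = of_bool (c + 1 <= a)"
  using ac by auto
  finally show "(\<Sum>r<q. of_bool (r ~= 0) * of_bool (r <= vv u mod q)*(of_bool (vv w mod q = r) - of_bool (vv w mod q = r - 1)))
   = (of_bool (vv w mod q = vv u mod q) :: int)" unfolding a_def c_def by auto
 qed
 also have "\<dots> = of_bool (u = w)"
 proof (cases "u = w")
  case False
  hence "w mod M ~= u mod M \<or> (\<exists>q\<in>P. vv w mod q ~= vv u mod q)" using vv_inj[of w u] assms by (auto simp: csup_def)
  thus ?thesis by simp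
 qed (auto intro!: prod.neutral)
 finally show ?thesis .
qed

lemma dif_row: "(\<Sum>k<m. \<bar>dif l k\<bar>) <= 2^card P"
proof -
 have "(\<Sum>k<m. \<bar>dif l k\<bar>) = (\<Sum>k<m. of_bool (k mod M = l mod M)*(\<Prod>q\<in>P. \<bar>of_bool (vv k mod q = vv l mod q) - of_bool (vv k mod q = vv l mod q - 1)\<bar> :: int))"
  by (simp only: dif_def abs_mult abs_prod abs_bool_eq)
 also have "\<dots> = (\<Prod>q\<in>P. \<Sum>r<q. \<bar>of_bool (r = vv l mod q) - of_bool (r = vv l mod q - 1)\<bar> :: int)" by (rule crt_sum)
 also have "\<dots> <= (\<Prod>q\<in>P. 2)"
 proof (rule prod_mono, intro conjI)
  fix q assume q: "q \<in> P"
  from posP[OF q] have *: "vv l mod q < q" "vv l mod q - 1 < q" by (auto intro: less_imp_diff_less)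
  have "(\<Sum>r<q. \<bar>of_bool (r = vv l mod q) - of_bool (r = vv l mod q - 1)\<bar> :: int) <= (\<Sum>r<q. of_bool (r = vv l mod q)*1 + of_bool (r = vv l mod q - 1)*1)"
   by (rule sum_mono) auto
  also have "\<dots> = 2" using*by (simp only: sum.distrib sum_of_bool_eq)
  finally show "(\<Sum>r<q. \<bar>of_bool (r = vv l mod q) - of_bool (r = vv l mod q - 1)\<bar> :: int) <= 2" .
 qed (auto intro: sum_nonneg)
 finally show ?thesis by simp
qed

lemma dif_col: "(\<Sum>l\<in>csup m. \<bar>dif l k\<bar>) <= 2^card P"
proof -
 have "(\<Sum>l\<in>csup m. \<bar>dif l k\<bar>) <= (\<Sum>l<m. of_bool (l mod M = k mod M)*(\<Prod>q\<in>P. of_bool (vv l mod q = vv k mod q) + of_bool (vv l mod q = vv k mod q + 1) :: int))"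
 proof (rule order_trans[OF _ sum_mono2])
  show "(\<Sum>l\<in>csup m. \<bar>dif l k\<bar>) <= (\<Sum>l\<in>csup m. of_bool (l mod M = k mod M)*(\<Prod>q\<in>P. of_bool (vv l mod q = vv k mod q) + of_bool (vv l mod q = vv k mod q + 1) :: int))"
  proof (rule sum_mono)
   fix l assume l: "l \<in> csup m"
   have "(\<Prod>q\<in>P. \<bar>of_bool (vv k mod q = vv l mod q) - of_bool (vv k mod q = vv l mod q - 1)\<bar> :: int)
    <= (\<Prod>q\<in>P. of_bool (vv l mod q = vv k mod q) + of_bool (vv l mod q = vv k mod q + 1) :: int)"
   proof (rule prod_mono, intro conjI)
    fix q assume q: "q \<in> P"
    hence "vv l mod q ~= 0" using l by (auto simp: csup_def dvd_eq_mod_eq_0)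
    thus "\<bar>of_bool (vv k mod q = vv l mod q) - of_bool (vv k mod q = vv l mod q - 1)\<bar>
     <= (of_bool (vv l mod q = vv k mod q) + of_bool (vv l mod q = vv k mod q + 1) :: int)" by auto
   qed simp
   thus "\<bar>dif l k\<bar> <= of_bool (l mod M = k mod M)*(\<Prod>q\<in>P. of_bool (vv l mod q = vv k mod q) + of_bool (vv l mod q = vv k mod q + 1) :: int)"
    by (auto simp: dif_def abs_prod)
  qed
 qed (auto simp: csup_def intro!: prod_nonneg)
 also have "\<dots> = (\<Prod>q\<in>P. \<Sum>r<q. of_bool (r = vv k mod q) + of_bool (r = vv k mod q + 1) :: int)" by (rule crt_sum)
 also have "\<dots> <= (\<Prod>q\<in>P. 2)"
 proof (rule prod_mono, intro conjI)
  fix q assume q: "q \<in> P"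
  have 1: "(\<Sum>r<q. of_bool (r = a) :: int) <= 1" for a
   by (cases "a < q") auto
  show "(\<Sum>r<q. of_bool (r = vv k mod q) + of_bool (r = vv k mod q + 1) :: int) <= 2"
   using 1[of "vv k mod q"] 1[of "vv k mod q + 1"] by (simp only: sum.distrib)
 qed (auto intro: sum_nonneg)
 finally show ?thesis by simp
qed

text \<open>A vector of small dual form may have long coordinates of its own, as the Gram matrix of
  the product basis has the eigenvalue \<open>R\<close>. Its differences do not suffer from this,
  and the bound on the sum of their squares is what the enumeration of short vectors is based
  on.\<close>

lemma digits_exist:
 fixes y :: "nat => int"
 shows "\<exists>d :: nat => int. (\<forall>i<N. y i = (\<Sum>j<N. cykap m (e i) (e j)*d j)) &
   of_int (\<Sum>j<N. (d j)\<^sup>2) <= (2^card P)\<^sup>2*(\<Sum>i<N. \<Sum>j<N. cyA m (e i) (e j) * of_int (y i) * of_int (y j))"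
proof (intro exI conjI allI impI)
 let ?d = "%j. \<Sum>i<N. dif (e j) (e i)*y i"
 fix i assume i: "i < N"
 have "(\<Sum>j<N. cykap m (e i) (e j)*?d j) = (\<Sum>k<N. (\<Sum>j<N. cykap m (e i) (e j)*dif (e j) (e k))*y k)"
  by (simp only: sum_distrib_left sum_distrib_right mult.assoc) (rule sum.swap)
 also have "\<dots> = (\<Sum>k<N. of_bool (k = i)*y k)"
 proof (rule sum_cong)
  fix k assume k: "k \<in> {..<N}"
  have "(\<Sum>j<N. cykap m (e i) (e j)*dif (e j) (e k)) = (\<Sum>v\<in>csup m. cykap m (e i) v * dif v (e k))" by (rule sum_e)
  also have "\<dots> = of_bool (e i = e k)" using i k by (intro kap_dif e_S) auto
  also have "\<dots> = of_bool (k = i)" using e_inj[of i k] i k by auto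
  finally show "(\<Sum>j<N. cykap m (e i) (e j)*dif (e j) (e k))*y k = of_bool (k = i)*y k" by simp
 qed
 also have "\<dots> = y i" by (rule sum_of_bool_eq[OF i])
 finally show "y i = (\<Sum>j<N. cykap m (e i) (e j)*?d j)" ..
next
 let ?d = "%j. \<Sum>i<N. dif (e j) (e i)*y i"
 define T where "T = (2^card P :: real)"
 have T: "0 <= T" by (simp add: T_def)
 define w where "w l = (\<Sum>i<N. of_int (y i)*cyA m (e i) l)" for l
 have D: "of_int (?d j) = (\<Sum>l<m. of_int (dif (e j) l)*w l)" if j: "j < N" for j
 proof -
  have "(\<Sum>l<m. of_int (dif (e j) l)*w l) = (\<Sum>i<N. of_int (y i)*(\<Sum>l<m. of_int (dif (e j) l)*cyA m l (e i)))"
   by (simp only: w_def sum_distrib_left A_sym[of "e _"]) (subst sum.swap, simp only: mult_ac)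
  also have "\<dots> = (\<Sum>i<N. of_int (y i) * of_int (dif (e j) (e i)))"
  proof (intro sum_cong arg_cong2[of _ _ _ _ "(*)"] refl)
   fix i
   define k where "k = e i"
   have "(\<Sum>l<m. of_int (dif (e j) l)*cyA m l k) = (\<Sum>l<m. \<Sum>i<N. of_int (dif (e j) (e i))*(of_int (b (e i) l)*cyA m l k))"
    by (subst V_expand[OF dif_V[OF e_S[OF j]]]) (simp only: sum_distrib_right mult.assoc)
   also have "\<dots> = (\<Sum>i<N. of_int (dif (e j) (e i))*(\<Sum>l<m. of_int (b (e i) l)*cyA m l k))"
    by (subst sum.swap) (simp only: sum_distrib_left)
   also have "\<dots> = of_int (dif (e j) k)" unfolding A_reproduce by (rule V_expand[OF dif_V[OF e_S[OF j]], symmetric])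
   finally show "(\<Sum>l<m. of_int (dif (e j) l)*cyA m l (e i)) = of_int (dif (e j) (e i))" unfolding k_def .
  qed
  finally show ?thesis by (simp add: mult.commute)
 qed
 have D2: "(of_int (?d j))\<^sup>2 <= T*(\<Sum>l<m. \<bar>of_int (dif (e j) l)\<bar>*(w l)\<^sup>2)" if j: "j < N" for j
 proof -
  let ?D = "%l. \<bar>of_int (dif (e j) l)\<bar> :: real"
  have "\<bar>\<Sum>l<m. of_int (dif (e j) l)*w l\<bar> <= (\<Sum>l<m. sqrt (?D l)*(sqrt (?D l)*\<bar>w l\<bar>))"
   by (rule order_trans[OF sum_abs]) (simp add: abs_mult flip: mult.assoc)
  hence "(\<Sum>l<m. of_int (dif (e j) l)*w l)\<^sup>2 <= (\<Sum>l<m. sqrt (?D l)*(sqrt (?D l)*\<bar>w l\<bar>))\<^sup>2"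
   using power_mono[of "\<bar>\<Sum>l<m. of_int (dif (e j) l)*w l\<bar>" _ 2] by simp
  also have "\<dots> <= (\<Sum>l<m. (sqrt (?D l))\<^sup>2)*(\<Sum>l<m. (sqrt (?D l)*\<bar>w l\<bar>)\<^sup>2)" by (rule Cauchy_Schwarz_ineq_sum)
  also have "\<dots> = (\<Sum>l<m. ?D l)*(\<Sum>l<m. ?D l*(w l)\<^sup>2)" by (simp add: power_mult_distrib)
  also have "\<dots> <= T*(\<Sum>l<m. ?D l*(w l)\<^sup>2)"
  proof (rule mult_right_mono)
   have "of_int (\<Sum>l<m. \<bar>dif (e j) l\<bar>) <= (of_int (2^card P) :: real)" using dif_row by (simp only: of_int_le_iff)
   thus "(\<Sum>l<m. ?D l) <= T" by (simp add: T_def)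
  qed (auto intro: sum_nonneg)
  finally show ?thesis unfolding D[OF j] .
 qed
 have "of_int (\<Sum>j<N. (?d j)\<^sup>2) = (\<Sum>j<N. (of_int (?d j) :: real)\<^sup>2)" by simp
 also have "\<dots> <= (\<Sum>j<N. T*(\<Sum>l<m. \<bar>of_int (dif (e j) l)\<bar>*(w l)\<^sup>2))" by (rule sum_mono) (use D2 in auto)
 also have "\<dots> = T*(\<Sum>l<m. (\<Sum>j<N. \<bar>of_int (dif (e j) l)\<bar>)*(w l)\<^sup>2)"
  by (simp only: sum_distrib_left[symmetric] sum_distrib_right) (subst sum.swap, rule refl)
 also have "\<dots> <= T*(\<Sum>l<m. T*(w l)\<^sup>2)"
 proof (intro mult_left_mono sum_mono mult_right_mono)
  fix l
  have "of_int (\<Sum>l'\<in>csup m. \<bar>dif l' l\<bar>) <= (of_int (2^card P) :: real)" using dif_col by (simp only: of_int_le_iff)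
  hence "(\<Sum>l'\<in>csup m. \<bar>of_int (dif l' l)\<bar>) <= T" by (simp add: T_def)
  thus "(\<Sum>j<N. \<bar>of_int (dif (e j) l)\<bar>) <= T" unfolding sum_e[of "%l'. \<bar>of_int (dif l' l)\<bar>"] .
 qed (use T in auto)
 also have "\<dots> = T\<^sup>2*(\<Sum>l<m. (w l)\<^sup>2)" by (simp only: sum_distrib_left[symmetric] power2_eq_square)
 also have "(\<Sum>l<m. (w l)\<^sup>2) = (\<Sum>i<N. \<Sum>j<N. cyA m (e i) (e j) * of_int (y i) * of_int (y j))" unfolding A_square w_def ..
 finally show "of_int (\<Sum>j<N. (?d j)\<^sup>2) <= (2^card P)\<^sup>2*(\<Sum>i<N. \<Sum>j<N. cyA m (e i) (e j) * of_int (y i) * of_int (y j))"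
  by (simp add: T_def)
qed

end

section \<open>The ring generated by a root of unity, and the Frobenius congruence\<close>

inductive_set zring :: "complex => complex set" for z where
 zring_0: "0 \<in> zring z"
| zring_plus: "w \<in> zring z ==> w + z^k \<in> zring z"
| zring_minus: "w \<in> zring z ==> w - z^k \<in> zring z"

lemma zring_add: "u \<in> zring z ==> w \<in> zring z ==> w + u \<in> zring z"
proof (induction rule: zring.induct)
 case (zring_plus u k)
 hence "(w + u) + z^k \<in> zring z" by (intro zring.zring_plus) auto
 thus ?case by (simp only: add.assoc)
next
 case (zring_minus u k)
 hence "(w + u) - z^k \<in> zring z" by (intro zring.zring_minus) auto
 thus ?case by (simp only: add_diff_eq)
qed simp

lemma zring_uminus: "u \<in> zring z ==> - u \<in> zring z"
proof (induction rule: zring.induct)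
 case (zring_plus u k)
 hence "- u - z^k \<in> zring z" by (intro zring.zring_minus)
 thus ?case by simp
next
 case (zring_minus u k)
 hence "- u + z^k \<in> zring z" by (intro zring.zring_plus)
 thus ?case by simp
qed (simp add: zring_0)

lemma zring_diff: "w \<in> zring z ==> u \<in> zring z ==> w - u \<in> zring z"
 using zring_add[OF zring_uminus, of u z w] by simp

lemma zring_mult_power: "u \<in> zring z ==> u*z^j \<in> zring z"
proof (induction rule: zring.induct)
 case (zring_plus u k)
 from zring.zring_plus[OF zring_plus.IH, of "k + j"] show ?case by (simp add: power_add algebra_simps)
next
 case (zring_minus u k)
 from zring.zring_minus[OF zring_minus.IH, of "k + j"] show ?case by (simp add: power_add algebra_simps)
qed (simp add: zring_0)

lemma zring_mult: "u \<in> zring z ==> w \<in> zring z ==> w*u \<in> zring z"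
proof (induction rule: zring.induct)
 case (zring_plus u k)
 thus ?case by (simp add: distrib_left zring_add zring_mult_power)
next
 case (zring_minus u k)
 thus ?case by (simp add: right_diff_distrib zring_diff zring_mult_power)
qed (simp add: zring_0)

lemma zring_power_z: "z^k \<in> zring z"
 using zring_plus[OF zring_0] by simp

lemma zring_one: "1 \<in> zring z"
 using zring_power_z[of z 0] by simp

lemma zring_power: "u \<in> zring z ==> u^n \<in> zring z"
 by (induction n) (auto simp: zring_one zring_mult)

lemma zring_of_nat: "of_nat n \<in> zring z"
 by (induction n) (auto simp: zring_0 zring_one zring_add)

lemma zring_sum: "(!!i. i \<in> A ==> f i \<in> zring z) ==> sum f A \<in> zring z"
 by (induction A rule: infinite_finite_induct) (auto simp: zring_0 zring_add)

lemma zring_subset: "u \<in> zring (z^a) ==> u \<in> zring z"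
 by (induction rule: zring.induct) (auto simp: zring_0 zring_add zring_diff zring_power_z simp flip: power_mult)

lemma frobenius_sum:
 assumes q: "prime q" and u: "u \<in> zring z" and w: "w \<in> zring z"
 shows "\<exists>x\<in>zring z. (u + w)^q = u^q + w^q + of_nat q*x"
proof -
 have q0: "0 < q" using q prime_gt_0_nat by blast
 have "\<exists>c. k \<in> {0<..<q} --> q choose k = q*c" for k
 proof (cases "k \<in> {0<..<q}")
  case True
  hence "q dvd q choose k" using q by (intro dvd_choose_prime) auto
  thus ?thesis by blast
 next
  case False
  thus ?thesis by blast
 qed
 then obtain c where c: "!!k. k \<in> {0<..<q} ==> q choose k = q*c k" by metis
 define x where "x = (\<Sum>k\<in>{0<..<q}. of_nat (c k)*(u^k*w^(q - k)))"
 have "(u + w)^q = (\<Sum>k\<le>q. of_nat (q choose k)*u^k*w^(q - k))" by (rule binomial_ring)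
 also have "{..q} = insert 0 (insert q {0<..<q})" by auto
 also have "(\<Sum>k\<in>\<dots>. of_nat (q choose k)*u^k*w^(q - k)) = w^q + (u^q + (\<Sum>k\<in>{0<..<q}. of_nat (q choose k)*u^k*w^(q - k)))"
  using q0 by simp
 also have "(\<Sum>k\<in>{0<..<q}. of_nat (q choose k)*u^k*w^(q - k)) = of_nat q*x"
  unfolding x_def sum_distrib_left by (rule sum_cong) (simp add: c)
 finally have "(u + w)^q = u^q + w^q + of_nat q*x" by simp
 moreover have "x \<in> zring z" unfolding x_def by (intro zring_sum zring_mult zring_of_nat zring_power u w)
 ultimately show ?thesis by blast
qed

text \<open>Values of one and the same integral polynomial at the two points \<open>z\<close> and
  \<open>z'\<close>. Building them in parallel allows an induction that adds one monomial at a
  time.\<close>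

inductive_set zpair :: "complex => complex => (complex \<times> complex) set" for z z' where
 zpair_0: "(0, 0) \<in> zpair z z'"
| zpair_plus: "(w, w') \<in> zpair z z' ==> (w + z^k, w' + z'^k) \<in> zpair z z'"
| zpair_minus: "(w, w') \<in> zpair z z' ==> (w - z^k, w' - z'^k) \<in> zpair z z'"

lemma zpair_zring: "(w, w') \<in> zpair z z' ==> w \<in> zring z"
 by (induction rule: zpair.induct) (auto intro: zring.intros)

text \<open>For an integral polynomial \<open>g\<close> the numbers \<open>g(z)^q\<close> and
  \<open>g(z^q)\<close> agree modulo \<open>q\<close>, because the inner binomial coefficients are
  divisible by \<open>q\<close>. The sign of a monomial \<open>- z^k\<close> survives since
  \<open>q\<close> is odd.\<close>

lemma zpair_frobenius:
 assumes "(w, w') \<in> zpair z (z^q)" and q: "prime q" "2 < q"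
 shows "\<exists>x\<in>zring z. w^q = w' + of_nat q*x"
 using assms(1)
proof (induction rule: zpair.induct)
 case zpair_0
 thus ?case using q zring_0 by (intro bexI[of _ 0]) auto
next
 case (zpair_plus w w' k)
 then obtain x where x: "x \<in> zring z" "w^q = w' + of_nat q*x" by blast
 obtain y where y: "y \<in> zring z" "(w + z^k)^q = w^q + (z^k)^q + of_nat q*y"
  using frobenius_sum[OF q(1) zpair_zring[OF zpair_plus(1)] zring_power_z] by blast
 hence "(w + z^k)^q = (w' + (z^q)^k) + of_nat q*(x + y)"
  unfolding x(2) by (simp add: algebra_simps flip: power_mult)
 thus ?case using x y zring_add by blast
next
 case (zpair_minus w w' k)
 then obtain x where x: "x \<in> zring z" "w^q = w' + of_nat q*x" by blast
 obtain y where y: "y \<in> zring z" "(w + - (z^k))^q = w^q + (- (z^k))^q + of_nat q*y"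
  using frobenius_sum[OF q(1) zpair_zring[OF zpair_minus(1)] zring_uminus[OF zring_power_z]] by blast
 have "odd q" using q prime_odd_nat by blast
 hence "(w - z^k)^q = (w' - (z^q)^k) + of_nat q*(x + y)"
  using y(2) unfolding x(2) by (simp add: algebra_simps flip: power_mult)
 thus ?case using x y zring_add by blast
qed

lemma zpair_add_int:
 assumes "(w, w') \<in> zpair z z'"
 shows "(w + of_int c*z^k, w' + of_int c*z'^k) \<in> zpair z z'"
proof (induction c rule: int_induct[where k = 0])
 case (step1 i)
 from zpair_plus[OF step1(2), of k] show ?case by (simp add: algebra_simps)
next
 case (step2 i)
 from zpair_minus[OF step2(2), of k] show ?case by (simp add: algebra_simps)
qed (simp add: assms)

lemma zpair_sum: "((\<Sum>k<n. of_int (f k)*z^k), (\<Sum>k<n. of_int (f k)*z'^k)) \<in> zpair z z'"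
 by (induction n) (auto simp: zpair_0 zpair_add_int)

text \<open>A rational linear functional on \<open>\<complex>\<close> with value \<open>1\<close> at \<open>\<theta>\<close> has bounded denominators on
 \<open>\<int>[z]\<close>.\<close>

lemma zring_divisors_bounded:
 assumes z: "z^m = 1" "0 < m" and \<theta>: "\<theta> ~= 0"
 shows "\<exists>D>0. \<forall>q w. w \<in> zring z --> \<theta> = of_nat q*w --> q <= (D :: nat)"
proof -
 let ?s = "%(a :: rat) (x :: complex). of_rat a*x"
 interpret vector_space_pair ?s "%(a :: rat) b. a*b"
  by unfold_locales (auto simp: algebra_simps of_rat_add of_rat_mult)
 have "vs1.independent {\<theta>}" using \<theta> by simp
 from linear_independent_extend[OF this, of "%_. 1"] obtain g where
  g: "Vector_Spaces.linear ?s (*) g" "g \<theta> = 1" by blast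
 interpret g: Vector_Spaces.linear ?s "(*)" g by (rule g)
 define D where "D = (\<Prod>k<m. nat (snd (quotient_of (g (z^k)))))"
 have pos: "0 < nat (snd (quotient_of x))" for x using quotient_of_denom_pos'[of x] by simp
 have D: "0 < D" unfolding D_def by (intro prod_pos) (use pos in auto)
 have den: "of_nat (nat (snd (quotient_of x)))*x \<in> \<int>" for x :: rat
 proof -
  obtain a b where ab: "quotient_of x = (a, b)" by fastforce
  from quotient_of_denom_pos[OF ab] quotient_of_div[OF ab] have "of_nat (nat b)*x = of_int a" by simp
  thus ?thesis using ab by simp
 qed
 have zk: "of_nat D*g (z^k) \<in> \<int>" for k
 proof -
  have "z^k = z^(k mod m)"
   by (metis z(1) div_mult_mod_eq power_add power_mult power_one mult.commute mult_1)
  moreover have "nat (snd (quotient_of (g (z^(k mod m))))) dvd D"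
   unfolding D_def using z(2) by auto
  then obtain d where "D = nat (snd (quotient_of (g (z^(k mod m)))))*d" by blast
  hence "of_nat D*g (z^(k mod m)) = of_nat d*(of_nat (nat (snd (quotient_of (g (z^(k mod m))))))*g (z^(k mod m)))"
   by simp
  hence "of_nat D*g (z^(k mod m)) \<in> \<int>" using den[of "g (z^(k mod m))"] by (simp only: Ints_mult Ints_of_nat)
  ultimately show ?thesis by simp
 qed
 have w: "of_nat D*g w \<in> \<int>" if "w \<in> zring z" for w
  using that
 proof (induction rule: zring.induct)
  case zring_0
  show ?case by simp
 next
  case (zring_plus w k)
  thus ?case using zk[of k] by (simp only: g.add distrib_left Ints_add)
 next
  case (zring_minus w k)
  thus ?case using zk[of k] by (simp only: g.diff right_diff_distrib Ints_diff)
 qed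
 have "q <= D" if u: "u \<in> zring z" "\<theta> = of_nat q*u" for q u
 proof -
  have "g \<theta> = of_nat q*g u" using g.scale[of "of_nat q" u] u(2) by simp
  hence "of_nat D = of_nat q*(of_nat D*g u)" using g(2) by simp
  then obtain c where "of_nat D = (of_nat q * of_int c :: rat)" using w[OF u(1)] by (metis Ints_cases)
  hence "of_int (int D) = (of_int (int q*c) :: rat)" by simp
  hence "int D = int q*c" by (simp only: of_int_eq_iff)
  hence "int q dvd int D" by simp
  hence "q dvd D" by simp
  thus ?thesis using D by auto
 qed
 thus ?thesis using D by blast
qed

text \<open>Let \<open>p\<close> be a prime up to \<open>K\<close>. If it divides \<open>a\<close>,
  it divides neither \<open>m\<close> nor the added product; otherwise it divides the added term but
  not \<open>a\<close>. So \<open>a'\<close> has large prime factors only, and multiplication by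
  \<open>a\<close> modulo \<open>m\<close> becomes a chain of multiplications by large
  primes.\<close>

lemma exists_large_prime_representative:
 assumes "coprime a (m :: nat)" "0 < m"
 shows "\<exists>a'>0. [a' = a] (mod m) & (\<forall>p. prime p --> p dvd a' --> K < p)"
proof -
 define A where "A = {p. prime p & p <= K & \<not> p dvd a}"
 have A: "finite A" unfolding A_def by simp
 define a' where "a' = a + m*\<Prod>A"
 have pos: "0 < \<Prod>A" by (rule prod_pos) (auto simp: A_def prime_gt_0_nat)
 have "K < p" if p: "prime p" "p dvd a'" for p
 proof (rule ccontr)
  assume K: "\<not> K < p"
  show False
  proof (cases "p dvd a")
   case True
   hence "p dvd m*\<Prod>A" using p(2) unfolding a'_def by (metis dvd_add_right_iff)
   moreover have "\<not> p dvd m" using True assms(1) p(1) by (metis coprime_common_divisor not_prime_unit)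
   ultimately have "p dvd \<Prod>A" using p(1) by (simp add: prime_dvd_mult_iff)
   then obtain r where "r \<in> A" "p dvd r" using p(1) A by (auto simp: prime_dvd_prod_iff)
   thus False using True p(1) primes_dvd_imp_eq[of p r] by (auto simp: A_def)
  next
   case False
   hence "p \<in> A" using p K by (simp add: A_def)
   hence "p dvd m*\<Prod>A" using A by (intro dvd_mult dvd_prodI)
   thus False using False p(2) unfolding a'_def by (metis dvd_add_left_iff)
  qed
 qed
 moreover have "[a' = a] (mod m)" by (simp add: a'_def cong_def)
 moreover have "0 < a'" using assms pos by (simp add: a'_def)
 ultimately show ?thesis by blast
qed

section \<open>Fourier analysis modulo m and nonsingularity of the Hankel matrices\<close>

context cyclo
begin

definition zeta :: complex where "zeta = exp (2 * of_real pi*\<i> * of_nat 1 / of_nat m)"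

definition Ft :: "(nat => int) => nat => complex" where
 "Ft f a = (\<Sum>k<m. of_int (f k)*(zeta^a)^k)"

lemma zeta_pow: "zeta^j = exp (2 * of_real pi*\<i> * of_nat j / of_nat m)"
 unfolding zeta_def exp_of_nat_mult[symmetric] by (simp add: mult_ac)

lemma zeta_m: "zeta^m = 1" unfolding zeta_pow using m by simp

lemma zeta_1: "zeta^j = 1 \<longleftrightarrow> m dvd j" unfolding zeta_pow using complex_root_unity_eq_1[of m j] m by simp

lemma zeta_nz: "zeta ~= 0" by (simp add: zeta_def)

lemma zeta_mod: "zeta^(j mod m) = zeta^j"
 by (metis zeta_m div_mult_mod_eq power_add power_mult power_one mult.commute mult_1)

lemma Ft_mod: "Ft f (a mod m) = Ft f a" unfolding Ft_def zeta_mod ..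

lemma Ft_cong: "[a = c] (mod m) ==> Ft f a = Ft f c" by (metis Ft_mod cong_def)

text \<open>If the value at \<open>a\<close> is zero, Frobenius makes the value at
  \<open>a * q\<close> divisible by \<open>q\<close> in \<open>zring zeta\<close>. A nonzero value
  has only bounded divisors of this kind, and there are finitely many values because
  \<open>a\<close> matters modulo \<open>m\<close>; so one bound \<open>K\<close> works for
  all.\<close>

lemma Ft_prime_step: "\<exists>K. \<forall>q a. prime q --> K < q --> Ft f a = 0 --> Ft f (a*q) = 0"
proof -
 have "\<exists>D. Ft f b ~= 0 --> (\<forall>q w. w \<in> zring zeta --> Ft f b = of_nat q*w --> q <= (D :: nat))" for b
  using zring_divisors_bounded[OF zeta_m, of "Ft f b"] m by auto
 then obtain D where D: "!!b q w. Ft f b ~= 0 ==> w \<in> zring zeta ==> Ft f b = of_nat q*w ==> q <= (D b :: nat)" by metis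
 define K where "K = 2 + (\<Sum>b<m. D b)"
 have "Ft f (a*q) = 0" if q: "prime q" "K < q" and a: "Ft f a = 0" for q a
 proof (rule ccontr)
  assume nz: "Ft f (a*q) ~= 0"
  define b where "b = (a*q) mod m"
  have b: "Ft f b = Ft f (a*q)" "b < m" using m by (auto simp: b_def Ft_mod)
  have "(Ft f a, Ft f (a*q)) \<in> zpair (zeta^a) ((zeta^a)^q)"
   using zpair_sum[of f "zeta^a" m "(zeta^a)^q"] by (simp add: Ft_def power_mult)
  from zpair_frobenius[OF this q(1)] q(2) obtain x where x: "x \<in> zring (zeta^a)" "Ft f a^q = Ft f (a*q) + of_nat q*x"
   by (auto simp: K_def)
  have "0 < q" using q(1) prime_gt_0_nat by blast
  hence "Ft f b = of_nat q*(- x)" using x(2) a b by (simp add: eq_neg_iff_add_eq_0 zero_power)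
  moreover have "- x \<in> zring zeta" using x(1) zring_subset zring_uminus by blast
  ultimately have "q <= D b" using D nz b by metis
  also have "D b <= (\<Sum>b<m. D b)" using b(2) by (intro member_le_sum) auto
  finally show False using q(2) by (simp add: K_def)
 qed
 thus ?thesis by blast
qed

text \<open>This is the irreducibility of the cyclotomic polynomial: vanishing at one primitive root
  passes to all its conjugates. The class of \<open>c / a\<close> modulo \<open>m\<close> is
  represented by a product of primes above \<open>K\<close>, which are applied one after the
  other.\<close>

theorem Ft_irreducible:
 assumes a: "coprime a m" and c: "coprime c m" and 0: "Ft f a = 0"
 shows "Ft f c = 0"
proof -
 obtain K where K: "!!q a. prime q ==> K < q ==> Ft f a = 0 ==> Ft f (a*q) = 0" using Ft_prime_step[of f] by blast
 have step: "Ft f (a*d) = 0" if "0 < d" "!!p. prime p ==> p dvd d ==> K < p" for d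
  using that
 proof (induction d rule: less_induct)
  case (less d)
  show ?case
  proof (cases "d = 1")
   case False
   then obtain p where p: "prime p" "p dvd d" using prime_factor_nat by blast
   then obtain d' where d': "d = p*d'" by blast
   have "Ft f (a*d') = 0"
    by (rule less(1)) (use less(2,3) d' p prime_gt_1_nat[of p] in auto)
   hence "Ft f (a*d'*p) = 0" using K[OF p(1) less(3)[OF p]] by blast
   thus ?thesis by (simp add: d' mult_ac)
  qed (use 0 in simp)
 qed
 obtain x where x: "[a*x = 1] (mod m)" using cong_solve_coprime_nat[OF a] by auto
 hence "coprime x m" by (metis cong_imp_coprime coprime_1_left coprime_mult_left_iff cong_sym)
 hence "coprime (x*c) m" using c by simp
 moreover have "0 < m" using m by simp
 ultimately obtain d where
  d: "0 < d" "[d = x*c] (mod m)" "!!p. prime p ==> p dvd d ==> K < p"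
  using exists_large_prime_representative[of "x*c" m K] by blast
 have "[a*d = a*(x*c)] (mod m)" using d(2) by (rule cong_scalar_left)
 also have "[a*(x*c) = 1*c] (mod m)" using cong_scalar_right[OF x, of c] by (simp add: mult.assoc)
 finally have "[a*d = c] (mod m)" by simp
 from Ft_cong[OF this] step[OF d(1,3)] show ?thesis by metis
qed

lemma Ft_inversion:
 assumes k: "k < m"
 shows "(\<Sum>a<m. Ft f a*inverse zeta^(a*k)) = of_nat m * of_int (f k)"
proof -
 have "(\<Sum>a<m. Ft f a*inverse zeta^(a*k)) = (\<Sum>l<m. of_int (f l)*(\<Sum>a<m. (zeta^l*inverse zeta^k)^a))"
  unfolding Ft_def sum_distrib_left sum_distrib_right
  by (subst sum.swap) (simp add: power_mult_distrib mult_ac flip: power_mult)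
 also have "\<dots> = (\<Sum>l<m. of_int (f l)*(if l = k then of_nat m else 0))"
 proof (intro sum_cong arg_cong2[of _ _ _ _ "(*)"] refl)
  fix l assume l: "l \<in> {..<m}"
  show "(\<Sum>a<m. (zeta^l*inverse zeta^k)^a) = (if l = k then of_nat m else 0)"
  proof (cases "l = k")
   case True
   hence "zeta^l*inverse zeta^k = 1" using zeta_nz by (simp add: power_inverse)
   thus ?thesis using True by simp
  next
   case False
   have "zeta^l ~= zeta^k" using complex_root_unity_eq[of m l k] l k False by (simp add: zeta_pow)
   hence ne: "zeta^l*inverse zeta^k ~= 1" by (simp add: field_simps)
   have "(zeta^l*inverse zeta^k)^m = (zeta^m)^l*inverse (zeta^m)^k"
    by (simp add: power_mult_distrib power_inverse mult.commute flip: power_mult)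
   hence "(zeta^l*inverse zeta^k)^m = 1" by (simp add: zeta_m)
   thus ?thesis using False geometric_sum[OF ne, of m] by simp
  qed
 qed
 also have "\<dots> = of_nat m * of_int (f k)" using k by (simp add: if_distrib cong: if_cong)
 finally show ?thesis .
qed

text \<open>If \<open>q\<close> divides \<open>a\<close> and \<open>m\<close>, the character is
  constant along steps \<open>m div q\<close>, so summing along these steps first gives zero.
  Functions in \<open>V\<close> have transforms supported on the primitive characters.\<close>

lemma Ft_V_noncoprime:
 assumes f: "f \<in> V" and a: "\<not> coprime a m"
 shows "Ft f a = 0"
proof -
 obtain q where q: "prime q" "q dvd a" "q dvd m"
  using a prime_factor_nat[of "gcd a m"] by (metis coprime_iff_gcd_eq_1 gcd_greatest_iff)
 hence qP: "q \<in> P" using m by (auto simp: in_prime_factors_iff)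
 let ?c = "m div q"
 have z: "(zeta^a)^(t*?c) = 1" for t
 using q nonzero_mult_div_cancel_left less_numeral_extra(3) dvd_triv_left by (auto simp: power_mult[symmetric] zeta_1)
 let ?g = "%k. of_int (f k)*(zeta^a)^k"
 have per: "?g (k + m) = ?g k" for k
 proof -
  have "(zeta^a)^(k + m) = (zeta^a)^k*(zeta^m)^a" by (simp only: power_add power_mult[symmetric] mult.commute)
  thus ?thesis using VD(1)[OF f] by (simp add: zeta_m)
 qed
 have "of_nat q*Ft f a = (\<Sum>t<q. \<Sum>k<m. ?g (k + t*?c))"
  unfolding sum_periodic_shift[of ?g, OF per] by (simp add: Ft_def)
 also have "\<dots> = (\<Sum>k<m. (zeta^a)^k * of_int (\<Sum>t<q. f (k + t*?c)))"
  by (subst sum.swap) (simp add: power_add z sum_distrib_left mult.commute)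
 also have "\<dots> = 0" using VD(2)[OF f qP] by simp
 finally show ?thesis using q(1) by simp
qed

lemma Ft_V_nonzero:
 assumes f: "f \<in> V" and nz: "f k ~= 0" and a: "coprime a m"
 shows "Ft f a ~= 0"
proof
 assume 0: "Ft f a = 0"
 have "Ft f c = 0" for c
  using Ft_irreducible[OF a _ 0] Ft_V_noncoprime[OF f] by blast
 moreover have "k mod m < m" using m by simp
 ultimately have "of_nat m * of_int (f (k mod m)) = (0 :: complex)"
  using Ft_inversion[of "k mod m" f] by simp
 thus False using nz m V_mod[OF f, of k] by simp
qed

text \<open>A correlation transforms into the product of \<open>Y a\<close> and
  \<open>Ft f a\<close>. If \<open>f\<close> is nonzero, the second factor has no zero at a
  primitive character, so \<open>Y\<close> vanishes there. Pairing \<open>Y\<close> with the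
  transform of a basis function, which lives on primitive characters, returns
  \<open>m * y i\<close>.\<close>

lemma correlation_nonzero:
 fixes y :: "nat => int"
 assumes y: "i < N" "y i ~= 0" and f: "f \<in> V" and g: "!!k. (\<Sum>j<N. y j*f (k + e j)) = 0"
 shows "f k = 0"
proof (rule ccontr)
 assume nz: "f k ~= 0"
 define Y where "Y a = (\<Sum>j<N. of_int (y j)*inverse zeta^(a*e j))" for a
 have Y: "Y a = 0" if a: "coprime a m" for a
 proof -
  let ?g = "%k. of_int (f k)*(zeta^a)^k"
  have per: "?g (k + m) = ?g k" for k
  proof -
   have "(zeta^a)^(k + m) = (zeta^a)^k*(zeta^m)^a" by (simp only: power_add power_mult[symmetric] mult.commute)
   thus ?thesis using VD(1)[OF f] by (simp add: zeta_m)
  qed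
  have s: "of_int (f (k + c))*(zeta^a)^k = inverse zeta^(a*c)*?g (k + c)" for k c
   using zeta_nz by (simp add: power_add power_mult field_simps)
  have "0 = (\<Sum>k<m. of_int (\<Sum>j<N. y j*f (k + e j))*(zeta^a)^k)" by (simp add: g)
  also have "\<dots> = (\<Sum>j<N. of_int (y j)*(\<Sum>k<m. of_int (f (k + e j))*(zeta^a)^k))"
   unfolding of_int_sum of_int_mult sum_distrib_left sum_distrib_right
   by (subst sum.swap) (simp only: mult.assoc)
  also have "\<dots> = (\<Sum>j<N. of_int (y j)*(inverse zeta^(a*e j)*Ft f a))"
   unfolding s sum_distrib_left[symmetric] sum_periodic_shift[of ?g, OF per] Ft_def ..
  also have "\<dots> = Y a*Ft f a" by (simp add: Y_def sum_distrib_right mult.assoc)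
  finally show ?thesis using Ft_V_nonzero[OF f nz a] by simp
 qed
 let ?b = "b (e i)"
 have bV: "?b \<in> V" using b_V[OF e_S[OF y(1)], where ?'a = int] by simp
 have "of_nat m * of_int (y i) = (\<Sum>j<N. of_int (y j)*(of_nat m * of_int (?b (e j))) :: complex)"
 proof -
  have "(\<Sum>j<N. of_int (y j)*(of_nat m * of_int (?b (e j))) :: complex) = (\<Sum>j<N. of_bool (j = i)*(of_nat m * of_int (y j)))"
   by (rule sum_cong) (use y(1) e_S e_inj b_delta in auto)
  thus ?thesis unfolding sum_of_bool_eq[OF y(1), of "%j. of_nat m * of_int (y j)"] by simp
 qed
 also have "\<dots> = (\<Sum>j<N. of_int (y j)*(\<Sum>a<m. Ft ?b a*inverse zeta^(a*e j)))"
  by (rule sum_cong) (simp add: Ft_inversion e_lt)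
 also have "\<dots> = (\<Sum>a<m. Ft ?b a*Y a)"
  unfolding Y_def sum_distrib_left by (subst sum.swap) (simp only: mult_ac)
 also have "\<dots> = 0"
  by (rule sum.neutral) (use Y Ft_V_noncoprime[OF bV] in force)
 finally show False using y(2) m by simp
qed

text \<open>A rational kernel vector becomes, after clearing denominators, an integral function
  \<open>f\<close> in \<open>V\<close> whose correlation with \<open>y\<close> vanishes at the
  evaluation points. The correlation is in \<open>V\<close> too, hence vanishes everywhere, and then
  so does \<open>f\<close>. Elimination over the rationals is what makes \<open>f\<close> integral,
  as the Fourier argument demands; the rational inverse then solves the real system.\<close>

lemma hankel_nonsingular:
 fixes y :: "nat => int" and t :: "nat => real"
 assumes y: "\<exists>i<N. y i ~= 0"
 shows "\<exists>s. \<forall>i<N. (\<Sum>l<N. of_int (\<Sum>j<N. y j*b (e l) (e i + e j)) * s l) = t i"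
proof -
 define h where "h i l = (\<Sum>j<N. y j*b (e l) (e i + e j))" for i l
 define A where "A = mat N N (%(i, l). rat_of_int (h i l))"
 have A: "A \<in> carrier_mat N N" by (simp add: A_def)
 have "Determinant.det A ~= 0"
 proof
  assume "Determinant.det A = 0"
  then obtain v where v: "v \<in> carrier_vec N" "v ~= 0\<^sub>v N" "A *\<^sub>v v = 0\<^sub>v N"
   using det_0_iff_vec_prod_zero_field[OF A] by blast
  define D where "D = (\<Prod>l<N. nat (snd (quotient_of (v $ l))))"
  have pos: "0 < nat (snd (quotient_of x))" for x using quotient_of_denom_pos'[of x] by simp
  have D: "0 < D" unfolding D_def by (intro prod_pos) (use pos in auto)
  have "\<exists>s. of_nat D * v $ l = of_int s" if l: "l < N" for l
  proof -
   obtain a b where ab: "quotient_of (v $ l) = (a, b)" by fastforce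
   have 1: "of_nat (nat b) * v $ l = of_int a" using quotient_of_denom_pos[OF ab] quotient_of_div[OF ab] by simp
   have "nat b dvd D" unfolding D_def using l ab by auto
   then obtain d where "D = nat b*d" by blast
   hence "of_nat D * v $ l = of_nat d*(of_nat (nat b) * v $ l)" by simp
   hence "of_nat D * v $ l = of_int (int d*a)" unfolding 1 by simp
   thus ?thesis by blast
  qed
  then obtain s where s: "!!l. l < N ==> of_nat D * v $ l = of_int (s l)" by metis
  define f where "f k = (\<Sum>l<N. s l*b (e l) k)" for k
  have f: "f \<in> V" unfolding f_def[abs_def] by (rule V_sum) (use b_V[OF e_S, where ?'a = int] in simp)
  have g: "(%k. \<Sum>j<N. y j*f (k + e j)) \<in> V" by (rule V_sum) (rule V_shift[OF f])
  have "(\<Sum>j<N. y j*f (k + e j)) = 0" for k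
  proof (rule V_zero[OF g])
   fix k assume "k \<in> csup m"
   then obtain i where i: "i < N" "k = e i" using e_bij by (auto simp: bij_betw_def)
   have "(\<Sum>j<N. y j*f (k + e j)) = (\<Sum>l<N. h i l * s l)"
    unfolding f_def h_def i sum_distrib_left sum_distrib_right by (subst sum.swap) (simp only: mult_ac)
   moreover have "rat_of_int (\<Sum>l<N. h i l * s l) = of_nat D*(\<Sum>l<N. of_int (h i l) * v $ l)"
    unfolding sum_distrib_left of_int_sum by (rule sum_cong) (simp add: s[symmetric])
   moreover have "(\<Sum>l<N. of_int (h i l) * v $ l) = (A *\<^sub>v v) $ i"
    using i v(1) by (simp add: A_def scalar_prod_def lessThan_atLeast0)
   moreover have "(A *\<^sub>v v) $ i = 0" using v(3) i(1) by simp
   ultimately have "rat_of_int (\<Sum>j<N. y j*f (k + e j)) = 0" by simp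
   thus "(\<Sum>j<N. y j*f (k + e j)) = 0" by (simp only: of_int_eq_0_iff)
  qed
  hence f0: "f k = 0" for k using correlation_nonzero[OF _ _ f] y by blast
  have "v $ l = 0" if l: "l < N" for l
  proof -
   have "f (e l) = (\<Sum>j<N. of_bool (j = l) * s j)" unfolding f_def
    by (rule sum_cong) (use l e_S e_inj b_delta in auto)
   hence "s l = 0" using f0[of "e l"] sum_of_bool_eq[OF l, of s] by simp
   thus ?thesis using s[OF l] D by simp
  qed
  hence "v = 0\<^sub>v N" using v(1) by auto
  with v(2) show False by blast
 qed
 from det_non_zero_imp_unit[OF A this, of "()"] obtain X where X: "X \<in> carrier_mat N N" "A*X = 1\<^sub>m N"
  by (auto simp: Units_def ring_mat_def)
 have AX: "(\<Sum>l<N. of_int (h i l)*X $$ (l, k)) = of_bool (i = k)" if "i < N" "k < N" for i k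
 proof -
  have "(A*X) $$ (i, k) = (\<Sum>l<N. of_int (h i l)*X $$ (l, k))"
   using that X(1) by (simp add: A_def scalar_prod_def lessThan_atLeast0)
  moreover have "(A*X) $$ (i, k) = of_bool (i = k)" using X(2) that by simp
  ultimately show ?thesis by simp
 qed
 have "(\<Sum>l<N. of_int (h i l)*(\<Sum>k<N. of_rat (X $$ (l, k))*t k)) = t i" if i: "i < N" for i
 proof -
  have "(\<Sum>l<N. of_int (h i l)*(\<Sum>k<N. of_rat (X $$ (l, k))*t k)) = (\<Sum>k<N. of_rat (\<Sum>l<N. of_int (h i l)*X $$ (l, k))*t k)"
   unfolding sum_distrib_left sum_distrib_right of_rat_sum by (subst sum.swap) (simp add: of_rat_mult mult.assoc)
  also have "\<dots> = (\<Sum>k<N. of_bool (k = i)*t k)" by (rule sum_cong) (use i AX in auto)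
  also have "\<dots> = t i" by (rule sum_of_bool_eq[OF i])
  finally show ?thesis .
 qed
 thus ?thesis unfolding h_def by (intro exI[of _ "%l. \<Sum>k<N. of_rat (X $$ (l, k))*t k"]) blast
qed

sublocale shift_lattice "totient m" m "2^card (prime_factors m)" "celem m" "%i. cyb m (celem m i)" "%i j. cyA m (celem m i) (celem m j)"
proof
 show "0 < totient m" using m by simp
 show "0 < m" using m by simp
 show "!!i. i < N ==> e i < m" by (rule e_lt)
 show "inj_on e {..<N}" using e_bij by (simp add: bij_betw_def)
 show "!!i k. b (e i) (k + m) = b (e i) k" by (rule b_per)
 show "!!i j. i < N ==> j < N ==> b (e i) (e j) = of_bool (i = j)" using b_delta e_S e_inj by auto
 show "b (e i) (k + 1) = (\<Sum>j<N. b (e i) (e j + 1)*b (e j) k)" if "i < N" for i k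
 proof -
  have "(%k. b (e i) (k + 1)) \<in> V" using V_shift[of "b (e i)" 1] b_V[OF e_S[OF that], where ?'a = int] by simp
  thus ?thesis by (subst V_expand) simp_all
 qed
 show "!!i j. cyA m (e i) (e j) = cyA m (e j) (e i)" by (rule A_sym)
 show "!!i k. i < N ==> k < N ==> (\<Sum>j<N. cyA m (e i) (e j) * of_int (\<Sum>l<m. b (e j) l*b (e k) l)) = of_bool (i = k)"
  by (rule A_inverse)
 show "!!u. (\<Sum>i<N. \<Sum>j<N. cyA m (e i) (e j)*u i*u j) <= (\<Sum>i<N. (u i)\<^sup>2)" by (rule A_contraction)
 show "!!i. i < N ==> of_int (\<Sum>k<m. \<bar>b (e i) k\<bar>) <= (2^card P :: real)" using b_abs e_S by simp
 show "z i = 0" if c: "0 < c" "c < m" and p: "!!k. (\<Sum>i<N. z i*real_of_int (b (e i) (k + c))) = (\<Sum>i<N. z i * of_int (b (e i) k))" and i: "i < N" for c z i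
 proof -
  have V: "(%k. \<Sum>i<N. z i*real_of_int (b (e i) k)) \<in> V" by (rule V_sum) (use b_V e_S in auto)
  have "(\<Sum>j<N. z j*real_of_int (b (e j) (e i))) = 0" by (rule V_period_zero[OF V c p])
  also have "(\<Sum>j<N. z j*real_of_int (b (e j) (e i))) = (\<Sum>j<N. of_bool (j = i)*z j)"
   by (rule sum_cong) (use i e_S e_inj b_delta in auto)
  finally show ?thesis using sum_of_bool_eq[OF i, of z] by simp
 qed
 show "!!y t. \<exists>i<N. y i ~= 0 ==> \<exists>s. \<forall>i<N. (\<Sum>l<N. of_int (\<Sum>j<N. y j*b (e l) (e i + e j)) * s l) = (t i :: real)"
  by (rule hankel_nonsingular)
qed

end

section \<open>Integral encodings of the Gram matrices and short vectors\<close>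

primrec dstate :: "nat => nat => nat => nat" where
 "dstate C k 0 = k"
| "dstate C k (Suc v) = dstate C k v div C div 2^(dstate C k v mod C)"

text \<open>A code is read from its low end: modulo \<open>C\<close> it gives a width
  \<open>w\<close>, the next \<open>w\<close> bits give the digit, offset by
  \<open>2^w div 2\<close> to allow both signs, and the remaining quotient is the state for the
  following digit. Variable widths let the range of codes adapt to the actual sizes of the
  digits.\<close>

definition digit :: "nat => nat => nat => int" where
 "digit C k v = int ((dstate C k v div C) mod 2^(dstate C k v mod C)) - int (2^(dstate C k v mod C) div 2)"

lemma dstate_shift: "dstate C k (Suc v) = dstate C (dstate C k (Suc 0)) v"
 by (induction v) auto

lemma digit_shift: "digit C k (Suc v) = digit C (dstate C k (Suc 0)) v"
 by (simp only: digit_def dstate_shift[of C k v])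

text \<open>A zero digit gets width 0, any other the length of its absolute value plus one bit for
  the sign; hence the factor 4 in the bound.\<close>

lemma digit_width: "\<exists>c. - int (2^c div 2) <= d & d + int (2^c div 2) < 2^c & (2 :: int)^c <= 4*(1 + \<bar>d\<bar>)"
proof (cases "d = 0")
 case True
 thus ?thesis by (intro exI[of _ 0]) auto
next
 case False
 define k where "k = floorlog 2 (nat \<bar>d\<bar>)"
 have k: "0 < k" "2^(k - 1) <= nat \<bar>d\<bar>" "nat \<bar>d\<bar> < 2^k"
  using floorlog_bounds[of "nat \<bar>d\<bar>" 2] False by (auto simp: k_def floorlog_def)
 have "(2 :: int)^(k - 1) <= \<bar>d\<bar>" using k(2) by simp
 moreover have "\<bar>d\<bar> < (2 :: int)^k" using k(3) by simp
 moreover have "(2 :: int)^Suc k = 4*2^(k - 1)" using k(1) by (cases k) auto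
 moreover have "int (2^Suc k div 2) = 2^k" by simp
 ultimately show ?thesis by (intro exI[of _ "Suc k"]) auto
qed

lemma digits_encode:
 assumes "!!v. v < n ==> w v < C" "!!v. v < n ==> - int (2^w v div 2) <= d v & d v + int (2^w v div 2) < 2^w v"
 shows "\<exists>k < (\<Prod>v<n. C*2^w v). \<forall>v<n. digit C k v = d v"
 using assms
proof (induction n arbitrary: w d)
 case (Suc n)
 obtain k1 where k1: "k1 < (\<Prod>v<n. C*2^w (Suc v))" "!!v. v < n ==> digit C k1 v = d (Suc v)"
  using Suc.IH[of "%v. w (Suc v)" "%v. d (Suc v)"] Suc.prems by auto
 define a where "a = nat (d 0 + int (2^w 0 div 2))"
 have a: "int a = d 0 + int (2^w 0 div 2)" "a < 2^w 0" using Suc.prems(2)[of 0]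
  by (auto simp: a_def)
 define k where "k = w 0 + C*(a + 2^w 0*k1)"
 have w0: "w 0 < C" using Suc.prems(1)[of 0] by simp
 have kC: "k mod C = w 0" "k div C = a + 2^w 0*k1" using w0 by (auto simp: k_def)
 have "digit C k 0 = d 0" using a by (simp add: digit_def kC)
 moreover have "dstate C k (Suc 0) = k1" using a(2) by (simp add: kC)
 hence "digit C k (Suc v) = d (Suc v)" if "v < n" for v using k1(2)[OF that] by (simp only: digit_shift)
 ultimately have "\<forall>v<Suc n. digit C k v = d v" by (metis less_Suc_eq_0_disj)
 moreover have "k < (\<Prod>v<Suc n. C*2^w v)"
 proof -
  have "a + 2^w 0*k1 < 2^w 0*(k1 + 1)" using a(2) by simp
  also have "\<dots> <= 2^w 0*(\<Prod>v<n. C*2^w (Suc v))" using k1(1) by (intro mult_left_mono) auto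
  finally have "a + 2^w 0*k1 + 1 <= 2^w 0*(\<Prod>v<n. C*2^w (Suc v))" by simp
  hence "C*(a + 2^w 0*k1 + 1) <= C*(2^w 0*(\<Prod>v<n. C*2^w (Suc v)))" by (rule mult_left_mono) simp
  moreover have "k < C*(a + 2^w 0*k1 + 1)" using w0 by (simp add: k_def)
  ultimately show ?thesis unfolding prod.lessThan_Suc_shift by simp
 qed
 ultimately show ?case by blast
qed simp

text \<open>The inequality of arithmetic and geometric means, from \<open>u <= exp (u - 1)\<close>.
  It bounds the product of the ranges of all digits by means of their average size.\<close>

lemma prod_le_mean_power:
 fixes x :: "nat => real"
 assumes "!!v. v < n ==> 0 <= x v" "(\<Sum>v<n. x v) <= real n*a" "0 < a"
 shows "(\<Prod>v<n. x v) <= a^n"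
proof -
 have "(\<Prod>v<n. x v) = a^n*(\<Prod>v<n. x v / a)" using assms(3) by (simp add: prod_dividef)
 also have "(\<Prod>v<n. x v / a) <= (\<Prod>v<n. exp (x v / a - 1))"
 proof (rule prod_mono)
  fix v assume "v \<in> {..<n}"
  thus "0 <= x v / a & x v / a <= exp (x v / a - 1)"
   using assms(1)[of v] assms(3) exp_ge_add_one_self[of "x v / a - 1"] by auto
 qed
 also have "\<dots> = exp ((\<Sum>v<n. x v) / a - real n)"
  by (simp add: exp_sum[symmetric] sum_subtractf sum_divide_distrib)
 also have "\<dots> <= exp 0" using assms(2,3) by (simp add: field_simps)
 finally show ?thesis using assms(3) by simp
qed

section \<open>The quadratic form in integers\<close>

definition "sp_h m c i j = (\<Sum>l<totient m. int (c l)*cyb m (celem m l) (celem m i + celem m j))"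

text \<open>\<open>p\<close> times the first half of the basis vector \<open>a\<close>: a unit
  vector for \<open>a < N\<close>, a column of the Hankel matrix otherwise. Throughout,
  \<open>H\<close> carries the factor \<open>p\<close> and \<open>A\<close> the factor
  \<open>crad m\<close>, and \<open>sp_den\<close> is the common denominator of the form.\<close>

definition "sp_z m p c a i = int p * of_bool (i = a) + (\<Sum>j<totient m. of_bool (a = totient m + j) * sp_h m c i j)"

definition "sp_A m l k = of_bool (k mod cof m = l mod cof m) *
   (\<Prod>q\<in>prime_factors m. int q * of_bool ((k div cof m) mod q = (l div cof m) mod q) - 1)"

definition "sp_form m \<alpha> p z y z' y' =
   int \<alpha>*int \<alpha>*int (crad m)*(\<Sum>k<m. (\<Sum>i<totient m. z i*cyb m (celem m i) k)*(\<Sum>i<totient m. z' i*cyb m (celem m i) k))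
   + int p*int p*(\<Sum>i<totient m. \<Sum>j<totient m. y i*y' j * sp_A m (celem m i) (celem m j))"

definition "sp_num m \<alpha> p c a b = sp_form m \<alpha> p (sp_z m p c a) (%i. of_bool (a = totient m + i)) (sp_z m p c b) (%i. of_bool (b = totient m + i))"

definition "sp_den m \<alpha> p = \<alpha>*p*p*crad m"

definition "sp_y m C k i = (\<Sum>v<totient m. cykap m (celem m i) (celem m v)*digit C k v)"

definition "sp_w m c C k i = (\<Sum>j<totient m. sp_h m c i j * sp_y m C k j)"

text \<open>The representative of \<open>H y\<close> modulo \<open>p\<close> closest to zero, which
  determines \<open>x\<close> for a short vector. The multiple \<open>p * 2^m\<close> changes
  nothing modulo \<open>p\<close>; it keeps the dividend nonnegative, as division of machine words
  requires.\<close>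

definition "sp_cz m p c C k i = (sp_w m c C k i + int p*2^m + int p div 2) mod int p - int p div 2"

definition "sp_q m \<alpha> p c C k = sp_form m \<alpha> p (sp_cz m p c C k) (sp_y m C k) (sp_cz m p c C k) (sp_y m C k)"

context cyclo
begin

lemma AR: "of_int (sp_A m l k) = real R*cyA m l k"
 using R_pos by (simp add: sp_A_def cyA_def)

definition svec :: "nat => (nat => nat) => nat => real" where "svec p c l = real (c l) / real p"

lemma h_val: "0 < p ==> of_int (sp_h m c i j) = real p * val (svec p c) (e i + e j)"
 by (simp add: sp_h_def val_def svec_def sum_distrib_left)

lemma h_hank: "0 < p ==> (\<Sum>j<N. of_int (sp_h m c i j)*y j) = real p*hank (svec p c) y i"
 by (simp add: h_val hank_def sum_distrib_left mult.assoc)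

lemma nB_scale: "nB (%i. a*z i) = a\<^sup>2*nB z"
 by (simp add: nB_def val_def power_mult_distrib mult.assoc flip: sum_distrib_left)

lemma form_eq:
 "of_int (sp_form m \<alpha> p z y z y) = (real \<alpha>)\<^sup>2*real R*nB (%i. of_int (z i)) + (real p)\<^sup>2*real R*nA (%i. of_int (y i))"
by (simp add: nA_def sum_distrib_left sp_form_def AR power2_eq_square mult_ac nB_def val_def mult.assoc)

lemma form_quot:
 assumes p: "0 < p" and \<alpha>: "0 < \<alpha>" and z: "!!i. i < N ==> z i = int p*x i + (\<Sum>j<N. sp_h m c i j*y j)"
 shows "of_int (sp_form m \<alpha> p z y z y) / real (sp_den m \<alpha> p)
  = real \<alpha>*nB (%i. of_int (x i) + hank (svec p c) (%j. of_int (y j)) i) + nA (%j. of_int (y j)) / real \<alpha>"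
proof -
 have "nB (%i. of_int (z i)) = nB (%i. real p*(of_int (x i) + hank (svec p c) (%j. of_int (y j)) i))"
  by (rule nB_cong) (simp add: z h_hank[OF p, symmetric] distrib_left)
 thus ?thesis unfolding form_eq nB_scale sp_den_def using p \<alpha> R_pos
  by (simp add: field_simps power2_eq_square)
qed

lemma sum_split: "(\<Sum>a<2*N. f a) = (\<Sum>i<N. f i) + (\<Sum>j<N. f (N + j) :: 'a :: comm_monoid_add)"
proof -
 have "(\<Sum>a<2*N. f a) = (\<Sum>i<N. f i) + (\<Sum>a\<in>{N..<2*N}. f a)"
  by (subst sum.union_disjoint[symmetric]) (auto intro: sum.cong)
 also have "(\<Sum>a\<in>{N..<2*N}. f a) = (\<Sum>j<N. f (N + j))"
  by (rule sum.reindex_bij_witness[where i = "%j. N + j" and j = "%a. a - N"]) auto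
 finally show ?thesis .
qed

lemma z_low: "a < N ==> sp_z m p c a i = int p * of_bool (i = a)"
 by (simp add: sp_z_def)

lemma z_high: "a < N ==> i < N ==> sp_z m p c (N + a) i = sp_h m c i a"
 by (simp add: sp_z_def)

lemma sum_product_coeff:
 fixes u X Y :: "nat => real"
 shows "(\<Sum>a\<in>I. u a*X a)*(\<Sum>a\<in>I. u a*Y a) = (\<Sum>a\<in>I. \<Sum>a'\<in>I. X a*Y a'*(u a*u a'))"
 unfolding sum_product by (intro sum.cong refl) (simp only: mult_ac)

lemma sum_form_coeff:
 fixes u :: "nat => real"
 shows "(\<Sum>a\<in>I. \<Sum>a'\<in>I. (c1*S1 a a' + c2*S2 a a')*u a*u a')
  = c1*(\<Sum>a\<in>I. \<Sum>a'\<in>I. S1 a a'*(u a*u a')) + c2*(\<Sum>a\<in>I. \<Sum>a'\<in>I. S2 a a'*(u a*u a'))"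
 by (simp add: sum_distrib_left sum.distrib distrib_right mult.assoc)

text \<open>The polarised form. Its bilinearity relates the matrix \<open>Qm\<close> of values on
  basis vectors to the form at an arbitrary combination.\<close>

definition rform :: "real => (nat => real) => (nat => real) => (nat => real) => (nat => real) => real" where
 "rform \<alpha> z y z' y' = \<alpha>*(\<Sum>k<m. val z k * val z' k) + 1 / \<alpha>*(\<Sum>i<N. \<Sum>j<N. cyA m (e i) (e j)*y i*y' j)"

lemma rform_diag: "rform \<alpha> z y z y = \<alpha>*nB z + nA y / \<alpha>"
 by (simp add: rform_def nB_def nA_def power2_eq_square)

lemma rform_bilinear:
 fixes u :: "nat => real"
 shows "(\<Sum>a\<in>I. \<Sum>a'\<in>I. rform \<alpha> (z a) (y a) (z a') (y a')*u a*u a')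
  = rform \<alpha> (%i. \<Sum>a\<in>I. u a*z a i) (%i. \<Sum>a\<in>I. u a*y a i) (%i. \<Sum>a\<in>I. u a*z a i) (%i. \<Sum>a\<in>I. u a*y a i)"
proof -
 have 1: "val (%i. \<Sum>a\<in>I. u a*z a i) k = (\<Sum>a\<in>I. u a * val (z a) k)" for k
  unfolding val_def sum_distrib_left sum_distrib_right by (subst sum.swap) (simp only: mult.assoc)
 have z: "(\<Sum>k<m. val (%i. \<Sum>a\<in>I. u a*z a i) k * val (%i. \<Sum>a\<in>I. u a*z a i) k)
  = (\<Sum>a\<in>I. \<Sum>a'\<in>I. (\<Sum>k<m. val (z a) k * val (z a') k)*(u a*u a'))"
  unfolding 1 sum_product_coeff unfolding sum_distrib_right
  by (subst sum.swap, rule sum_cong, rule sum.swap)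
 have y: "(\<Sum>i<N. \<Sum>j<N. cyA m (e i) (e j)*(\<Sum>a\<in>I. u a*y a i)*(\<Sum>a\<in>I. u a*y a j))
  = (\<Sum>a\<in>I. \<Sum>a'\<in>I. (\<Sum>i<N. \<Sum>j<N. cyA m (e i) (e j)*y a i*y a' j)*(u a*u a'))"
 proof -
  have "(\<Sum>i<N. \<Sum>j<N. cyA m (e i) (e j)*(\<Sum>a\<in>I. u a*y a i)*(\<Sum>a\<in>I. u a*y a j))
   = (\<Sum>i<N. \<Sum>j<N. \<Sum>a\<in>I. \<Sum>a'\<in>I. cyA m (e i) (e j)*y a i*y a' j*(u a*u a'))"
   unfolding mult.assoc unfolding sum_product_coeff unfolding sum_distrib_left by (intro sum.cong refl) (simp only: mult_ac)
  also have "\<dots> = (\<Sum>i<N. \<Sum>a\<in>I. \<Sum>a'\<in>I. \<Sum>j<N. cyA m (e i) (e j)*y a i*y a' j*(u a*u a'))"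
   by (rule sum_cong, subst sum.swap, rule sum_cong, rule sum.swap)
  also have "\<dots> = (\<Sum>a\<in>I. \<Sum>a'\<in>I. \<Sum>i<N. \<Sum>j<N. cyA m (e i) (e j)*y a i*y a' j*(u a*u a'))"
   by (subst sum.swap, rule sum_cong, rule sum.swap)
  finally show ?thesis by (simp only: sum_distrib_right)
 qed
 show ?thesis unfolding rform_def z y by (rule sum_form_coeff)
qed

definition Qm :: "nat => nat => (nat => nat) => nat => nat => real" where
 "Qm \<alpha> p c a a' = of_int (sp_num m \<alpha> p c a a') / real (sp_den m \<alpha> p)"

lemma den_pos: "0 < p ==> 0 < \<alpha> ==> 0 < sp_den m \<alpha> p" using R_pos by (simp add: sp_den_def)

lemma Qm_rform:
 assumes p: "0 < p" and \<alpha>: "0 < \<alpha>"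
 shows "Qm \<alpha> p c a a' = rform (real \<alpha>) (%i. of_int (sp_z m p c a i) / real p) (%i. of_bool (a = N + i))
  (%i. of_int (sp_z m p c a' i) / real p) (%i. of_bool (a' = N + i))"
proof -
 have v: "val (%i. of_int (sp_z m p c a i) / real p) k = of_int (\<Sum>i<N. sp_z m p c a i*b (e i) k) / real p" for a k
  by (simp add: val_def sum_divide_distrib)
 have y: "(\<Sum>i<N. \<Sum>j<N. of_int (of_bool (a = N + i) * of_bool (a' = N + j) * sp_A m (e i) (e j)))
  = real R*(\<Sum>i<N. \<Sum>j<N. cyA m (e i) (e j) * of_bool (a = N + i) * of_bool (a' = N + j))"
  unfolding sum_distrib_left by (intro sum.cong refl) (simp add: AR)
 have z: "(\<Sum>k<m. val (%i. of_int (sp_z m p c a i) / real p) k * val (%i. of_int (sp_z m p c a' i) / real p) k)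
  = of_int (\<Sum>k<m. (\<Sum>i<N. sp_z m p c a i*b (e i) k)*(\<Sum>i<N. sp_z m p c a' i*b (e i) k)) / (real p*real p)"
  unfolding v unfolding times_divide_times_eq sum_divide_distrib[symmetric] by simp
 have "of_int (sp_num m \<alpha> p c a a') = real \<alpha>*real \<alpha>*real R * of_int (\<Sum>k<m. (\<Sum>i<N. sp_z m p c a i*b (e i) k)*(\<Sum>i<N. sp_z m p c a' i*b (e i) k))
  + real p*real p*(real R*(\<Sum>i<N. \<Sum>j<N. cyA m (e i) (e j) * of_bool (a = N + i) * of_bool (a' = N + j)))"
  unfolding sp_num_def sp_form_def y[symmetric] by simp
 thus ?thesis unfolding Qm_def rform_def z sp_den_def using p \<alpha> R_pos by (simp add: field_simps)
qed

lemma Qm_real: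
 assumes p: "0 < p" and \<alpha>: "0 < \<alpha>"
 shows "(\<Sum>a<2*N. \<Sum>a'<2*N. Qm \<alpha> p c a a'*u a*u a')
  = real \<alpha>*nB (%i. u i + hank (svec p c) (%j. u (N + j)) i) + nA (%j. u (N + j)) / real \<alpha>"
proof -
 define z where "z i = (\<Sum>a<2*N. u a*(of_int (sp_z m p c a i) / real p))" for i
 define y where "y i = (\<Sum>a<2*N. u a * of_bool (a = N + i))" for i
 have y: "y i = u (N + i)" if "i < N" for i
 proof -
  have "y i = (\<Sum>a<2*N. of_bool (a = N + i)*u a)" by (simp only: y_def mult.commute)
  also have "\<dots> = u (N + i)" by (rule sum_of_bool_eq) (use that in simp)
  finally show ?thesis .
 qed
 have z: "z i = u i + hank (svec p c) (%j. u (N + j)) i" if i: "i < N" for i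
 proof -
  have "z i = (\<Sum>a<N. of_bool (a = i)*u a) + (\<Sum>j<N. of_int (sp_h m c i j)*u (N + j)) / real p"
   unfolding z_def sum_split sum_divide_distrib
   by (intro arg_cong2[of _ _ _ _ "(+)"] sum.cong refl) (use i p in \<open>auto simp: z_low z_high\<close>)
  thus ?thesis using p by (simp only: sum_of_bool_eq[OF i] h_hank[OF p]) simp
 qed
 have "(\<Sum>a<2*N. \<Sum>a'<2*N. Qm \<alpha> p c a a'*u a*u a') = rform (real \<alpha>) z y z y"
  unfolding Qm_rform[OF p \<alpha>] rform_bilinear z_def[abs_def] y_def[abs_def] ..
 also have "\<dots> = real \<alpha>*nB z + nA y / real \<alpha>" by (rule rform_diag)
 also have "nA y = nA (%j. u (N + j))" by (rule nA_cong) (simp add: y)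
 also have "nB z = nB (%i. u i + hank (svec p c) (%j. u (N + j)) i)" by (rule nB_cong) (simp add: z)
 finally show ?thesis .
qed

lemma Qm_sym:
 assumes p: "0 < p" and \<alpha>: "0 < \<alpha>"
 shows "Qm \<alpha> p c a a' = Qm \<alpha> p c a' a"
proof -
 have "(\<Sum>i<N. \<Sum>j<N. cyA m (e i) (e j)*y i*y' j) = (\<Sum>i<N. \<Sum>j<N. cyA m (e i) (e j)*y' i*y j)" for y y'
 proof -
  have "(\<Sum>i<N. \<Sum>j<N. cyA m (e i) (e j)*y i*y' j) = (\<Sum>j<N. \<Sum>i<N. cyA m (e i) (e j)*y i*y' j)" by (rule sum.swap)
  also have "\<dots> = (\<Sum>j<N. \<Sum>i<N. cyA m (e j) (e i)*y' j*y i)"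
  proof (intro sum.cong refl)
   fix i j show "cyA m (e i) (e j)*y i*y' j = cyA m (e j) (e i)*y' j*y i" using A_sym[of "e i" "e j"] by simp
  qed
  finally show ?thesis .
 qed
 moreover have "(\<Sum>k<m. val z k * val z' k) = (\<Sum>k<m. val z' k * val z k)" for z z'
  by (rule sum_cong, rule mult.commute)
 ultimately show ?thesis unfolding Qm_rform[OF p \<alpha>] rform_def
  by (intro arg_cong2[of _ _ _ _ "(+)"] arg_cong2[of _ _ _ _ "(*)"] refl)
qed

lemma Qm_pos:
 assumes p: "0 < p" and \<alpha>: "0 < \<alpha>" and u: "\<exists>a<2*N. u a ~= 0"
 shows "0 < (\<Sum>a<2*N. \<Sum>a'<2*N. Qm \<alpha> p c a a'*u a*u a')"
proof (cases "\<exists>j<N. u (N + j) ~= 0")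
 case True
 from nA_pos[OF this] have "0 < nA (%j. u (N + j)) / real \<alpha>" using \<alpha> by simp
 moreover have "0 <= real \<alpha>*nB (%i. u i + hank (svec p c) (%j. u (N + j)) i)" using nB_nonneg by simp
 ultimately show ?thesis unfolding Qm_real[OF p \<alpha>] by linarith
next
 case False
 hence h: "hank (svec p c) (%j. u (N + j)) i = 0" for i by (simp add: hank_def)
 obtain a where a: "a < 2*N" "u a ~= 0" using u by blast
 have "a < N"
 proof (rule ccontr)
  assume "\<not> a < N"
  hence "u (N + (a - N)) ~= 0" "a - N < N" using a by auto
  thus False using False by blast
 qed
 hence "0 < nB u" using nB_pos[of u] a by blast
 moreover have "0 <= nA (%j. u (N + j)) / real \<alpha>" using nA_nonneg by simp
 ultimately show ?thesis unfolding Qm_real[OF p \<alpha>] h using \<alpha> by (simp add: add_pos_nonneg)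
qed

lemma Qm_den: "0 < p ==> 0 < \<alpha> ==> of_nat (sp_den m \<alpha> p)*Qm \<alpha> p c a a' \<in> \<int>"
 by (simp add: Qm_def)

end

section \<open>The symplectic relation for block matrices\<close>

lemma mat_cancel:
 fixes X :: "real mat"
 shows "X \<in> carrier_mat n n ==> X + - X = 0\<^sub>m n n"
  and "X \<in> carrier_mat n n ==> Y \<in> carrier_mat n n ==> X + (- X + Y) = Y"
  and "X \<in> carrier_mat n n ==> Y \<in> carrier_mat n n ==> (X + Y) + - X = Y"
  and "X \<in> carrier_mat n n ==> Y \<in> carrier_mat n n ==> X + Y + (- X + - Y) = 0\<^sub>m n n"
 by auto

text \<open>The matrix is the product of the lower unipotent block matrix of \<open>H\<close>, the
  diagonal blocks \<open>C\<close> and \<open>C'\<close>, and the upper unipotent block matrix of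
  \<open>H\<close>. Writing \<open>H\<close> in both corners builds its symmetry into the statement,
  and the relation is then checked by multiplying out.\<close>

lemma symplectic_block:
 fixes C C' H :: "real mat"
 assumes C: "C \<in> carrier_mat n n" and C': "C' \<in> carrier_mat n n" and H: "H \<in> carrier_mat n n"
  and CC': "C*C' = 1\<^sub>m n" and C'C: "C'*C = 1\<^sub>m n"
 shows "four_block_mat C (C*H) (H*C) (H*C*H + C')*Jmat n*four_block_mat C (C*H) (H*C) (H*C*H + C') = Jmat n"
proof -
 let ?X = "H*C*H + C'"
 note c [simp] = C C' H mult_carrier_mat[of _ n n _ n] add_carrier_mat[of _ n n] uminus_carrier_mat[of _ n n]
 note as = assoc_mult_mat[of _ n n _ n _ n]
 have as': "(A*B)*D = A*(B*D)" if "A \<in> carrier_mat n n" "B \<in> carrier_mat n n" "D \<in> carrier_mat n n" for A B D :: "real mat"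
  using that by simp
 have ml: "- A*B = - (A*B)" and mr: "A*- B = - (A*B)" if "A \<in> carrier_mat n n" "B \<in> carrier_mat n n" for A B :: "real mat"
  using that by auto
 have unit: "A*1\<^sub>m n = A" "1\<^sub>m n*A = A" "A*0\<^sub>m n n = 0\<^sub>m n n" "0\<^sub>m n n + A = A" "A + 0\<^sub>m n n = A" if "A \<in> carrier_mat n n" for A :: "real mat"
  using that by auto
 have dl: "A*(B + D) = A*B + A*D" and dr: "(B + D)*A = B*A + D*A" if "A \<in> carrier_mat n n" "B \<in> carrier_mat n n" "D \<in> carrier_mat n n" for A B D :: "real mat"
  using that by (auto intro: mult_add_distrib_mat add_mult_distrib_mat)
 have CC: "C*(C'*A) = A" and CC2: "C'*(C*A) = A" if "A \<in> carrier_mat n n" for A :: "real mat"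
  using as'[OF C C' that] as'[OF C' C that] that by (simp_all add: CC' C'C unit)
 have "four_block_mat C (C*H) (H*C) ?X*Jmat n = four_block_mat (C*H) (- C) ?X (- (H*C))"
  unfolding Jmat_def by (subst mult_four_block_mat[of _ n n _ n _ n _ _ n _ n]) (simp_all add: mr unit)
 moreover have "four_block_mat (C*H) (- C) ?X (- (H*C))*four_block_mat C (C*H) (H*C) ?X
  = four_block_mat ((C*H)*C + (- C)*(H*C)) ((C*H)*(C*H) + (- C)*?X)
    (?X*C + (- (H*C))*(H*C)) (?X*(C*H) + (- (H*C))*?X)"
  by (rule mult_four_block_mat[of _ n n _ n _ n _ _ n _ n]) simp_all
 moreover have "(C*H)*C + (- C)*(H*C) = 0\<^sub>m n n"
  by (simp add: as' ml mat_cancel(1)[of _ n])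
 moreover have "(C*H)*(C*H) + (- C)*?X = - 1\<^sub>m n"
  by (simp add: as' ml dl CC' mat_cancel(2)[of _ n])
 moreover have "?X*C + (- (H*C))*(H*C) = 1\<^sub>m n"
  by (simp add: as' ml dr C'C mat_cancel(3)[of _ n])
 moreover have "?X*(C*H) + (- (H*C))*?X = 0\<^sub>m n n"
  by (simp add: as' ml dr dl CC2 CC' unit mat_cancel(4)[of _ n])
 ultimately show ?thesis by (simp add: Jmat_def)
qed

context cyclo
begin

text \<open>\<open>C\<close> is \<open>\<alpha>\<close> times the Gram matrix of the basis,
  \<open>C'\<close> is its inverse, from the dual form, and \<open>H\<close> is a Hankel matrix,
  hence symmetric. The four blocks of \<open>Qm\<close> are identified with those of
  \<open>symplectic_block\<close>.\<close>

lemma Qm_symplectic: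
 assumes p: "0 < p" and \<alpha>: "0 < \<alpha>"
 shows "mat (2*N) (2*N) (%(i, j). Qm \<alpha> p c i j)*Jmat N*mat (2*N) (2*N) (%(i, j). Qm \<alpha> p c i j) = Jmat N"
proof -
 define Bf where "Bf i j = real_of_int (\<Sum>k<m. b (e i) k*b (e j) k)" for i j
 define hf where "hf i j = val (svec p c) (e i + e j)" for i j
 define C where "C = mat N N (%(i, j). real \<alpha>*Bf i j)"
 define C' where "C' = mat N N (%(i, j). cyA m (e i) (e j) / real \<alpha>)"
 define H where "H = mat N N (%(i, j). hf i j)"
 have car [simp]: "C \<in> carrier_mat N N" "C' \<in> carrier_mat N N" "H \<in> carrier_mat N N"
  by (simp_all add: C_def C'_def H_def)
 note dims [simp] = carrier_matD[OF car(1)] carrier_matD[OF car(2)] carrier_matD[OF car(3)]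
 have idx: "(X*Y) $$ (i, j) = (\<Sum>l<N. X $$ (i, l)*Y $$ (l, j))"
  if "X \<in> carrier_mat N N" "Y \<in> carrier_mat N N" "i < N" "j < N" for X Y :: "real mat" and i j
  using that by (simp add: scalar_prod_def lessThan_atLeast0)
 have hf: "of_int (sp_h m c i j) / real p = hf i j" for i j using p by (simp add: h_val hf_def)
 have hfs: "hf i j = hf j i" for i j by (simp add: hf_def add.commute)
 have AB: "(\<Sum>j<N. cyA m (e i) (e j)*Bf j k) = of_bool (i = k)" if "i < N" "k < N" for i k
  unfolding Bf_def using A_inverse[OF that] .
 have Bs: "Bf i j = Bf j i" for i j by (simp only: Bf_def mult.commute)
 have C'C: "C'*C = 1\<^sub>m N"
 using \<alpha> AB by (auto simp: C_def C'_def scalar_prod_def lessThan_atLeast0)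
 have CC': "C*C' = 1\<^sub>m N" by (rule mat_mult_left_right_inverse[OF car(2,1) C'C])
 have vC: "val (%i. of_bool (i = a)) k = of_int (b (e a) k)" if "a < N" for a k
  unfolding val_def by (rule sum_of_bool_eq[OF that])
 have BB: "(\<Sum>k<m. of_int (b (e i) k) * val z k) = (\<Sum>l<N. Bf i l*z l)" for i z
 using sum.swap by (simp add: val_def sum_distrib_left Bf_def of_int_sum sum_distrib_right of_int_mult mult_ac)
 have VV: "(\<Sum>k<m. val w k * val z k) = (\<Sum>i<N. w i*(\<Sum>l<N. Bf i l*z l))" for w z
  unfolding BB[symmetric] val_def[of w] sum_distrib_left sum_distrib_right
  by (subst sum.swap) (simp only: mult.assoc)
 have z1: "(%i. of_int (sp_z m p c a i) / real p) = (%i. of_bool (i = a))" if "a < N" for a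
  using that p by (simp add: z_low)
 have z2: "val (%i. of_int (sp_z m p c (N + a) i) / real p) k = val (%i. hf i a) k" if "a < N" for a k
  by (rule val_cong) (use that in \<open>simp add: z_high hf\<close>)
 have y1: "of_bool (a = N + i) = (0 :: real)" if "a < N" for a i using that by simp
 have y2: "of_bool (N + a = N + i) = (of_bool (i = a) :: real)" for a i by auto
 have AA: "(\<Sum>i<N. \<Sum>j<N. cyA m (e i) (e j) * of_bool (i = a) * of_bool (j = a')) = cyA m (e a) (e a')" if "a < N" "a' < N" for a a'
 proof -
  have "(\<Sum>i<N. \<Sum>j<N. cyA m (e i) (e j) * of_bool (i = a) * of_bool (j = a')) = (\<Sum>i<N. of_bool (i = a)*(\<Sum>j<N. of_bool (j = a')*cyA m (e i) (e j)))"
   unfolding sum_distrib_left by (intro sum.cong refl) (simp only: mult_ac)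
  thus ?thesis by (simp only: sum_of_bool_eq[OF that(1)] sum_of_bool_eq[OF that(2)])
 qed
 have CH: "(C*H) $$ (i, j) = real \<alpha>*(\<Sum>l<N. Bf i l*hf l j)" if "i < N" "j < N" for i j
  using that by (simp add: C_def H_def scalar_prod_def lessThan_atLeast0 sum_distrib_left mult.assoc)
 have HC: "(H*C) $$ (i, j) = real \<alpha>*(\<Sum>l<N. Bf j l*hf l i)" if "i < N" "j < N" for i j
 proof -
  have "(H*C) $$ (i, j) = (\<Sum>l<N. hf i l*(real \<alpha>*Bf l j))"
   using that by (simp add: C_def H_def scalar_prod_def lessThan_atLeast0)
  also have "\<dots> = (\<Sum>l<N. real \<alpha>*(Bf j l*hf l i))"
  proof (rule sum_cong)
   fix l show "hf i l*(real \<alpha>*Bf l j) = real \<alpha>*(Bf j l*hf l i)"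
    using hfs[of i l] Bs[of l j] by simp
  qed
  finally show ?thesis by (simp only: sum_distrib_left)
 qed
 have HCH: "(H*C*H) $$ (i, j) = real \<alpha>*(\<Sum>i'<N. hf i' i*(\<Sum>l<N. Bf i' l*hf l j))" if ij: "i < N" "j < N" for i j
 proof -
  have "(H*C*H) $$ (i, j) = (H*(C*H)) $$ (i, j)" by (simp only: assoc_mult_mat[OF car(3,1,3)])
  also have "\<dots> = (\<Sum>i'<N. H $$ (i, i')*(C*H) $$ (i', j))"
   by (rule idx[OF car(3) mult_carrier_mat[OF car(1,3)] ij])
  also have "\<dots> = (\<Sum>i'<N. real \<alpha>*(hf i' i*(\<Sum>l<N. Bf i' l*hf l j)))"
  proof (rule sum_cong)
   fix i' assume i': "i' \<in> {..<N}"
   hence "H $$ (i, i') = hf i' i" using ij by (simp add: H_def hfs)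
   thus "H $$ (i, i')*(C*H) $$ (i', j) = real \<alpha>*(hf i' i*(\<Sum>l<N. Bf i' l*hf l j))"
    using CH[of i' j] i' ij by simp
  qed
  finally show ?thesis by (simp only: sum_distrib_left)
 qed
 have "mat (2*N) (2*N) (%(i, j). Qm \<alpha> p c i j) = four_block_mat C (C*H) (H*C) (H*C*H + C')"
 proof (rule eq_matI)
  fix i j assume "i < dim_row (four_block_mat C (C*H) (H*C) (H*C*H + C'))"
   "j < dim_col (four_block_mat C (C*H) (H*C) (H*C*H + C'))"
  hence ij: "i < 2*N" "j < 2*N" by auto
  show "mat (2*N) (2*N) (%(i, j). Qm \<alpha> p c i j) $$ (i, j) = four_block_mat C (C*H) (H*C) (H*C*H + C') $$ (i, j)"
  proof (cases "i < N")
   case i: True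
   show ?thesis
   proof (cases "j < N")
    case j: True
    have "Qm \<alpha> p c i j = real \<alpha>*Bf i j"
     unfolding Qm_rform[OF p \<alpha>] rform_def z1[OF i] z1[OF j] y1[OF i] vC[OF i] vC[OF j] by (simp add: Bf_def)
    thus ?thesis using i j by (simp add: four_block_mat_def Let_def) (simp add: C_def)
   next
    case False
    then obtain a where a: "j = N + a" "a < N" using ij by (metis add_diff_inverse_nat mult_2 nat_add_left_cancel_less)
    have "Qm \<alpha> p c i j = real \<alpha>*(\<Sum>l<N. Bf i l*hf l a)"
     unfolding Qm_rform[OF p \<alpha>] rform_def z1[OF i] a(1) z2[OF a(2)] y1[OF i] vC[OF i] BB by simp
    thus ?thesis using i a CH[OF i a(2)] by simp
   qed
  next
   case False
   then obtain a where a: "i = N + a" "a < N" using ij by (metis add_diff_inverse_nat mult_2 nat_add_left_cancel_less)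
   show ?thesis
   proof (cases "j < N")
    case j: True
    have "Qm \<alpha> p c i j = Qm \<alpha> p c j i" by (rule Qm_sym[OF p \<alpha>])
    also have "\<dots> = real \<alpha>*(\<Sum>l<N. Bf j l*hf l a)"
     unfolding Qm_rform[OF p \<alpha>] rform_def z1[OF j] a(1) z2[OF a(2)] y1[OF j] vC[OF j] BB by simp
    finally show ?thesis using j a HC[OF a(2) j] by simp
   next
    case False
    then obtain a' where a': "j = N + a'" "a' < N" using ij by (metis add_diff_inverse_nat mult_2 nat_add_left_cancel_less)
    have "Qm \<alpha> p c i j = real \<alpha>*(\<Sum>i'<N. hf i' a*(\<Sum>l<N. Bf i' l*hf l a')) + cyA m (e a) (e a') / real \<alpha>"
     unfolding Qm_rform[OF p \<alpha>] rform_def a(1) a'(1) z2[OF a(2)] z2[OF a'(2)] y2 VV AA[OF a(2) a'(2)] by simp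
    thus ?thesis using a a' HCH[OF a(2) a'(2)] by (simp add: four_block_mat_def Let_def C'_def)
   qed
  qed
 qed simp_all
 thus ?thesis using symplectic_block[OF car(1,2,3) CC' C'C] by simp
qed

text \<open>Vectors with nonzero \<open>y\<close> are covered by \<open>short\<close>. For
  \<open>y = 0\<close> some integral coordinate of \<open>x\<close> is nonzero, and since it is a
  value of the periodic function attached to \<open>x\<close>, the form is at least
  \<open>\<alpha>\<close>.\<close>

lemma Qm_lattice:
 assumes p: "0 < p" and \<alpha>: "0 < \<alpha>" and r: "0 < r"
  and short: "!!x y. \<exists>j<N. y j ~= 0 ==> r\<^sup>2 < real \<alpha>*nB (%i. of_int (x i) + hank (svec p c) (%j. of_int (y j)) i) + nA (%j. of_int (y j)) / real \<alpha>"
  and ra: "r\<^sup>2 < real \<alpha>"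
 shows "\<exists>\<Lambda> B. Z_basis (2*N) \<Lambda> B & transpose_mat B*B = mat (2*N) (2*N) (%(i, j). Qm \<alpha> p c i j) & symplectic_lattice (2*N) \<Lambda> &
  unit_ball_vol (real (2*N))*r^(2*N) / 2^(2*N) < lattice_density (2*N) \<Lambda>"
proof (rule lattice_of_gram[where N = N and D = "sp_den m \<alpha> p"])
 show "0 < N" by (rule N_pos)
 show "r\<^sup>2 < (\<Sum>i<2*N. \<Sum>j<2*N. Qm \<alpha> p c i j * of_int (u i) * of_int (u j))" if u: "\<exists>i<2*N. u i ~= 0" for u :: "nat => int"
 proof (cases "\<exists>j<N. u (N + j) ~= 0")
  case True
  thus ?thesis unfolding Qm_real[OF p \<alpha>] using short[of "%j. u (N + j)" u] by simp
 next
  case False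
  hence h: "hank (svec p c) (%j. of_int (u (N + j))) i = 0" for i by (simp add: hank_def)
  obtain a where a: "a < 2*N" "u a ~= 0" using u by blast
  have aN: "a < N"
  proof (rule ccontr)
   assume "\<not> a < N"
   hence "u (N + (a - N)) ~= 0" "a - N < N" using a by auto
   thus False using False by blast
  qed
  have "1 <= \<bar>u a\<bar>" using a(2) by simp
  hence "1 <= (u a)\<^sup>2" by (metis abs_le_square_iff abs_1 one_power2)
  hence "1 <= (real_of_int (u a))\<^sup>2" by (metis of_int_1_le_iff of_int_power)
  also have "\<dots> <= nB (%i. of_int (u i))" using val_sq_le_nB[OF aN, of "%i. of_int (u i)"] .
  finally have "real \<alpha> <= real \<alpha>*nB (%i. of_int (u i))" using \<alpha> by simp
  moreover have "0 <= nA (%j. of_int (u (N + j))) / real \<alpha>" using nA_nonneg by simp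
  ultimately show ?thesis unfolding Qm_real[OF p \<alpha>] h using ra by simp
 qed
qed (use Qm_sym[OF p \<alpha>] Qm_pos[OF p \<alpha>] Qm_den[OF p \<alpha>] Qm_symplectic[OF p \<alpha>] den_pos[OF p \<alpha>] r in simp_all)

end

section \<open>Exhaustive search over codes\<close>

lemma base_digits:
 fixes c :: "nat => nat"
 assumes "!!l. l < n ==> c l < p"
 shows "\<exists>k < p^n. \<forall>l<n. k div p^l mod p = c l"
 using assms
proof (induction n arbitrary: c)
 case (Suc n)
 obtain k where k: "k < p^n" "!!l. l < n ==> k div p^l mod p = c (Suc l)"
  using Suc.IH[of "%l. c (Suc l)"] Suc.prems by auto
 have c0: "c 0 < p" using Suc.prems[of 0] by simp
 have "(p*k + c 0) div p^l mod p = c l" if l: "l < Suc n" for l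
 proof (cases l)
  case 0
  thus ?thesis using c0 by simp
 next
  case (Suc j)
  hence "(p*k + c 0) div p^l = k div p^j" using c0 by (simp add: div_mult2_eq)
  thus ?thesis using k(2)[of j] l Suc by simp
 qed
 moreover have "p*k + c 0 < p^Suc n"
 proof -
  have "p*k + c 0 < p*(k + 1)" using c0 by simp
  also have "\<dots> <= p*p^n" using k(1) by (intro mult_left_mono) auto
  finally show ?thesis by simp
 qed
 ultimately show ?case by blast
qed simp

text \<open>The zero vector has value 0, and subtracting 1 modulo \<open>BIG\<close> turns this into
  the largest residue, so it drops out of the minimum without a case distinction in the program. A
  value of \<open>q\<close> violating the bound would then score below everything that
  \<open>q0\<close> attains.\<close>

lemma best_search:
 fixes q q0 :: "nat => int"
 assumes BIG: "!!k. k < KK ==> 0 <= q k & q k < BIG" "!!k. k < KK ==> 0 <= q0 k & q0 k < BIG"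
  and best: "(MIN k\<in>{..<KK}. (q0 k - 1) mod BIG) <= (MIN k\<in>{..<KK}. (q k - 1) mod BIG)"
  and good: "!!k. k < KK ==> q0 k ~= 0 ==> B < real_of_int (q0 k)"
  and k: "k < KK" "q k ~= 0"
 shows "B < real_of_int (q k)"
proof (rule ccontr)
 assume neg: "\<not> B < real_of_int (q k)"
 have "(MIN k\<in>{..<KK}. (q0 k - 1) mod BIG) \<in> (%k. (q0 k - 1) mod BIG) ` {..<KK}"
  using k(1) by (intro Min_in) auto
 then obtain k0 where k0: "k0 < KK" "(MIN k\<in>{..<KK}. (q0 k - 1) mod BIG) = (q0 k0 - 1) mod BIG" by auto
 have "(MIN k\<in>{..<KK}. (q k - 1) mod BIG) <= (q k - 1) mod BIG" using k(1) by simp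
 also have "(q k - 1) mod BIG = q k - 1" using BIG(1)[OF k(1)] k(2) by simp
 finally have 1: "(q0 k0 - 1) mod BIG <= q k - 1" using best k0 by linarith
 show False
 proof (cases "q0 k0 = 0")
  case True
  hence "(q0 k0 - 1) mod BIG = BIG - 1" using BIG(1)[OF k(1)] by (simp add: zmod_minus1)
  thus False using 1 BIG(1)[OF k(1)] by simp
 next
  case False
  hence "(q0 k0 - 1) mod BIG = q0 k0 - 1" using BIG(2)[OF k0(1)] by simp
  hence "q0 k0 <= q k" using 1 by simp
  hence "real_of_int (q0 k0) <= real_of_int (q k)" by simp
  thus False using good[OF k0(1) False] neg by linarith
 qed
qed

section \<open>Completeness of the search and existence of a good grid point\<close>

context cyclo
begin

definition qf :: "nat => nat => (nat => nat) => (nat => int) => (nat => int) => real" where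
 "qf \<alpha> p c x y = real \<alpha>*nB (%i. of_int (x i) + hank (svec p c) (%j. of_int (y j)) i) + nA (%j. of_int (y j)) / real \<alpha>"

lemma hank_cong: "(!!l. l < N ==> s l = s' l) ==> (!!j. j < N ==> y j = y' j) ==> hank s y i = hank s' y' i"
 unfolding hank_def using val_cong[of s s'] by simp

lemma qf_cong:
 assumes "!!l. l < N ==> c l = c' l" "!!j. j < N ==> y j = y' j"
 shows "qf \<alpha> p c x y = qf \<alpha> p c' x y'"
proof -
 have "hank (svec p c) (%j. of_int (y j)) i = hank (svec p c') (%j. of_int (y' j)) i" for i
  by (rule hank_cong) (use assms in \<open>auto simp: svec_def\<close>)
 moreover have "nA (%j. of_int (y j)) = nA (%j. of_int (y' j))" by (rule nA_cong) (use assms in simp)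
 ultimately show ?thesis by (simp add: qf_def)
qed

lemma q_sound:
 assumes p: "0 < p" and \<alpha>: "0 < \<alpha>"
 shows "\<exists>x. of_int (sp_q m \<alpha> p c C k) / real (sp_den m \<alpha> p) = qf \<alpha> p c x (sp_y m C k)"
proof -
 define x where "x i = 2^m - (sp_w m c C k i + int p*2^m + int p div 2) div int p" for i
 have "sp_cz m p c C k i = int p*x i + (\<Sum>j<N. sp_h m c i j * sp_y m C k j)" for i
  unfolding sp_cz_def x_def sp_w_def by (simp add: algebra_simps)
 thus ?thesis unfolding sp_q_def qf_def by (intro exI[of _ x] form_quot[OF p \<alpha>])
qed

lemma q_zero:
 assumes "0 < p" "!!i. i < N ==> sp_y m C k i = 0"
 shows "sp_q m \<alpha> p c C k = 0"
using assms(2) assms(1) by (simp add: sp_w_def sp_cz_def sp_q_def sp_form_def)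

lemma qf_pos: "0 < \<alpha> ==> \<exists>i<N. y i ~= 0 ==> 0 < qf \<alpha> p c x y"
 unfolding qf_def using nA_pos[of "%j. of_int (y j)"] nB_nonneg by (intro add_nonneg_pos) auto

text \<open>Two bounds make the search finite. As \<open>4 * R0 < \<alpha>\<close>, all coordinates
  of \<open>x + H y\<close> are below \<open>1/2\<close> in absolute value, so the centred remainder
  recovers \<open>x\<close>. As \<open>nA y\<close> is at most \<open>\<alpha> * R0\<close>, the
  mean square of the digits of \<open>y\<close> is at most \<open>g^2\<close>, and a code below
  \<open>(4 * C * (1 + g)) ^ N\<close> exists.\<close>

lemma q_complete:
 assumes p: "0 < p" and \<alpha>: "0 < \<alpha>" and R: "0 <= R0" "4 * R0 < real \<alpha>"
  and y: "\<exists>i<N. y i ~= 0" and le: "qf \<alpha> p c x y <= R0"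
  and g: "(2^card P)\<^sup>2*(real \<alpha> * R0) <= real N*(real g)\<^sup>2"
  and C: "!!w. 2^w <= 4*(1 + N*g) ==> w < C"
 shows "\<exists>k<(4*C*(1 + g))^N. sp_q m \<alpha> p c C k ~= 0 & of_int (sp_q m \<alpha> p c C k) / real (sp_den m \<alpha> p) <= R0"
proof -
 let ?ry = "%j. of_int (y j) :: real"
 have nB: "real \<alpha>*nB (%i. of_int (x i) + hank (svec p c) ?ry i) <= R0"
  and nA: "nA ?ry / real \<alpha> <= R0"
  using le nA_nonneg[of ?ry] nB_nonneg[of "%i. of_int (x i) + hank (svec p c) ?ry i"] \<alpha> unfolding qf_def
  by (smt (verit) divide_nonneg_pos of_nat_0_less_iff, smt (verit) mult_nonneg_nonneg of_nat_0_le_iff)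
 obtain d where d: "!!i. i < N ==> y i = (\<Sum>j<N. cykap m (e i) (e j)*d j)"
  "of_int (\<Sum>j<N. (d j)\<^sup>2) <= (2^card P)\<^sup>2*nA ?ry"
  using digits_exist[of y] unfolding nA_def by blast
 have "nA ?ry <= real \<alpha> * R0" using nA \<alpha> by (simp add: field_simps)
 hence "(2^card P)\<^sup>2*nA ?ry <= (2^card P)\<^sup>2*(real \<alpha> * R0)" by simp
 hence d2: "(\<Sum>j<N. (real_of_int (d j))\<^sup>2) <= real N*(real g)\<^sup>2"
 proof -
  have "(\<Sum>j<N. (real_of_int (d j))\<^sup>2) <= (2^card P)\<^sup>2*nA ?ry" using d(2) by simp
  thus ?thesis using \<open>(2^card P)\<^sup>2*nA ?ry <= _\<close> g by linarith
 qed
 have dj: "\<bar>d j\<bar> <= int (N*g)" if j: "j < N" for j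
 proof -
  have "(real_of_int (d j))\<^sup>2 <= (\<Sum>j<N. (real_of_int (d j))\<^sup>2)" using j by (intro member_le_sum) auto
  also have "\<dots> <= real N*(real g)\<^sup>2" by (rule d2)
  also have "\<dots> <= real N*real N*(real g)\<^sup>2"
  proof -
   have "1 <= real N" using N_pos by linarith
   hence "real N*1 <= real N*real N" by (intro mult_left_mono) auto
   thus ?thesis by (intro mult_right_mono) auto
  qed
  also have "\<dots> = (real (N*g))\<^sup>2" by (simp add: power2_eq_square)
  finally have "\<bar>real_of_int (d j)\<bar> <= real (N*g)" by (metis abs_le_square_iff abs_of_nat)
  hence "of_int \<bar>d j\<bar> <= (of_int (int (N*g)) :: real)" by simp
  thus ?thesis by (simp only: of_int_le_iff)
 qed
 \<comment> \<open>Cauchy-Schwarz passes from the mean square of the digits to their mean, the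
   quantity needed for \<open>prod_le_mean_power\<close>.\<close>
 have sum: "(\<Sum>j<N. 4*real C*(1 + \<bar>real_of_int (d j)\<bar>)) <= real N*(4*real C*(1 + real g))"
 proof -
  have "(\<Sum>j<N. \<bar>real_of_int (d j)\<bar>*1)\<^sup>2 <= (\<Sum>j<N. \<bar>real_of_int (d j)\<bar>\<^sup>2)*(\<Sum>j<N. 1\<^sup>2)" by (rule Cauchy_Schwarz_ineq_sum)
  also have "\<dots> <= (real N*(real g)\<^sup>2)*real N" using d2 by (intro mult_mono) auto
  also have "\<dots> = (real N*real g)\<^sup>2" by (simp add: power2_eq_square)
  finally have "(\<Sum>j<N. \<bar>real_of_int (d j)\<bar>)\<^sup>2 <= (real N*real g)\<^sup>2" by simp
  hence "(\<Sum>j<N. \<bar>real_of_int (d j)\<bar>) <= real N*real g" by simp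
  hence "(\<Sum>j<N. 1 + \<bar>real_of_int (d j)\<bar>) <= real N*(1 + real g)" by (simp add: sum.distrib distrib_left)
  from mult_left_mono[OF this, of "4*real C"] show ?thesis by (simp add: sum_distrib_left mult_ac)
 qed
 obtain w where w: "!!j. - int (2^w j div 2) <= d j & d j + int (2^w j div 2) < 2^w j & (2 :: int)^w j <= 4*(1 + \<bar>d j\<bar>)"
 proof -
  have "\<forall>j. \<exists>w. - int (2^w div 2) <= d j & d j + int (2^w div 2) < 2^w & (2 :: int)^w <= 4*(1 + \<bar>d j\<bar>)"
   using digit_width by blast
  from choice[OF this] show ?thesis using that by blast
 qed
 have wC: "w j < C" if "j < N" for j
 proof (rule C)
  have "int (2^w j) <= int (4*(1 + N*g))" using w[of j] dj[OF that] by simp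
  thus "2^w j <= 4*(1 + N*g)" by (simp only: of_nat_le_iff)
 qed
 obtain k where k: "k < (\<Prod>v<N. C*2^w v)" "!!v. v < N ==> digit C k v = d v"
  using digits_encode[of N w C d] wC w by blast
 have C0: "0 < C" using wC[OF N_pos] by simp
 have "real (\<Prod>v<N. C*2^w v) <= (\<Prod>v<N. 4*real C*(1 + \<bar>real_of_int (d v)\<bar>))"
  unfolding of_nat_prod
 proof (rule prod_mono, intro conjI)
  fix v
  have "(2 :: int)^w v <= 4*(1 + \<bar>d v\<bar>)" using w by blast
  hence "real_of_int (2^w v) <= real_of_int (4*(1 + \<bar>d v\<bar>))" by (simp only: of_int_le_iff)
  hence "(2 :: real)^w v <= 4*(1 + \<bar>real_of_int (d v)\<bar>)" by simp
  from mult_left_mono[OF this, of "real C"] show "real (C*2^w v) <= 4*real C*(1 + \<bar>real_of_int (d v)\<bar>)" by (simp add: algebra_simps)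
 qed simp
 also have "\<dots> <= (4*real C*(1 + real g))^N"
  by (rule prod_le_mean_power[OF _ sum]) (use C0 in auto)
 also have "\<dots> = real ((4*C*(1 + g))^N)" by (simp only: of_nat_power of_nat_mult of_nat_add of_nat_numeral of_nat_1)
 finally have kk: "k < (4*C*(1 + g))^N" using k(1) by linarith
 have yk: "sp_y m C k i = y i" if "i < N" for i
  unfolding sp_y_def d(1)[OF that] by (rule sum_cong) (simp add: k(2))
 have cz: "sp_cz m p c C k i = int p*x i + (\<Sum>j<N. sp_h m c i j * sp_y m C k j)" if i: "i < N" for i
 proof -
  define v where "v = int p*x i + (\<Sum>j<N. sp_h m c i j * sp_y m C k j)"
  have wv: "sp_w m c C k i = v - int p*x i" by (simp add: sp_w_def v_def)
  have rv: "real_of_int v = real p*(of_int (x i) + hank (svec p c) ?ry i)"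
  by (simp add: v_def yk h_hank[OF p, symmetric] distrib_left)
  have "(of_int (x i) + hank (svec p c) ?ry i)\<^sup>2 <= nB (%i. of_int (x i) + hank (svec p c) ?ry i)"
   by (rule val_sq_le_nB[OF i])
  also have "\<dots> < 1 / 4"
  proof (rule ccontr)
   assume "\<not> nB (%i. of_int (x i) + hank (svec p c) ?ry i) < 1 / 4"
   hence "real \<alpha>*(1 / 4) <= real \<alpha>*nB (%i. of_int (x i) + hank (svec p c) ?ry i)" by (intro mult_left_mono) auto
   thus False using nB R(2) by simp
  qed
  finally have "(of_int (x i) + hank (svec p c) ?ry i)\<^sup>2 < (1 / 2)\<^sup>2" by (simp add: power2_eq_square)
  hence "\<bar>of_int (x i) + hank (svec p c) ?ry i\<bar> < 1 / 2"
   using power2_less_imp_less[of "\<bar>of_int (x i) + hank (svec p c) ?ry i\<bar>" "1 / 2"] by simp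
  hence "\<bar>real_of_int v\<bar> < real p / 2" unfolding rv using p by (simp add: abs_mult)
  hence "2 * v < int p" "- int p < 2 * v" by auto
  hence v: "0 <= v + int p div 2" "v + int p div 2 < int p" by auto
  have "sp_w m c C k i + int p*2^m + int p div 2 = (v + int p div 2) + int p*(2^m - x i)"
   unfolding wv by (simp add: algebra_simps)
  hence "sp_cz m p c C k i = v" unfolding sp_cz_def \<open>_ = (v + int p div 2) + int p*(2^m - x i)\<close> using v by simp
  thus ?thesis by (simp add: v_def)
 qed
 have "of_int (sp_q m \<alpha> p c C k) / real (sp_den m \<alpha> p) = qf \<alpha> p c x (sp_y m C k)"
  unfolding sp_q_def qf_def by (rule form_quot[OF p \<alpha> cz])
 also have "\<dots> = qf \<alpha> p c x y" by (rule qf_cong) (auto simp: yk)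
 finally have q: "of_int (sp_q m \<alpha> p c C k) / real (sp_den m \<alpha> p) = qf \<alpha> p c x y" .
 thus ?thesis using kk le qf_pos[OF \<alpha> y, of p c x] by auto
qed

text \<open>If all grid points were bad, \<open>average_bound\<close> would contradict
  \<open>margin\<close>. The slack \<open>t\<close> is shared by
  \<open>2 * sqrt R0 * \<theta>\<close>, \<open>\<theta>^2\<close>, \<open>\<tau> = t / 4\<close>
  and \<open>N / (4 * \<alpha>) = 1 / (4 * K)\<close>, each at most \<open>t / 4\<close>. Enlarging
  \<open>R0\<close> to \<open>R0 + t\<close> multiplies the volume by at most
  \<open>exp (9 * t)\<close>, because \<open>R0\<close> is at least \<open>N / 9\<close>.\<close>

lemma grid_good:
 fixes K s :: nat and t R0 \<epsilon> :: real
 assumes \<alpha>: "\<alpha> = K*N" and p: "p = K*K*N*N * s*2^card P" and K: "0 < K"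
  and s: "real N <= (real s)\<^sup>2"
  and t: "0 < t" "t <= 1" "1 / real K <= t" and R0: "real N / 9 <= R0" "R0 <= real N"
  and vol: "unit_ball_vol (real (2*N)) * R0^N = (1 - \<epsilon>)*real m" and \<epsilon>: "\<epsilon> < 1"
  and margin: "(1 - \<epsilon>)*exp (9*t) < 1 - 16 / (3*(real K)\<^sup>2*t\<^sup>2) - 16 / (3*real K*t\<^sup>2)"
 shows "\<exists>k<p^N. \<forall>x y. (\<exists>i<N. y i ~= 0) --> R0 < qf \<alpha> p (%l. k div p^l mod p) x y"
proof (rule ccontr)
 assume neg: "\<not> ?thesis"
 have N: "0 < real N" using N_pos by simp
 have s0: "0 < s" using s N by (cases s) auto
 have \<alpha>0: "0 < \<alpha>" and p0: "0 < p" using \<alpha> p K N_pos s0 by auto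
 have R0p: "0 < R0" using R0 N by linarith
 define \<theta> where "\<theta> = t / (8 * sqrt N)"
 have \<theta>: "0 < \<theta>" using t N by (simp add: \<theta>_def)
 have \<theta>2: "\<theta>\<^sup>2 = t\<^sup>2 / (64*real N)" by (simp add: \<theta>_def power_divide)
 have slack: "2 * sqrt R0*\<theta> + \<theta>\<^sup>2 + t / 4 + real N / (4*real \<alpha>) <= t"
 proof -
  have "sqrt R0*\<theta> <= sqrt N*\<theta>" using R0 \<theta> by simp
  also have "\<dots> = t / 8" using N by (simp add: \<theta>_def)
  finally have 1: "2 * sqrt R0*\<theta> <= t / 4" by simp
  have "1 <= real N" using N_pos by linarith
  hence "64 <= 64*real N" by linarith
  hence "t\<^sup>2 / (64*real N) <= t\<^sup>2 / 64" by (intro divide_left_mono) (use m in simp_all)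
  also have "\<dots> <= t / 4" using t by (simp add: power2_eq_square)
  finally have 2: "\<theta>\<^sup>2 <= t / 4" unfolding \<theta>2 .
  have "real N / (4*real \<alpha>) = (1 / real K) / 4" using N unfolding \<alpha> by simp
  also have "\<dots> <= t / 4" using t(3) by simp
  finally show ?thesis using 1 2 by linarith
 qed
 have "\<exists>x y. (\<exists>i<N. y i ~= 0) & real \<alpha>*nB (%i. of_int (x i) + hank (%l. real (c l) / real p) (%j. of_int (y j)) i) + nA (%j. of_int (y j)) / real \<alpha> <= R0"
  if c: "c \<in> PiE {..<N} (%_. {..<p})" for c
 proof -
  obtain k where k: "k < p^N" "!!l. l < N ==> k div p^l mod p = c l"
   using base_digits[of N c p] c by auto
  obtain x y where xy: "\<exists>i<N. y i ~= 0" "qf \<alpha> p (%l. k div p^l mod p) x y <= R0" using neg k(1) by (metis linorder_not_le)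
  have "qf \<alpha> p (%l. k div p^l mod p) x y = qf \<alpha> p c x y" by (rule qf_cong) (use k(2) in auto)
  hence "qf \<alpha> p c x y <= R0" using xy(2) by simp
  thus ?thesis using xy(1) unfolding qf_def svec_def[abs_def] by blast
 qed
 hence "real m*(1 - (real \<alpha>)\<^sup>2*real N*(2^card P)\<^sup>2 * R0 / (12*(real p)\<^sup>2*\<theta>\<^sup>2) - R0 / (3*real \<alpha>*(t/4)\<^sup>2))
  <= unit_ball_vol (real (2*N))*(R0 + t)^N"
  using \<alpha>0 p0 R0p \<theta> t slack by (intro average_bound) auto
 also have "\<dots> <= unit_ball_vol (real (2*N))*(R0^N*exp (9*t))"
 proof (rule mult_left_mono)
  have "(R0 + t)^N = R0^N*(1 + t / R0)^N" using R0p by (simp add: power_mult_distrib[symmetric] distrib_left)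
  also have "(1 + t / R0)^N <= exp (t / R0)^N"
   using exp_ge_add_one_self[of "t / R0"] t R0p by (intro power_mono) auto
  also have "\<dots> = exp (real N*(t / R0))" by (rule exp_of_nat_mult[symmetric])
  also have "\<dots> <= exp (9*t)"
   using R0(1) R0p t by (simp add: field_simps)
  finally show "(R0 + t)^N <= R0^N*exp (9*t)" using R0p by simp
 qed simp
 also have "\<dots> = real m*((1 - \<epsilon>)*exp (9*t))" using vol by simp
 finally have A: "1 - (real \<alpha>)\<^sup>2*real N*(2^card P)\<^sup>2 * R0 / (12*(real p)\<^sup>2*\<theta>\<^sup>2) - R0 / (3*real \<alpha>*(t/4)\<^sup>2) <= (1 - \<epsilon>)*exp (9*t)"
  using m by simp
 have "(real \<alpha>)\<^sup>2*real N*(2^card P)\<^sup>2 * R0 / (12*(real p)\<^sup>2*\<theta>\<^sup>2) <= 16 / (3*(real K)\<^sup>2*t\<^sup>2)"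
 proof -
  let ?T = "2^card P :: real"
  \<comment> \<open>The factors of \<open>p\<close> are made to cancel: \<open>2 ^ card P\<close>
    against \<open>T\<close>, \<open>N * N\<close> against \<open>\<alpha>\<close> and the two
    further factors \<open>N\<close>, one of them from \<open>\<theta>\<close>, and
    \<open>s\<close>, about \<open>sqrt N\<close>, against \<open>R0\<close>. One of the two factors
    \<open>K\<close> remains and makes the error small.\<close>
  have "(real \<alpha>)\<^sup>2*real N*?T\<^sup>2 * R0 / (12*(real p)\<^sup>2*\<theta>\<^sup>2)
   = (16 / (3*(real K)\<^sup>2*t\<^sup>2))*(R0 / (real s)\<^sup>2)"
   unfolding \<theta>2 \<alpha> p using K N s0 t by (simp add: field_simps power2_eq_square)
  also have "\<dots> <= (16 / (3*(real K)\<^sup>2*t\<^sup>2))*1"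
  proof (rule mult_left_mono)
   have "R0 <= (real s)\<^sup>2" using R0(2) s by linarith
   thus "R0 / (real s)\<^sup>2 <= 1" using s0 by simp
  qed simp
  finally show ?thesis by simp
 qed
 moreover have "R0 / (3*real \<alpha>*(t/4)\<^sup>2) <= 16 / (3*real K*t\<^sup>2)"
 using K N t R0(2) by (simp add: \<alpha> field_simps power2_eq_square)
 ultimately show False using A margin by linarith
qed

end

section \<open>Number of prime factors and growth of the totient\<close>

lemma two_power_omega_le:
 fixes \<delta> :: real
 assumes \<delta>: "0 < \<delta>"
 shows "\<exists>C>0. \<forall>m>0. 2^card (prime_factors m) <= C*real m powr \<delta>"
proof -
 define X where "X = 2 powr (1 / \<delta>)"
 \<comment> \<open>A prime \<open>q\<close> outside \<open>A\<close> has
   \<open>q powr \<delta>\<close> at least 2 and pays for its own factor 2; the numbers in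
   \<open>A\<close> are finitely many and go into the constant.\<close>
 define A where "A = {q :: nat. real q <= X}"
 have A: "finite A" unfolding A_def by (rule finite_subset[of _ "{..nat \<lfloor>X\<rfloor>}"]) (auto simp: le_nat_floor)
 have "2^card (prime_factors m) <= 2^card A*real m powr \<delta>" if m: "0 < m" for m :: nat
 proof -
  let ?P = "prime_factors m"
  have "(2 :: real)^card ?P = (\<Prod>q\<in>?P. 2)" by simp
  also have "\<dots> = (\<Prod>q\<in>?P \<inter> A. 2)*(\<Prod>q\<in>?P - A. 2)"
   by (rule prod.Int_Diff) simp
  also have "\<dots> <= 2^card A*(\<Prod>q\<in>?P. real q powr \<delta>)"
  proof (rule mult_mono)
   show "(\<Prod>q\<in>?P \<inter> A. 2) <= (2 :: real)^card A" using A by (auto intro!: card_mono)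
   have "(\<Prod>q\<in>?P - A. 2) <= (\<Prod>q\<in>?P - A. real q powr \<delta>)"
   proof (rule prod_mono, intro conjI)
    fix q assume "q \<in> ?P - A"
    hence "2 powr (1 / \<delta>) < real q" by (auto simp: A_def X_def)
    hence "(2 powr (1 / \<delta>)) powr \<delta> <= real q powr \<delta>" using \<delta> by (intro powr_mono2) auto
    thus "2 <= real q powr \<delta>" using \<delta> by (simp add: powr_powr)
   qed simp
   also have "\<dots> <= (\<Prod>q\<in>?P. real q powr \<delta>)"
   proof -
    have "(\<Prod>q\<in>?P. real q powr \<delta>) = (\<Prod>q\<in>?P \<inter> A. real q powr \<delta>)*(\<Prod>q\<in>?P - A. real q powr \<delta>)"
     by (rule prod.Int_Diff) simp
    moreover have "1 <= (\<Prod>q\<in>?P \<inter> A. real q powr \<delta>)"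
    proof (rule prod_ge_1)
     fix q assume "q \<in> ?P \<inter> A"
     hence "1 <= q" using prime_ge_1_nat[of q] by auto
     thus "1 <= real q powr \<delta>" using \<delta> by (intro ge_one_powr_ge_zero) auto
    qed
    moreover have "0 <= (\<Prod>q\<in>?P - A. real q powr \<delta>)" by (intro prod_nonneg) auto
    ultimately show ?thesis by (metis mult_right_mono mult_1)
   qed
   finally show "(\<Prod>q\<in>?P - A. 2) <= (\<Prod>q\<in>?P. real q powr \<delta>)" .
  qed auto
  also have "(\<Prod>q\<in>?P. real q powr \<delta>) = (\<Prod>q\<in>?P. real q) powr \<delta>"
   by (rule prod_powr_distrib[symmetric])
  also have "\<dots> <= real m powr \<delta>"
  proof (rule powr_mono2)
   have "\<Prod>?P <= (\<Prod>p\<in>?P. p^multiplicity p m)"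
   proof (rule prod_mono, intro conjI)
    fix q assume q: "q \<in> ?P"
    hence "0 < multiplicity q m" by (auto simp: prime_factors_multiplicity)
    moreover have "0 < q" using q by (auto dest: in_prime_factors_imp_prime prime_gt_0_nat)
    ultimately show "q <= q^multiplicity q m" by (metis self_le_power Suc_leI One_nat_def)
   qed simp
   also have "\<dots> = m" using prime_factorization_nat[OF m] by simp
   finally have "real (\<Prod>?P) <= real m" by (simp only: of_nat_le_iff)
   thus "(\<Prod>q\<in>?P. real q) <= real m" by simp
  qed (use \<delta> in \<open>auto intro!: prod_nonneg\<close>)
  finally show ?thesis by simp
 qed
 thus ?thesis by (intro exI[of _ "2^card A"]) auto
qed

text \<open>Each Euler factor \<open>1 - 1 / p\<close> is at least \<open>1/2\<close>. With the
  bound on \<open>2 ^ card P\<close> this gives \<open>totient m = m^(1 - o(1))\<close>, by which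
  factors polynomial in \<open>m\<close> become negligible against the \<open>N\<close>th
  powers.\<close>

lemma le_totient_two_power_omega: "real m <= 2^card (prime_factors m)*real (totient m)"
proof -
 have "(\<Prod>p\<in>prime_factors m. (1 :: real)) <= (\<Prod>p\<in>prime_factors m. 2*(1 - 1 / real p))"
 proof (rule prod_mono, intro conjI)
  fix p assume "p \<in> prime_factors m"
  hence "2 <= real p" by (auto dest: in_prime_factors_imp_prime prime_ge_2_nat)
  thus "1 <= 2*(1 - 1 / real p)" by simp
 qed simp
 hence "1 <= 2^card (prime_factors m)*(\<Prod>p\<in>prime_factors m. 1 - 1 / real p)" by (simp only: prod.distrib prod_constant power_one)
 from mult_left_mono[OF this, of "real m"] show ?thesis unfolding totient_formula2 by (simp add: mult_ac)
qed

lemma ln_two_power_omega: "(%m. ln (2^card (prime_factors m)) / ln (real m)) \<longlonglongrightarrow> 0"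
proof (rule LIMSEQ_I)
 fix r :: real assume r: "0 < r"
 obtain C where C: "0 < C" "!!m. 0 < m ==> 2^card (prime_factors m) <= C*real m powr (r / 2)"
  using two_power_omega_le[of "r / 2"] r by auto
 have "(%m. ln C / ln (real m)) \<longlonglongrightarrow> 0" by real_asymp
 hence "\<forall>\<^sub>F m in sequentially. ln C / ln (real m) < r / 2" using r by (intro order_tendstoD) auto
 hence "\<forall>\<^sub>F m in sequentially. norm (ln (2^card (prime_factors m)) / ln (real m) - 0) < r"
  using eventually_gt_at_top[of 1]
 proof eventually_elim
  case (elim m)
  have lm: "0 < ln (real m)" using elim by simp
  have "ln ((2 :: real)^card (prime_factors m)) <= ln (C*real m powr (r / 2))" using C(2)[of m] elim by (subst ln_le_cancel_iff) (use C(1) in auto)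
  also have "\<dots> = ln C + r / 2*ln (real m)" using C(1) elim by (simp add: ln_mult)
  finally have "ln ((2 :: real)^card (prime_factors m)) / ln (real m) <= ln C / ln (real m) + r / 2" using lm by (simp add: field_simps)
  moreover have "0 <= ln ((2 :: real)^card (prime_factors m)) / ln (real m)" using lm by simp
  ultimately have "0 <= ln ((2 :: real)^card (prime_factors m)) / ln (real m)" "ln ((2 :: real)^card (prime_factors m)) / ln (real m) < r"
   using elim(1) by linarith+
  thus ?case by simp
 qed
 thus "\<exists>no. \<forall>n\<ge>no. norm (ln (2^card (prime_factors n)) / ln (real n) - 0) < r"
  by (simp add: eventually_sequentially)
qed

lemma ln_totient: "(%m. ln (real (totient m)) / ln (real m)) \<longlonglongrightarrow> 1"
proof (rule tendsto_sandwich)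
 show "\<forall>\<^sub>F m in sequentially. 1 - ln (2^card (prime_factors m)) / ln (real m) <= ln (real (totient m)) / ln (real m)"
  using eventually_gt_at_top[of 1]
 proof eventually_elim
  case (elim m)
  have "ln (real m) <= ln (2^card (prime_factors m)*real (totient m))"
   using le_totient_two_power_omega[of m] elim by simp
  also have "\<dots> = ln (2^card (prime_factors m)) + ln (real (totient m))" using elim by (intro ln_mult_pos) auto
  finally have "ln (real m) - ln (2^card (prime_factors m)) <= ln (real (totient m))" by linarith
  moreover have lm: "0 < ln (real m)" using elim by simp
  ultimately have "(ln (real m) - ln (2^card (prime_factors m))) / ln (real m) <= ln (real (totient m)) / ln (real m)"
   by (intro divide_right_mono) auto
  thus ?case using lm by (simp only: diff_divide_distrib) simp
 qed
 show "\<forall>\<^sub>F m in sequentially. ln (real (totient m)) / ln (real m) <= 1"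
  using eventually_gt_at_top[of 1]
 proof eventually_elim
  case (elim m)
  hence "ln (real (totient m)) <= ln (real m)" using totient_le[of m] by simp
  thus ?case using elim by simp
 qed
 show "(%m. 1 - ln (2^card (prime_factors m)) / ln (real m)) \<longlonglongrightarrow> 1"
  using tendsto_diff[OF tendsto_const[of 1] ln_two_power_omega] by simp
qed auto

lemma totient_at_top: "filterlim totient at_top sequentially"
proof -
 have "\<forall>\<^sub>F m in sequentially. 1 / 2 < ln (real (totient m)) / ln (real m)"
  using ln_totient by (intro order_tendstoD) auto
 hence ev: "\<forall>\<^sub>F m in sequentially. sqrt (real m) <= real (totient m)"
  using eventually_gt_at_top[of 1]
 proof eventually_elim
  case (elim m)
  have "ln (sqrt (real m)) = ln (real m) / 2" by (simp add: ln_sqrt)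
  also have "\<dots> < ln (real (totient m))" using elim by simp
  finally show ?case using elim by simp
 qed
 have "filterlim (%m. sqrt (real m)) at_top sequentially" by real_asymp
 from filterlim_at_top_mono[OF this ev] have "filterlim (%m. real (totient m)) at_top sequentially" .
 thus ?thesis by (simp add: filterlim_sequentially_iff_filterlim_real)
qed

section \<open>Programs for arithmetic expressions\<close>

type_synonym gen = "nat => program"
type_synonym ctx = "nat \<times> mem"

abbreviation "Reg i \<equiv> Load (Const i)"

text \<open>One unit pays for one assignment on words of \<open>L\<close> bits: a product takes
  quadratic time, and the factor 1000 leaves room for the few subexpressions of a command.
  Expressions are accordingly priced in thousandths of a unit, the number \<open>k\<close> of
  \<open>cheap\<close>.\<close>

definition unit_cost :: "nat => nat" where
 "unit_cost L = 1000*(L + 2)\<^sup>2"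

lemma unit_cost_ge: "1000*L + 2000 <= unit_cost L"
 by (simp add: unit_cost_def power2_eq_square)

lemma bits_le: "k < 2^j ==> 1 <= j ==> bits k <= j"
 by (auto simp: bits_def floorlog_le_iff)

text \<open>Stored values have about \<open>L\<close> bits, but an intermediate product may have
  twice as many, whence the bound \<open>2^(2 * L + 2)\<close>.\<close>

definition cheap :: "nat => nat => aexp => mem => bool" where
 "cheap L k e s \<longleftrightarrow> 1000*acost e s <= k*unit_cost L & aval e s < 2^(2*L + 2)"

lemma cheap_bits: "cheap L k e s ==> bits (aval e s) <= 2*L + 2"
 using bits_le[of "aval e s" "2*L + 2"] by (simp add: cheap_def)

lemma cheap_mono: "cheap L k e s ==> k <= l ==> cheap L l e s"
 unfolding cheap_def by (meson le_trans mult_le_mono1)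

lemma big_pow: "10 <= L ==> x <= 1000 ==> x <= (2 :: nat)^L"
 using power_increasing[of 10 L "2 :: nat"] by simp

lemma le_pow22: "x <= 2^L ==> x < (2 :: nat)^(2*L + 2)"
 by (erule le_less_trans) (rule power_strict_increasing, auto)

lemma bits_le22: "x <= 2^L ==> bits x <= 2*L + 2"
 by (rule bits_le[OF le_pow22]) auto

lemma cheap_Const: "k < 2^(2*L + 2) ==> cheap L 2 (Const k) s"
 using bits_le[of k "2*L + 2"] unit_cost_ge[of L] by (simp add: cheap_def)

lemma cheap_Num: "10 <= L ==> k <= 1000 ==> cheap L 2 (Const k) s"
 by (intro cheap_Const le_pow22 big_pow)

lemma cheap_Load:
 assumes "cheap L k e s" "s (aval e s) <= 2^L"
 shows "cheap L (k + 4) (Load e) s"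
 using assms le_pow22[OF assms(2)] cheap_bits[OF assms(1)] bits_le22[OF assms(2)] unit_cost_ge[of L]
 unfolding cheap_def acost.simps aval.simps add_mult_distrib add_mult_distrib2 by simp

lemma cheap_Reg: "10 <= L ==> i <= 1000 ==> s i <= 2^L ==> cheap L 6 (Reg i) s"
 using cheap_Load[OF cheap_Num] by simp

lemma cheap_Add:
 assumes "cheap L k e s" "cheap L l f s" "aval e s <= 2^L" "aval f s <= 2^L"
 shows "cheap L (k + l + 4) (Add e f) s"
proof -
 have "(2 :: nat)^(2*L + 2) = 4*(2^L*2^L)" by (simp add: power_add mult_2)
 moreover have "(2 :: nat)^L <= 2^L*2^L" by simp
 ultimately have "aval e s + aval f s < 2^(2*L + 2)" using assms(3,4) zero_less_power[of "2 :: nat" L] by linarith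
 thus ?thesis using assms cheap_bits[OF assms(1)] cheap_bits[OF assms(2)] unit_cost_ge[of L] unfolding cheap_def aval.simps add_mult_distrib add_mult_distrib2 by auto
qed

lemma cheap_Sub: "cheap L k e s ==> cheap L l f s ==> cheap L (k + l + 4) (Sub e f) s"
 using cheap_bits[of L k e s] cheap_bits[of L l f s] unit_cost_ge[of L] unfolding cheap_def aval.simps add_mult_distrib add_mult_distrib2 by auto

lemma bits_mult_le:
 assumes "cheap L k e s" "cheap L l f s"
 shows "1000*(bits (aval e s)*bits (aval f s)) <= 4*unit_cost L"
proof -
 have "bits (aval e s)*bits (aval f s) <= (2*L + 4)*(2*L + 4)"
  using cheap_bits[OF assms(1)] cheap_bits[OF assms(2)] by (intro mult_le_mono) auto
 thus ?thesis by (simp add: unit_cost_def power2_eq_square algebra_simps)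
qed

lemma cheap_Mul:
 assumes "cheap L k e s" "cheap L l f s" "aval e s*aval f s < 2^(2*L + 2)"
 shows "cheap L (k + l + 4) (Mul e f) s"
 using assms bits_mult_le[OF assms(1,2)] unfolding cheap_def aval.simps add_mult_distrib add_mult_distrib2 by simp

lemma cheap_Mul': "cheap L k e s ==> cheap L l f s ==> aval e s <= 2^L ==> aval f s <= 2^L ==> cheap L (k + l + 4) (Mul e f) s"
 by (intro cheap_Mul le_less_trans[OF mult_le_mono[of "aval e s" "2^L" "aval f s" "2^L"]]) (auto simp flip: power_add mult_2)

lemma cheap_Quot:
 assumes "cheap L k e s" "cheap L l f s"
 shows "cheap L (k + l + 4) (Quot e f) s"
 using assms bits_mult_le[OF assms] div_le_dividend[of "aval e s" "aval f s"]
 unfolding cheap_def acost.simps aval.simps add_mult_distrib add_mult_distrib2 by (safe; linarith)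

text \<open>Register 1 always holds \<open>2^L\<close>. Reduction by it makes a register an element
  of the integers modulo \<open>2^L\<close>, so that negative numbers are represented as in two's
  complement.\<close>

definition Mdl :: "aexp => aexp" where
 "Mdl e = Sub e (Mul (Reg 1) (Quot e (Reg 1)))"

lemma aval_Mdl: "aval (Mdl e) s = aval e s mod s 1"
 by (simp add: Mdl_def minus_mult_div_eq_mod)

lemma cheap_Mdl:
 assumes "cheap L k e s" "s 1 = 2^L" "10 <= L"
 shows "cheap L (k + (6 + (k + 6 + 4) + 4) + 4) (Mdl e) s"
proof -
 have g: "cheap L 6 (Reg 1) s" by (rule cheap_Reg) (use assms in auto)
 have "s 1*(aval e s div s 1) < 2^(2*L + 2)"
  using assms(1) times_div_less_eq_dividend[of "s 1" "aval e s"] unfolding cheap_def by linarith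
 thus ?thesis unfolding Mdl_def by (intro cheap_Sub cheap_Mul cheap_Quot assms(1) g) simp
qed

definition reach :: "nat => program => mem => nat => (mem => bool) => bool" where
 "reach L c s U Q \<longleftrightarrow> (\<exists>u s'. runs c s u s' & u <= U*unit_cost L & Q s')"

lemma reach_mono: "reach L c s U P ==> U <= V ==> (!!s'. P s' ==> Q s') ==> reach L c s V Q"
 unfolding reach_def by (meson le_trans mult_le_mono1)

lemma reach_seq:
 assumes "reach L c s U P" "!!s'. P s' ==> reach L d s' V Q" "U + V <= W"
 shows "reach L (Seq c d) s W Q"
proof -
 obtain u s' v s'' where 1: "runs c s u s'" "u <= U*unit_cost L" "runs d s' v s''" "v <= V*unit_cost L" "Q s''"
  using assms unfolding reach_def by meson
 have "u + v <= (U + V)*unit_cost L" using 1 by (simp add: add_mult_distrib)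
 also have "\<dots> <= W*unit_cost L" using assms(3) by simp
 finally show ?thesis using runs.Seq[OF 1(1,3)] 1(5) unfolding reach_def by blast
qed

lemma reach_store:
 assumes "cheap L k e s" "cheap L l f s" "k + l <= 900" "Q (s(aval e s := aval f s))"
 shows "reach L (Store e f) s 1 Q"
proof -
 have "(k + l)*unit_cost L <= 900*unit_cost L" using assms(3) by simp
 hence "acost e s + acost f s + bits (aval e s) + bits (aval f s) <= 1*unit_cost L"
  using assms(1,2) cheap_bits[OF assms(1)] cheap_bits[OF assms(2)] unit_cost_ge[of L]
  unfolding cheap_def add_mult_distrib add_mult_distrib2 by linarith
 thus ?thesis using runs.Store assms(4) unfolding reach_def by blast
qed

text \<open>The invariant is indexed by the number of rounds done; the same index proves termination
  and counts the cost.\<close>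

lemma reach_while:
 assumes step: "!!j s. j < n ==> I j s ==> aval e s ~= 0 & cheap L 100 e s & reach L b s V (I (Suc j))"
  and stop: "!!s. I n s ==> aval e s = 0 & cheap L 100 e s" and I: "I 0 s"
 shows "reach L (While e b) s (n*(V + 1) + 1) (I n)"
proof -
 have c: "acost e s + bits (aval e s) <= unit_cost L" if "cheap L 100 e s" for s
  using that cheap_bits[OF that] unit_cost_ge[of L] unfolding cheap_def by linarith
 have "j <= n ==> I j s ==> reach L (While e b) s ((n - j)*(V + 1) + 1) (I n)" for j s
 proof (induction "n - j" arbitrary: j s)
  case 0
  hence "I n s" by simp
  with runs.WhileFalse[of e s b] c[of s] stop[of s] 0 show ?case unfolding reach_def by auto
 next
  case (Suc k)
  hence j: "j < n" "k = n - Suc j" "Suc j <= n" by auto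
  from step[OF j(1) Suc.prems(2)] obtain u s' where 1: "aval e s ~= 0" "cheap L 100 e s"
   "runs b s u s'" "I (Suc j) s'" "u <= V*unit_cost L" unfolding reach_def by auto
  from Suc.hyps(1)[OF j(2,3) 1(4)] obtain w s'' where 2: "runs (While e b) s' w s''" "I n s''"
   "w <= ((n - Suc j)*(V + 1) + 1)*unit_cost L" unfolding reach_def by auto
  have "(n - j)*(V + 1) + 1 = (n - Suc j)*(V + 1) + 1 + V + 1" using j(1) by (simp add: Suc_diff_Suc[symmetric])
  hence "acost e s + bits (aval e s) + u + w <= ((n - j)*(V + 1) + 1)*unit_cost L"
   using 1(5) 2(3) c[OF 1(2)] by (simp only: add_mult_distrib)
  with runs.WhileTrue[OF 1(1,3) 2(1)] 2(2) show ?case unfolding reach_def by blast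
 qed
 from this[of 0 s] I show ?thesis by simp
qed

section \<open>Generators of code for expressions\<close>

definition frame :: "nat => nat => mem => mem => bool" where
 "frame d h s s' \<longleftrightarrow> (\<forall>i. i < d \<or> d + h <= i --> s' i = s i)"

definition ready :: "nat => ctx => nat => nat => mem => bool" where
 "ready L c d h s \<longleftrightarrow> fst c <= d & 2 <= d & d + h <= 1000 & 10 <= L & s 1 = 2^L & (\<forall>i<fst c. s i = snd c i)"

text \<open>Code for an expression is told the register \<open>d\<close> for its result and may use
  \<open>h\<close> registers from there on; everything below \<open>d\<close> survives, so
  subexpressions are stacked. The value is specified as an integer modulo \<open>2^L\<close>: ring
  operations are then correct without conditions, while division and comparison ask for values in
  range.\<close>

definition ev :: "nat => ctx => gen => int => nat => nat => bool" where
 "ev L c g v S h \<longleftrightarrow> (\<forall>d s. ready L c d h s --> reach L (g d) s S (%s'. int (s' d) = v mod 2^L & frame d h s s'))"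

lemma evD:
 assumes "ev L c g v S h" "ready L c d h s"
  "!!s'. int (s' d) = v mod 2^L ==> s' d < 2^L ==> frame d h s s' ==> Q s'"
 shows "reach L (g d) s S Q"
proof -
 have "x < 2^L" if "int x = v mod 2^L" for x
 proof -
  have "int x < int (2^L)" using that by simp
  thus ?thesis by simp
 qed
 thus ?thesis using assms unfolding ev_def by (blast intro: reach_mono[OF _ order_refl])
qed

lemma ev_weaken:
 assumes "ev L c g v' S' h'" "v' mod 2^L = v mod 2^L" "S' <= S" "h' <= h"
 shows "ev L c g v S h"
 unfolding ev_def
proof (intro allI impI)
 fix d s assume "ready L c d h s"
 hence "ready L c d h' s" using assms(4) by (simp add: ready_def)
 with assms(1) have "reach L (g d) s S' (%s'. int (s' d) = v' mod 2^L & frame d h' s s')" by (simp only: ev_def)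
 thus "reach L (g d) s S (%s'. int (s' d) = v mod 2^L & frame d h s s')"
  by (rule reach_mono) (use assms in \<open>auto simp: frame_def\<close>)
qed

definition ctx_le :: "ctx => ctx => bool" (infix "\<preceq>" 50) where
 "c \<preceq> c' \<longleftrightarrow> fst c <= fst c' & (\<forall>i<fst c. snd c' i = snd c i)"

lemma ctx_le_trans: "c \<preceq> c' ==> c' \<preceq> c'' ==> c \<preceq> c''" by (auto simp: ctx_le_def)

lemma ev_ctx: "ev L c g v S h ==> c \<preceq> c' ==> ev L c' g v S h"
by (simp add: ev_def ready_def ctx_le_def)

lemma ev_store:
 assumes "!!d s. ready L c d 1 s ==> cheap L 100 e s & int (aval e s) = v mod 2^L"
 shows "ev L c (%d. Store (Const d) e) v 1 1"
 unfolding ev_def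
proof (intro allI impI)
 fix d s assume r: "ready L c d 1 s"
 show "reach L (Store (Const d) e) s 1 (%s'. int (s' d) = v mod 2^L & frame d 1 s s')"
  by (rule reach_store[OF cheap_Num conjunct1[OF assms[OF r]]]) (use r assms[OF r] in \<open>auto simp: ready_def frame_def\<close>)
qed

definition "g_var i = (%d. Store (Const d) (Reg i))"
definition "g_const k = (%d. Store (Const d) (Const k))"

lemma ev_var:
 assumes "i < fst c" "snd c i < 2^L" "i <= 1000" "int (snd c i) = v mod 2^L"
 shows "ev L c (g_var i) v 1 1"
 unfolding g_var_def by (rule ev_store) (use assms in \<open>auto simp: ready_def intro!: cheap_mono[OF cheap_Reg]\<close>)

lemma ev_const:
 assumes "k < 2^10"
 shows "ev L c (g_const k) (int k) 1 1"
 unfolding g_const_def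
proof (rule ev_store)
 fix d s assume "ready L c d 1 s"
 hence k: "k < 2^L" using less_le_trans[OF assms power_increasing[of 10 L]] by (simp add: ready_def)
 hence "int k mod 2^L = int k" by simp
 thus "cheap L 100 (Const k) s & int (aval (Const k) s) = int k mod 2^L"
  using k by (auto intro!: cheap_mono[OF cheap_Const] le_pow22)
qed

definition "g_bin f a b = (%d. Seq (a d) (Seq (b (Suc d)) (Store (Const d) (f (Reg d) (Reg (Suc d))))))"

lemma ev_bin:
 assumes ea: "ev L c a va Sa ha" and eb: "ev L c b vb Sb hb" and h: "ha <= h" "Suc hb <= h" "2 <= h"
 and op: "!!s x y. 10 <= L ==> s 1 = 2^L ==> cheap L 6 x s ==> cheap L 6 y s ==> aval x s < 2^L ==> aval y s < 2^L ==>
   int (aval x s) = va mod 2^L ==> int (aval y s) = vb mod 2^L ==>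
   cheap L 100 (f x y) s & int (aval (f x y) s) = v mod 2^L"
 shows "ev L c (g_bin f a b) v (Sa + Sb + 1) h"
 unfolding ev_def g_bin_def
proof (intro allI impI)
 fix d s assume r: "ready L c d h s"
 let ?P = "%t. t 1 = 2^L & frame d h s t & int (t d) = va mod 2^L & t d < 2^L"
 have 1: "reach L (a d) s Sa (%t. ready L c (Suc d) hb t & ?P t)"
  by (rule evD[OF ea]) (use r h in \<open>auto simp: ready_def frame_def\<close>)
 have 2: "reach L (b (Suc d)) t Sb (%u. ?P u & int (u (Suc d)) = vb mod 2^L & u (Suc d) < 2^L)"
  if "ready L c (Suc d) hb t & ?P t" for t
  by (rule evD[OF eb]) (use that h in \<open>auto simp: ready_def frame_def\<close>)
 have 3: "reach L (Store (Const d) (f (Reg d) (Reg (Suc d)))) u 1 (%s'. int (s' d) = v mod 2^L & frame d h s s')"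
  if u: "?P u & int (u (Suc d)) = vb mod 2^L & u (Suc d) < 2^L" for u
 proof -
  have "cheap L 6 (Reg d) u" "cheap L 6 (Reg (Suc d)) u" by (rule cheap_Reg; use r h u in \<open>simp add: ready_def\<close>)+
  hence o: "cheap L 100 (f (Reg d) (Reg (Suc d))) u & int (aval (f (Reg d) (Reg (Suc d))) u) = v mod 2^L"
   using r u by (intro op) (auto simp: ready_def)
  show ?thesis by (rule reach_store[OF cheap_Num conjunct1[OF o]]) (use r h u o in \<open>auto simp: ready_def frame_def\<close>)
 qed
 show "reach L (Seq (a d) (Seq (b (Suc d)) (Store (Const d) (f (Reg d) (Reg (Suc d)))))) s (Sa + Sb + 1)
   (%s'. int (s' d) = v mod 2^L & frame d h s s')"
  by (rule reach_seq[OF 1 reach_seq[OF 2 3 order_refl]]) auto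
qed

lemma ev_bin_nat:
 assumes "ev L c a va Sa ha" "ev L c b vb Sb hb" "ha <= h" "Suc hb <= h" "2 <= h"
  and v: "0 <= va" "va < 2^L" "0 <= vb" "vb < 2^L" "0 <= v" "10 <= L ==> v < 2^L"
  and op: "!!s x y. 10 <= L ==> cheap L 6 x s ==> cheap L 6 y s ==> aval x s < 2^L ==> aval y s < 2^L ==>
   int (aval x s) = va ==> int (aval y s) = vb ==> cheap L 100 (f x y) s & int (aval (f x y) s) = v"
 shows "ev L c (g_bin f a b) v (Sa + Sb + 1) h"
 by (rule ev_bin[OF assms(1-5)]) (use op v in simp)

text \<open>\<open>g_sub\<close> adds the modulus first because subtraction of naturals is
  truncated. Comparison, equality and minimum exploit just this truncation: \<open>x - y\<close> is
  0 iff \<open>x <= y\<close>, and \<open>x - (x - y)\<close> is the minimum.\<close>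

definition "g_add = g_bin (%x y. Mdl (Add x y))"
definition "g_sub = g_bin (%x y. Mdl (Sub (Add x (Reg 1)) y))"
definition "g_mul = g_bin (%x y. Mdl (Mul x y))"
definition "g_div = g_bin Quot"
definition "g_mod = g_bin (%x y. Sub x (Mul y (Quot x y)))"
definition "g_le = g_bin (%x y. Sub (Const 1) (Sub x y))"
definition "g_eq = g_bin (%x y. Sub (Const 1) (Add (Sub x y) (Sub y x)))"
definition "g_min = g_bin (%x y. Sub x (Sub x y))"

context
 fixes L c a b va vb Sa Sb ha hb h
 assumes ab: "ev L c a va Sa ha" "ev L c b vb Sb hb" "ha <= h" "Suc hb <= h" "2 <= h"
begin

lemma ev_add: "ev L c (g_add a b) (va + vb) (Sa + Sb + 1) h"
 unfolding g_add_def
 by (rule ev_bin[OF ab], rule conjI, rule cheap_mono[OF cheap_Mdl[OF cheap_Add]]) (auto simp: aval_Mdl zmod_int mod_add_eq)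

lemma ev_mul: "ev L c (g_mul a b) (va * vb) (Sa + Sb + 1) h"
 unfolding g_mul_def
 by (rule ev_bin[OF ab], rule conjI, rule cheap_mono[OF cheap_Mdl[OF cheap_Mul']]) (auto simp: aval_Mdl zmod_int mod_mult_eq)

lemma ev_sub: "ev L c (g_sub a b) (va - vb) (Sa + Sb + 1) h"
 unfolding g_sub_def
proof (rule ev_bin[OF ab], rule conjI, rule cheap_mono[OF cheap_Mdl[OF cheap_Sub[OF cheap_Add[OF _ cheap_Reg]]]])
 fix s x y assume a: "s 1 = 2^L" "aval y s < 2^L" "int (aval x s) = va mod 2^L" "int (aval y s) = vb mod 2^L"
 have "int ((aval x s + s 1 - aval y s) mod 2^L) = (va mod 2^L - vb mod 2^L + 2^L) mod 2^L"
  using a by (simp add: zmod_int algebra_simps)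
 thus "int (aval (Mdl (Sub (Add x (Reg 1)) y)) s) = (va - vb) mod 2^L"
  using a(1) by (simp add: aval_Mdl mod_diff_eq)
qed auto

context
 assumes v: "0 <= va" "va < 2^L" "0 <= vb" "vb < 2^L"
begin

lemma ev_div: "ev L c (g_div a b) (va div vb) (Sa + Sb + 1) h"
 unfolding g_div_def
proof (rule ev_bin_nat[OF ab v])
 show "0 <= va div vb" using v by (auto simp: div_int_pos_iff)
 show "va div vb < 2^L"
 proof (cases "vb = 0")
  case False
  hence "va div vb <= va" using v by (auto intro: zdiv_mono2[of va 1 vb, simplified])
  thus ?thesis using v by linarith
 qed simp
qed (auto simp: zdiv_int intro!: cheap_mono[OF cheap_Quot])

lemma ev_mod: "ev L c (g_mod a b) (va mod vb) (Sa + Sb + 1) h"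
 unfolding g_mod_def
proof (rule ev_bin_nat[OF ab v])
 show "0 <= va mod vb" using v by (cases "vb = 0") auto
 show "va mod vb < 2^L" using v zmod_le_nonneg_dividend[of va vb] by linarith
 fix s x y assume a: "cheap L 6 x s" "cheap L 6 y s" "aval x s < 2^L" "aval y s < 2^L" "int (aval x s) = va" "int (aval y s) = vb"
 have "aval x s div aval y s <= 2^L" using a(3) div_le_dividend[of "aval x s" "aval y s"] by linarith
 hence "cheap L (6 + (6 + (6 + 6 + 4) + 4) + 4) (Sub x (Mul y (Quot x y))) s"
  using a by (intro cheap_Sub cheap_Mul' cheap_Quot) auto
 hence "cheap L 100 (Sub x (Mul y (Quot x y))) s" by (rule cheap_mono) simp
 moreover have "int (aval x s - aval y s*(aval x s div aval y s)) = va mod vb"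
  using a(5,6) by (simp only: minus_mult_div_eq_mod zmod_int)
 ultimately show "cheap L 100 (Sub x (Mul y (Quot x y))) s & int (aval (Sub x (Mul y (Quot x y))) s) = va mod vb"
  by simp
qed

lemma ev_le: "ev L c (g_le a b) (of_bool (va <= vb)) (Sa + Sb + 1) h"
 unfolding g_le_def
 by (rule ev_bin_nat[OF ab v], simp, simp add: one_less_power, rule conjI, rule cheap_mono[OF cheap_Sub[OF cheap_Num cheap_Sub]])
  auto

lemma ev_eq: "ev L c (g_eq a b) (of_bool (va = vb)) (Sa + Sb + 1) h"
 unfolding g_eq_def
 by (rule ev_bin_nat[OF ab v], simp, simp add: one_less_power, rule conjI,
   rule cheap_mono[OF cheap_Sub[OF cheap_Num cheap_Add[OF cheap_Sub cheap_Sub]]]) auto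

lemma ev_min: "ev L c (g_min a b) (min va vb) (Sa + Sb + 1) h"
 unfolding g_min_def
 by (rule ev_bin_nat[OF ab v], use v in simp, use v in simp, rule conjI, rule cheap_mono[OF cheap_Sub[OF _ cheap_Sub]]) auto

end

end

definition Incr :: "nat => program" where "Incr d = Store (Const d) (Add (Reg d) (Const 1))"

text \<open>Register \<open>d\<close> counts, \<open>d + 1\<close> accumulates, \<open>d + 2\<close>
  holds the bound, and the body computes from \<open>d + 3\<close> on; the result is moved to
  \<open>d\<close> at the end. The body is a function of code for the index and for the accumulator,
  so loops nest like expressions.\<close>

definition "g_loop b a f = (%d. Seq (a (d + 1)) (Seq (b (d + 2)) (Seq (Store (Const d) (Const 0))
   (Seq (While (Sub (Reg (d + 2)) (Reg d)) (Seq (f (g_var d) (g_var (d + 1)) (d + 3)) (Seq (Store (Const (d + 1)) (Reg (d + 3))) (Incr d))))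
    (Store (Const d) (Reg (d + 1)))))))"

lemma reach_incr:
 assumes "10 <= L" "d <= 1000" "s d < 2^L" "Q (s(d := Suc (s d)))"
 shows "reach L (Incr d) s 1 Q"
 unfolding Incr_def by (rule reach_store[OF cheap_Num cheap_Add[OF cheap_Reg cheap_Num]]) (use assms in auto)

text \<open>The body is required in every context extending \<open>c\<close>, since it refers to
  variables bound outside as well as to the two registers of its own loop.\<close>

lemma ev_loop:
 fixes F :: "nat => int"
 assumes b: "ev L c b (int \<beta>) Sb hb" and a: "ev L c a (F 0) Sa ha" and \<beta>: "\<beta> < 2^L"
 and body: "!!c' x acc j. c \<preceq> c' ==> j < \<beta> ==> ev L c' x (int j) 1 1 ==> ev L c' acc (F j) 1 1 ==> ev L c' (f x acc) (F (Suc j)) S h"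
 and H: "ha + 1 <= H" "hb + 2 <= H" "h + 3 <= H" "4 <= H"
 shows "ev L c (g_loop b a f) (F \<beta>) (Sa + Sb + (\<beta> + 1)*(S + 3)) H"
 unfolding ev_def g_loop_def
proof (intro allI impI)
 fix d s assume r: "ready L c d H s"
 define X where "X j v t \<longleftrightarrow> ready L c d H t & int (t (d + 1)) = F j mod 2^L & t (d + 1) < 2^L & frame d H s t" for j and v :: nat and t
 define I where "I j t \<longleftrightarrow> X j 0 t & t d = j & t (d + 2) = \<beta> & j <= \<beta>" for j t
 have 1: "reach L (a (d + 1)) s Sa (X 0 0)"
  by (rule evD[OF a]) (use r H in \<open>auto simp: ready_def frame_def X_def\<close>)
 have e: "int \<beta> < 2^L" using \<beta> by simp
 hence 2: "reach L (b (d + 2)) t Sb (%t. X 0 0 t & t (d + 2) = \<beta>)" if "X 0 0 t" for t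
  by (intro evD[OF b]) (use that H in \<open>auto simp: ready_def frame_def X_def\<close>)
 have 3: "reach L (Store (Const d) (Const 0)) t 1 (I 0)" if "X 0 0 t & t (d + 2) = \<beta>" for t
  by (rule reach_store[OF cheap_Num cheap_Num]) (use that H in \<open>auto simp: ready_def frame_def X_def I_def\<close>)
 have c: "cheap L 100 (Sub (Reg (d + 2)) (Reg d)) t" if "I j t" for j t
  by (rule cheap_mono[OF cheap_Sub[OF cheap_Reg cheap_Reg]]) (use that H \<beta> in \<open>auto simp: ready_def X_def I_def\<close>)
 let ?B = "Seq (f (g_var d) (g_var (d + 1)) (d + 3)) (Seq (Store (Const (d + 1)) (Reg (d + 3))) (Incr d))"
 have 4: "reach L (While (Sub (Reg (d + 2)) (Reg d)) ?B) t (\<beta>*(S + 2 + 1) + 1) (I \<beta>)" if "I 0 t" for t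
 proof (rule reach_while[where I = I]; (rule that)?)
  show "aval (Sub (Reg (d + 2)) (Reg d)) t = 0 & cheap L 100 (Sub (Reg (d + 2)) (Reg d)) t" if "I \<beta> t" for t
   using c[OF that] that by (simp add: I_def)
 next
  fix j t assume j: "j < \<beta>" and t: "I j t"
  let ?c = "(d + 3, t)"
  have cc: "c \<preceq> ?c" using t by (auto simp: ctx_le_def I_def X_def ready_def)
  have jm: "int j mod 2^L = int j" using j e by simp
  have x: "ev L ?c (g_var d) (int j) 1 1"
   by (rule ev_var) (use t \<beta> jm in \<open>simp_all add: I_def X_def ready_def\<close>)
  have y: "ev L ?c (g_var (d + 1)) (F j) 1 1"
   by (rule ev_var) (use t H in \<open>auto simp: I_def X_def ready_def\<close>)
  let ?R = "%u. I j u & int (u (d + 3)) = F (Suc j) mod 2^L & u (d + 3) < 2^L"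
  have 5: "reach L (f (g_var d) (g_var (d + 1)) (d + 3)) t S ?R"
   by (rule evD[OF body[OF cc j x y]]) (use t H in \<open>auto simp: I_def X_def ready_def frame_def\<close>)
  let ?T = "%u. X (Suc j) 0 u & u d = j & u (d + 2) = \<beta>"
  have 6: "reach L (Store (Const (d + 1)) (Reg (d + 3))) u 1 ?T" if "?R u" for u
   by (rule reach_store[OF cheap_Num cheap_Reg]) (use that H in \<open>auto simp: I_def X_def ready_def frame_def\<close>)
  have 7: "reach L (Incr d) u 1 (I (Suc j))" if "?T u" for u
   by (rule reach_incr) (use that H j \<beta> in \<open>auto simp: I_def X_def ready_def frame_def\<close>)
  have "reach L ?B t (S + 2) (I (Suc j))" by (rule reach_seq[OF 5 reach_seq[OF 6 7 order_refl]]) auto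
  thus "aval (Sub (Reg (d + 2)) (Reg d)) t ~= 0 & cheap L 100 (Sub (Reg (d + 2)) (Reg d)) t & reach L ?B t (S + 2) (I (Suc j))"
   using c[OF t] t j by (simp add: I_def)
 qed
 have 5: "reach L (Store (Const d) (Reg (d + 1))) t 1 (%s'. int (s' d) = F \<beta> mod 2^L & frame d H s s')" if "I \<beta> t" for t
  by (rule reach_store[OF cheap_Num cheap_Reg]) (use that H in \<open>auto simp: ready_def frame_def X_def I_def\<close>)
 show "reach L (Seq (a (d + 1)) (Seq (b (d + 2)) (Seq (Store (Const d) (Const 0)) (Seq (While (Sub (Reg (d + 2)) (Reg d)) ?B)
    (Store (Const d) (Reg (d + 1))))))) s (Sa + Sb + (\<beta> + 1)*(S + 3)) (%s'. int (s' d) = F \<beta> mod 2^L & frame d H s s')"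
  by (rule reach_seq[OF 1 reach_seq[OF 2 reach_seq[OF 3 reach_seq[OF 4 5 order_refl] order_refl] order_refl]]) (auto simp: algebra_simps)
qed

section \<open>Input and output\<close>

definition prog_init :: program where
 "prog_init = Seq (Store (Const 2) (Mul (Reg 0) (Reg 0))) (Seq (Store (Const 1) (Const 1))
   (While (Reg 2) (Seq (Store (Const 1) (Mul (Reg 1) (Const 2))) (Store (Const 2) (Sub (Reg 2) (Const 1))))))"

text \<open>The items of the output are first stored, increased by one, from cell \<open>1000\<close> on; the final loop
 moves them down and stops at the first cell containing \<open>0\<close>.\<close>

definition prog_items :: "(gen => gen => gen) => program" where
 "prog_items item = Seq (Store (Const 3) (Const 0)) (While (Sub (Reg 2) (Reg 3))
   (Seq (item (g_var 0) (g_var 3) 4) (Seq (Store (Add (Reg 3) (Const 1000)) (Add (Reg 4) (Const 1))) (Incr 3))))"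

definition prog_shift :: program where
 "prog_shift = Seq (Store (Const 0) (Const 0)) (While (Load (Add (Reg 0) (Const 1000)))
   (Seq (Store (Add (Reg 0) (Const 1)) (Sub (Load (Add (Reg 0) (Const 1000))) (Const 1))) (Incr 0)))"

definition prog_output :: "(gen => gen) => (gen => gen => gen) => program" where
 "prog_output len item = Seq prog_init (Seq (len (g_var 0) 2) (Seq (prog_items item) prog_shift))"

text \<open>The word length is fixed at run time as \<open>m * m\<close>. The numbers of grid points
  and of codes have \<open>O(m log m)\<close> bits, so they fit into one word, while operations on
  words still cost only a power of \<open>m\<close>.\<close>

lemma run_init:
 assumes "10 <= m" and Ldef: "L = m*m"
 shows "reach L prog_init (input_mem m) (3*L + 4) (%s. s 0 = m & s 1 = 2^L & (\<forall>i\<ge>3. s i = 0))"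
proof -
 have L: "10 <= L" unfolding Ldef using assms(1) by (metis le_square le_trans)
 have mL: "L < 2^L" by simp
 have m1: "m < 2^L" using le_square[of m] mL Ldef by linarith
 define J where "J j k s \<longleftrightarrow> s (0 :: nat) = m & s 2 = L - j & s 1 = 2^k & (\<forall>i\<ge>3. s i = (0 :: nat)) & j <= L" for j k and s :: mem
 have 1: "reach L (Store (Const 2) (Mul (Reg 0) (Reg 0))) (input_mem m) 1 (%s. s 0 = m & s 2 = L & (\<forall>i\<ge>3. s i = 0))"
  by (rule reach_store[OF cheap_Num cheap_Mul'[OF cheap_Reg cheap_Reg]]) (use L m1 in \<open>simp_all add: input_mem_def Ldef\<close>)
 have 2: "reach L (Store (Const 1) (Const 1)) s 1 (%s. J 0 0 s)" if "s 0 = m & s 2 = L & (\<forall>i\<ge>3. s i = 0)" for s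
  by (rule reach_store[OF cheap_Num cheap_Num]) (use that L in \<open>simp_all add: J_def\<close>)
 have r2: "cheap L 6 (Reg 2) s" if "J j k s" for j k s
  by (rule cheap_Reg) (use that L le_trans[OF diff_le_self less_imp_le[OF mL]] in \<open>auto simp: J_def\<close>)
 let ?B = "Seq (Store (Const 1) (Mul (Reg 1) (Const 2))) (Store (Const 2) (Sub (Reg 2) (Const 1)))"
 have 3: "reach L (While (Reg 2) ?B) s (L*(2 + 1) + 1) (%s. J L L s)" if "J 0 0 s" for s
 proof (rule reach_while[where I = "%j. J j j"]; (rule that)?)
  show "aval (Reg 2) s = 0 & cheap L 100 (Reg 2) s" if "J L L s" for s
   using cheap_mono[OF r2[OF that]] that by (simp add: J_def)
 next
  fix j s assume j: "j < L" "J j j s"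
  have "reach L (Store (Const 1) (Mul (Reg 1) (Const 2))) s 1 (J j (Suc j))"
   by (rule reach_store[OF cheap_Num cheap_Mul'[OF cheap_Reg cheap_Num]]) (use j L big_pow[OF L, of 2] in \<open>auto simp: J_def\<close>)
  moreover have "reach L (Store (Const 2) (Sub (Reg 2) (Const 1))) t 1 (J (Suc j) (Suc j))" if "J j (Suc j) t" for t
   by (rule reach_store[OF cheap_Num cheap_Sub[OF r2[OF that] cheap_Num]]) (use that j L in \<open>auto simp: J_def\<close>)
  ultimately have "reach L ?B s 2 (J (Suc j) (Suc j))" by (rule reach_seq) auto
  thus "aval (Reg 2) s ~= 0 & cheap L 100 (Reg 2) s & reach L ?B s 2 (J (Suc j) (Suc j))"
   using cheap_mono[OF r2[OF j(2)]] j by (simp add: J_def)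
 qed
 show ?thesis unfolding prog_init_def
  by (rule reach_mono[OF reach_seq[OF 1 reach_seq[OF 2 3 order_refl]] order_refl]) (auto simp: J_def)
qed

context
 fixes L :: nat and items :: "nat list"
 assumes L: "10 <= L" and len: "1000 + length items < 2^L" and items: "!!i. i < length items ==> items ! i + 1 < 2^L"
begin

lemma run_items:
 assumes h: "h <= 900" "1 <= h"
  and item: "!!c x y i. i < length items ==> ev L c x (int m) 1 1 ==> ev L c y (int i) 1 1 ==> ev L c (item x y) (int (items ! i)) S h"
  and s: "s 0 = m & s 1 = 2^L & s 2 = length items & (\<forall>i\<ge>1000. s i = 0)" and m: "m < 2^L"
 shows "reach L (prog_items item) s (length items*(S + 3) + 2) (%s'. (\<forall>i<length items. s' (1000 + i) = items ! i + 1) & s' (1000 + length items) = 0)"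
proof -
 define J where "J j k s \<longleftrightarrow> s (0 :: nat) = m & s 1 = 2^L & s 2 = length items & s 3 = j &
   (\<forall>i<k. s (1000 + i) = items ! i + 1) & (\<forall>i\<ge>1000+k. s i = 0) & j <= length items" for j k and s :: mem
 have 1: "reach L (Store (Const 3) (Const 0)) s 1 (J 0 0)"
  by (rule reach_store[OF cheap_Num cheap_Num]) (use s L in \<open>simp_all add: J_def\<close>)
 have test: "cheap L 100 (Sub (Reg 2) (Reg 3)) s" if "J j k s" for j k s
  by (rule cheap_mono[OF cheap_Sub[OF cheap_Reg cheap_Reg]]) (use that len L in \<open>auto simp: J_def\<close>)
 let ?B = "Seq (item (g_var 0) (g_var 3) 4) (Seq (Store (Add (Reg 3) (Const 1000)) (Add (Reg 4) (Const 1))) (Incr 3))"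
 have 2: "reach L (While (Sub (Reg 2) (Reg 3)) ?B) s (length items*(S + 2 + 1) + 1) (J (length items) (length items))" if "J 0 0 s" for s
 proof (rule reach_while[where I = "%j. J j j"]; (rule that)?)
  show "aval (Sub (Reg 2) (Reg 3)) s = 0 & cheap L 100 (Sub (Reg 2) (Reg 3)) s" if "J (length items) (length items) s" for s
   using test[OF that] that by (simp add: J_def)
 next
  fix j s assume j: "j < length items" and s: "J j j s"
  have jL: "j < 2^L" using j len by simp
  have im: "int k mod 2^L = int k" if "k < 2^L" for k :: nat
   using that by simp
  have x: "ev L (4, s) (g_var 0) (int m) 1 1" and y: "ev L (4, s) (g_var 3) (int j) 1 1"
   by (rule ev_var; use s m jL in \<open>simp add: J_def im\<close>)+
  let ?R = "%t. J j j t & t 4 = items ! j"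
  have 1: "reach L (item (g_var 0) (g_var 3) 4) s S ?R"
   by (rule evD[OF item[OF j x y]]) (use s h L items[OF j] in \<open>auto simp: J_def ready_def frame_def im\<close>)
  have 2: "reach L (Store (Add (Reg 3) (Const 1000)) (Add (Reg 4) (Const 1))) t 1 (J j (Suc j))" if "?R t" for t
   by (rule reach_store[OF cheap_Add[OF cheap_Reg cheap_Num] cheap_Add[OF cheap_Reg cheap_Num]])
    (use that items[OF j] jL L big_pow[OF L] in \<open>auto simp: J_def less_Suc_eq\<close>)
  have 3: "reach L (Incr 3) t 1 (J (Suc j) (Suc j))" if "J j (Suc j) t" for t
   by (rule reach_incr) (use that L j jL in \<open>auto simp: J_def\<close>)
  have "reach L ?B s (S + 2) (J (Suc j) (Suc j))" by (rule reach_seq[OF 1 reach_seq[OF 2 3 order_refl]]) auto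
  thus "aval (Sub (Reg 2) (Reg 3)) s ~= 0 & cheap L 100 (Sub (Reg 2) (Reg 3)) s & reach L ?B s (S + 2) (J (Suc j) (Suc j))"
   using test[OF s] s j by (simp add: J_def)
 qed
 show ?thesis unfolding prog_items_def by (rule reach_mono[OF reach_seq[OF 1 2] order_refl]) (auto simp: J_def algebra_simps)
qed

text \<open>Cell 0 serves as the loop counter, so in the end it holds the length of the output, as
  \<open>output_list\<close> demands. The input is overwritten only in this last phase.\<close>

lemma run_shift:
 assumes s: "(\<forall>i<length items. s (1000 + i) = items ! i + 1) & s (1000 + length items) = 0"
 shows "reach L prog_shift s (length items*3 + 2) (%s'. output_list s' = items)"
proof -
 define J where "J j k s \<longleftrightarrow> s (0 :: nat) = j & (\<forall>i<k. s (1 + i) = items ! i) &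
   (\<forall>i<length items. k <= i --> s (1000 + i) = items ! i + 1) & s (1000 + length items) = 0 & j <= length items" for j k and s :: mem
 have 1: "reach L (Store (Const 0) (Const 0)) s 1 (J 0 0)"
  by (rule reach_store[OF cheap_Num cheap_Num]) (use s L in \<open>simp_all add: J_def\<close>)
 have test: "cheap L 100 (Load (Add (Reg 0) (Const 1000))) s" if s: "J j j s" for j s
 proof -
  have "s (1000 + j) < 2^L" using s items[of j] by (cases "j = length items") (auto simp: J_def)
  thus ?thesis using s L len by (intro cheap_mono[OF cheap_Load[OF cheap_Add[OF cheap_Reg cheap_Num]]]) (auto simp: J_def add.commute)
 qed
 let ?B = "Seq (Store (Add (Reg 0) (Const 1)) (Sub (Load (Add (Reg 0) (Const 1000))) (Const 1))) (Incr 0)"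
 have 2: "reach L (While (Load (Add (Reg 0) (Const 1000))) ?B) s (length items*(2 + 1) + 1) (J (length items) (length items))" if "J 0 0 s" for s
 proof (rule reach_while[where I = "%j. J j j"]; (rule that)?)
  show "aval (Load (Add (Reg 0) (Const 1000))) s = 0 & cheap L 100 (Load (Add (Reg 0) (Const 1000))) s" if "J (length items) (length items) s" for s
   using test[OF that] that by (simp add: J_def add.commute)
 next
  fix j s assume j: "j < length items" and s: "J j j s"
  have sj: "s (1000 + j) = items ! j + 1" using s j by (simp add: J_def)
  have "reach L (Store (Add (Reg 0) (Const 1)) (Sub (Load (Add (Reg 0) (Const 1000))) (Const 1))) s 1 (J j (Suc j))"
   by (rule reach_store[OF cheap_Add[OF cheap_Reg cheap_Num] cheap_Sub[OF test[OF s] cheap_Num]])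
    (use s sj L len big_pow[OF L, of 1] in \<open>auto simp: J_def less_Suc_eq add.commute\<close>)
  moreover have "reach L (Incr 0) t 1 (J (Suc j) (Suc j))" if "J j (Suc j) t" for t
   by (rule reach_incr) (use that L j len in \<open>auto simp: J_def less_Suc_eq_0_disj\<close>)
  ultimately have "reach L ?B s 2 (J (Suc j) (Suc j))" by (rule reach_seq) auto
  thus "aval (Load (Add (Reg 0) (Const 1000))) s ~= 0 & cheap L 100 (Load (Add (Reg 0) (Const 1000))) s & reach L ?B s 2 (J (Suc j) (Suc j))"
   using test[OF s] s sj by (simp add: J_def add.commute)
 qed
 have "output_list t = items" if "J (length items) (length items) t" for t
  using that by (intro nth_equalityI) (auto simp: output_list_def J_def simp del: upt_Suc)
 thus ?thesis unfolding prog_shift_def by (intro reach_mono[OF reach_seq[OF 1 2] order_refl]) auto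
qed

theorem run_output:
 assumes m: "10 <= m" and Lm: "L = m*m" and h: "h <= 900" "1 <= h"
  and gl: "!!c x. ev L c x (int m) 1 1 ==> ev L c (gl x) (int (length items)) S h"
  and item: "!!c x y i. i < length items ==> ev L c x (int m) 1 1 ==> ev L c y (int i) 1 1 ==> ev L c (item x y) (int (items ! i)) S h"
 shows "\<exists>u s'. runs (prog_output gl item) (input_mem m) u s' & u <= (length items + 1)*(S + 3*L + 10)*unit_cost L & output_list s' = items"
proof -
 have mL: "m < 2^L" using le_square[of m] less_exp[of L] Lm by linarith
 have im: "int k mod 2^L = int k" if "k < 2^L" for k :: nat
  using that by simp
 have 2: "reach L (gl (g_var 0) 2) s S (%s. s 0 = m & s 1 = 2^L & s 2 = length items & (\<forall>i\<ge>1000. s i = 0))"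
  if s: "s 0 = m & s 1 = 2^L & (\<forall>i\<ge>3. s i = 0)" for s :: mem
 proof (rule evD[OF gl])
  show "ev L (2, s) (g_var 0) (int m) 1 1" by (rule ev_var) (use s mL in \<open>simp_all add: im\<close>)
 qed (use s h L len in \<open>auto simp: ready_def frame_def im\<close>)
 have "reach L (prog_output gl item) (input_mem m) ((length items + 1)*(S + 3*L + 10)) (%s'. output_list s' = items)"
  unfolding prog_output_def
  by (rule reach_seq[OF run_init[OF m Lm] reach_seq[OF 2 reach_seq[OF run_items[OF h item _ mL] run_shift order_refl] order_refl]])
   (auto simp: algebra_simps)
 thus ?thesis by (simp only: reach_def)
qed

end

text \<open>One exponent \<open>e\<close> bounds both the time and the demand for registers. It
  grows by 1 with an operation and by 3 with a loop, so the cost of nested code is found by counting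
  its depth.\<close>

definition evm :: "nat => ctx => gen => int => nat => bool" where
 "evm m c g v e \<longleftrightarrow> ev (m*m) c g v (m^e) (4*e + 1)"

text \<open>In a context in which \<open>x\<close> holds the input \<open>m\<close>, the code \<open>g\<close> computes \<open>v\<close> in time \<open>O(m\<^sup>e)\<close> (up to
 the factor \<^const>\<open>unit_cost\<close>), provided that the side condition \<open>\<phi>\<close> holds. Carrying side conditions
 along makes the rules below syntax-directed.\<close>

definition evq :: "nat => gen => ctx => gen => int => nat => bool => bool" where
 "evq m x c g v e \<phi> \<longleftrightarrow> (100 <= m --> evm m c x (int m) 0 --> \<phi> --> evm m c g v e)"

abbreviation rng :: "nat => int => bool" where
 "rng m v \<equiv> 0 <= v & v < 2^(m*m)"

lemma evm_weaken: "evm m c g v e ==> e <= e' ==> 0 < m ==> evm m c g v e'"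
 unfolding evm_def by (erule ev_weaken) (auto intro: power_increasing)

lemma evm_congruent: "evm m c g v e ==> v mod 2^(m*m) = v' mod 2^(m*m) ==> evm m c g v' e"
 unfolding evm_def by (erule ev_weaken) auto

lemma evm_ctx: "evm m c g v e ==> c \<preceq> c' ==> evm m c' g v e"
 unfolding evm_def by (rule ev_ctx)

lemma evq_input: "evq m x c x (int m) 0 True" by (simp add: evq_def)

lemma evq_const: "k < 2^10 ==> evq m x c (g_const k) (int k) 0 True"
 using ev_const[of k "m*m" c] by (simp add: evq_def evm_def)

lemma evq_const':
 "evq m x c (g_const 0) 0 0 True" "evq m x c (g_const 1) 1 0 True" "evq m x c (g_const 2) 2 0 True"
 "evq m x c (g_const 4) 4 0 True" "evq m x c (g_const 6) 6 0 True" "evq m x c (g_const 7) 7 0 True"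
 "evq m x c (g_const 3) 3 0 True" "evq m x c (g_const 5) 5 0 True"
 using evq_const[of 0 m x c] evq_const[of 1 m x c] evq_const[of 2 m x c] evq_const[of 4 m x c] evq_const[of 6 m x c]
  evq_const[of 7 m x c] evq_const[of 3 m x c] evq_const[of 5 m x c] by simp_all

lemma evq_mono:
 assumes "evq m x c g v' e' \<phi>'" "\<phi> ==> \<phi>' & v' = v" "e' <= e"
 shows "evq m x c g v e \<phi>"
 using assms evm_weaken[of m c g v e' e] unfolding evq_def by auto

lemma power_bin:
 fixes m :: nat
 assumes "100 <= m"
 shows "m^a + m^b + 1 <= m^Suc (max a b)"
proof -
 have "m^a <= m^max a b" "m^b <= m^max a b" "1 <= m^max a b" using assms by auto
 hence "m^a + m^b + 1 <= 3*m^max a b" by linarith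
 also have "\<dots> <= m*m^max a b" using assms by simp
 finally show ?thesis by simp
qed

lemma power_loop:
 fixes m :: nat
 assumes m: "100 <= m" and \<beta>: "\<beta> <= m + 1"
 shows "m^a + m^b + (\<beta> + 1)*(m^e + 3) <= m^(max a (max b e) + 3)"
proof -
 define Z where "Z = m^max a (max b e)"
 have Z: "m^a <= Z" "m^b <= Z" "m^e <= Z" "1 <= Z" using m by (auto simp: Z_def)
 have "(\<beta> + 1)*(m^e + 3) <= (m + 2)*(4*Z)" using Z \<beta> by (intro mult_mono) auto
 hence "m^a + m^b + (\<beta> + 1)*(m^e + 3) <= (4*m + 10)*Z" using Z by (simp add: algebra_simps)
 also have "\<dots> <= (m*m*m)*Z"
 proof (rule mult_right_mono)
  have "4*m + 10 <= 5*m" using m by simp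
  also have "\<dots> <= m*m" using m by simp
  also have "\<dots> <= m*m*m" by simp
  finally show "4*m + 10 <= m*m*m" .
 qed simp
 finally show ?thesis by (simp add: Z_def eval_nat_numeral)
qed

lemma evm_bin:
 assumes ab: "evm m c a va ea" "evm m c b vb eb" and m: "100 <= m"
  and op: "!!ha hb h. ev (m*m) c a va (m^ea) ha ==> ev (m*m) c b vb (m^eb) hb ==> ha <= h ==> Suc hb <= h ==> 2 <= h ==>
   ev (m*m) c g v (m^ea + m^eb + 1) h"
 shows "evm m c g v (Suc (max ea eb))"
proof -
 have "ev (m*m) c g v (m^ea + m^eb + 1) (4*Suc (max ea eb) + 1)"
  by (rule op[of "4*ea + 1" "4*eb + 1"]) (use ab in \<open>auto simp: evm_def\<close>)
 thus ?thesis unfolding evm_def by (rule ev_weaken) (use power_bin[OF m] in auto)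
qed

lemma evq_bin:
 assumes a: "evq m x c a va ea \<phi>a" and b: "evq m x c b vb eb \<phi>b"
  and op: "!!ha hb h. \<psi> ==> ev (m*m) c a va (m^ea) ha ==> ev (m*m) c b vb (m^eb) hb ==> ha <= h ==> Suc hb <= h ==> 2 <= h ==>
   ev (m*m) c g v (m^ea + m^eb + 1) h"
 shows "evq m x c g v (Suc (max ea eb)) (\<phi>a & \<phi>b & \<psi>)"
 unfolding evq_def
proof (intro impI, elim conjE)
 assume m: "100 <= m" "evm m c x (int m) 0" and p: "\<phi>a" "\<phi>b" "\<psi>"
 have ab: "evm m c a va ea" "evm m c b vb eb" using a b m p by (auto simp: evq_def)
 show "evm m c g v (Suc (max ea eb))" by (rule evm_bin[OF ab m(1) op[OF p(3)]])
qed

lemma evq_bin_total: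
 assumes "evq m x c a va ea \<phi>a" "evq m x c b vb eb \<phi>b"
  and "!!ha hb h. ev (m*m) c a va (m^ea) ha ==> ev (m*m) c b vb (m^eb) hb ==> ha <= h ==> Suc hb <= h ==> 2 <= h ==>
   ev (m*m) c g v (m^ea + m^eb + 1) h"
 shows "evq m x c g v (Suc (max ea eb)) (\<phi>a & \<phi>b)"
 by (rule evq_mono[OF evq_bin[where \<psi> = True, OF assms]]) auto

context
 fixes m x c a va ea \<phi>a b vb eb \<phi>b
 assumes ab: "evq m x c a va ea \<phi>a" "evq m x c b vb eb \<phi>b"
begin

lemma evq_add: "evq m x c (g_add a b) (va + vb) (Suc (max ea eb)) (\<phi>a & \<phi>b)"
 and evq_sub: "evq m x c (g_sub a b) (va - vb) (Suc (max ea eb)) (\<phi>a & \<phi>b)"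
 and evq_mul: "evq m x c (g_mul a b) (va * vb) (Suc (max ea eb)) (\<phi>a & \<phi>b)"
 by (rule evq_bin_total[OF ab]; rule ev_add ev_sub ev_mul; assumption)+

lemma evq_div: "evq m x c (g_div a b) (va div vb) (Suc (max ea eb)) (\<phi>a & \<phi>b & rng m va & rng m vb)"
 and evq_mod: "evq m x c (g_mod a b) (va mod vb) (Suc (max ea eb)) (\<phi>a & \<phi>b & rng m va & rng m vb)"
 and evq_le: "evq m x c (g_le a b) (of_bool (va <= vb)) (Suc (max ea eb)) (\<phi>a & \<phi>b & rng m va & rng m vb)"
 and evq_eq: "evq m x c (g_eq a b) (of_bool (va = vb)) (Suc (max ea eb)) (\<phi>a & \<phi>b & rng m va & rng m vb)"
 by (rule evq_bin[OF ab]; rule ev_div ev_mod ev_le ev_eq; (assumption | simp))+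

end

lemma evq_ctx: "evq m x c g v e \<phi> ==> c \<preceq> c' ==> evm m c x (int m) 0 ==> evq m x c' g v e \<phi>"
 unfolding evq_def using evm_ctx by blast

text \<open>Loops of at most \<open>m + 1\<close> rounds keep the cost a power of \<open>m\<close>.
  The two exponential loops of the search are treated by \<open>ev_loop\<close> directly.\<close>

lemma evq_iter:
 assumes n: "evq m x c n vn en \<phi>n" and a: "evq m x c a (F 0) ea \<phi>a"
  and f: "!!c' y acc j. c \<preceq> c' ==> evm m c x (int m) 0 ==> int j < vn ==> evq m x c' y (int j) 0 True ==> evq m x c' acc (F j) 0 True ==>
   evq m x c' (f y acc) (F (Suc j)) e (\<phi> j)"
 shows "evq m x c (g_loop n a f) (F (nat vn)) (max ea (max en e) + 3) (\<phi>n & \<phi>a & 0 <= vn & vn <= int m + 1 & (\<forall>j. int j < vn --> \<phi> j))"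
 unfolding evq_def
proof (intro impI, elim conjE)
 assume m: "100 <= m" and x: "evm m c x (int m) 0" and \<phi>: "\<phi>n" "\<phi>a" "0 <= vn" "vn <= int m + 1" "\<forall>j. int j < vn --> \<phi> j"
 obtain \<beta> where \<beta>: "vn = int \<beta>" using \<phi>(3) nonneg_int_cases by blast
 have \<beta>m: "\<beta> <= m + 1" using \<phi>(4) \<beta> by simp
 have "ev (m*m) c (g_loop n a f) (F \<beta>) (m^ea + m^en + (\<beta> + 1)*(m^e + 3)) (4*(max ea (max en e) + 3) + 1)"
 proof (rule ev_loop[where ha = "4*ea + 1" and hb = "4*en + 1" and h = "4*e + 1"])
  have "m + 1 <= 2^m" using less_exp[of m] by linarith
  also have "(2 :: nat)^m < 2^(m*m)" using m by simp
  finally show "\<beta> < 2^(m*m)" using \<beta>m by simp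
  show "ev (m*m) c' (f y acc) (F (Suc j)) (m^e) (4*e + 1)"
   if "c \<preceq> c'" "j < \<beta>" "ev (m*m) c' y (int j) 1 1" "ev (m*m) c' acc (F j) 1 1" for c' y acc j
   using f[OF that(1) x, of j y acc] that \<phi>(5) m evm_ctx[OF x that(1)] by (simp add: evq_def evm_def \<beta>)
 qed (use n a m x \<phi> in \<open>auto simp: evq_def evm_def \<beta>\<close>)
 thus "evm m c (g_loop n a f) (F (nat vn)) (max ea (max en e) + 3)"
  unfolding evm_def by (rule ev_weaken) (use power_loop[OF m \<beta>m] in \<open>auto simp: \<beta>\<close>)
qed

definition "g_sum n f = g_loop n (g_const 0) (%y acc. g_add acc (f y))"
definition "g_prod n f = g_loop n (g_const 1) (%y acc. g_mul acc (f y))"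

context
 fixes m x c n vn en \<phi>n f e \<phi> and F :: "nat => int"
 assumes n: "evq m x c n vn en \<phi>n"
  and f: "!!c' y j. c \<preceq> c' ==> evm m c x (int m) 0 ==> int j < vn ==> evq m x c' y (int j) 0 True ==> evq m x c' (f y) (F j) e (\<phi> j)"
begin

lemma evq_sum: "evq m x c (g_sum n f) (\<Sum>j<nat vn. F j) (max en e + 4) (\<phi>n & 0 <= vn & vn <= int m + 1 & (\<forall>j. int j < vn --> \<phi> j))"
 unfolding g_sum_def
proof (rule evq_mono, rule evq_iter[OF n, where F = "%k. \<Sum>j<k. F j"])
 show "evq m x c (g_const 0) (\<Sum>j<0. F j) 0 True" by (simp add: evq_const')
 fix c' y acc j assume a: "c \<preceq> c'" "evm m c x (int m) 0" "int j < vn" "evq m x c' y (int j) 0 True" and acc: "evq m x c' acc (\<Sum>j<j. F j) 0 True"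
 show "evq m x c' (g_add acc (f y)) (\<Sum>j<Suc j. F j) (Suc e) (\<phi> j)" by (rule evq_mono[OF evq_add[OF acc f[OF a]]]) auto
qed auto

lemma evq_prod: "evq m x c (g_prod n f) (\<Prod>j<nat vn. F j) (max en e + 4) (\<phi>n & 0 <= vn & vn <= int m + 1 & (\<forall>j. int j < vn --> \<phi> j))"
 unfolding g_prod_def
proof (rule evq_mono, rule evq_iter[OF n, where F = "%k. \<Prod>j<k. F j"])
 show "evq m x c (g_const 1) (\<Prod>j<0. F j) 0 True" by (simp only: evq_const' lessThan_0 prod.empty)
 fix c' y acc j assume a: "c \<preceq> c'" "evm m c x (int m) 0" "int j < vn" "evq m x c' y (int j) 0 True" and acc: "evq m x c' acc (\<Prod>j<j. F j) 0 True"
 show "evq m x c' (g_mul acc (f y)) (\<Prod>j<Suc j. F j) (Suc e) (\<phi> j)" by (rule evq_mono[OF evq_mul[OF acc f[OF a]]]) auto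
qed auto

end

text \<open>Literals must fit the shortest admissible word, of 10 bits, but \<open>K\<close> depends
  on \<open>\<epsilon>\<close> without bound. It is therefore built up by additions, in time at most
  \<open>m\<close> when \<open>m\<close> is large.\<close>

primrec g_num :: "nat => gen" where
 "g_num 0 = g_const 0"
| "g_num (Suc k) = g_add (g_num k) (g_const 1)"

lemma ev_num: "ev L c (g_num k) (int k) (2*k + 1) 2"
proof (induction k)
 case 0
 show ?case using ev_weaken[OF ev_const[of 0 L c], of 0 1 2] by simp
next
 case (Suc k)
 have "ev L c (g_const 1) 1 1 1" using ev_const[of 1 L c] by simp
 from ev_add[OF Suc this, of 2] show ?case by (simp add: add.commute)
qed

lemma evq_num: "evq m x c (g_num k) (int k) 1 (2*k + 1 <= m)"
 unfolding evq_def evm_def using ev_weaken[OF ev_num] by auto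

lemmas evq_rules = evq_input evq_const' evq_add evq_sub evq_mul evq_div evq_mod evq_le evq_eq evq_sum evq_prod evq_num

section \<open>The search program\<close>

text \<open>Exponents of composed code are nested maxima of unknowns; bounding these by a fresh
  \<open>E\<close> leaves inequalities between sums.\<close>

lemma max2I: "(!!E. a <= E ==> k <= E ==> l <= E + d) ==> l <= max a k + (d :: nat)"
 by simp

lemma max3I: "(!!E. a <= E ==> b <= E ==> k <= E ==> l <= E + d) ==> l <= max a (max b k) + (d :: nat)"
 by simp

lemma evq_step: "c \<preceq> c' ==> evm m c x (int m) 0 ==> evq m x c g v e \<phi> ==> evq m x c' g v e \<phi>"
 by (rule evq_ctx)

section \<open>Code for the cyclotomic data\<close>

definition "g_isp x q = g_mul (g_eq (g_mod x q) (g_const 0)) (g_eq (g_sum q (%d. g_eq (g_mod q d) (g_const 0))) (g_const 1))"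

text \<open>A product over the primes dividing \<open>m\<close> is taken over all \<open>q\<close>
  up to \<open>m\<close>, with factor 1 at the others. No list of primes is stored; testing anew
  each time costs a power of \<open>m\<close>.\<close>

definition "g_pprod x f = g_prod (g_add x (g_const 1)) (%q. g_add (g_const 1) (g_mul (g_isp x q) (g_sub (f q) (g_const 1))))"

definition "g_rad x = g_pprod x (%q. q)"
definition "g_omega x = g_pprod x (%q. g_const 2)"
definition "g_cof x = g_div x (g_rad x)"
definition "g_res x k q = g_mod (g_div k (g_cof x)) q"
definition "g_fib x k l = g_eq (g_mod k (g_cof x)) (g_mod l (g_cof x))"

definition "g_cyb x l k = g_mul (g_fib x k l) (g_pprod x (%q. g_sub (g_eq (g_res x k q) (g_res x l q)) (g_eq (g_res x k q) (g_const 0))))"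

definition "g_cyA x l k = g_mul (g_fib x k l) (g_pprod x (%q. g_sub (g_mul q (g_eq (g_res x k q) (g_res x l q))) (g_const 1)))"

definition "g_kap x l k = g_mul (g_fib x k l) (g_pprod x (%q. g_le (g_res x k q) (g_res x l q)))"

definition "g_inS x k = g_pprod x (%q. g_sub (g_const 1) (g_eq (g_res x k q) (g_const 0)))"

definition "g_tot x = g_sum x (%k. g_inS x k)"

text \<open>Selection without sorting: the only \<open>k\<close> that counts is the element of the
  support with exactly \<open>i\<close> smaller elements of the support.\<close>

definition "g_elem x i = g_sum x (%k. g_mul (g_mul k (g_inS x k)) (g_eq (g_sum k (%j. g_inS x j)) i))"

text \<open>A prime has exactly one divisor below itself. The index \<open>d = 0\<close> does not
  count for positive \<open>q\<close>, since \<open>q mod 0 = q\<close>, and for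
  \<open>q = 0\<close> and \<open>q = 1\<close> the sum is 0.\<close>

lemma prime_iff_divisor_count:
 fixes q :: nat
 shows "(\<Sum>d<q. of_bool (q mod d = 0)) = (1 :: int) \<longleftrightarrow> prime q"
proof -
 have S: "(\<Sum>d<q. of_bool (q mod d = 0)) = int (card {d. d < q & d dvd q})"
 proof -
  have "(\<Sum>d<q. of_bool (q mod d = 0)) = int (card ({..<q} \<inter> {d. q mod d = 0}))" by simp
  also have "{..<q} \<inter> {d. q mod d = 0} = {d. d < q & d dvd q}" by auto
  finally show ?thesis .
 qed
 show ?thesis
 proof
  assume p: "prime q"
  have "{d. d < q & d dvd q} = {1}" using p by (auto simp: prime_nat_iff)
  thus "(\<Sum>d<q. of_bool (q mod d = 0)) = (1 :: int)" unfolding S by simp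
 next
  assume "(\<Sum>d<q. of_bool (q mod d = 0)) = (1 :: int)"
  hence c: "card {d. d < q & d dvd q} = 1" unfolding S by simp
  have "q ~= 0"
  proof
   assume "q = 0"
   hence "{d. d < q & d dvd q} = {}" by auto
   thus False using c by (simp only: card.empty)
  qed
  moreover have "q ~= 1"
  proof
   assume "q = 1"
   hence "{d. d < q & d dvd q} = {}" by auto
   thus False using c by (simp only: card.empty)
  qed
  ultimately have q: "1 < q" by simp
  obtain x where x: "{d. d < q & d dvd q} = {x}" using c by (rule card_1_singletonE)
  have "1 \<in> {d. d < q & d dvd q}" using q by simp
  hence "x = 1" unfolding x by simp
  hence e: "{d. d < q & d dvd q} = {1}" unfolding x by simp
  have "d = 1 \<or> d = q" if "d dvd q" for d
  proof (cases "d = q")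
   case False
   hence "d \<in> {d. d < q & d dvd q}" using that q dvd_imp_le[OF that] by auto
   thus ?thesis unfolding e by simp
  qed simp
  thus "prime q" using q unfolding prime_nat_iff by blast
 qed
qed

text \<open>The condition \<open>m^40 <= 2^m\<close> serves the range checks: quantities polynomial
  in \<open>m\<close> of degree up to 40 stay below \<open>2^m\<close>, and powers with base up to
  \<open>m^20\<close> and exponent up to \<open>m\<close> stay below the modulus
  \<open>2^(m * m)\<close>. The condition on \<open>K\<close> pays for producing the number
  \<open>K\<close> by \<open>g_num\<close>.\<close>

locale algo = cyclo +
 fixes K :: nat
 assumes K: "0 < K" "2*K + 1 <= m" and m100: "100 <= m" and big: "m^40 <= 2^m"
begin

lemma rngI: "0 <= v ==> v <= int (2^m*2^m) ==> rng m v"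
proof -
 have "m + m < m*m" using mult_less_mono1[of 2 m m] m100 by linarith
 hence "(2 :: nat)^m*2^m < 2^(m*m)" unfolding power_add[symmetric] by simp
 hence "int (2^m*2^m) < 2^(m*m)" by (metis of_nat_less_iff of_nat_numeral of_nat_power)
 thus "0 <= v ==> v <= int (2^m*2^m) ==> rng m v" by linarith
qed

lemma rng_small: "k <= m^40 ==> rng m (int k)"
proof (rule rngI)
 assume "k <= m^40"
 also have "\<dots> <= 2^m" by (rule big)
 also have "\<dots> <= 2^m*2^m" by simp
 finally show "int k <= int (2^m*2^m)" by (simp only: of_nat_le_iff)
qed simp

lemma rng_m2: "k <= 2*m + 2 ==> rng m (int k)"
proof (rule rng_small)
 assume "k <= 2*m + 2"
 also have "\<dots> <= m*m"
  using mult_le_mono1[of 3 m m] m100 by linarith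
 also have "\<dots> = m^2" by (simp add: power2_eq_square)
 also have "\<dots> <= m^40" using m by simp
 finally show "k <= m^40" .
qed

lemma lt_big: "v <= 2*int m + 2 ==> v < 2^(m*m)"
 using rng_m2[of "nat v"] by (cases "0 <= v") (auto intro: order_less_le_trans[of v 0])

lemma lt_big_nat: "k <= 2*m + 2 ==> k < 2^(m*m)"
proof -
 assume "k <= 2*m + 2"
 hence "int k < 2^(m*m)" by (intro lt_big) linarith
 hence "int k < int (2^(m*m))" by simp
 thus ?thesis by simp
qed

lemmas big_intros = lt_big lt_big_nat

lemma evq_isp: "evq m x c y (int j) ee \<phi> ==> evq m x c (g_isp x y) (of_bool (j \<in> P)) (ee + 9) (\<phi> & j <= m)"
 unfolding g_isp_def
proof (rule evq_mono, (rule evq_rules | assumption | erule (1) evq_step)+, goal_cases)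
 case 1
 have c: "(\<Sum>ja<j. of_bool (int j mod int ja = 0)) = (\<Sum>d<j. of_bool (j mod d = 0) :: int)"
  by (simp only: zmod_int[symmetric] of_nat_eq_0_iff)
 have "of_bool (int m mod int j = 0) * of_bool ((\<Sum>ja<j. of_bool (int j mod int ja = 0)) = (1 :: int)) = (of_bool (j \<in> P) :: int)"
  unfolding c prime_iff_divisor_count using m by (auto simp: in_prime_factors_iff zmod_int[symmetric] dvd_eq_mod_eq_0)
 moreover have "rng m (\<Sum>ja<j. of_bool (int j mod int ja = 0))"
 proof -
  have "(\<Sum>ja<j. of_bool (int j mod int ja = 0) :: int) <= (\<Sum>ja<j. 1)" by (rule sum_mono) simp
  hence "(\<Sum>ja<j. of_bool (int j mod int ja = 0) :: int) <= int j" by simp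
  thus ?thesis using 1 by (intro conjI sum_nonneg lt_big) auto
 qed
 moreover have "rng m (int m mod int j)" "!!i. rng m (int j mod int i)"
  using 1 by (auto simp: zmod_int[symmetric] intro!: big_intros le_trans[OF mod_less_eq_dividend])
 ultimately show ?case using 1 by (auto intro!: big_intros)
qed simp

lemma pprod_eq: "(\<Prod>j<nat (int m + 1). 1 + of_bool (j \<in> P)*(F j - 1)) = (\<Prod>q\<in>P. F q :: int)"
proof -
 have "(\<Prod>j<nat (int m + 1). 1 + of_bool (j \<in> P)*(F j - 1)) = (\<Prod>q\<in>P. 1 + of_bool (q \<in> P)*(F q - 1))"
  by (rule prod.mono_neutral_right) (use m in \<open>auto simp: in_prime_factors_iff dest!: dvd_imp_le\<close>)
 thus ?thesis by simp
qed

lemma evq_pprod: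
 assumes f: "!!c' y j. c \<preceq> c' ==> evm m c x (int m) 0 ==> j <= m ==> evq m x c' y (int j) 0 True ==> evq m x c' (f y) (F j) ee (\<phi> j)"
 shows "evq m x c (g_pprod x f) (\<Prod>q\<in>P. F q) (max ee 9 + 7) (\<forall>j\<le>m. \<phi> j)"
 unfolding g_pprod_def
proof (rule evq_mono, rule evq_prod)
 show "evq m x c (g_add x (g_const 1)) (int m + 1) 1 True"
  by (rule evq_mono, (rule evq_rules)+) auto
 fix c' y j assume a: "c \<preceq> c'" "evm m c x (int m) 0" "int j < int m + 1" "evq m x c' y (int j) 0 True"
 have fj: "evq m x c' (f y) (F j) ee (\<phi> j)" using f[OF a(1,2) _ a(4)] a(3) by simp
 show "evq m x c' (g_add (g_const 1) (g_mul (g_isp x y) (g_sub (f y) (g_const 1)))) (1 + of_bool (j \<in> P)*(F j - 1)) (max ee 9 + 3) (\<phi> j)"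
  by (rule evq_mono, (rule evq_rules evq_isp a(4) fj)+) (use a(3) in auto)
qed (auto simp: pprod_eq)

lemma evq_rad: "evq m x c (g_rad x) (int R) 20 True"
 unfolding g_rad_def by (rule evq_mono, (rule evq_pprod | assumption)+) (auto simp: crad_def)

lemma evq_omega: "evq m x c (g_omega x) (2^card P) 20 True"
 unfolding g_omega_def by (rule evq_mono, (rule evq_pprod evq_rules | assumption)+) auto

lemma R_le: "R <= m"
 using m_eq M_pos by (metis Suc_leI mult.right_neutral mult_le_mono2 One_nat_def)

lemma M_le: "M <= m"
 unfolding cof_def by simp

lemma evq_cof: "evq m x c (g_cof x) (int M) 21 True"
 unfolding g_cof_def by (rule evq_mono, (rule evq_rules evq_rad)+) (use R_le in \<open>auto simp: cof_def zdiv_int intro!: big_intros\<close>)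

lemma evq_res:
 assumes k: "evq m x c k vk e1 \<phi>1" and q: "evq m x c q (int j) e2 \<phi>2"
 shows "evq m x c (g_res x k q) (int (nat vk div M mod j)) (max e1 (max e2 21) + 2) (\<phi>1 & \<phi>2 & j <= m & rng m vk)"
 unfolding g_res_def
proof (rule evq_mono, (rule evq_rules evq_cof k q)+, goal_cases)
 case 1
 obtain k where k: "vk = int k" using 1 nonneg_int_cases by blast
 have "int (k div M) < 2^(m*m)" using 1 div_le_dividend[of k M] unfolding k by linarith
 thus ?case using 1 M_le unfolding k by (auto simp: zmod_int[symmetric] zdiv_int[symmetric] intro!: big_intros)
qed auto

lemma evq_fib:
 assumes k: "evq m x c k vk e1 \<phi>1" and l: "evq m x c l vl e2 \<phi>2"
 shows "evq m x c (g_fib x k l) (of_bool (nat vk mod M = nat vl mod M)) (max e1 (max e2 21) + 2) (\<phi>1 & \<phi>2 & rng m vk & rng m vl)"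
 unfolding g_fib_def
proof (rule evq_mono, (rule evq_rules evq_cof k l)+, goal_cases)
 case 1
 have "vk mod int M < int M" "vl mod int M < int M" using M_pos by auto
 hence "vk mod int M < 2^(m*m)" "vl mod int M < 2^(m*m)" using M_le by (auto intro!: big_intros)
 moreover have "int (nat vk mod M) = vk mod int M" "int (nat vl mod M) = vl mod int M" using 1 by (auto simp: zmod_int)
 hence "(nat vk mod M = nat vl mod M) = (vk mod int M = vl mod int M)" by auto
 ultimately show ?case using 1 M_le M_pos by (auto intro!: big_intros)
qed auto

lemma res_rng: "rng m vk ==> rng m (int (nat vk div M mod j))"
proof -
 assume 1: "rng m vk"
 obtain k where k: "vk = int k" using 1 nonneg_int_cases by blast
 have "int (k div M mod j) <= int k" using div_le_dividend[of k M] mod_less_eq_dividend[of "k div M" j] by linarith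
 thus ?thesis using 1 unfolding k by simp
qed

lemma res_lt: "0 <= vk ==> vk < 2^(m*m) ==> nat vk div M mod j < 2^(m*m)"
 using res_rng[of vk j] by simp

lemma evq_cyb:
 assumes l: "evq m x c l vl e1 \<phi>1" and k: "evq m x c k vk e2 \<phi>2"
 shows "evq m x c (g_cyb x l k) (cyb m (nat vl) (nat vk)) (max e1 (max e2 21) + 12) (\<phi>1 & \<phi>2 & rng m vl & rng m vk)"
 unfolding g_cyb_def
proof (rule evq_mono, (rule evq_rules evq_fib evq_pprod evq_res l k | assumption | erule (1) evq_step)+, goal_cases)
 case 1
 thus ?case by (auto simp: cyb_def dvd_eq_mod_eq_0 res_lt)
qed (rule max3I, simp)

lemma evq_cyA:
 assumes l: "evq m x c l vl e1 \<phi>1" and k: "evq m x c k vk e2 \<phi>2"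
 shows "evq m x c (g_cyA x l k) (sp_A m (nat vl) (nat vk)) (max e1 (max e2 21) + 13) (\<phi>1 & \<phi>2 & rng m vl & rng m vk)"
 unfolding g_cyA_def
proof (rule evq_mono, (rule evq_rules evq_fib evq_pprod evq_res l k | assumption | erule (1) evq_step)+, goal_cases)
 case 1
 thus ?case by (auto simp: sp_A_def res_lt)
qed (rule max3I, simp)

lemma evq_kap:
 assumes l: "evq m x c l vl e1 \<phi>1" and k: "evq m x c k vk e2 \<phi>2"
 shows "evq m x c (g_kap x l k) (cykap m (nat vl) (nat vk)) (max e1 (max e2 21) + 12) (\<phi>1 & \<phi>2 & rng m vl & rng m vk)"
 unfolding g_kap_def
proof (rule evq_mono, (rule evq_rules evq_fib evq_pprod evq_res l k | assumption | erule (1) evq_step)+, goal_cases)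
 case 1
 thus ?case by (auto simp: cykap_def res_lt)
qed (rule max3I, simp)

lemma evq_inS:
 assumes k: "evq m x c k vk e2 \<phi>2"
 shows "evq m x c (g_inS x k) (of_bool (\<forall>q\<in>P. \<not> q dvd nat vk div M)) (max e2 21 + 12) (\<phi>2 & rng m vk)"
 unfolding g_inS_def
proof (rule evq_mono, (rule evq_rules evq_pprod evq_res k | assumption | erule (1) evq_step)+, goal_cases)
 case 1
 have "(\<Prod>q\<in>P. 1 - of_bool (int (nat vk div M mod q) = 0)) = (of_bool (\<forall>q\<in>P. \<not> q dvd nat vk div M) :: int)"
  by (auto simp: dvd_eq_mod_eq_0 intro!: prod.neutral)
 thus ?case using 1 by (auto simp: res_lt)
qed (rule max2I, simp)

lemma sum_inS: "k <= m ==> (\<Sum>j<k. of_bool (\<forall>q\<in>P. \<not> q dvd j div M)) = int (card {j \<in> csup m. j < k})"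
proof -
 assume k: "k <= m"
 have "(\<Sum>j<k. of_bool (\<forall>q\<in>P. \<not> q dvd j div M)) = int (card ({..<k} \<inter> {j. \<forall>q\<in>P. \<not> q dvd j div M}))"
  by simp
 also have "{..<k} \<inter> {j. \<forall>q\<in>P. \<not> q dvd j div M} = {j \<in> csup m. j < k}" using k by (auto simp: csup_def)
 finally show ?thesis .
qed

lemma evq_tot: "evq m x c (g_tot x) (int N) 40 True"
 unfolding g_tot_def
proof (rule evq_mono, (rule evq_rules evq_inS | assumption | erule (1) evq_step)+, goal_cases)
 case 1
 have "{j \<in> csup m. j < m} = csup m" by (auto simp: csup_def)
 hence "(\<Sum>j<m. of_bool (\<forall>q\<in>P. \<not> q dvd j div M)) = int N" using sum_inS[of m] card_csup by simp
 thus ?case by (auto intro!: big_intros)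
qed simp

lemma celem_rank:
 assumes i: "i < N"
 shows "{j \<in> csup m. j < e i} = e ` {..<i}"
proof -
 let ?xs = "sorted_list_of_set (csup m)"
 have len: "length ?xs = N" using card_csup by simp
 have sorted: "sorted_wrt (<) ?xs" by simp
 have mono: "e a < e c" if "a < c" "c < N" for a c
  using sorted_wrt_nth_less[OF sorted that(1)] that len by (simp add: celem_def)
 show ?thesis
 proof (intro equalityI subsetI)
  fix j assume j: "j \<in> {j \<in> csup m. j < e i}"
  then obtain a where a: "a < N" "j = e a" using e_bij by (auto simp: bij_betw_def)
  have "a < i"
  proof (rule ccontr)
   assume "\<not> a < i"
   hence "e i <= e a" using mono[of i a] a(1) by (cases "a = i") auto
   thus False using j a by simp
  qed
  thus "j \<in> e ` {..<i}" using a by auto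
 next
  fix j assume "j \<in> e ` {..<i}"
  then obtain a where "a < i" "j = e a" by auto
  thus "j \<in> {j \<in> csup m. j < e i}" using mono[of a i] e_S[of a] i by auto
 qed
qed

lemma celem_sum:
 assumes i: "i < N"
 shows "(\<Sum>k<m. int k * of_bool (\<forall>q\<in>P. \<not> q dvd k div M) * of_bool (int (card {j \<in> csup m. j < k}) = int i)) = int (e i)"
proof -
 have card: "card {j \<in> csup m. j < e a} = a" if "a < N" for a
  unfolding celem_rank[OF that] using e_inj that by (subst card_image) (auto simp: inj_on_def)
 have "(\<Sum>k<m. int k * of_bool (\<forall>q\<in>P. \<not> q dvd k div M) * of_bool (int (card {j \<in> csup m. j < k}) = int i))
  = (\<Sum>k<m. of_bool (k = e i)*int k)"
 proof (rule sum_cong)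
  fix k assume k: "k \<in> {..<m}"
  show "int k * of_bool (\<forall>q\<in>P. \<not> q dvd k div M) * of_bool (int (card {j \<in> csup m. j < k}) = int i) = of_bool (k = e i)*int k"
  proof (cases "k \<in> csup m")
   case True
   then obtain a where a: "a < N" "k = e a" using e_bij by (auto simp: bij_betw_def)
   have "(card {j \<in> csup m. j < k} = i) = (k = e i)" using card[OF a(1)] e_inj[OF a(1) i] a(2) by auto
   moreover have "\<forall>q\<in>P. \<not> q dvd k div M" using True by (auto simp: csup_def)
   ultimately show ?thesis by simp
  next
   case False
   hence "\<not> (\<forall>q\<in>P. \<not> q dvd k div M)" using k by (auto simp: csup_def)
   moreover have "k ~= e i" using False e_S[OF i] by auto
   ultimately show ?thesis by simp
  qed
 qed
 also have "\<dots> = int (e i)" by (rule sum_of_bool_eq[OF e_lt[OF i]])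
 finally show ?thesis .
qed

lemma evq_elem:
 assumes i: "evq m x c i vi e1 \<phi>1"
 shows "evq m x c (g_elem x i) (int (celem m (nat vi))) (max e1 40 + 7) (\<phi>1 & 0 <= vi & vi < int N)"
 unfolding g_elem_def
proof (rule evq_mono, (rule evq_rules evq_inS i | assumption | erule (1) evq_step)+, goal_cases)
 case 1
 then obtain a where a: "vi = int a" "a < N" using nonneg_int_cases[of vi] by auto
 have Nm: "N <= m" by (rule totient_le)
 have s: "(\<Sum>ja<j. of_bool (\<forall>q\<in>P. \<not> q dvd ja div M)) = int (card {j' \<in> csup m. j' < j})" if "j < m" for j
  using sum_inS[of j] that by simp
 have cm: "card {j' \<in> csup m. j' < j} <= m" for j
  using card_mono[OF finS, of "{j' \<in> csup m. j' < j}"] card_csup Nm by auto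
 have c: "int (card {j' \<in> csup m. j' < j}) < 2^(m*m)" for j
  by (rule lt_big) (use cm[of j] in linarith)
 have "(\<Sum>j<nat (int m). int j * of_bool (\<forall>q\<in>P. \<not> q dvd nat (int j) div M) * of_bool ((\<Sum>ja<nat (int j). of_bool (\<forall>q\<in>P. \<not> q dvd nat (int ja) div M)) = vi))
  = (\<Sum>k<m. int k * of_bool (\<forall>q\<in>P. \<not> q dvd k div M) * of_bool (int (card {j \<in> csup m. j < k}) = int a))"
  unfolding nat_int a(1) by (rule sum_cong) (simp only: s lessThan_iff)
 hence v: "(\<Sum>j<nat (int m). int j * of_bool (\<forall>q\<in>P. \<not> q dvd nat (int j) div M) * of_bool ((\<Sum>ja<nat (int j). of_bool (\<forall>q\<in>P. \<not> q dvd nat (int ja) div M)) = vi)) = int (celem m (nat vi))"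
  unfolding celem_sum[OF a(2)] a(1) by simp
 have r: "rng m (\<Sum>ja<nat (int j). of_bool (\<forall>q\<in>P. \<not> q dvd nat (int ja) div M))" if "j < m" for j
  unfolding nat_int s[OF that] using c[of j] by simp
 have r2: "rng m vi" using a Nm by (auto intro!: big_intros)
 show ?case
  unfolding v using 1 r r2 by (auto intro!: big_intros simp del: Groups_Big.sum_of_bool_eq)
qed (rule max2I, simp)

end

section \<open>Parameters of the search\<close>

definition ps :: "nat => nat" where "ps m = card {i. i < totient m & (i + 1)*(i + 1) <= totient m} + 1"
definition pal :: "nat => nat => nat" where "pal K m = K*totient m"
text \<open>The grid denominator of \<open>grid_good\<close>, where \<open>ps m\<close>, the integer
  part of \<open>sqrt N\<close> plus 1, plays the part of \<open>s\<close>. So it is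
  \<open>N^2.5\<close> up to a constant and the factor
  \<open>2 ^ card (prime_factors m)\<close>.\<close>

definition pp :: "nat => nat => nat" where "pp K m = K*K*totient m*totient m*ps m*2^card (prime_factors m)"
definition pg :: "nat => nat => nat" where "pg K m = 2^card (prime_factors m)*K*ps m"
text \<open>The number of admissible digit widths, those whose range is at most the grid
  denominator. It is logarithmic in \<open>m\<close> and so has little effect on the number of
  codes.\<close>

definition pC :: "nat => nat => nat" where "pC K m = card {i. i < m & 2^i <= pp K m}"
definition pKK :: "nat => nat => nat" where "pKK K m = (4*pC K m*(1 + pg K m))^totient m"
definition pdig :: "nat => nat => nat => nat => nat" where "pdig K m k l = k div pp K m^l mod pp K m"

definition "g_ps x = g_add (g_sum (g_tot x) (%i. g_le (g_mul (g_add i (g_const 1)) (g_add i (g_const 1))) (g_tot x))) (g_const 1)"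
definition "g_al K x = g_mul (g_num K) (g_tot x)"
definition "g_pp K x = g_mul (g_mul (g_mul (g_mul (g_mul (g_num K) (g_num K)) (g_tot x)) (g_tot x)) (g_ps x)) (g_omega x)"
definition "g_pg K x = g_mul (g_mul (g_omega x) (g_num K)) (g_ps x)"
definition "g_pow2 i = g_prod i (%_. g_const 2)"
definition "g_pC K x = g_sum x (%i. g_le (g_pow2 i) (g_pp K x))"
definition "g_pKK K x = g_prod (g_tot x) (%_. g_mul (g_mul (g_const 4) (g_pC K x)) (g_add (g_const 1) (g_pg K x)))"
definition "g_pdig K x k l = g_mod (g_div k (g_prod l (%_. g_pp K x))) (g_pp K x)"

definition "g_h K x k i j = g_sum (g_tot x) (%l. g_mul (g_pdig K x k l) (g_cyb x (g_elem x l) (g_add (g_elem x i) (g_elem x j))))"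

context algo
begin

lemma N_le: "N <= m" by (rule totient_le)

lemma T_le: "2^card P <= m"
proof -
 have "(\<Prod>q\<in>P. 2) <= (\<Prod>q\<in>P. q)" using prime_ge_2_nat by (intro prod_mono) auto
 thus ?thesis using R_le by (simp add: crad_def)
qed

lemma ps_le: "ps m <= m + 1"
proof -
 have "card {i. i < N & (i + 1)*(i + 1) <= N} <= card {..<N}" by (intro card_mono) auto
 thus ?thesis using N_le by (simp add: ps_def)
qed

lemma ps_le2: "ps m <= m*m" using ps_le mult_le_mono1[of 2 m m] m100 by linarith

lemma K_le: "K <= m" using K by simp

lemma pp_le: "pp K m <= m^7"
proof -
 have "pp K m <= m*m*m*m*(m*m)*m" unfolding pp_def
  by (intro mult_le_mono K_le N_le ps_le2 T_le)
 also have "\<dots> = m^7" by (simp add: eval_nat_numeral)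
 finally show ?thesis .
qed

lemma ps_pos: "0 < ps m" by (simp add: ps_def)

lemma pp_pos: "0 < pp K m" using K ps_pos by (simp add: pp_def)

lemma pg_le: "pg K m <= m^4"
proof -
 have "pg K m <= m*m*(m*m)" unfolding pg_def by (intro mult_le_mono K_le ps_le2 T_le)
 also have "\<dots> = m^4" by (simp add: eval_nat_numeral)
 finally show ?thesis .
qed

lemma pC_le: "pC K m <= m"
proof -
 have "pC K m <= card {..<m}" unfolding pC_def by (intro card_mono) auto
 thus ?thesis by simp
qed

lemma pC_init: "c < m ==> 2^c <= pp K m ==> c < pC K m"
proof -
 assume c: "c < m" "2^c <= pp K m"
 have "{..c} \<subseteq> {i. i < m & 2^i <= pp K m}"
 using c(1) le_trans[OF _ c(2)] by auto
 hence "card {..c} <= pC K m" unfolding pC_def by (intro card_mono) auto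
 thus ?thesis by simp
qed

lemma pC_pos: "0 < pC K m"
 using pC_init[of 0] m pp_pos by simp

lemma pow_lt_2m: "a < 40 ==> m^a < 2^m"
proof -
 assume "a < 40"
 hence "m^a < m^40" using m by simp
 thus ?thesis using big by simp
qed

lemma pC_pow: "c < pC K m ==> 2^c <= pp K m & c < m"
proof (rule ccontr)
 assume c: "c < pC K m" and n: "\<not> (2^c <= pp K m & c < m)"
 have "{i. i < m & 2^i <= pp K m} \<subseteq> {..<c}"
 proof
  fix i assume i: "i \<in> {i. i < m & 2^i <= pp K m}"
  have "i < c"
  proof (rule ccontr)
   assume "\<not> i < c"
   hence ci: "c <= i" by simp
   hence "(2 :: nat)^c <= 2^i" by simp
   moreover have "i < m" "2^i <= pp K m" using i by auto
   ultimately have "2^c <= pp K m" "c < m" using ci by linarith+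
   thus False using n by blast
  qed
  thus "i \<in> {..<c}" by simp
 qed
 hence "pC K m <= card {..<c}" unfolding pC_def by (intro card_mono) auto
 thus False using c by simp
qed

lemma big_power: "x <= m^20 ==> l <= m ==> x^l < 2^(m*m)"
proof -
 assume x: "x <= m^20" and l: "l <= m"
 have "x^l <= (m^20)^l" using x by (rule power_mono) simp
 also have "\<dots> <= (m^20)^m" using l m by (intro power_increasing) auto
 also have "\<dots> < (m^40)^m"
  using m by (intro power_strict_mono power_strict_increasing) auto
 also have "\<dots> <= (2^m)^m" using big by (rule power_mono) simp
 finally show ?thesis by (simp add: power_mult)
qed

lemma pKK_lt: "pKK K m < 2^(m*m)"
 unfolding pKK_def
proof (rule big_power[OF _ N_le])
 have "4*pC K m*(1 + pg K m) <= m*m*(m^4 + m^4)"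
  using pC_le pg_le m100 by (intro mult_le_mono add_mono) auto
 also have "\<dots> <= m*m*(m*m^4)"
 proof (intro mult_le_mono order_refl)
  show "m^4 + m^4 <= m*m^4" using mult_le_mono1[of 2 m "m^4"] m100 by linarith
 qed
 also have "\<dots> = m^7" by (simp add: eval_nat_numeral)
 also have "\<dots> <= m^20" using m by simp
 finally show "4*pC K m*(1 + pg K m) <= m^20" .
qed

lemma ppow_lt: "l <= m ==> pp K m^l < 2^(m*m)"
proof (rule big_power)
 have "m^7 <= m^20" using m by simp
 thus "pp K m <= m^20" using pp_le by linarith
qed

lemma pow_lt: "a <= 40 ==> k <= m^a ==> k < 2^(m*m)"
proof -
 assume a: "a <= 40" and k: "k <= m^a"
 have "m^a <= m^40" using a m by simp
 hence "rng m (int k)" using k by (intro rng_small) simp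
 thus ?thesis by simp
qed

lemma evq_ps: "evq m x c (g_ps x) (int (ps m)) 46 True"
 unfolding g_ps_def
proof (rule evq_mono, (rule evq_rules evq_tot | assumption | erule (1) evq_step)+, goal_cases)
 case 1
 have "(\<Sum>j<N. of_bool ((int j + 1)*(int j + 1) <= int N)) = (\<Sum>j<N. of_bool ((j + 1)*(j + 1) <= N) :: int)"
 proof (rule sum_cong)
  fix j
  have "((int j + 1)*(int j + 1) <= int N) = (int ((j + 1)*(j + 1)) <= int N)" by (simp only: of_nat_mult of_nat_add of_nat_1)
  thus "of_bool ((int j + 1)*(int j + 1) <= int N) = (of_bool ((j + 1)*(j + 1) <= N) :: int)" by (simp only: of_nat_le_iff)
 qed
 also have "\<dots> = int (card ({..<N} \<inter> {j. (j + 1)*(j + 1) <= N}))"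
  by simp
 also have "{..<N} \<inter> {j. (j + 1)*(j + 1) <= N} = {i. i < N & (i + 1)*(i + 1) <= N}" by auto
 finally have v: "(\<Sum>j<N. of_bool ((int j + 1)*(int j + 1) <= int N)) = int (ps m) - 1" by (simp add: ps_def)
 have r: "rng m ((int j + 1)*(int j + 1))" if "j < N" for j
 proof -
  have "(j + 1)*(j + 1) <= m^2" using that N_le by (simp only: power2_eq_square) (intro mult_le_mono, auto)
  hence "(j + 1)*(j + 1) < 2^(m*m)" by (intro pow_lt[of 2]) auto
  hence "int ((j + 1)*(j + 1)) < int (2^(m*m))" by (simp only: of_nat_less_iff)
  hence "(int j + 1)*(int j + 1) < 2^(m*m)" by (simp only: of_nat_mult of_nat_add of_nat_1 of_nat_power of_nat_numeral)
  thus ?thesis by simp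
 qed
 show ?case using v r N_le by (auto intro!: big_intros)
qed simp

lemma evq_al: "evq m x c (g_al K x) (int (pal K m)) 41 True"
 unfolding g_al_def by (rule evq_mono, (rule evq_rules evq_tot)+) (use K in \<open>auto simp: pal_def\<close>)

lemma evq_pp: "evq m x c (g_pp K x) (int (pp K m)) 48 True"
 unfolding g_pp_def by (rule evq_mono, (rule evq_rules evq_tot evq_ps evq_omega)+) (use K in \<open>auto simp: pp_def\<close>)

lemma evq_pg: "evq m x c (g_pg K x) (int (pg K m)) 47 True"
 unfolding g_pg_def by (rule evq_mono, (rule evq_rules evq_ps evq_omega)+) (use K in \<open>auto simp: pg_def\<close>)

lemma evq_pow2:
 assumes i: "evq m x c i vi e1 \<phi>1"
 shows "evq m x c (g_pow2 i) (2^nat vi) (e1 + 4) (\<phi>1 & 0 <= vi & vi <= int m + 1)"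
 unfolding g_pow2_def
 by (rule evq_mono, (rule evq_rules i | assumption | erule (1) evq_step)+) auto

lemma evq_pC: "evq m x c (g_pC K x) (int (pC K m)) 53 True"
 unfolding g_pC_def
proof (rule evq_mono, (rule evq_rules evq_pow2 evq_pp | assumption | erule (1) evq_step)+, goal_cases)
 case 1
 have "(\<Sum>j<m. of_bool (2^nat (int j) <= int (pp K m))) = (\<Sum>j<m. of_bool (2^j <= pp K m) :: int)"
 by simp
 also have "\<dots> = int (card ({..<m} \<inter> {j. 2^j <= pp K m}))"
  by simp
 also have "{..<m} \<inter> {j. 2^j <= pp K m} = {i. i < m & 2^i <= pp K m}" by auto
 finally have v: "(\<Sum>j<m. of_bool (2^nat (int j) <= int (pp K m))) = int (pC K m)" by (simp add: pC_def)
 have r: "(2 :: int)^j < 2^(m*m)" if "j < m" for j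
  using that by (intro power_strict_increasing) (auto intro: less_le_trans)
 have "pp K m < 2^(m*m)" using pp_le by (intro pow_lt[of 7]) auto
 thus ?case using v r by simp
qed simp

lemma evq_pKK: "evq m x c (g_pKK K x) (int (pKK K m)) 60 True"
 unfolding g_pKK_def
 by (rule evq_mono, (rule evq_rules evq_tot evq_pC evq_pg | assumption | erule (1) evq_step)+)
  (use N_le in \<open>auto simp: pKK_def algebra_simps\<close>)

lemma evq_pdig:
 assumes k: "evq m x c k vk e1 \<phi>1" and l: "evq m x c l vl e2 \<phi>2"
 shows "evq m x c (g_pdig K x k l) (int (pdig K m (nat vk) (nat vl))) (max e1 (max e2 48) + 6) (\<phi>1 & \<phi>2 & rng m vk & 0 <= vl & vl <= int m)"
 unfolding g_pdig_def
proof (rule evq_mono, (rule evq_rules k l evq_pp | assumption | erule (1) evq_step)+, goal_cases)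
 case 1
 then obtain a d where ad: "vk = int a" "vl = int d" "d <= m" using nonneg_int_cases[of vk] nonneg_int_cases[of vl] by (metis of_nat_le_iff)
 have p: "pp K m < 2^(m*m)" using pp_le by (intro pow_lt[of 7]) auto
 have p2: "int (pp K m^d) < 2^(m*m)" using ppow_lt[OF ad(3)] by (metis of_nat_less_iff of_nat_numeral of_nat_power)
 have "int (a div pp K m^d) <= int a" by simp
 hence "int (a div pp K m^d) < 2^(m*m)" using 1 ad(1) by linarith
 thus ?case using 1 p p2 unfolding ad by (auto simp: pdig_def zmod_int zdiv_int pos_imp_zdiv_nonneg_iff pp_pos)
qed (rule max3I, simp)

lemma e_le: "i < N ==> e i <= m" using e_lt by (simp add: less_imp_le)

lemma evq_h:
 assumes k: "evq m x c k vk e1 \<phi>1" and i: "evq m x c i vi e2 \<phi>2" and j: "evq m x c j vj e3 \<phi>3"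
 shows "evq m x c (g_h K x k i j) (sp_h m (pdig K m (nat vk)) (nat vi) (nat vj)) (max e1 (max (max e2 e3) 40) + 27)
  (\<phi>1 & \<phi>2 & \<phi>3 & rng m vk & 0 <= vi & vi < int N & 0 <= vj & vj < int N)"
 unfolding g_h_def
proof (rule evq_mono, (rule evq_rules evq_tot evq_pdig evq_cyb evq_elem k i j | assumption | erule (1) evq_step)+, goal_cases)
 case 1
 then obtain a d where ad: "vi = int a" "vj = int d" "a < N" "d < N" using nonneg_int_cases[of vi] nonneg_int_cases[of vj] by (metis of_nat_less_iff)
 have "e l <= 2*m + 2" if "l < N" for l using e_le[OF that] by simp
 moreover have "e a + e d <= 2*m + 2" using e_le[OF ad(3)] e_le[OF ad(4)] by simp
 ultimately show ?case using 1 N_le unfolding ad by (auto simp: sp_h_def nat_add_distrib intro!: big_intros)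
qed (rule max3I, simp)

end

section \<open>Code for digits, short vectors and the form\<close>

definition "g_dst K x k v = g_loop v k (%_ acc. g_div (g_div acc (g_pC K x)) (g_pow2 (g_mod acc (g_pC K x))))"
definition "g_digit K x k v = g_sub (g_mod (g_div (g_dst K x k v) (g_pC K x)) (g_pow2 (g_mod (g_dst K x k v) (g_pC K x))))
   (g_div (g_pow2 (g_mod (g_dst K x k v) (g_pC K x))) (g_const 2))"
definition "g_y K x k i = g_sum (g_tot x) (%v. g_mul (g_kap x (g_elem x i) (g_elem x v)) (g_digit K x k v))"
definition "g_w K x g k i = g_sum (g_tot x) (%j. g_mul (g_h K x g i j) (g_y K x k j))"
definition "g_cz K x g k i = g_sub (g_mod (g_add (g_add (g_w K x g k i) (g_mul (g_pp K x) (g_pow2 x))) (g_div (g_pp K x) (g_const 2))) (g_pp K x))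
   (g_div (g_pp K x) (g_const 2))"
text \<open>Coordinates are passed as functions from code to code. The same generator thus serves
  for the value at a candidate vector, in \<open>g_q\<close>, and for the entries of the Gram
  matrix, in \<open>g_entry\<close>.\<close>

definition "g_form K x z y z' y' = g_add
   (g_mul (g_mul (g_mul (g_al K x) (g_al K x)) (g_rad x))
    (g_sum x (%k. g_mul (g_sum (g_tot x) (%i. g_mul (z i) (g_cyb x (g_elem x i) k)))
              (g_sum (g_tot x) (%i. g_mul (z' i) (g_cyb x (g_elem x i) k))))))
   (g_mul (g_mul (g_pp K x) (g_pp K x))
    (g_sum (g_tot x) (%i. g_sum (g_tot x) (%j. g_mul (g_mul (y i) (y' j)) (g_cyA x (g_elem x i) (g_elem x j))))))"
definition "g_q K x g k = g_form K x (g_cz K x g k) (g_y K x k) (g_cz K x g k) (g_y K x k)"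
definition "g_z K x g a i = g_add (g_mul (g_pp K x) (g_eq i a)) (g_sum (g_tot x) (%j. g_mul (g_eq a (g_add (g_tot x) j)) (g_h K x g i j)))"
definition "g_entry K x g a b = g_form K x (g_z K x g a) (%i. g_eq a (g_add (g_tot x) i)) (g_z K x g b) (%i. g_eq b (g_add (g_tot x) i))"

lemma max4I: "(!!E. a <= E ==> b <= E ==> c <= E ==> k <= E ==> l <= E + d) ==> l <= max a (max b (max c k)) + (d :: nat)"
 by simp

context algo
begin

abbreviation "C \<equiv> pC K m"
abbreviation "p \<equiv> pp K m"

lemma dstate_le: "dstate D k v <= k"
proof (induction v)
 case (Suc v)
 have "dstate D k (Suc v) <= dstate D k v" by (simp add: le_trans[OF div_le_dividend div_le_dividend])
 thus ?case using Suc by linarith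
qed simp

lemma lt_of_int: "k < 2^j ==> int k < 2^j"
 by simp

lemma p_lt: "p < 2^(m*m)" using pp_le by (intro pow_lt[of 7]) auto

lemma pow_mod_C: "2^(a mod C) <= p" "a mod C < m"
 using pC_pow[of "a mod C"] pC_pos by auto

lemma pow_mod_C_lt: "2^(a mod C) < (2 :: nat)^(m*m)"
 using pow_mod_C(1)[of a] p_lt by linarith

lemma pow_mod_C_int: "(2 :: int)^(a mod C) < 2^(m*m)"
 using lt_of_int[OF pow_mod_C_lt[of a]] by simp

lemma C_lt: "C < 2^(m*m)" using pC_le by (intro big_intros) simp

lemma evq_dst:
 assumes k: "evq m x c k (int vk) e1 \<phi>1" and v: "evq m x c v vi e2 \<phi>2"
 shows "evq m x c (g_dst K x k v) (int (dstate C vk (nat vi))) (max e1 (max e2 53) + 9) (\<phi>1 & \<phi>2 & vk < 2^(m*m) & 0 <= vi & vi <= int m)"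
 unfolding g_dst_def
proof (rule evq_mono, rule evq_iter[where F = "%v. int (dstate C vk v)" and \<phi> = "%_. vk < 2^(m*m)"])
 show "evq m x c k (int (dstate C vk 0)) e1 \<phi>1" using k by simp
 fix c' y acc j assume acc: "evq m x c' acc (int (dstate C vk j)) 0 True"
 show "evq m x c' (g_div (g_div acc (g_pC K x)) (g_pow2 (g_mod acc (g_pC K x)))) (int (dstate C vk (Suc j))) 59 (vk < 2^(m*m))"
 proof (rule evq_mono, (rule evq_rules evq_pC evq_pow2 acc)+, goal_cases)
  case 1
  define D where "D = dstate C vk j"
  have D: "D < 2^(m*m)" "D div C < 2^(m*m)" using 1 dstate_le[of C vk j] div_le_dividend[of D C] unfolding D_def by linarith+
  have e: "int D mod int C = int (D mod C)" "int D div int C = int (D div C)" "nat (int (D mod C)) = D mod C"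
   by (simp_all only: zdiv_int, simp_all only: zmod_int[symmetric])
  have v: "int (D div C) div 2^(D mod C) = int (dstate C vk (Suc j))" by (simp add: D_def zdiv_int)
  have r: "rng m (int D)" "rng m (int (D div C))" "rng m (int C)" "rng m (2^(D mod C))" "0 <= int (D mod C)" "int (D mod C) <= int m + 1"
   using lt_of_int[OF D(1)] lt_of_int[OF D(2)] lt_of_int[OF C_lt] pow_mod_C_int[of D] pow_mod_C(2)[of D] by auto
  show ?case unfolding D_def[symmetric] e using r v by blast
 qed simp
qed (use v in auto)

lemma evq_digit:
 assumes k: "evq m x c k (int vk) e1 \<phi>1" and v: "evq m x c v vi e2 \<phi>2"
 shows "evq m x c (g_digit K x k v) (digit C vk (nat vi)) (max e1 (max e2 53) + 17) (\<phi>1 & \<phi>2 & vk < 2^(m*m) & 0 <= vi & vi <= int m)"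
 unfolding g_digit_def
proof (rule evq_mono, (rule evq_rules evq_pC evq_pow2 evq_dst k v)+, goal_cases)
 case 1
 define D where "D = dstate C vk (nat vi)"
 have D: "D < 2^(m*m)" "D div C < 2^(m*m)" using 1 dstate_le[of C vk "nat vi"] div_le_dividend[of D C] unfolding D_def by linarith+
 have e: "int D mod int C = int (D mod C)" "int D div int C = int (D div C)" "nat (int (D mod C)) = D mod C"
  by (simp_all only: zdiv_int, simp_all only: zmod_int[symmetric])
 have v: "int (D div C) mod 2^(D mod C) - 2^(D mod C) div 2 = digit C vk (nat vi)"
  by (simp add: digit_def D_def zmod_int zdiv_int)
 have r: "rng m (int D)" "rng m (int (D div C))" "rng m (int C)" "rng m (2^(D mod C))" "0 <= int (D mod C)" "int (D mod C) <= int m + 1" "rng m 2"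
  using lt_of_int[OF D(1)] lt_of_int[OF D(2)] lt_of_int[OF C_lt] pow_mod_C_int[of D] pow_mod_C(2)[of D] by (auto intro!: big_intros)
 show ?case unfolding D_def[symmetric] e using 1 r v by blast
qed (rule max3I, simp)

lemma evq_y:
 assumes k: "evq m x c k (int vk) e1 \<phi>1" and i: "evq m x c i vi e2 \<phi>2"
 shows "evq m x c (g_y K x k i) (sp_y m C vk (nat vi)) (max e1 (max e2 53) + 24) (\<phi>1 & \<phi>2 & vk < 2^(m*m) & 0 <= vi & vi < int N)"
 unfolding g_y_def
proof (rule evq_mono, (rule evq_rules evq_tot evq_kap evq_elem evq_digit k i | assumption | erule (1) evq_step)+, goal_cases)
 case 1
 then obtain a where a: "vi = int a" "a < N" using nonneg_int_cases[of vi] by auto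
 have "e l <= 2*m + 2" if "l < N" for l using e_le[OF that] by simp
 thus ?case using 1 N_le unfolding a(1) by (auto simp: sp_y_def intro!: big_intros)
qed (rule max3I, simp)

lemma evq_w:
 assumes g: "evq m x c g (int vg) e1 \<phi>1" and k: "evq m x c k (int vk) e2 \<phi>2" and i: "evq m x c i vi e3 \<phi>3"
 shows "evq m x c (g_w K x g k i) (sp_w m (pdig K m vg) C vk (nat vi)) (max e1 (max e2 (max e3 53)) + 34)
  (\<phi>1 & \<phi>2 & \<phi>3 & vg < 2^(m*m) & vk < 2^(m*m) & 0 <= vi & vi < int N)"
 unfolding g_w_def
proof (rule evq_mono, (rule evq_rules evq_tot evq_h evq_y g k i | assumption | erule (1) evq_step)+, goal_cases)
 case 1
 thus ?case using N_le by (auto simp: sp_w_def)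
qed (rule max4I, simp)

section \<open>Sizes of the integers that occur\<close>

lemma cyb_abs: "\<bar>cyb m l k\<bar> <= 1"
proof -
 have "(\<Prod>q\<in>P. \<bar>of_bool (k div M mod q = l div M mod q) - of_bool (q dvd k div M) :: int\<bar>) <= (\<Prod>q\<in>P. 1)"
  by (rule prod_mono) auto
 thus ?thesis unfolding cyb_def abs_mult abs_prod by simp
qed

lemma kap_range: "0 <= cykap m l k" "cykap m l k <= 1"
proof -
 have "0 <= (\<Prod>q\<in>P. of_bool (k div M mod q <= l div M mod q) :: int)" by (rule prod_nonneg) auto
 moreover have "(\<Prod>q\<in>P. of_bool (k div M mod q <= l div M mod q) :: int) <= (\<Prod>q\<in>P. 1)" by (rule prod_mono) auto
 ultimately show "0 <= cykap m l k" "cykap m l k <= 1" by (auto simp: cykap_def)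
qed

lemma spA_abs: "\<bar>sp_A m l k\<bar> <= int R"
proof -
 have "(\<Prod>q\<in>P. \<bar>int q * of_bool (k div M mod q = l div M mod q) - 1\<bar>) <= (\<Prod>q\<in>P. int q)"
 proof (rule prod_mono, intro conjI)
  fix q assume "q \<in> P"
  hence "1 < q" by (rule gtP)
  thus "\<bar>int q * of_bool (k div M mod q = l div M mod q) - 1\<bar> <= int q" by simp
 qed simp
 moreover have "0 <= (\<Prod>q\<in>P. int q)" by (rule prod_nonneg) simp
 ultimately show ?thesis unfolding sp_A_def abs_mult abs_prod by (cases "k mod M = l mod M") (auto simp: crad_def)
qed

lemma digit_abs: "\<bar>digit C k v\<bar> <= int p"
proof -
 define D where "D = dstate C k v"
 define B where "B = (2 :: nat)^(D mod C)"
 have B: "B <= p" "0 < B" using pow_mod_C(1)[of D] by (auto simp: B_def)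
 have "(D div C) mod B < B" using B by simp
 hence "\<bar>int ((D div C) mod B) - int (B div 2)\<bar> <= int B" by linarith
 also have "int ((D div C) mod B) - int (B div 2) = digit C k v" by (simp add: digit_def D_def B_def)
 finally show ?thesis using B(1) by linarith
qed

lemma sum_abs_bound:
 assumes "!!i. i < n ==> \<bar>f i\<bar> <= (B :: int)" "int n <= D" "0 <= B"
 shows "\<bar>\<Sum>i<n. f i\<bar> <= D*B"
proof -
 have "\<bar>\<Sum>i<n. f i\<bar> <= (\<Sum>i<n. \<bar>f i\<bar>)" by simp
 also have "\<dots> <= (\<Sum>i<n. B)" by (rule sum_mono) (use assms(1) in auto)
 also have "\<dots> = int n*B" by simp
 also have "\<dots> <= D*B" using assms by (intro mult_right_mono) auto
 finally show ?thesis .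
qed

lemma mult_abs_bound: "\<bar>v\<bar> <= A ==> \<bar>v'\<bar> <= B ==> \<bar>v * v'\<bar> <= A*(B :: int)"
 unfolding abs_mult by (intro mult_mono) auto

lemma p_le: "int p <= int m^7"
 using pp_le by simp

lemma h_abs: "\<bar>sp_h m (pdig K m k) i j\<bar> <= int m^8"
proof -
 have "\<bar>sp_h m (pdig K m k) i j\<bar> <= int m*(int m^7*1)"
  unfolding sp_h_def
 proof (rule sum_abs_bound)
  fix l
  have "pdig K m k l < p" using pp_pos by (simp add: pdig_def)
  hence "\<bar>int (pdig K m k l)\<bar> <= int m^7" using p_le by linarith
  thus "\<bar>int (pdig K m k l)*cyb m (celem m l) (celem m i + celem m j)\<bar> <= int m^7*1"
   by (rule mult_abs_bound) (rule cyb_abs)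
 qed (use N_le in auto)
 thus ?thesis by (simp add: eval_nat_numeral)
qed

lemma y_abs: "\<bar>sp_y m C k i\<bar> <= int m^8"
proof -
 have "\<bar>sp_y m C k i\<bar> <= int m*(1*int m^7)"
  unfolding sp_y_def
 proof (rule sum_abs_bound)
  fix l
  have "\<bar>digit C k l\<bar> <= int m^7" using digit_abs[of k l] p_le by linarith
  moreover have "\<bar>cykap m (celem m i) (celem m l)\<bar> <= 1" using kap_range[of "celem m i" "celem m l"] by linarith
  ultimately show "\<bar>cykap m (celem m i) (celem m l)*digit C k l\<bar> <= 1*int m^7" by (rule mult_abs_bound[rotated])
 qed (use N_le in auto)
 thus ?thesis by (simp add: eval_nat_numeral)
qed

lemma w_abs: "\<bar>sp_w m (pdig K m g) C k i\<bar> <= int m^17"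
proof -
 have "\<bar>sp_w m (pdig K m g) C k i\<bar> <= int m*(int m^8*int m^8)"
  unfolding sp_w_def by (rule sum_abs_bound, rule mult_abs_bound[OF h_abs y_abs]) (use N_le in auto)
 thus ?thesis by (simp add: eval_nat_numeral)
qed

lemma pow_lt_2m_int: "j < 40 ==> int m^j < 2^m"
 using pow_lt_2m[of j] by (metis of_nat_less_iff of_nat_numeral of_nat_power)

text \<open>The coordinate of \<open>H y\<close> is less than \<open>2^m\<close> in absolute value,
  and \<open>p\<close> lies between 1 and \<open>2^m / 100\<close>. So the offset makes the sum
  nonnegative and leaves it below \<open>2^m * 2^m\<close>.\<close>

lemma cz_arg_rng: "rng m (sp_w m (pdig K m g) C k i + int p*2^m + int p div 2)"
proof -
 have w: "\<bar>sp_w m (pdig K m g) C k i\<bar> < 2^m" using w_abs[of g k i] pow_lt_2m_int[of 17] by linarith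
 have p1: "1 <= int p" using pp_pos by linarith
 have p2: "int p*100 <= 2^m"
 proof -
  have "int p*100 <= int m^7*int m" using p_le m100 by (intro mult_mono) auto
  also have "\<dots> = int m^8" by (simp add: eval_nat_numeral)
  finally show ?thesis using pow_lt_2m_int[of 8] by linarith
 qed
 show ?thesis
 proof (rule rngI)
  have "(2 :: int)^m <= int p*2^m" using p1 by simp
  thus "0 <= sp_w m (pdig K m g) C k i + int p*2^m + int p div 2" using w by linarith
  have "int p*2^m*100 <= 2^m*2^m" using mult_right_mono[OF p2, of "2^m"] by simp
  moreover have "int p div 2 <= int p" by linarith
  moreover have "(2 :: int)^m <= int p*2^m" using p1 by simp
  ultimately have "sp_w m (pdig K m g) C k i + int p*2^m + int p div 2 <= 2^m*2^m" using w p2 by linarith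
  thus "sp_w m (pdig K m g) C k i + int p*2^m + int p div 2 <= int (2^m*2^m)" by simp
 qed
qed

lemma evq_cz:
 assumes g: "evq m x c g (int vg) e1 \<phi>1" and k: "evq m x c k (int vk) e2 \<phi>2" and i: "evq m x c i vi e3 \<phi>3"
 shows "evq m x c (g_cz K x g k i) (sp_cz m p (pdig K m vg) C vk (nat vi)) (max e1 (max e2 (max e3 53)) + 38)
  (\<phi>1 & \<phi>2 & \<phi>3 & vg < 2^(m*m) & vk < 2^(m*m) & 0 <= vi & vi < int N)"
 unfolding g_cz_def
proof (rule evq_mono, (rule evq_rules evq_w evq_pp evq_pow2 g k i)+, goal_cases)
 case 1
 show ?case using 1 cz_arg_rng[of vg vk "nat vi"] lt_of_int[OF p_lt] by (auto simp: sp_cz_def intro!: big_intros)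
qed (rule max4I, simp)

lemma evq_form:
 assumes z: "!!c' i j. evq m x c' i (int j) 0 True ==> c \<preceq> c' ==> evm m c x (int m) 0 ==> int j < int N ==> evq m x c' (z i) (zv j) ez (\<phi> j)"
  and y: "!!c' i j. evq m x c' i (int j) 0 True ==> c \<preceq> c' ==> evm m c x (int m) 0 ==> int j < int N ==> evq m x c' (y i) (yv j) ez (\<phi> j)"
  and z': "!!c' i j. evq m x c' i (int j) 0 True ==> c \<preceq> c' ==> evm m c x (int m) 0 ==> int j < int N ==> evq m x c' (z' i) (zv' j) ez (\<phi> j)"
  and y': "!!c' i j. evq m x c' i (int j) 0 True ==> c \<preceq> c' ==> evm m c x (int m) 0 ==> int j < int N ==> evq m x c' (y' i) (yv' j) ez (\<phi> j)"
 shows "evq m x c (g_form K x z y z' y') (sp_form m (pal K m) p zv yv zv' yv') (max ez 62 + 13) (\<forall>j<N. \<phi> j)"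
 unfolding g_form_def
proof (rule evq_mono, (rule evq_rules evq_tot evq_al evq_rad evq_pp evq_cyb evq_cyA evq_elem z y z' y' | assumption
  | erule (1) evq_step | rule ctx_le_trans, assumption)+, goal_cases)
 case 1
 have "e l <= 2*m + 2" if "l < N" for l using e_le[OF that] by simp
 thus ?case using 1 N_le by (auto simp: sp_form_def intro!: big_intros)
qed (rule max2I, simp)

lemma evq_q:
 assumes g: "evq m x c g (int vg) e1 \<phi>1" and k: "evq m x c k (int vk) e2 \<phi>2"
 shows "evq m x c (g_q K x g k) (sp_q m (pal K m) p (pdig K m vg) C vk) (max e1 (max e2 53) + 51) (\<phi>1 & \<phi>2 & vg < 2^(m*m) & vk < 2^(m*m))"
 (is "evq _ _ _ _ _ _ ?\<phi>")
 unfolding g_q_def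
proof (rule evq_mono, rule evq_form[where ez = "max e1 (max e2 53) + 38" and \<phi> = "%_. ?\<phi>"])
 fix c' i j assume a: "c \<preceq> c'" "evm m c x (int m) 0" "int j < int N" and i: "evq m x c' i (int j) 0 True"
 note g' = evq_ctx[OF g a(1,2)] and k' = evq_ctx[OF k a(1,2)]
 show "evq m x c' (g_cz K x g k i) (sp_cz m p (pdig K m vg) C vk j) (max e1 (max e2 53) + 38) ?\<phi>"
  by (rule evq_mono, rule evq_cz[OF g' k' i]) (use a(3) in auto)
 show "evq m x c' (g_y K x k i) (sp_y m C vk j) (max e1 (max e2 53) + 38) ?\<phi>"
  by (rule evq_mono, rule evq_y[OF k' i]) (use a(3) in auto)
 thus "evq m x c' (g_y K x k i) (sp_y m C vk j) (max e1 (max e2 53) + 38) ?\<phi>" .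
 show "evq m x c' (g_cz K x g k i) (sp_cz m p (pdig K m vg) C vk j) (max e1 (max e2 53) + 38) ?\<phi>"
  by (rule evq_mono, rule evq_cz[OF g' k' i]) (use a(3) in auto)
qed (auto simp: sp_q_def)

lemma evq_z:
 assumes g: "evq m x c g (int vg) e1 \<phi>1" and a: "evq m x c a (int va) e2 \<phi>2" and i: "evq m x c i (int vi) e3 \<phi>3"
 shows "evq m x c (g_z K x g a i) (sp_z m p (pdig K m vg) va vi) (max e1 (max e2 (max e3 53)) + 33)
  (\<phi>1 & \<phi>2 & \<phi>3 & vg < 2^(m*m) & va < 2*N & vi < N)"
 unfolding g_z_def
proof (rule evq_mono, (rule evq_rules evq_h evq_pp evq_tot g a i | assumption | erule (1) evq_step)+, goal_cases)
 case 1
 have s: "(\<Sum>j<N. of_bool (int va = int N + int j) * sp_h m (pdig K m vg) vi j) = (\<Sum>j<N. of_bool (va = N + j) * sp_h m (pdig K m vg) vi j)"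
  by (rule sum_cong) (simp only: of_nat_add[symmetric] of_nat_eq_iff)
 have "va <= 2*m + 2" "vi <= 2*m + 2" using 1 N_le by auto
 thus ?case using 1 N_le by (auto simp: sp_z_def s intro!: big_intros)
qed (rule max4I, simp)

lemma evq_entry:
 assumes g: "evq m x c g (int vg) e1 \<phi>1" and a: "evq m x c a (int va) e2 \<phi>2" and d: "evq m x c d (int vd) e2 \<phi>2"
 shows "evq m x c (g_entry K x g a d) (sp_num m (pal K m) p (pdig K m vg) va vd) (max e1 (max e2 53) + 46) (\<phi>1 & \<phi>2 & vg < 2^(m*m) & va < 2*N & vd < 2*N)"
 (is "evq _ _ _ _ _ _ ?\<phi>")
 unfolding g_entry_def
proof (rule evq_mono, rule evq_form[where ez = "max e1 (max e2 53) + 33" and \<phi> = "%_. ?\<phi>"])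
 fix c' i j assume i: "evq m x c' i (int j) 0 True" and ctx: "c \<preceq> c'" "evm m c x (int m) 0" and j: "int j < int N"
 note g' = evq_ctx[OF g ctx] and a' = evq_ctx[OF a ctx] and d' = evq_ctx[OF d ctx]
 show "evq m x c' (g_z K x g a i) (sp_z m p (pdig K m vg) va j) (max e1 (max e2 53) + 33) ?\<phi>"
  by (rule evq_mono, rule evq_z[OF g' a' i]) (use j in auto)
 show "evq m x c' (g_z K x g d i) (sp_z m p (pdig K m vg) vd j) (max e1 (max e2 53) + 33) ?\<phi>"
  by (rule evq_mono, rule evq_z[OF g' d' i]) (use j in auto)
 have eqv: "evq m x c' (g_eq f (g_add (g_tot x) i)) (of_bool (vf = N + j)) (max e1 (max e2 53) + 33) ?\<phi>"
  if f: "evq m x c' f (int vf) e2 \<phi>2" and vf: "vf = va \<or> vf = vd" for f vf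
 proof (rule evq_mono, (rule evq_rules evq_tot f i)+, goal_cases)
  case 1
  hence "vf <= 2*m + 2" using vf N_le by auto
  moreover have "(int vf = int N + int j) = (vf = N + j)" by auto
  ultimately show ?case using 1 N_le j by (auto intro!: big_intros)
 qed (rule max3I, simp)
 show "evq m x c' (g_eq a (g_add (g_tot x) i)) (of_bool (va = N + j)) (max e1 (max e2 53) + 33) ?\<phi>"
  by (rule eqv[OF a']) simp
 show "evq m x c' (g_eq d (g_add (g_tot x) i)) (of_bool (vd = N + j)) (max e1 (max e2 53) + 33) ?\<phi>"
  by (rule eqv[OF d']) simp
qed (auto simp: sp_num_def)

lemma pal_le: "int (pal K m) <= int m^2"
by (smt (verit) mult_le_mono K_le N_le of_nat_le_iff of_nat_power power2_eq_square pal_def)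

text \<open>Power counting. The exponent 35 is below 40, so values of the form are less than
  \<open>2^m\<close>, a bound that is used again for the isolating intervals of the output.\<close>

lemma form_abs:
 assumes z: "!!i. \<bar>zv i\<bar> <= int m^10" "!!i. \<bar>zv' i\<bar> <= int m^10"
  and y: "!!i. \<bar>yv i\<bar> <= int m^8" "!!i. \<bar>yv' i\<bar> <= int m^8"
 shows "\<bar>sp_form m (pal K m) p zv yv zv' yv'\<bar> <= int m^35"
proof -
 have R1: "\<bar>int R\<bar> <= int m" using R_le by simp
 have v: "\<bar>\<Sum>i<N. u i*cyb m (e i) k\<bar> <= int m*(int m^10*1)" if "!!i. \<bar>u i\<bar> <= int m^10" for u k
  by (rule sum_abs_bound, rule mult_abs_bound[OF that cyb_abs]) (use N_le in auto)
 have 1: "\<bar>\<Sum>k<m. (\<Sum>i<N. zv i*cyb m (e i) k)*(\<Sum>i<N. zv' i*cyb m (e i) k)\<bar> <= int m*(int m*(int m^10*1)*(int m*(int m^10*1)))"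
  by (rule sum_abs_bound, rule mult_abs_bound[OF v[OF z(1)] v[OF z(2)]]) auto
 have al: "\<bar>int (pal K m)\<bar> <= int m^2" and pa: "\<bar>int p\<bar> <= int m^7" using pal_le p_le by auto
 have 2: "\<bar>\<Sum>i<N. \<Sum>j<N. yv i*yv' j * sp_A m (e i) (e j)\<bar> <= int m*(int m*(int m^8*int m^8*int m))"
 proof (rule sum_abs_bound, rule sum_abs_bound)
  fix i j
  have "\<bar>sp_A m (e i) (e j)\<bar> <= int m" using spA_abs[of "e i" "e j"] R1 by linarith
  thus "\<bar>yv i*yv' j * sp_A m (e i) (e j)\<bar> <= int m^8*int m^8*int m"
   by (intro mult_abs_bound y)
 qed (use N_le in auto)
 have "\<bar>sp_form m (pal K m) p zv yv zv' yv'\<bar>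
  <= int m^2*int m^2*int m*(int m*(int m*(int m^10*1)*(int m*(int m^10*1))))
   + int m^7*int m^7*(int m*(int m*(int m^8*int m^8*int m)))"
  unfolding sp_form_def by (rule order_trans[OF abs_triangle_ineq]) (intro add_mono mult_abs_bound 1 2 al pa R1)
 also have "\<dots> = int m^28 + int m^33" by (simp add: eval_nat_numeral)
 also have "\<dots> <= int m^34 + int m^34" using m by (intro add_mono power_increasing) auto
 also have "\<dots> <= int m*int m^34" using m by simp
 also have "\<dots> = int m^35" by (simp add: eval_nat_numeral)
 finally show ?thesis .
qed

lemma cz_abs: "\<bar>sp_cz m p d C k i\<bar> <= int m^10"
proof -
 define A where "A = sp_w m d C k i + int p*2^m + int p div 2"
 have "0 < int p" using pp_pos by simp
 hence "0 <= A mod int p" "A mod int p < int p" by simp_all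
 hence "\<bar>A mod int p - int p div 2\<bar> <= int p" by linarith
 also have "\<dots> <= int m^7" by (rule p_le)
 also have "\<dots> <= int m^10" using m by simp
 finally show ?thesis by (simp add: sp_cz_def A_def)
qed

lemma z_abs: "\<bar>sp_z m p (pdig K m g) a i\<bar> <= int m^10"
proof -
 have "\<bar>\<Sum>j<N. of_bool (a = N + j) * sp_h m (pdig K m g) i j\<bar> <= int m*(1*int m^8)"
  by (rule sum_abs_bound, rule mult_abs_bound[OF _ h_abs]) (use N_le in auto)
 moreover have "\<bar>int p * of_bool (i = a)\<bar> <= int m^7*1" using p_le by simp
 ultimately have "\<bar>sp_z m p (pdig K m g) a i\<bar> <= int m^7*1 + int m*(1*int m^8)" unfolding sp_z_def by linarith
 also have "\<dots> = int m^7 + int m^9" by (simp add: eval_nat_numeral)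
 also have "\<dots> <= int m^9 + int m^9" using m by simp
 also have "\<dots> <= int m*int m^9" using m by simp
 also have "\<dots> = int m^10" by (simp add: eval_nat_numeral)
 finally show ?thesis .
qed

lemma q_rng: "rng m (sp_q m (pal K m) p d C k)"
proof (rule rngI)
 have "0 <= real_of_int (sp_q m (pal K m) p d C k)"
  unfolding sp_q_def form_eq using nB_nonneg nA_nonneg by simp
 thus "0 <= sp_q m (pal K m) p d C k" by simp
 have "\<bar>sp_q m (pal K m) p d C k\<bar> <= int m^35" unfolding sp_q_def by (intro form_abs cz_abs y_abs)
 also have "\<dots> < 2^m" by (rule pow_lt_2m_int) simp
 also have "\<dots> <= int (2^m*2^m)" by simp
 finally show "sp_q m (pal K m) p d C k <= int (2^m*2^m)" by linarith
qed

lemma num_abs: "\<bar>sp_num m (pal K m) p (pdig K m g) a d\<bar> < 2^m"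
proof -
 have one: "\<bar>of_bool u\<bar> <= int m^8" for u
 using m by simp
 have "\<bar>sp_num m (pal K m) p (pdig K m g) a d\<bar> <= int m^35"
  unfolding sp_num_def by (rule form_abs[OF z_abs z_abs one one])
 also have "\<dots> < 2^m" by (rule pow_lt_2m_int) simp
 finally show ?thesis .
qed

end

section \<open>The minimum over all codes and the best grid point\<close>

primrec smin :: "int => (nat => int) => nat => int" where
 "smin B q 0 = B - 1"
| "smin B q (Suc n) = min (smin B q n) ((q n - 1) mod B)"

text \<open>The initial value \<open>B - 1\<close> is the largest residue, hence neutral. It is also
  the residue of -1, so the program obtains it as \<open>0 - 1\<close>.\<close>

lemma smin_Min:
 assumes "0 < B" "0 < n"
 shows "smin B q n = (MIN k\<in>{..<n}. (q k - 1) mod B)"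
proof -
 have "smin B q (Suc k) = (MIN k\<in>{..<Suc k}. (q k - 1) mod B)" for k
 proof (induction k)
  case 0
  have "(q 0 - 1) mod B < B" using assms(1) by simp
  hence "(q 0 - 1) mod B <= B - 1" by linarith
  thus ?case by (simp add: lessThan_Suc)
 next
  case (Suc k)
  have "(MIN k\<in>{..<Suc (Suc k)}. (q k - 1) mod B) = min ((q (Suc k) - 1) mod B) (MIN k\<in>{..<Suc k}. (q k - 1) mod B)"
   unfolding lessThan_Suc[of "Suc k"] image_insert by (rule Min_insert) auto
  thus ?case using Suc by simp
 qed
 from this[of "n - 1"] show ?thesis using assms(2) by simp
qed

lemma smin_rng: "0 < B ==> 0 <= smin B q n & smin B q n < B"
 by (induction n) auto

primrec best :: "(nat => int) => nat => nat" where
 "best sc 0 = 0"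
| "best sc (Suc n) = (if sc n <= sc (best sc n) then best sc n else n)"

lemma best_lt: "0 < n ==> best sc n < n"
proof (induction n)
 case (Suc n)
 thus ?case by (cases n) auto
qed simp

lemma best_ge: "k < n ==> sc k <= sc (best sc n)"
 by (induction n) (auto simp: less_Suc_eq)

definition "g_score K x g = g_loop (g_pKK K x) (g_sub (g_const 0) (g_const 1)) (%k acc. g_min acc (g_sub (g_q K x g k) (g_const 1)))"

text \<open>Replacing the champion is done arithmetically: the difference \<open>k - acc\<close> is
  added with a factor 0 or 1. The score of the champion is recomputed in every round, which doubles
  the time and spares a second accumulator.\<close>

definition "g_best K x = g_loop (g_prod (g_tot x) (%_. g_pp K x)) (g_const 0)
   (%k acc. g_add acc (g_mul (g_sub (g_const 1) (g_le (g_score K x k) (g_score K x acc))) (g_sub k acc)))"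

context algo
begin

definition score :: "nat => int" where
 "score vg = smin (2^(m*m)) (sp_q m (pal K m) p (pdig K m vg) C) (pKK K m)"

lemma evq_evm: "evq m x c g v ee \<phi> ==> evm m c x (int m) 0 ==> \<phi> ==> evm m c g v ee"
 using m100 by (simp add: evq_def)

lemma evm_evq: "evm m c g v ee ==> evq m x c g v ee True"
 by (simp add: evq_def)

text \<open>The loop is exponential: its number of rounds stays a factor of the bound, and a power
  of \<open>m\<close> collects the rest. Each candidate enters the minimum as a residue, which is
  where the value 0 of the zero vector wraps around to the top.\<close>

lemma ev_score:
 assumes x: "evm m c x (int m) 0" and g: "evm m c g (int vg) 0" and vg: "vg < 2^(m*m)"
 shows "ev (m*m) c (g_score K x g) (score vg) ((pKK K m + 1)*m^110) 432"
proof -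
 let ?L = "m*m"
 let ?q = "sp_q m (pal K m) p (pdig K m vg) C"
 have KK: "evm m c (g_pKK K x) (int (pKK K m)) 60" by (rule evq_evm[OF evq_pKK x]) simp
 have m1: "evm m c (g_sub (g_const 0) (g_const 1)) (smin (2^?L) ?q 0) 1"
 proof (rule evm_congruent)
  show "evm m c (g_sub (g_const 0) (g_const 1)) (0 - 1) 1"
   by (rule evq_evm[OF evq_mono x TrueI], (rule evq_rules)+) auto
  show "(0 - 1 :: int) mod 2^(m*m) = smin (2^(m*m)) ?q 0 mod 2^(m*m)"
   by simp
 qed
 have "ev ?L c (g_score K x g) (smin (2^?L) ?q (pKK K m)) (m^1 + m^60 + (pKK K m + 1)*(m^106 + 3)) 432"
  unfolding g_score_def
 proof (rule ev_loop[where ha = "4*1 + 1" and hb = "4*60 + 1" and h = "4*106 + 1" and F = "smin (2^?L) ?q"])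
  show "ev ?L c (g_pKK K x) (int (pKK K m)) (m^60) (4*60 + 1)" using KK by (simp add: evm_def)
  show "ev ?L c (g_sub (g_const 0) (g_const 1)) (smin (2^?L) ?q 0) (m^1) (4*1 + 1)" using m1 by (simp only: evm_def)
  show "pKK K m < 2^?L" by (rule pKK_lt)
  fix c' k acc j assume a: "c \<preceq> c'" "j < pKK K m" "ev ?L c' k (int j) 1 1" "ev ?L c' acc (smin (2^?L) ?q j) 1 1"
  have k: "evm m c' k (int j) 0" using a(3) by (simp add: evm_def)
  have acc: "evm m c' acc (smin (2^?L) ?q j) 0" using a(4) by (simp add: evm_def)
  note x' = evm_ctx[OF x a(1)] and g' = evm_ctx[OF g a(1)]
  have j: "j < 2^?L" using a(2) pKK_lt by linarith
  have "evm m c' (g_sub (g_q K x g k) (g_const 1)) (?q j - 1) 105"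
   by (rule evq_evm[OF evq_mono x' TrueI], (rule evq_rules evq_q evm_evq[OF k] evm_evq[OF g'])+) (use j vg in auto)
  hence q1: "evm m c' (g_sub (g_q K x g k) (g_const 1)) ((?q j - 1) mod 2^?L) 105"
   by (rule evm_congruent) simp
  have "evm m c' (g_min acc (g_sub (g_q K x g k) (g_const 1))) (min (smin (2^?L) ?q j) ((?q j - 1) mod 2^?L)) (Suc (max 0 105))"
   using smin_rng[of "2^?L" ?q j]
   by (intro evm_bin[OF acc q1 m100] ev_min) auto
  thus "ev ?L c' (g_min acc (g_sub (g_q K x g k) (g_const 1))) (smin (2^?L) ?q (Suc j)) (m^106) (4*106 + 1)"
   by (simp add: evm_def)
 qed auto
 thus ?thesis unfolding score_def
 proof (rule ev_weaken)
  define Z where "Z = m^106"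
  have Z: "m^1 <= Z" "m^60 <= Z" "1 <= Z" unfolding Z_def using m by (intro power_increasing one_le_power; simp)+
  hence "m^1 + m^60 <= 1*(2*Z)" by linarith
  also have "\<dots> <= (pKK K m + 1)*(2*Z)" by simp
  finally have "m^1 + m^60 <= (pKK K m + 1)*(2*Z)" .
  moreover have "(pKK K m + 1)*(Z + 3) <= (pKK K m + 1)*(4*Z)" using Z(3) by (intro mult_le_mono2) linarith
  ultimately have "m^1 + m^60 + (pKK K m + 1)*(Z + 3) <= (pKK K m + 1)*(2*Z) + (pKK K m + 1)*(4*Z)" by (rule add_mono)
  also have "\<dots> = (pKK K m + 1)*(6*Z)" by simp
  finally have "m^1 + m^60 + (pKK K m + 1)*(Z + 3) <= (pKK K m + 1)*(6*Z)" .
  also have "\<dots> <= (pKK K m + 1)*(m^4*Z)"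
   using m100 power_increasing[of 1 4 m] by (intro mult_le_mono order_refl) auto
  also have "m^4*Z = m^110" by (simp add: Z_def)
  finally show "m^1 + m^60 + (pKK K m + 1)*(m^106 + 3) <= (pKK K m + 1)*m^110" unfolding Z_def .
 qed auto
qed

lemma score_rng: "0 <= score vg" "score vg < 2^(m*m)"
 using smin_rng[of "2^(m*m)"] by (auto simp: score_def)

lemma ev_best:
 assumes x: "evm m c x (int m) 0"
 shows "ev (m*m) c (g_best K x) (int (best score (p^N))) ((p^N + 1)*(pKK K m + 1)*m^112) 440"
proof -
 let ?L = "m*m"
 define S where "S = (pKK K m + 1)*m^110"
 have L: "10 <= ?L" using m100 mult_le_mono[of 10 m 1 m] by simp
 have pN: "p^N < 2^?L" by (rule ppow_lt[OF N_le])
 have n: "evm m c (g_prod (g_tot x) (%_. g_pp K x)) (int (p^N)) 52"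
  by (rule evq_evm[OF evq_mono x TrueI], (rule evq_rules evq_tot evq_pp | assumption | erule (1) evq_step)+) (use N_le in auto)
 have c0: "ev ?L c0 (g_const 0) 0 1 1" and c1: "ev ?L c0 (g_const 1) 1 1 1" for c0
  using ev_const[of 0 ?L c0] ev_const[of 1 ?L c0] by simp_all
 have "ev ?L c (g_best K x) (int (best score (p^N))) (1 + m^52 + (p^N + 1)*(2*S + 10 + 3)) 440"
  unfolding g_best_def
 proof (rule ev_loop[where ha = 1 and hb = "4*52 + 1" and h = 437 and F = "%n. int (best score n)"])
  show "ev ?L c (g_prod (g_tot x) (%_. g_pp K x)) (int (p^N)) (m^52) (4*52 + 1)" using n by (simp add: evm_def)
  show "ev ?L c (g_const 0) (int (best score 0)) 1 1" using c0 by simp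
  show "p^N < 2^?L" by (rule pN)
  fix c' k acc j assume a: "c \<preceq> c'" "j < p^N" "ev ?L c' k (int j) 1 1" "ev ?L c' acc (int (best score j)) 1 1"
  have jb1: "j < 2^?L" using a(2) pN by simp
  have "best score j <= j" using best_lt[of j score] by (cases j) auto
  hence jb: "j < 2^?L" "best score j < 2^?L" using jb1 by auto
  note x' = evm_ctx[OF x a(1)]
  have sk: "ev ?L c' (g_score K x k) (score j) S 432" unfolding S_def using a(3) jb by (intro ev_score x') (simp_all add: evm_def)
  have sa: "ev ?L c' (g_score K x acc) (score (best score j)) S 432" unfolding S_def using a(4) jb by (intro ev_score x') (simp_all add: evm_def)
  have "ev ?L c' (g_le (g_score K x k) (g_score K x acc)) (of_bool (score j <= score (best score j))) (S + S + 1) 433"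
   by (rule ev_le[OF sk sa]) (use score_rng in auto)
  from ev_sub[OF c1 this, of 434]
  have s1: "ev ?L c' (g_sub (g_const 1) (g_le (g_score K x k) (g_score K x acc))) (1 - of_bool (score j <= score (best score j))) (1 + (S + S + 1) + 1) 434" by simp
  have s2: "ev ?L c' (g_sub k acc) (int j - int (best score j)) (1 + 1 + 1) 2" by (rule ev_sub[OF a(3,4)]) auto
  let ?G = "g_mul (g_sub (g_const 1) (g_le (g_score K x k) (g_score K x acc))) (g_sub k acc)"
  have s3: "ev ?L c' ?G
   ((1 - of_bool (score j <= score (best score j)))*(int j - int (best score j))) ((1 + (S + S + 1) + 1) + (1 + 1 + 1) + 1) 434"
   by (rule ev_mul[OF s1 s2]) auto
  have "ev ?L c' (g_add acc ?G)
   (int (best score j) + (1 - of_bool (score j <= score (best score j)))*(int j - int (best score j)))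
   (1 + ((1 + (S + S + 1) + 1) + (1 + 1 + 1) + 1) + 1) 435"
   by (rule ev_add[OF a(4) s3]) auto
  thus "ev ?L c' (g_add acc ?G) (int (best score (Suc j))) (2*S + 10) 437"
   by (rule ev_weaken) auto
 qed auto
 thus ?thesis unfolding S_def
 proof (rule ev_weaken)
  define W where "W = (pKK K m + 1)*m^110"
  have "m^52 <= m^110" using m by simp
  also have "\<dots> <= W" by (simp add: W_def)
  finally have W: "m^52 <= W" .
  moreover have "1 <= m^52" using m by simp
  ultimately have W': "1 <= W" by linarith
  have "1 + m^52 + (p^N + 1)*(2*W + 10 + 3) <= (p^N + 1)*(17*W)"
  proof -
   have "1 + m^52 <= 1*(2*W)" using W W' by linarith
   also have "\<dots> <= (p^N + 1)*(2*W)" by simp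
   finally have "1 + m^52 <= (p^N + 1)*(2*W)" .
   moreover have "(p^N + 1)*(2*W + 10 + 3) <= (p^N + 1)*(15*W)" using W' by (intro mult_le_mono2) linarith
   ultimately have "1 + m^52 + (p^N + 1)*(2*W + 10 + 3) <= (p^N + 1)*(2*W) + (p^N + 1)*(15*W)" by (rule add_mono)
   also have "\<dots> = (p^N + 1)*(17*W)" by simp
   finally show ?thesis .
  qed
  also have "\<dots> <= (p^N + 1)*(m^2*W)"
   using m100 power_increasing[of 1 2 m] by (intro mult_le_mono order_refl) auto
  also have "\<dots> = (p^N + 1)*(pKK K m + 1)*m^112"
  proof -
   have "m^2*m^110 = m^112" by simp
   hence "m^2*W = (pKK K m + 1)*m^112" unfolding W_def by (simp only: mult.left_commute[of "m^2"])
   thus ?thesis by (simp only: mult.assoc)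
  qed
  finally show "1 + m^52 + (p^N + 1)*(2*((pKK K m + 1)*m^110) + 10 + 3) <= (p^N + 1)*(pKK K m + 1)*m^112" unfolding W_def .
 qed auto
qed

end

section \<open>Encoding of the entries\<close>

lemma int_encode_eq: "int_encode v = (if 0 <= v then 2*nat v else 2*nat (- v) - 1)"
 by (auto simp: int_encode_def sum_encode_def)

text \<open>The rational number \<open>v / D\<close> as the root of \<open>D * X - v\<close>,
  isolated by the interval from \<open>- W\<close> to \<open>W\<close>: two coefficients, then both
  ends with denominator 1. The numbers \<open>2 * D\<close>, \<open>2 * W - 1\<close> and
  \<open>2 * W\<close> are the values of \<open>int_encode\<close> at \<open>D\<close>,
  \<open>- W\<close> and \<open>W\<close>.\<close>

definition ent_code :: "int => nat => nat => nat => nat" where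
 "ent_code v D W r = [2, int_encode (- v), 2*D, 2*W - 1, 1, 2*W, 1] ! r"

definition out_item :: "nat => nat => nat => nat => nat" where
 "out_item K m vg i = (if i = 0 then 2*totient m else
   ent_code (sp_num m (pal K m) (pp K m) (pdig K m vg) ((i - 1) div 7 div (2*totient m)) ((i - 1) div 7 mod (2*totient m)))
    (sp_den m (pal K m) (pp K m)) (2^m) ((i - 1) mod 7))"

definition "g_dim x = g_mul (g_const 2) (g_tot x)"
text \<open>Values are residues, so \<open>y - 1\<close> at \<open>y = 0\<close> would be the
  largest one. Adding 6 before the division avoids this, and the last summand repairs the case
  \<open>y = 0\<close>, where truncated subtraction is meant.\<close>

definition "g_idx y = g_add (g_sub (g_div (g_add y (g_const 6)) (g_const 7)) (g_const 1)) (g_eq y (g_const 0))"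
definition "g_comp y = g_mod (g_add y (g_const 6)) (g_const 7)"
definition "g_num_at K x g y = g_entry K x g (g_div (g_idx y) (g_dim x)) (g_mod (g_idx y) (g_dim x))"
definition "g_den K x = g_mul (g_mul (g_mul (g_al K x) (g_pp K x)) (g_pp K x)) (g_rad x)"
text \<open>One of the seven numbers is selected by indicators. The sign of the entry is read off
  after adding \<open>2^m\<close>, which exceeds its absolute value.\<close>

definition "g_code K x g y =
   g_add (g_mul (g_eq (g_comp y) (g_const 0)) (g_const 2))
  (g_add (g_mul (g_eq (g_comp y) (g_const 1))
    (g_add (g_mul (g_le (g_add (g_num_at K x g y) (g_pow2 x)) (g_pow2 x)) (g_mul (g_const 2) (g_sub (g_const 0) (g_num_at K x g y))))
        (g_mul (g_sub (g_const 1) (g_le (g_add (g_num_at K x g y) (g_pow2 x)) (g_pow2 x))) (g_sub (g_mul (g_const 2) (g_num_at K x g y)) (g_const 1)))))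
  (g_add (g_mul (g_eq (g_comp y) (g_const 2)) (g_mul (g_const 2) (g_den K x)))
  (g_add (g_mul (g_eq (g_comp y) (g_const 3)) (g_sub (g_mul (g_const 2) (g_pow2 x)) (g_const 1)))
  (g_add (g_eq (g_comp y) (g_const 4))
  (g_add (g_mul (g_eq (g_comp y) (g_const 5)) (g_mul (g_const 2) (g_pow2 x)))
      (g_eq (g_comp y) (g_const 6)))))))"
definition "g_item K x g y = g_add (g_mul (g_eq y (g_const 0)) (g_dim x)) (g_mul (g_sub (g_const 1) (g_eq y (g_const 0))) (g_code K x g y))"

context algo
begin

lemma small_rng: "k <= m^4 + 6 ==> rng m (int k)"
proof (rule rng_small)
 assume "k <= m^4 + 6"
 also have "\<dots> <= 2*m^4" using m100 power_increasing[of 1 4 m] by simp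
 also have "\<dots> <= m*m^4" using m by simp
 also have "\<dots> = m^5" by (simp add: eval_nat_numeral)
 also have "\<dots> <= m^40" using m by simp
 finally show "k <= m^40" .
qed

lemma evq_comp: "evq m x c y (int vy) 0 \<phi> ==> evq m x c (g_comp y) (int ((vy + 6) mod 7)) 2 (\<phi> & vy <= m^4)"
 unfolding g_comp_def
proof (rule evq_mono, (rule evq_rules | assumption)+, goal_cases)
 case 1
 hence "rng m (int (vy + 6))" by (intro small_rng) simp
 thus ?case using 1 m100 by (auto simp: zmod_int intro!: big_intros)
qed simp

lemma evq_idx: "evq m x c y (int vy) 0 \<phi> ==> evq m x c (g_idx y) (int ((vy - 1) div 7)) 4 (\<phi> & vy <= m^4)"
 unfolding g_idx_def
proof (rule evq_mono, (rule evq_rules | assumption)+, goal_cases)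
 case 1
 hence r: "rng m (int (vy + 6))" "rng m (int vy)" by (intro small_rng, simp)+
 have "(int vy + 6) div 7 - 1 + of_bool (int vy = 0) = int ((vy - 1) div 7)"
 by auto
 thus ?case using 1 r m100 by (auto intro!: big_intros)
qed simp

lemma evq_dim: "evq m x c (g_dim x) (2*int N) 41 True"
 unfolding g_dim_def by (rule evq_mono, (rule evq_rules evq_tot)+) auto

lemma N_dim: "(2*N)*(2*N) <= m^3"
proof -
 have "(2*N)*(2*N) <= (2*m)*(2*m)" using N_le by (intro mult_le_mono) auto
 also have "\<dots> = 4*(m*m)" by simp
 also have "\<dots> <= m*(m*m)" using m100 by simp
 also have "\<dots> = m^3" by (simp add: eval_nat_numeral)
 finally show ?thesis .
qed

lemma evq_num_at:
 assumes g: "evq m x c g (int vg) 0 \<phi>1" and y: "evq m x c y (int vy) 0 \<phi>2"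
 shows "evq m x c (g_num_at K x g y) (sp_num m (pal K m) p (pdig K m vg) ((vy - 1) div 7 div (2*N)) ((vy - 1) div 7 mod (2*N))) 100
  (\<phi>1 & \<phi>2 & vg < 2^(m*m) & vy <= m^4 & (vy - 1) div 7 < (2*N)*(2*N))"
proof -
 let ?t = "(vy - 1) div 7"
 let ?\<phi> = "\<phi>2 & vy <= m^4 & ?t < (2*N)*(2*N)"
 have t: "rng m (int ?t)" if "vy <= m^4"
  using that by (intro small_rng) linarith
 have d: "rng m (2*int N)" using N_le by (auto intro!: big_intros)
 have r: "evq m x c (g_div (g_idx y) (g_dim x)) (int (?t div (2*N))) 42 ?\<phi>"
  by (rule evq_mono, (rule evq_rules evq_idx evq_dim y)+) (use t d in \<open>auto simp: zdiv_int\<close>)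
 have s: "evq m x c (g_mod (g_idx y) (g_dim x)) (int (?t mod (2*N))) 42 ?\<phi>"
  by (rule evq_mono, (rule evq_rules evq_idx evq_dim y)+) (use t d in \<open>auto simp: zmod_int\<close>)
 have N0: "0 < 2*N" using m by simp
 show ?thesis unfolding g_num_at_def
  by (rule evq_mono, rule evq_entry[OF g r s]) (use N0 in \<open>auto simp: less_mult_imp_div_less\<close>)
qed

lemma evq_den: "evq m x c (g_den K x) (int (sp_den m (pal K m) p)) 52 True"
 unfolding g_den_def by (rule evq_mono, (rule evq_rules evq_al evq_pp evq_rad)+) (auto simp: sp_den_def)

lemma evq_code:
 assumes g: "evq m x c g (int vg) 0 \<phi>1" and y: "evq m x c y (int vy) 0 \<phi>2"
 shows "evq m x c (g_code K x g y) (int (ent_code (sp_num m (pal K m) p (pdig K m vg) ((vy - 1) div 7 div (2*N)) ((vy - 1) div 7 mod (2*N)))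
    (sp_den m (pal K m) p) (2^m) ((vy + 6) mod 7))) 115
  (\<phi>1 & \<phi>2 & vg < 2^(m*m) & vy <= m^4 & (vy - 1) div 7 < (2*N)*(2*N))"
 unfolding g_code_def
proof (rule evq_mono, (rule evq_rules evq_comp evq_num_at evq_pow2 evq_den g y)+, goal_cases)
 case 1
 define v where "v = sp_num m (pal K m) p (pdig K m vg) ((vy - 1) div 7 div (2*N)) ((vy - 1) div 7 mod (2*N))"
 define r where "r = (vy + 6) mod 7"
 define D where "D = sp_den m (pal K m) p"
 have v: "\<bar>v\<bar> < 2^m" unfolding v_def by (rule num_abs)
 have W: "rng m (2^m)" by (rule rngI) auto
 have vW: "rng m (v + 2^m)"
 proof (rule rngI)
  have "(2 :: int)*1 <= 2^m" using m power_increasing[of 1 m "2 :: int"] by simp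
  hence "(2 :: int)*2^m <= 2^m*2^m" by simp
  thus "v + 2^m <= int (2^m*2^m)" using v by (simp only: of_nat_mult of_nat_power of_nat_numeral)
 qed (use v in linarith)
 have W1: "int (2*2^m - 1) = 2*2^m - 1" by simp
 have "r < 7" by (simp add: r_def)
 hence "r \<in> {0, 1, 2, 3, 4, 5, 6}" by auto
 hence eqn: "of_bool (int r = 0)*2 + (of_bool (int r = 1)*(of_bool (v + 2^m <= 2^m)*(2*(0 - v)) + (1 - of_bool (v + 2^m <= 2^m))*(2 * v - 1))
   + (of_bool (int r = 2)*(2*int D) + (of_bool (int r = 3)*(2*2^m - 1) + (of_bool (int r = 4) + (of_bool (int r = 5)*(2*2^m) + of_bool (int r = 6)))))) = int (ent_code v D (2^m) r)"
  by (elim insertE emptyE) (auto simp: ent_code_def int_encode_eq)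
 have r: "rng m (int r)" using \<open>r < 7\<close> m100 by (auto intro!: big_intros)
 have n: "rng m 0" "rng m 1" "rng m 2" "rng m 3" "rng m 4" "rng m 5" "rng m 6" using m100 by (auto intro!: big_intros)
 have i: "0 <= int m" "int m <= int m + 1" by auto
 show ?case unfolding v_def[symmetric] r_def[symmetric] D_def[symmetric] nat_int eqn
  using 1 W vW r n i by blast
qed simp

lemma evq_item:
 assumes g: "evq m x c g (int vg) 0 \<phi>1" and y: "evq m x c y (int vy) 0 \<phi>2"
 shows "evq m x c (g_item K x g y) (int (out_item K m vg vy)) 120
  (\<phi>1 & \<phi>2 & vg < 2^(m*m) & vy <= m^4 & (vy - 1) div 7 < (2*N)*(2*N))"
 unfolding g_item_def
proof (rule evq_mono, (rule evq_rules evq_dim evq_code g y)+, goal_cases)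
 case 1
 have "rng m (int vy)" using 1 by (intro small_rng) simp
 moreover have "(vy + 6) mod 7 = (vy - 1) mod 7" if "vy ~= 0"
 proof -
  have "vy + 6 = (vy - 1) + 7" using that by simp
  thus ?thesis by (simp only: mod_add_self2)
 qed
 ultimately show ?case using 1 by (auto simp: out_item_def)
qed simp

end

section \<open>The program and its output\<close>

definition "g_len x = g_add (g_const 1) (g_mul (g_const 7) (g_mul (g_dim x) (g_dim x)))"

text \<open>The loop with a single round is a binding construct: its accumulator holds the result of
  the search, to which the item refers many times. The search is repeated for every item of the
  output, which costs another power of \<open>m\<close>.\<close>

definition lattice_program :: "nat => program" where
 "lattice_program K = prog_output g_len (%x y. g_loop (g_const 1) (g_best K x) (%_ g. g_item K x g y))"

context algo
begin

definition opt :: nat where "opt = best score (p^N)"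

definition olen :: nat where "olen = 1 + 7*((2*N)*(2*N))"

definition items :: "nat list" where "items = map (out_item K m opt) [0..<olen]"

lemma opt_lt: "opt < p^N"
 unfolding opt_def by (rule best_lt) (use pp_pos in simp)

lemma olen_le: "olen <= m^4"
proof -
 have "olen <= 1 + 7*m^3" unfolding olen_def using N_dim by linarith
 also have "\<dots> <= 8*m^3" using m by simp
 also have "\<dots> <= m*m^3" using m100 by simp
 also have "\<dots> = m^4" by (simp add: eval_nat_numeral)
 finally show ?thesis .
qed

lemma den_le: "sp_den m (pal K m) p <= m^17"
proof -
 have "pal K m <= m^2" using pal_le by simp
 hence "sp_den m (pal K m) p <= m^2*m^7*m^7*m" unfolding sp_den_def by (intro mult_le_mono pp_le R_le)
 also have "\<dots> = m^17" by (simp add: eval_nat_numeral)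
 finally show ?thesis .
qed

lemma out_item_bound: "out_item K m vg i + 1 < 2^(m*m)"
proof -
 have mm: "m + 3 <= m*m" using m100 mult_le_mono1[of 2 m m] by linarith
 have 8: "(2 :: nat)^m*8 <= 2^(m*m)" using power_increasing[OF mm, of "2 :: nat"] by (simp add: power_add)
 have m2: "m < 2^m" by simp
 have "sp_den m (pal K m) p < 2^m" using den_le pow_lt_2m[of 17] by simp
 hence "ent_code (sp_num m (pal K m) p (pdig K m vg) a d) (sp_den m (pal K m) p) (2^m) r <= 2*2^m" if "r < 7" for a d r
 proof -
  have v: "\<bar>sp_num m (pal K m) p (pdig K m vg) a d\<bar> < 2^m" by (rule num_abs)
  have "int_encode (- sp_num m (pal K m) p (pdig K m vg) a d) <= 2*2^m"
  proof -
   let ?v = "sp_num m (pal K m) p (pdig K m vg) a d"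
   have "?v <= 2^m" "- ?v <= 2^m" using v by auto
   hence "nat ?v <= 2^m" "nat (- ?v) <= 2^m" by auto
   thus ?thesis by (auto simp: int_encode_eq intro!: diff_le_self[THEN le_trans])
  qed
  moreover have "r \<in> {0, 1, 2, 3, 4, 5, 6}" using that by auto
  ultimately show ?thesis using \<open>sp_den m (pal K m) p < 2^m\<close> by (elim insertE emptyE) (auto simp: ent_code_def)
 qed
 moreover have "2*N <= 2*2^m" using m2 N_le by linarith
 ultimately have "out_item K m vg i <= 2*2^m" by (auto simp: out_item_def)
 moreover have "(1 :: nat) <= 2^m" by simp
 ultimately have "out_item K m vg i + 1 < 2^m*8" by linarith
 thus ?thesis using 8 by linarith
qed

lemma run_program:
 "\<exists>u s'. runs (lattice_program K) (input_mem m) u s' & u <= (p^N + 1)*(pKK K m + 1)*m^140 & output_list s' = items"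
proof -
 let ?L = "m*m"
 define Sb where "Sb = (p^N + 1)*(pKK K m + 1)*m^112"
 define S where "S = Sb + 1 + (1 + 1)*(m^120 + 3)"
 have len: "length items = olen" by (simp add: items_def)
 have mm: "10 <= m" "10 <= ?L" using m100 mult_le_mono[of 10 m 1 m] by simp_all
 have ol: "1000 + olen < 2^?L"
 proof (rule pow_lt[of 5])
  have "1000 + olen <= m^4 + m^4"
  proof (rule add_mono[OF _ olen_le])
   have "(10 :: nat)^4 <= m^4" using m100 by (intro power_mono) auto
   thus "1000 <= m^4" by simp
  qed
  also have "\<dots> <= m*m^4" using mult_le_mono1[of 2 m "m^4"] m by linarith
  also have "\<dots> = m^5" by (simp add: eval_nat_numeral)
  finally show "1000 + olen <= m^5" .
 qed simp
 have *: "\<exists>u s'. runs (prog_output g_len (%x y. g_loop (g_const 1) (g_best K x) (%_ g. g_item K x g y))) (input_mem m) u s'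
  & u <= (length items + 1)*(S + 3*?L + 10)*unit_cost ?L & output_list s' = items"
 proof (rule run_output[where h = 490])
  show "1000 + length items < 2^?L" using ol len by simp
  show "items ! i + 1 < 2^?L" if "i < length items" for i
   using that out_item_bound by (simp add: items_def)
  fix c x assume "ev ?L c x (int m) 1 1"
  hence x: "evm m c x (int m) 0" by (simp add: evm_def)
  have "evm m c (g_len x) (int olen) 45"
   unfolding g_len_def by (rule evq_evm[OF evq_mono x TrueI], (rule evq_rules evq_dim)+) (auto simp: olen_def)
  hence "ev ?L c (g_len x) (int olen) (m^45) (4*45 + 1)" by (simp only: evm_def)
  hence "ev ?L c (g_len x) (int olen) S 490"
  proof (rule ev_weaken)
   define Z where "Z = m^120"
   have "m^45 <= Z" unfolding Z_def using m by simp
   thus "m^45 <= S" unfolding S_def Z_def[symmetric] by simp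
  qed auto
  thus "ev ?L c (g_len x) (int (length items)) S 490" by (simp only: len)
  fix y i assume i: "i < length items" and "ev ?L c y (int i) 1 1"
  hence y: "evm m c y (int i) 0" by (simp add: evm_def)
  have io: "i < olen" using i len by simp
  have il: "i <= m^4" using io olen_le by linarith
  have id: "(i - 1) div 7 < (2*N)*(2*N)"
  proof -
   have "0 < (2*N)*(2*N)" using m by simp
   moreover have "i - 1 < ((2*N)*(2*N))*7 \<or> i = 0" using io unfolding olen_def by linarith
   ultimately show ?thesis by auto
  qed
  \<comment> \<open>Before the only round the accumulator holds the optimal grid point, after it the
    item of the output.\<close>
  define F where "F = (%n :: nat. if n = 0 then int opt else int (out_item K m opt i))"
  have "ev ?L c (g_loop (g_const 1) (g_best K x) (%_ g. g_item K x g y)) (F 1) (Sb + 1 + (1 + 1)*(m^120 + 3)) 490"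
  proof (rule ev_loop[where ha = 440 and hb = 1 and h = "4*120 + 1"])
   show "ev ?L c (g_const 1) (int 1) 1 1" using ev_const[of 1 ?L c] by simp
   show "ev ?L c (g_best K x) (F 0) Sb 440"
    using ev_best[OF x] by (simp only: Sb_def opt_def F_def if_True refl)
   show "1 < (2 :: nat)^?L" using mm(2) by (intro one_less_power) linarith+
   fix c' k acc j assume a: "c \<preceq> c'" "j < (1 :: nat)" "ev ?L c' acc (F j) 1 1"
   have acc: "evm m c' acc (int opt) 0" using a(2,3) by (simp add: evm_def F_def)
   have o: "opt < 2^?L" using opt_lt ppow_lt[OF N_le] by simp
   have "evm m c' (g_item K x acc y) (int (out_item K m opt i)) 120"
    by (rule evq_evm[OF evq_item[OF evm_evq[OF acc] evm_evq[OF evm_ctx[OF y a(1)]]] evm_ctx[OF x a(1)]]) (use o il id in blast)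
   thus "ev ?L c' (g_item K x acc y) (F (Suc j)) (m^120) (4*120 + 1)"
    by (simp only: evm_def F_def if_False nat.distinct)
  qed auto
  thus "ev ?L c (g_loop (g_const 1) (g_best K x) (%_ g. g_item K x g y)) (int (items ! i)) S 490"
   using io by (simp add: S_def items_def F_def)
 qed (use mm in auto)
 have "(length items + 1)*(S + 3*?L + 10)*unit_cost ?L <= (p^N + 1)*(pKK K m + 1)*m^140"
 proof -
  define Q where "Q = (p^N + 1)*(pKK K m + 1)"
  have Q: "1 <= Q" by (simp add: Q_def)
  have 1: "length items + 1 <= m^5"
  proof -
   have "length items + 1 <= m^4 + m^4" using olen_le len m by (intro add_mono) auto
   also have "\<dots> <= m*m^4" using mult_le_mono1[of 2 m "m^4"] m by linarith
   finally show ?thesis by (simp add: eval_nat_numeral)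
  qed
  have 2: "S + 3*?L + 10 <= Q*m^121"
  proof -
   define Z where "Z = m^120"
   have Z: "m^112 <= Z" "m^2 <= Z" "1 <= Z" unfolding Z_def using m by auto
   have "Sb <= Q*Z" unfolding Sb_def Q_def[symmetric] using Z by simp
   moreover have "1 + (1 + 1)*(Z + 3) + 3*?L + 10 <= 1*(22*Z)"
   using Z(2,3) by (simp add: power2_eq_square)
   moreover have "1*(22*Z) <= Q*(22*Z)" using Q by simp
   ultimately have "S + 3*?L + 10 <= Q*Z + Q*(22*Z)" unfolding S_def Z_def[symmetric] by linarith
   also have "\<dots> = Q*(23*Z)" by simp
   also have "\<dots> <= Q*(m*Z)" using m100 by simp
   also have "m*Z = m^121" unfolding Z_def by (simp only: power_Suc[symmetric]) simp
   finally show ?thesis .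
  qed
  have 3: "unit_cost ?L <= m^7"
  proof -
   have "?L + 2 <= m*m + m*m" using mm by simp
   hence "(?L + 2)\<^sup>2 <= (2*m^2)^2" by (intro power_mono) (simp_all add: power2_eq_square)
   hence "unit_cost ?L <= 1000*(2*m^2)^2" unfolding unit_cost_def by simp
   also have "\<dots> = 4000*m^4" by simp
   also have "\<dots> <= m^3*m^4"
   proof (rule mult_le_mono1)
    have "(100 :: nat)^3 <= m^3" using m100 by (intro power_mono) auto
    thus "4000 <= m^3" by simp
   qed
   also have "\<dots> = m^7" by simp
   finally show ?thesis .
  qed
  have "(length items + 1)*(S + 3*?L + 10)*unit_cost ?L <= m^5*(Q*m^121)*m^7"
   by (intro mult_le_mono 1 2 3)
  also have "\<dots> = Q*(m^5*m^121*m^7)" by simp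
  also have "m^5*m^121*m^7 = m^133" by simp
  also have "Q*m^133 <= Q*m^140" using m by simp
  finally show ?thesis by (simp only: Q_def)
 qed
 with * show ?thesis unfolding lattice_program_def using le_trans by blast
qed

end

lemma map_upt_mult: "map f [0..<k*n] = concat (map (%t. map (%r. f (k*t + r)) [0..<k]) [0..<n])"
proof (induction n)
 case (Suc n)
 have "[0..<k*Suc n] = [0..<k*n] @ [k*n..<k*n + k]" using upt_add_eq_append[of 0 "k*n" k] by (simp add: add.commute)
 moreover have "map f [k*n..<k*n + k] = map (%r. f (k*n + r)) [0..<k]"
  by (rule nth_equalityI) auto
 ultimately show ?case using Suc by simp
qed simp

text \<open>A linear polynomial has a single real root, so every interval containing
  \<open>v / D\<close> isolates it; the one given by \<open>W\<close> does because \<open>D\<close>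
  is at least 1.\<close>

lemma ent_code_real_alg:
 assumes D: "0 < D" and v: "\<bar>v\<bar> < int W" and W: "0 < W"
 shows "codes_real_alg (map (ent_code v D W) [0..<7]) (of_int v / real D)"
proof -
 let ?p = "[:- v, int D:]"
 have sol: "- of_int v + x*real D = 0 \<longleftrightarrow> x = of_int v / real D" for x using D by (auto simp: field_simps)
 have "\<bar>of_int v / real D\<bar> <= real W"
 using v D mult_left_mono[of 1 "real D" "real W"] by (simp add: pos_divide_le_eq)
 hence i: "- real W <= of_int v / real D" "of_int v / real D <= real W" by linarith+
 have q: "quotient_of (of_int z) = (z, 1)" for z by simp
 have "map (ent_code v D W) [0..<7] = [2, int_encode (- v), 2*D, 2*W - 1, 1, 2*W, 1]"
  by (simp add: ent_code_def eval_nat_numeral)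
 also have "\<dots> = length (coeffs ?p) # map int_encode (coeffs ?p) @ rat_code (of_int (- int W)) @ rat_code (of_int (int W))"
  using D unfolding rat_code_def q by (auto simp: int_encode_eq cCons_def)
 finally have w: "map (ent_code v D W) [0..<7] = length (coeffs ?p) # map int_encode (coeffs ?p) @ rat_code (of_int (- int W)) @ rat_code (of_int (int W))" .
 have "{x. of_rat (of_int (- int W)) <= x & x <= of_rat (of_int (int W)) & poly (map_poly of_int ?p) x = 0} = {of_int v / real D}"
  using i D by (auto simp: map_poly_pCons of_rat_minus nonzero_eq_divide_eq)
 moreover have "?p ~= 0" using D by simp
 ultimately show ?thesis unfolding codes_real_alg_def
  by (intro exI[of _ ?p] exI[of _ "of_int (- int W)"] exI[of _ "of_int (int W)"] conjI w)
qed

context algo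
begin

lemma items_code: "codes_matrix (2*N) items (mat (2*N) (2*N) (%(i, j). Qm (pal K m) p (pdig K m opt) i j))"
proof -
 let ?n = "2*N"
 let ?c = "%t. ent_code (sp_num m (pal K m) p (pdig K m opt) (t div ?n) (t mod ?n)) (sp_den m (pal K m) p) (2^m)"
 define ws where "ws = map (%t. map (?c t) [0..<7]) [0..<?n*?n]"
 have "items = out_item K m opt 0 # map (%i. out_item K m opt (Suc i)) [0..<7*(?n*?n)]"
  unfolding items_def olen_def by (simp add: upt_conv_Cons map_Suc_upt[symmetric] del: upt_Suc map_Suc_upt)
 also have "map (%i. out_item K m opt (Suc i)) [0..<7*(?n*?n)] = concat ws"
  unfolding ws_def map_upt_mult
 proof (intro arg_cong[of _ _ concat] map_cong refl)
  fix t r assume "r \<in> set [0..<7]"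
  hence r: "r < 7" by simp
  have "(7*t + r) div 7 = t" "(7*t + r) mod 7 = r" using r by simp_all
  thus "out_item K m opt (Suc (7*t + r)) = ?c t r" by (simp add: out_item_def)
 qed
 finally have w: "items = ?n # concat ws" by (simp add: out_item_def)
 have dm: "(i*n + j) div n = i" "(i*n + j) mod n = j" if "j < n" for i j n :: nat using that by simp_all
 have "codes_real_alg (ws ! (i*?n + j)) (mat ?n ?n (%(i, j). Qm (pal K m) p (pdig K m opt) i j) $$ (i, j))" if ij: "i < ?n" "j < ?n" for i j
 proof -
  have "i*?n + j < Suc i*?n" using ij by simp
  also have "\<dots> <= ?n*?n" using ij by (intro mult_le_mono1) simp
  finally have "ws ! (i*?n + j) = map (?c (i*?n + j)) [0..<7]" by (simp add: ws_def)
  also have "(i*?n + j) div ?n = i" by (rule dm(1)[OF ij(2)])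
  also have "(i*?n + j) mod ?n = j" by (rule dm(2)[OF ij(2)])
  finally have e: "ws ! (i*?n + j) = map (ent_code (sp_num m (pal K m) p (pdig K m opt) i j) (sp_den m (pal K m) p) (2^m)) [0..<7]" .
  have "0 < pal K m" using K by (simp add: pal_def)
  hence "codes_real_alg (ws ! (i*?n + j)) (of_int (sp_num m (pal K m) p (pdig K m opt) i j) / real (sp_den m (pal K m) p))"
   unfolding e by (intro ent_code_real_alg den_pos pp_pos) (use num_abs in auto)
  thus ?thesis using ij by (simp add: Qm_def)
 qed
 moreover have "length ws = ?n*?n" by (simp add: ws_def)
 ultimately show ?thesis unfolding codes_matrix_def by (intro exI[of _ ws] conjI allI impI w) blast+
qed

end

section \<open>Correctness and running time\<close>

context algo
begin

lemma ps_sq: "N <= ps m*ps m"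
proof (rule ccontr)
 assume "\<not> N <= ps m*ps m"
 hence a: "ps m*ps m < N" by simp
 have "(i + 1)*(i + 1) <= N" if "i < ps m" for i
  using that a mult_le_mono[of "i + 1" "ps m" "i + 1" "ps m"] by linarith
 moreover have "ps m <= ps m*ps m" by simp
 ultimately have "{..<ps m} \<subseteq> {i. i < N & (i + 1)*(i + 1) <= N}" by fastforce
 from card_mono[OF _ this] show False by (simp add: ps_def)
qed

lemma ps_upper: "(ps m - 1)*(ps m - 1) <= N"
proof -
 let ?S = "{i. i < N & (i + 1)*(i + 1) <= N}"
 have "card ?S*card ?S <= N"
 proof (rule ccontr)
  assume a: "\<not> card ?S*card ?S <= N"
  have "?S \<subseteq> {..<card ?S - 1}"
  proof
   fix i assume i: "i \<in> ?S"
   have "i + 1 < card ?S"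
   proof (rule ccontr)
    assume "\<not> i + 1 < card ?S"
    hence "card ?S*card ?S <= (i + 1)*(i + 1)" by (intro mult_le_mono) auto
    thus False using i a by simp
   qed
   thus "i \<in> {..<card ?S - 1}" by simp
  qed
  from card_mono[OF _ this] have "card ?S <= card ?S - 1" by (simp only: card_lessThan finite_lessThan)
  hence "card ?S = 0" by linarith
  thus False using a by (simp only: not_le)
 qed
 thus ?thesis by (simp add: ps_def)
qed

text \<open>At the good grid point \<open>k0\<close> every nonzero value exceeds \<open>R0\<close>
  times the denominator, and the optimal point scores at least as high. A vector of value at most
  \<open>R0\<close> at the optimal point would have a code by \<open>q_complete\<close> and push its
  score below that of \<open>k0\<close>.\<close>

lemma opt_short:
 assumes K8: "8 <= K" and R0: "0 <= R0" "R0 <= real N"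
  and k0: "k0 < p^N" "!!x y. \<exists>i<N. y i ~= 0 ==> R0 < qf (pal K m) p (pdig K m k0) x y"
  and y: "\<exists>i<N. y i ~= 0"
 shows "R0 < qf (pal K m) p (pdig K m opt) x y"
proof (rule ccontr)
 assume "\<not> ?thesis"
 hence le: "qf (pal K m) p (pdig K m opt) x y <= R0" by simp
 let ?g = "pg K m"
 let ?q = "%k. sp_q m (pal K m) p (pdig K m k) C"
 define T where "T = (2 :: nat)^card P"
 have T1: "1 <= T" by (simp add: T_def)
 have N1: "1 <= N" using N_pos by linarith
 have \<alpha>: "0 < pal K m" using K by (simp add: pal_def)
 have R4: "4 * R0 < real (pal K m)"
 proof -
  have "4 * R0 <= 4*real N" using R0 by simp
  also have "\<dots> < real K*real N" using K8 N_pos by simp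
  finally show ?thesis by (simp add: pal_def)
 qed
 have sq: "real N <= real (ps m)*real (ps m)" using ps_sq by (metis of_nat_le_iff of_nat_mult)
 have g: "(2^card P)\<^sup>2*(real (pal K m) * R0) <= real N*(real ?g)\<^sup>2"
 proof -
  have "real K * R0 <= real K*real K*(real (ps m)*real (ps m))"
  proof (rule mult_mono)
   show "real K <= real K*real K" using K8 by simp
  qed (use R0 sq in auto)
  hence "real N*(real T)\<^sup>2*(real K * R0) <= real N*(real T)\<^sup>2*(real K*real K*(real (ps m)*real (ps m)))"
   by (rule mult_left_mono) simp
  thus ?thesis by (simp add: pal_def pg_def T_def power2_eq_square mult_ac)
 qed
 \<comment> \<open>\<open>pC\<close> admits the widths whose range is at most \<open>p\<close>. The
   range needed for a digit is at most \<open>4 * (1 + N * g)\<close>, and \<open>p\<close> equals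
   \<open>K * N * (N * g)\<close>, so that \<open>8 <= K\<close> suffices.\<close>
 have Cc: "w < C" if w: "2^w <= 4*(1 + N*?g)" for w
 proof -
  define X where "X = N*?g"
  have "1*(1*1*1) <= N*(T*K*ps m)" using N1 T1 K8 ps_pos by simp
  hence X1: "1 <= X" by (simp add: X_def pg_def)
  have "4*(1 + X) <= 8*X" using X1 by simp
  also have "8*X = 8*1*X" by simp
  also have "\<dots> <= K*N*X" using K8 N1 by (intro mult_le_mono order_refl)
  also have "\<dots> = p" by (simp add: X_def pg_def pp_def)
  finally have wp: "2^w <= p" using w unfolding X_def by linarith
  have "(2 :: nat)^w < 2^m" using wp pp_le pow_lt_2m[of 7] by linarith
  hence "w < m" by simp
  thus ?thesis using wp by (rule pC_init)
 qed
 obtain k where k: "k < pKK K m" "?q opt k ~= 0" "of_int (?q opt k) / real (sp_den m (pal K m) p) <= R0"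
  using q_complete[OF pp_pos \<alpha> R0(1) R4 y le g Cc] unfolding pKK_def by auto
 have D: "0 < real (sp_den m (pal K m) p)" using den_pos[OF pp_pos \<alpha>] by simp
 have "score k0 <= score opt" unfolding opt_def by (rule best_ge[OF k0(1)])
 moreover have "0 < pKK K m" using k(1) by simp
 ultimately have sc: "(MIN k\<in>{..<pKK K m}. (?q k0 k - 1) mod 2^(m*m)) <= (MIN k\<in>{..<pKK K m}. (?q opt k - 1) mod 2^(m*m))"
  by (simp add: score_def smin_Min)
 have "sp_den m (pal K m) p * R0 < real_of_int (?q opt k)"
 proof (rule best_search[OF _ _ sc _ k(1,2)])
  show "0 <= ?q k' j & ?q k' j < 2^(m*m)" for k' j using q_rng by blast
  show "0 <= ?q k' j & ?q k' j < 2^(m*m)" for k' j using q_rng by blast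
  fix j assume "?q k0 j ~= 0"
  hence "\<exists>i<N. sp_y m C j i ~= 0" using q_zero[OF pp_pos] by blast
  hence *: "R0 < qf (pal K m) p (pdig K m k0) x' (sp_y m C j)" for x' by (rule k0(2))
  obtain x' where "of_int (?q k0 j) / real (sp_den m (pal K m) p) = qf (pal K m) p (pdig K m k0) x' (sp_y m C j)"
   using q_sound[OF pp_pos \<alpha>] by blast
  hence "R0 < of_int (?q k0 j) / real (sp_den m (pal K m) p)" using *[of x'] by simp
  thus "sp_den m (pal K m) p * R0 < real_of_int (?q k0 j)" using D by (simp add: pos_less_divide_eq mult.commute)
 qed
 thus False using k(3) D by (simp add: pos_divide_le_eq mult.commute)
qed

theorem opt_lattice:
 fixes t R0 \<epsilon> :: real
 assumes K8: "8 <= K" and t: "0 < t" "t <= 1" "1 / real K <= t" and R0: "real N / 9 <= R0" "R0 <= real N"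
  and vol: "unit_ball_vol (real (2*N)) * R0^N = (1 - \<epsilon>)*real m" and \<epsilon>: "\<epsilon> < 1"
  and margin: "(1 - \<epsilon>)*exp (9*t) < 1 - 16 / (3*(real K)\<^sup>2*t\<^sup>2) - 16 / (3*real K*t\<^sup>2)"
 shows "\<exists>\<Lambda> B. Z_basis (2*N) \<Lambda> B & transpose_mat B*B = mat (2*N) (2*N) (%(i, j). Qm (pal K m) p (pdig K m opt) i j)
  & symplectic_lattice (2*N) \<Lambda> & (1 - \<epsilon>)*real m / 2^(2*N) < lattice_density (2*N) \<Lambda>"
proof -
 have R0p: "0 < R0" using R0 N_pos by (smt (verit) divide_pos_pos of_nat_0_less_iff)
 have "real N <= (real (ps m))\<^sup>2" using ps_sq by (metis of_nat_le_iff of_nat_mult power2_eq_square)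
 then obtain k0 where k0: "k0 < p^N" "!!x y. \<exists>i<N. y i ~= 0 ==> R0 < qf (pal K m) p (pdig K m k0) x y"
  using grid_good[OF pal_def pp_def K(1) _ t R0 vol \<epsilon> margin] unfolding pdig_def by blast
 have short: "R0 < qf (pal K m) p (pdig K m opt) x y" if "\<exists>i<N. y i ~= 0" for x y
  by (rule opt_short[OF K8 less_imp_le[OF R0p] R0(2) k0 that])
 have \<alpha>: "0 < pal K m" using K by (simp add: pal_def)
 have "R0 < real (pal K m)"
 proof -
  have "R0 <= 1*real N" using R0 by simp
  also have "\<dots> < real K*real N" using K8 N_pos by simp
  finally show ?thesis by (simp add: pal_def)
 qed
 then obtain \<Lambda> B where LB: "Z_basis (2*N) \<Lambda> B" "transpose_mat B*B = mat (2*N) (2*N) (%(i, j). Qm (pal K m) p (pdig K m opt) i j)"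
  "symplectic_lattice (2*N) \<Lambda>" "unit_ball_vol (real (2*N))*(sqrt R0)^(2*N) / 2^(2*N) < lattice_density (2*N) \<Lambda>"
  using Qm_lattice[OF pp_pos \<alpha>, of "sqrt R0" "pdig K m opt"] short R0p unfolding qf_def by auto
 have "(sqrt R0)^(2*N) = R0^N" using R0p by (simp add: power_mult)
 thus ?thesis using LB vol by auto
qed

theorem run_optimal:
 fixes t R0 \<epsilon> :: real
 assumes K8: "8 <= K" and t: "0 < t" "t <= 1" "1 / real K <= t" and R0: "real N / 9 <= R0" "R0 <= real N"
  and vol: "unit_ball_vol (real (2*N)) * R0^N = (1 - \<epsilon>)*real m" and \<epsilon>: "\<epsilon> < 1"
  and margin: "(1 - \<epsilon>)*exp (9*t) < 1 - 16 / (3*(real K)\<^sup>2*t\<^sup>2) - 16 / (3*real K*t\<^sup>2)"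
  and T: "real ((p^N + 1)*(pKK K m + 1)*m^140) <= T"
 shows "\<exists>w \<Lambda>. computes_within (lattice_program K) m T w & codes_lattice (2*N) w \<Lambda>
  & symplectic_lattice (2*N) \<Lambda> & (1 - \<epsilon>)*real m / 2^(2*N) < lattice_density (2*N) \<Lambda>"
proof -
 obtain \<Lambda> B where LB: "Z_basis (2*N) \<Lambda> B" "transpose_mat B*B = mat (2*N) (2*N) (%(i, j). Qm (pal K m) p (pdig K m opt) i j)"
  "symplectic_lattice (2*N) \<Lambda>" "(1 - \<epsilon>)*real m / 2^(2*N) < lattice_density (2*N) \<Lambda>"
  using opt_lattice[OF assms(1-9)] by blast
 have "codes_lattice (2*N) items \<Lambda>" unfolding codes_lattice_def
  by (rule exI[of _ B], rule conjI[OF LB(1)], subst LB(2), rule items_code)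
 moreover obtain u s' where r: "runs (lattice_program K) (input_mem m) u s'" "u <= (p^N + 1)*(pKK K m + 1)*m^140" "output_list s' = items"
  using run_program by blast
 hence "real u <= T" using T by (smt (verit) of_nat_le_iff)
 hence "computes_within (lattice_program K) m T items" unfolding computes_within_def using r by blast
 ultimately show ?thesis using LB by blast
qed

end

section \<open>The radius, and the running time asymptotically\<close>

lemma unit_ball_vol_even_root:
 fixes c :: real
 assumes N: "0 < N" and c: "1 <= c" "c <= pi^N"
 shows "\<exists>R. unit_ball_vol (real (2*N)) * R^N = c & real N / 9 <= R & R <= real N"
proof -
 define R where "R = root N (c*fact N / pi^N)"
 have R0: "0 <= R" unfolding R_def using N c by simp
 have RN: "R^N = c*fact N / pi^N" unfolding R_def using N c by simp
 have "unit_ball_vol (real (2*N)) * R^N = c" unfolding RN unit_ball_vol_even by simp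
 moreover have "real N / 9 <= R"
 proof (rule power_le_imp_le_base)
  \<comment> \<open>One term of the exponential series takes the place of Stirling's formula; since
    \<open>pi * exp 1\<close> is at most 9, it yields the lower bound \<open>N / 9\<close>.\<close>
  have "real N^N / fact N <= exp (real N)"
  proof -
   have "(%k. real N^k /\<^sub>R fact k) sums exp (real N)" by (rule exp_converges)
   hence "(\<Sum>k\<in>{N}. real N^k /\<^sub>R fact k) <= exp (real N)"
    using sum_le_suminf[of "%k. real N^k /\<^sub>R fact k" "{N}"] by (auto simp: sums_iff)
   thus ?thesis by (simp add: divide_inverse mult.commute)
  qed
  also have "exp (real N) = exp 1^N" using exp_of_nat_mult[of N "1 :: real"] by simp
  finally have "real N^N <= exp 1^N*fact N" by (simp add: pos_divide_le_eq)
  hence "pi^N*real N^N <= pi^N*(exp 1^N*fact N)" by simp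
  also have "\<dots> = (pi*exp 1)^N*fact N" by (simp add: power_mult_distrib)
  also have "\<dots> <= 9^N*fact N"
  proof (intro mult_right_mono power_mono)
   have "pi*exp 1 <= 3.15*(2.72 :: real)" using e_less_272 pi_approx by (intro mult_mono) auto
   thus "pi*exp 1 <= 9" by simp
  qed auto
  also have "\<dots> <= 9^N*(c*fact N)" using c by simp
  finally show "(real N / 9)^Suc (N - 1) <= R^Suc (N - 1)" using N by (simp add: RN field_simps)
 qed (rule R0)
 moreover have "R <= real N"
 proof (rule power_le_imp_le_base)
  have "c*fact N <= pi^N*real N^N"
  proof (rule mult_mono)
   show "fact N <= real N^N" using fact_le_power[of N, where 'a = real] by simp
  qed (use c in auto)
  thus "R^Suc (N - 1) <= real N^Suc (N - 1)" using N by (simp add: RN pos_divide_le_eq mult.commute)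
 qed simp
 ultimately show ?thesis by blast
qed

lemma margin_exists:
 fixes \<epsilon> :: real
 assumes \<epsilon>: "0 < \<epsilon>" "\<epsilon> < 1"
 shows "\<exists>(K :: nat) t. 8 <= K & 0 < t & t <= 1 & 1 / real K <= t &
  (1 - \<epsilon>)*exp (9*t) < 1 - 16 / (3*(real K)\<^sup>2*t\<^sup>2) - 16 / (3*real K*t\<^sup>2)"
proof -
 \<comment> \<open>Then \<open>exp (9 * t) = exp (\<epsilon> / 2)\<close> while
   \<open>1 - \<epsilon> <= exp (- \<epsilon>)\<close>, so the left side is at most
   \<open>exp (- \<epsilon> / 2)\<close>, below 1. Afterwards \<open>K\<close> is taken large
   depending on \<open>t\<close>.\<close>
 define t where "t = \<epsilon> / 18"
 have t: "0 < t" "t <= 1" using \<epsilon> by (simp_all add: t_def)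
 have "(1 - \<epsilon>)*exp (9*t) <= exp (- \<epsilon>)*exp (9*t)" using exp_ge_add_one_self[of "- \<epsilon>"] by simp
 also have "\<dots> = exp (- \<epsilon> / 2)" by (simp add: t_def flip: exp_add)
 also have "\<dots> < 1" using \<epsilon> by simp
 finally have lt: "(1 - \<epsilon>)*exp (9*t) < 1" .
 have "(%K. 1 - 16 / (3*(real K)\<^sup>2*t\<^sup>2) - 16 / (3*real K*t\<^sup>2)) \<longlonglongrightarrow> 1" using t by real_asymp
 from order_tendstoD(1)[OF this lt]
 have 1: "\<forall>\<^sub>F K in sequentially. (1 - \<epsilon>)*exp (9*t) < 1 - 16 / (3*(real K)\<^sup>2*t\<^sup>2) - 16 / (3*real K*t\<^sup>2)" .
 have "(%K. 1 / real K) \<longlonglongrightarrow> 0" by real_asymp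
 from order_tendstoD(2)[OF this t(1)] have 2: "\<forall>\<^sub>F K in sequentially. 1 / real K < t" .
 have "\<forall>\<^sub>F K in sequentially. 8 <= K & 1 / real K <= t & (1 - \<epsilon>)*exp (9*t) < 1 - 16 / (3*(real K)\<^sup>2*t\<^sup>2) - 16 / (3*real K*t\<^sup>2)"
  using 1 2 eventually_ge_at_top[of 8] by eventually_elim auto
 then obtain K where "8 <= K" "1 / real K <= t" "(1 - \<epsilon>)*exp (9*t) < 1 - 16 / (3*(real K)\<^sup>2*t\<^sup>2) - 16 / (3*real K*t\<^sup>2)"
  using eventually_happens'[OF sequentially_bot] by blast
 thus ?thesis using t by blast
qed

text \<open>The logarithm of the bound \<open>4 * m^140 * (P0 * Q0)^N\<close> found in
  \<open>cost_le\<close>, where \<open>P0\<close> bounds the grid denominator and \<open>Q0\<close>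
  the base of the number of codes. They contribute \<open>N^2.5\<close> and \<open>N^0.5\<close>,
  whence \<open>3 * ln N\<close>.\<close>

definition cost_exponent :: "nat => nat => real" where
 "cost_exponent K m = 2*ln 2 + 140*ln m + real (totient m) *
   (3*ln (totient m) + (3*ln K + 5*ln 2) + 2*ln (2^card (prime_factors m)) + ln (14*ln m + 1))"

text \<open>Numerator and denominator are divided by \<open>N * ln m\<close>. What survives on both
  sides is three times \<open>ln N / ln m\<close>, which tends to 1.\<close>

lemma cost_exponent_asymp:
 "(%m. cost_exponent K m / (3*real (totient m)*ln (2*real (totient m))) - 1) \<longlonglongrightarrow> 0"
proof -
 define a where "a m = ln (real (totient m)) / ln (real m)" for m
 define w where "w m = ln (2^card (prime_factors m)) / ln (real m)" for m
 have a: "a \<longlonglongrightarrow> 1" unfolding a_def by (rule ln_totient)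
 have w: "w \<longlonglongrightarrow> 0" unfolding w_def by (rule ln_two_power_omega)
 have n: "(%m. 1 / real (totient m)) \<longlonglongrightarrow> 0"
  by (rule filterlim_compose[OF lim_1_over_n totient_at_top])
 have l: "(%m. 1 / ln (real m)) \<longlonglongrightarrow> 0" and ll: "(%m. ln (14*ln (real m) + 1) / ln (real m)) \<longlonglongrightarrow> 0" by real_asymp+
 define U where "U m = ((2*ln 2*(1 / ln m) + 140)*(1 / real (totient m)) +
   (3*a m + (3*ln K + 5*ln 2)*(1 / ln m) + 2*w m + ln (14*ln m + 1) / ln m)) / (3*(ln 2*(1 / ln m) + a m)) - 1" for m
 have "U \<longlonglongrightarrow> ((2*ln 2*0 + 140)*0 + (3*1 + (3*ln K + 5*ln 2)*0 + 2*0 + 0)) / (3*(ln 2*0 + 1)) - 1"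
  unfolding U_def by (intro tendsto_intros a w n l ll) auto
 hence U: "U \<longlonglongrightarrow> 0" by simp
 moreover have "\<forall>\<^sub>F m in sequentially. U m = cost_exponent K m / (3*real (totient m)*ln (2*real (totient m))) - 1"
  using eventually_ge_at_top[of 2]
 proof eventually_elim
  case (elim m)
  define L N where "L = ln (real m)" and "N = real (totient m)"
  have L: "0 < L" and N: "0 < N" using elim by (simp_all add: L_def N_def)
  have "ln (2*N) = ln 2 + ln N" using N by (simp add: ln_mult)
  hence "U m = (((2*ln 2 + 140*L) / N + (3*ln N + (3*ln K + 5*ln 2) + 2*ln (2^card (prime_factors m)) + ln (14*L + 1))) / L) / ((3*ln (2*N)) / L) - 1"
   unfolding U_def a_def w_def L_def[symmetric] N_def[symmetric] by (simp add: add_divide_distrib)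
  also have "\<dots> = (N*((2*ln 2 + 140*L) / N + (3*ln N + (3*ln K + 5*ln 2) + 2*ln (2^card (prime_factors m)) + ln (14*L + 1)))) / (N*(3*ln (2*N))) - 1"
   using L by simp
  also have "N*((2*ln 2 + 140*L) / N + (3*ln N + (3*ln K + 5*ln 2) + 2*ln (2^card (prime_factors m)) + ln (14*L + 1))) = cost_exponent K m"
   using N unfolding cost_exponent_def L_def[symmetric] N_def[symmetric] distrib_left[of N "(2*ln 2 + 140*L) / N"] by simp
  finally show ?case by (simp add: N_def)
 qed
 ultimately show ?thesis by (rule Lim_transform_eventually)
qed

context algo
begin

lemma cost_le: "real ((p^N + 1)*(pKK K m + 1)*m^140) <= exp (cost_exponent K m)"
proof -
 define L where "L = ln (real m)"
 define T where "T = (2 :: real)^card P"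
 define n where "n = real N"
 define k where "k = real K"
 have L: "0 < L" using m by (simp add: L_def)
 have T: "1 <= T" by (simp add: T_def)
 have n: "1 <= n" using N_pos unfolding n_def by linarith
 have k: "1 <= k" using K by (simp add: k_def)
 have ps: "real (ps m) <= 2 * sqrt n"
 proof -
  have "(real (ps m - 1))\<^sup>2 <= n" using ps_upper unfolding n_def power2_eq_square by (metis of_nat_le_iff of_nat_mult)
  hence "real (ps m - 1) <= sqrt n" by (rule real_le_rsqrt)
  moreover have "1 <= sqrt n" using n by simp
  ultimately show ?thesis by linarith
 qed
 define P0 where "P0 = k*k*n*n*(2 * sqrt n)*T"
 define Q0 where "Q0 = 4*(14*L + 1)*(2*(T*k*(2 * sqrt n)))"
 have p0: "real p <= P0"
  unfolding pp_def P0_def k_def n_def[symmetric] T_def of_nat_mult using ps n by (intro mult_mono) auto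
 have c: "real C <= 14*L + 1"
 proof -
  have "{i. i < m & 2^i <= p} \<subseteq> {..nat \<lfloor>14*L\<rfloor>}"
  proof
   fix i assume "i \<in> {i. i < m & 2^i <= p}"
   hence "2^i <= m^7" using pp_le by simp
   hence "(2 :: real)^i <= real m^7" by (metis of_nat_le_iff of_nat_numeral of_nat_power)
   hence "ln ((2 :: real)^i) <= ln (real m^7)" using m by simp
   hence "real i*ln 2 <= 7*L" by (simp add: ln_realpow L_def)
   moreover have "real i*(1 / 2) <= real i*ln 2" using ln2_ge_two_thirds by (intro mult_left_mono) auto
   ultimately have "real i <= 14*L" by linarith
   thus "i \<in> {..nat \<lfloor>14*L\<rfloor>}" by (simp add: le_nat_floor)
  qed
  from card_mono[OF _ this] have "C <= nat \<lfloor>14*L\<rfloor> + 1" by (simp add: pC_def)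
  thus ?thesis using L by linarith
 qed
 have "0 < pg K m" using K ps_pos by (simp add: pg_def)
 hence g1: "1 <= real (pg K m)" by simp
 have g: "real (pg K m) <= T*k*(2 * sqrt n)"
  unfolding pg_def k_def T_def of_nat_mult using ps by (intro mult_mono) auto
 have q0: "real (4*C*(1 + pg K m)) <= Q0"
 proof -
  have "real (1 + pg K m) <= 2*(T*k*(2 * sqrt n))" using g g1 by simp
  thus ?thesis unfolding Q0_def of_nat_mult using c by (intro mult_mono) auto
 qed
 have c1: "1 <= 4*C*(1 + pg K m)" using pC_pos by simp
 have "1 <= p^N" "1 <= pKK K m" using pp_pos c1 by (auto simp: pKK_def)
 hence "(p^N + 1)*(pKK K m + 1)*m^140 <= (2*p^N)*(2*pKK K m)*m^140" by (intro mult_le_mono) auto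
 hence "real ((p^N + 1)*(pKK K m + 1)*m^140) <= real ((2*p^N)*(2*pKK K m)*m^140)" by (simp only: of_nat_le_iff)
 also have "\<dots> = (2*real p^N)*(2*real (4*C*(1 + pg K m))^N)*real m^140" by (simp only: pKK_def of_nat_mult of_nat_power)
 also have "\<dots> <= (2*P0^N)*(2*Q0^N)*real m^140"
  using p0 q0 by (intro mult_right_mono mult_mono power_mono) auto
 also have "\<dots> = 4*real m^140*(P0*Q0)^N" by (simp add: power_mult_distrib)
 also have "P0*Q0 = exp (3*ln n + (3*ln k + 5*ln 2) + 2*ln T + ln (14*L + 1))"
 proof -
  have "P0*Q0 = n^3*(k^3*2^5)*T^2*(14*L + 1)"
  proof -
   have "P0*Q0 = 32*(k*k*k)*(n*n)*(sqrt n * sqrt n)*(T*T)*(14*L + 1)"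
    unfolding P0_def Q0_def by (simp add: algebra_simps del: real_sqrt_mult_self)
   also have "sqrt n * sqrt n = n" using n by simp
   finally show ?thesis by (simp add: power2_eq_square power3_eq_cube)
  qed
  moreover have "exp (3*ln n) = n^3" "exp (3*ln k) = k^3" "exp (5*ln 2) = (2 :: real)^5" "exp (2*ln T) = T^2"
   using n k T exp_of_nat_mult[of 3 "ln n"] exp_of_nat_mult[of 3 "ln k"] exp_of_nat_mult[of 5 "ln 2 :: real"] exp_of_nat_mult[of 2 "ln T"] by simp_all
  moreover have "exp (ln (14*L + 1)) = 14*L + 1" using L by simp
  ultimately show ?thesis by (simp only: exp_add)
 qed
 also have "(4 :: real) = exp (2*ln 2)" using exp_of_nat_mult[of 2 "ln 2 :: real"] by simp
 also have "real m^140 = exp (140*L)" using exp_of_nat_mult[of 140 L] m by (simp add: L_def)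
 finally show ?thesis
  unfolding cost_exponent_def L_def[symmetric] T_def[symmetric] k_def[symmetric] by (simp only: exp_add exp_of_nat_mult n_def)
qed

end

lemma eventually_algo:
 assumes "0 < K"
 shows "\<forall>\<^sub>F m in sequentially. algo m K"
proof -
 have "\<forall>\<^sub>F m in sequentially. real m^40 <= 2^m" by real_asymp
 thus ?thesis using eventually_ge_at_top[of 100] eventually_ge_at_top[of "2*K + 1"]
 proof eventually_elim
  case (elim m)
  have "m^40 <= 2^m" using elim(1) by (metis of_nat_le_iff of_nat_numeral of_nat_power)
  thus ?case using elim assms by unfold_locales auto
 qed
qed

theorem proposition2:
  fixes \<epsilon> :: real
  assumes "0 < \<epsilon>" and "\<epsilon> < 1"
  shows "\<exists>(A :: program) (\<delta> :: nat \<Rightarrow> real). \<delta> \<longlonglongrightarrow> 0 \<and>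
    (\<forall>\<^sub>F m in sequentially. \<forall>n. n = 2 * totient m \<longrightarrow>
       (\<exists>w \<Lambda>. computes_within A m (exp (1.5 * real n * ln (real n) * (1 + \<delta> m))) w \<and>
              codes_lattice n w \<Lambda> \<and>
              symplectic_lattice n \<Lambda> \<and>
              lattice_density n \<Lambda> > (1 - \<epsilon>) * real m / 2 ^ (2 * totient m)))"
proof -
 obtain K t where Kt: "8 <= K" "0 < t" "t <= 1" "1 / real K <= t"
  and margin: "(1 - \<epsilon>)*exp (9*t) < 1 - 16 / (3*(real K)\<^sup>2*t\<^sup>2) - 16 / (3*real K*t\<^sup>2)"
  using margin_exists[OF assms] by blast
 \<comment> \<open>Chosen so that the exponent \<open>1.5 * n * ln n * (1 + \<delta> m)\<close> is
   exactly \<open>cost_exponent K m\<close>.\<close>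
 define \<delta> where "\<delta> m = cost_exponent K m / (3*real (totient m)*ln (2*real (totient m))) - 1" for m
 have "\<delta> \<longlonglongrightarrow> 0" unfolding \<delta>_def by (rule cost_exponent_asymp)
 moreover have "\<forall>\<^sub>F m in sequentially. \<forall>n. n = 2*totient m -->
    (\<exists>w \<Lambda>. computes_within (lattice_program K) m (exp (1.5*real n*ln (real n)*(1 + \<delta> m))) w &
       codes_lattice n w \<Lambda> & symplectic_lattice n \<Lambda> &
       lattice_density n \<Lambda> > (1 - \<epsilon>)*real m / 2^(2*totient m))"
 proof -
  have "\<forall>\<^sub>F m in sequentially. algo m K" using Kt by (intro eventually_algo) auto
  moreover have "\<forall>\<^sub>F m in sequentially. 1 <= (1 - \<epsilon>)*real m" using assms by real_asymp
  \<comment> \<open>This says that \<open>m\<close> is below \<open>N^2\<close>, hence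
    \<open>(1 - \<epsilon>) * m\<close> is at most \<open>pi^N\<close>, the range in which
    \<open>unit_ball_vol_even_root\<close> finds a radius.\<close>
  moreover have "\<forall>\<^sub>F m in sequentially. 1 / 2 < ln (real (totient m)) / ln (real m)"
   using ln_totient by (intro order_tendstoD) auto
  moreover have "\<forall>\<^sub>F m in sequentially. (real (totient m))\<^sup>2 <= pi^totient m"
  proof (rule eventually_compose_filterlim[OF _ totient_at_top])
   have "\<forall>\<^sub>F n in sequentially. (real n)\<^sup>2 <= 2^n" by real_asymp
   thus "\<forall>\<^sub>F n in sequentially. (real n)\<^sup>2 <= pi^n"
   proof eventually_elim
    case (elim n)
    also have "(2 :: real)^n <= pi^n" using pi_ge_two by (intro power_mono) auto
    finally show ?case .
   qed
  qed
  ultimately show ?thesis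
  proof eventually_elim
   case (elim m)
   interpret algo m K by (rule elim(1))
   let ?N = "totient m"
   have N: "0 < ?N" by (rule N_pos)
   have l: "0 < ln (real m)" using m by simp
   have "ln (real m) < 2*ln (real ?N)" using elim(3) l by simp
   also have "\<dots> = ln ((real ?N)\<^sup>2)" by (simp add: ln_realpow)
   finally have "real m < (real ?N)\<^sup>2" using N by simp
   hence "(1 - \<epsilon>)*real m <= 1*(real ?N)\<^sup>2" using assms by (intro mult_mono) auto
   also have "\<dots> <= pi^?N" using elim(4) by simp
   finally obtain R where R: "unit_ball_vol (real (2*?N)) * R^?N = (1 - \<epsilon>)*real m" "real ?N / 9 <= R" "R <= real ?N"
    using unit_ball_vol_even_root[OF N elim(2)] by blast
   have "1.5*real (2*?N)*ln (real (2*?N))*(1 + \<delta> m) = cost_exponent K m"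
   proof -
    have "1 < 2*real ?N" using N by linarith
    hence "0 < ln (2*real ?N)" by (rule ln_gt_zero)
    thus ?thesis using N by (simp add: \<delta>_def)
   qed
   thus ?case using run_optimal[OF Kt R(2,3,1) assms(2) margin cost_le] by metis
  qed
 qed
 ultimately show ?thesis by blast
qed

end
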